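(* In the problem $\textsc{KnapsackExtendWeak}^+$, suppose there are $m$ distinct sets among $S[0],S[1],\dots,S[L-1]$, and $|S[i]|\le b$ for all $i$. Then $\textsc{KnapsackExtendWeak}^+$ can be solved deterministically in $\tilde O(|U|m+bL)$ time.
   Context: A function $f\colon\mathbb{Z}_{\ge0}\to\mathbb{Z}$ is strictly concave if $f(x)-f(x-1)>f(x+1)-f(x)$ for all $x\ge1$. $\textsc{KnapsackExtendWeak}^+$: The input is a set $U\subseteq[w_{\max}]=\{1,\dots,w_{\max}\}$; for every $w\in U$ a strictly concave function $Q_w\colon\mathbb{Z}_{\ge0}\to\mathbb{Z}$ with $Q_w(0)=0$ that can be evaluated in constant time; initial values $q[0],\dots,q[L-1]\in\mathbb{Z}$ (with $q[i]=-\infty$ for $i\notin\{0,\dots,L-1\}$); and sets $S[0],\dots,S[L-1]\subseteq U$. For each $0\le i\le L-1$, a candidate solution is a vector $\vec x\in\mathbb{Z}_{\ge0}^U$; it determines $z=i-\sum_{w\in U}w\cdot x_w$ and objective value $r=q[z]+\sum_{w\in U}Q_w(x_w)$. The output is, for each $i$, a vector $\vec x[i]$ together with its $z[i]$ and $r[i]$. The requirement is: for each $i$, if all maximizers $(z,\vec x)$ of $r$ (over all $\vec x\in\mathbb{Z}_{\ge0}^U$) satisfy $\mathrm{supp}(\vec x)\subseteq S[z]$, then the output for $i$ must be a maximizer; otherwise the output for $i$ may be suboptimal. Here $\mathrm{supp}(\vec x)=\{w: x_w\ne0\}$. $\tilde O(f)$ denotes $O(f\,\mathrm{poly}\log f)$.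 *)

theory Defs
  imports Complex_Main "HOL-Library.Extended_Real"
begin

section \<open>The problem KnapsackExtendWeak+\<close>

definition strictly_concave :: "(nat \<Rightarrow> int) \<Rightarrow> bool" where
  "strictly_concave f \<longleftrightarrow> (\<forall>x\<ge>1. f x - f (x - 1) > f (x + 1) - f x)"

text \<open>\<open>profit I w\<close> is \<open>Q\<^sub>w\<close>, \<open>len I\<close> is \<open>L\<close>, \<open>init I\<close> is \<open>q\<close> and \<open>allowed I\<close> is \<open>S\<close>.
  Only \<open>profit I w\<close> for \<open>w \<in> items I\<close>, and \<open>init I i\<close>, \<open>allowed I i\<close> for \<open>i < len I\<close>, carry
  meaning; the remaining values are arbitrary and unconstrained.\<close>

record kew =
  items :: "nat set"
  wmax :: nat
  profit :: "nat \<Rightarrow> nat \<Rightarrow> int"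
  len :: nat
  init :: "nat \<Rightarrow> int"
  allowed :: "nat \<Rightarrow> nat set"

definition kew_instance :: "kew \<Rightarrow> bool" where
  "kew_instance I \<longleftrightarrow>
     items I \<subseteq> {1..wmax I} \<and>
     (\<forall>w\<in>items I. strictly_concave (profit I w) \<and> profit I w 0 = 0) \<and>
     (\<forall>i<len I. allowed I i \<subseteq> items I)"

definition supp :: "(nat \<Rightarrow> nat) \<Rightarrow> nat set" where
  "supp x = {w. x w \<noteq> 0}"

text \<open>A vector indexed by the set \<open>items I\<close> is a function that vanishes outside that set.\<close>

definition vectors :: "kew \<Rightarrow> (nat \<Rightarrow> nat) set" where
  "vectors I = {x. supp x \<subseteq> items I}"

definition residual :: "kew \<Rightarrow> nat \<Rightarrow> (nat \<Rightarrow> nat) \<Rightarrow> int" where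
  "residual I i x = int i - (\<Sum>w\<in>items I. int w * int (x w))"

definition init_ext :: "kew \<Rightarrow> int \<Rightarrow> ereal" where
  "init_ext I z = (if 0 \<le> z \<and> z < int (len I) then ereal (of_int (init I (nat z))) else - \<infinity>)"

definition objective :: "kew \<Rightarrow> nat \<Rightarrow> (nat \<Rightarrow> nat) \<Rightarrow> ereal" where
  "objective I i x =
     init_ext I (residual I i x) + ereal (of_int (\<Sum>w\<in>items I. profit I w (x w)))"

definition maximizer :: "kew \<Rightarrow> nat \<Rightarrow> (nat \<Rightarrow> nat) \<Rightarrow> bool" where
  "maximizer I i x \<longleftrightarrow>
     x \<in> vectors I \<and> (\<forall>y\<in>vectors I. objective I i y \<le> objective I i x)"

text \<open>For \<open>i < len I\<close> the zero vector has a finite objective value, so the residual of a maximizer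
  lies in \<open>{0..<len I}\<close> and the conversion by \<open>nat\<close> below loses nothing.\<close>

definition kew_solution ::
  "kew \<Rightarrow> (nat \<Rightarrow> nat \<Rightarrow> nat) \<Rightarrow> (nat \<Rightarrow> int) \<Rightarrow> (nat \<Rightarrow> ereal) \<Rightarrow> bool" where
  "kew_solution I x z r \<longleftrightarrow>
     (\<forall>i<len I.
        x i \<in> vectors I \<and> z i = residual I i (x i) \<and> r i = objective I i (x i) \<and>
        ((\<forall>y. maximizer I i y \<longrightarrow> supp y \<subseteq> allowed I (nat (residual I i y)))
           \<longrightarrow> maximizer I i (x i)))"


section \<open>Deterministic word RAM programs with profit evaluation\<close>

text \<open>A program is a finite while-program over integer variables and integer arrays. Since the text
  of a program mentions only finitely many arrays, they can be interleaved in one random access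
  memory, with constant overhead. Every operator, memory access, test and profit evaluation costs one
  step. All values occurring in a run, intermediate results and addresses included, must have
  absolute value less than a word bound \<open>W\<close>; an execution that violates this has no result.
  The evaluator of an instance is \<open>(w, x) \<mapsto> Q\<^sub>w(x)\<close>.\<close>

datatype binop = Add | Sub | Mul | Div | Mod

fun apply_op :: "binop \<Rightarrow> int \<Rightarrow> int \<Rightarrow> int" where
  "apply_op Add a b = a + b"
| "apply_op Sub a b = a - b"
| "apply_op Mul a b = a * b"
| "apply_op Div a b = a div b"
| "apply_op Mod a b = a mod b"

datatype aexp =
    Const int
  | Var string
  | Read string aexp
  | Op binop aexp aexp
  | Query aexp aexp

datatype bexp = Less aexp aexp | Equal aexp aexp | BNot bexp | BAnd bexp bexp

datatype com =
    Skip
  | Assign string aexp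
  | Write string aexp aexp
  | Seq com com
  | Cond bexp com com
  | While bexp com

record state =
  vars :: "string \<Rightarrow> int"
  arrs :: "string \<Rightarrow> int \<Rightarrow> int"

type_synonym evaluator = "int \<Rightarrow> int \<Rightarrow> int"

fun aval :: "evaluator \<Rightarrow> state \<Rightarrow> aexp \<Rightarrow> int" where
  "aval Q s (Const n) = n"
| "aval Q s (Var v) = vars s v"
| "aval Q s (Read a e) = arrs s a (aval Q s e)"
| "aval Q s (Op f e1 e2) = apply_op f (aval Q s e1) (aval Q s e2)"
| "aval Q s (Query e1 e2) = Q (aval Q s e1) (aval Q s e2)"

fun bval :: "evaluator \<Rightarrow> state \<Rightarrow> bexp \<Rightarrow> bool" where
  "bval Q s (Less e1 e2) = (aval Q s e1 < aval Q s e2)"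
| "bval Q s (Equal e1 e2) = (aval Q s e1 = aval Q s e2)"
| "bval Q s (BNot c) = (\<not> bval Q s c)"
| "bval Q s (BAnd c1 c2) = (bval Q s c1 \<and> bval Q s c2)"

fun subexps :: "aexp \<Rightarrow> aexp set" where
  "subexps (Const n) = {Const n}"
| "subexps (Var v) = {Var v}"
| "subexps (Read a e) = insert (Read a e) (subexps e)"
| "subexps (Op f e1 e2) = insert (Op f e1 e2) (subexps e1 \<union> subexps e2)"
| "subexps (Query e1 e2) = insert (Query e1 e2) (subexps e1 \<union> subexps e2)"

fun bsubexps :: "bexp \<Rightarrow> aexp set" where
  "bsubexps (Less e1 e2) = subexps e1 \<union> subexps e2"
| "bsubexps (Equal e1 e2) = subexps e1 \<union> subexps e2"
| "bsubexps (BNot c) = bsubexps c"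
| "bsubexps (BAnd c1 c2) = bsubexps c1 \<union> bsubexps c2"

definition in_words :: "evaluator \<Rightarrow> int \<Rightarrow> state \<Rightarrow> aexp set \<Rightarrow> bool" where
  "in_words Q W s E \<longleftrightarrow> (\<forall>e\<in>E. \<bar>aval Q s e\<bar> < W)"

fun acost :: "aexp \<Rightarrow> nat" where
  "acost (Const n) = 1"
| "acost (Var v) = 1"
| "acost (Read a e) = 1 + acost e"
| "acost (Op f e1 e2) = 1 + acost e1 + acost e2"
| "acost (Query e1 e2) = 1 + acost e1 + acost e2"

fun bcost :: "bexp \<Rightarrow> nat" where
  "bcost (Less e1 e2) = 1 + acost e1 + acost e2"
| "bcost (Equal e1 e2) = 1 + acost e1 + acost e2"
| "bcost (BNot c) = 1 + bcost c"
| "bcost (BAnd c1 c2) = 1 + bcost c1 + bcost c2"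

text \<open>\<open>exec Q W c s t s'\<close>: with evaluator \<open>Q\<close> and word bound \<open>W\<close>, the program \<open>c\<close> started in \<open>s\<close>
  halts after \<open>t\<close> steps in \<open>s'\<close>.\<close>

inductive exec :: "evaluator \<Rightarrow> int \<Rightarrow> com \<Rightarrow> state \<Rightarrow> nat \<Rightarrow> state \<Rightarrow> bool"
  for Q :: evaluator and W :: int where
  Skip: "exec Q W Skip s 1 s"
| Assign: "in_words Q W s (subexps e) \<Longrightarrow>
    exec Q W (Assign v e) s (1 + acost e) (s\<lparr>vars := (vars s)(v := aval Q s e)\<rparr>)"
| Write: "in_words Q W s (subexps d \<union> subexps e) \<Longrightarrow>
    exec Q W (Write a d e) s (1 + acost d + acost e)
      (s\<lparr>arrs := (arrs s)(a := (arrs s a)(aval Q s d := aval Q s e))\<rparr>)"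
| Seq: "exec Q W c1 s1 t1 s2 \<Longrightarrow> exec Q W c2 s2 t2 s3 \<Longrightarrow>
    exec Q W (Seq c1 c2) s1 (t1 + t2) s3"
| CondTrue: "in_words Q W s (bsubexps b) \<Longrightarrow> bval Q s b \<Longrightarrow> exec Q W c1 s t s' \<Longrightarrow>
    exec Q W (Cond b c1 c2) s (bcost b + t) s'"
| CondFalse: "in_words Q W s (bsubexps b) \<Longrightarrow> \<not> bval Q s b \<Longrightarrow> exec Q W c2 s t s' \<Longrightarrow>
    exec Q W (Cond b c1 c2) s (bcost b + t) s'"
| WhileFalse: "in_words Q W s (bsubexps b) \<Longrightarrow> \<not> bval Q s b \<Longrightarrow>
    exec Q W (While b c) s (bcost b) s"
| WhileTrue: "in_words Q W s1 (bsubexps b) \<Longrightarrow> bval Q s1 b \<Longrightarrow> exec Q W c s1 t1 s2 \<Longrightarrow>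
    exec Q W (While b c) s2 t2 s3 \<Longrightarrow>
    exec Q W (While b c) s1 (bcost b + t1 + t2) s3"

inductive_cases SkipE: "exec Q W Skip s t s'"
inductive_cases AssignE: "exec Q W (Assign v e) s t s'"
inductive_cases WriteE: "exec Q W (Write a d e) s t s'"
inductive_cases SeqE: "exec Q W (Seq c1 c2) s t s'"
inductive_cases CondE: "exec Q W (Cond b c1 c2) s t s'"
inductive_cases WhileE: "exec Q W (While b c) s t s'"

lemma exec_deterministic:
  "exec Q W c s t s' \<Longrightarrow> exec Q W c s u s'' \<Longrightarrow> u = t \<and> s'' = s'"
proof (induction arbitrary: u s'' rule: exec.induct)
  case (Skip s)
  then show ?case by (auto elim: SkipE)
next
  case (Assign s e v)
  from Assign.prems show ?case by (auto elim: AssignE)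
next
  case (Write s d e a)
  from Write.prems show ?case by (auto elim: WriteE)
next
  case (Seq c1 s1 t1 s2 c2 t2 s3)
  from Seq.prems show ?case by (rule SeqE) (use Seq.IH in blast)
next
  case (CondTrue s b c1 t s' c2)
  from CondTrue.prems show ?case by (rule CondE) (use CondTrue in blast)+
next
  case (CondFalse s b c2 t s' c1)
  from CondFalse.prems show ?case by (rule CondE) (use CondFalse in blast)+
next
  case (WhileFalse s b c)
  from WhileFalse.prems show ?case by (rule WhileE) (use WhileFalse in blast)+
next
  case (WhileTrue s1 b c t1 s2 t2 s3)
  from WhileTrue.prems show ?case by (rule WhileE) (use WhileTrue in blast)+
qed


section \<open>Input and output conventions\<close>

definition evaluator_of :: "kew \<Rightarrow> evaluator" where
  "evaluator_of I w x = profit I (nat w) (nat x)"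

text \<open>The numbers of the input have at most \<open>l\<close> bits. No feasible vector has an entry exceeding
  \<open>len I\<close>, so larger arguments of the profit functions are irrelevant.\<close>

definition fits :: "nat \<Rightarrow> kew \<Rightarrow> bool" where
  "fits l I \<longleftrightarrow>
     len I < 2 ^ l \<and> wmax I < 2 ^ l \<and>
     (\<forall>i<len I. \<bar>init I i\<bar> < 2 ^ l) \<and>
     (\<forall>w\<in>items I. \<forall>x\<le>len I. \<bar>profit I w x\<bar> < 2 ^ l)"

definition array_of :: "int list \<Rightarrow> int \<Rightarrow> int" where
  "array_of xs k = (if 0 \<le> k \<and> k < int (length xs) then xs ! nat k else 0)"

text \<open>Sets are given by listing their elements, in any order and without repetition. The lists of
  \<open>S[0], \<dots>, S[L-1]\<close> are stored one after the other in the array \<open>S\<close>; the list of \<open>S[i]\<close> occupies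
  the positions from \<open>off[i]\<close> up to, but excluding, \<open>off[i+1]\<close>. All other memory is initially 0.\<close>

definition input_state :: "kew \<Rightarrow> nat list \<Rightarrow> nat list list \<Rightarrow> state" where
  "input_state I us ss =
     \<lparr>vars = (\<lambda>_. 0)
        (''L'' := int (len I),
         ''n'' := int (length us),
         ''wmax'' := int (wmax I)),
      arrs = (\<lambda>_ _. 0)
        (''U'' := array_of (map int us),
         ''q'' := array_of (map (init I) [0..<len I]),
         ''off'' := array_of (map (\<lambda>i. int (length (concat (take i ss)))) [0..<len I + 1]),
         ''S'' := array_of (map int (concat ss)))\<rparr>"

definition encodes_input :: "kew \<Rightarrow> state \<Rightarrow> bool" where
  "encodes_input I s \<longleftrightarrow>
     (\<exists>us ss. distinct us \<and> set us = items I \<and> length ss = len I \<and>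
        (\<forall>i<len I. distinct (ss ! i) \<and> set (ss ! i) = allowed I i) \<and>
        s = input_state I us ss)"

text \<open>The output vectors are written sparsely, since dense vectors would take \<open>|U| L\<close> cells: the
  support of the \<open>i\<close>-th vector is listed in the array \<open>supp\<close> from position \<open>xoff[i]\<close> up to, but
  excluding, \<open>xoff[i+1]\<close>, and the corresponding entries stand at the same positions in the array
  \<open>mult\<close>. An objective value of \<open>-\<infinity>\<close> is indicated by \<open>fin[i] = 0\<close>.\<close>

definition output_block :: "state \<Rightarrow> string \<Rightarrow> nat \<Rightarrow> int list" where
  "output_block s a i =
     map (arrs s a) [arrs s ''xoff'' (int i) .. arrs s ''xoff'' (int i + 1) - 1]"

definition encodes_output ::
  "kew \<Rightarrow> state \<Rightarrow> (nat \<Rightarrow> nat \<Rightarrow> nat) \<Rightarrow> (nat \<Rightarrow> int) \<Rightarrow> (nat \<Rightarrow> ereal) \<Rightarrow> bool" where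
  "encodes_output I s x z r \<longleftrightarrow>
     (\<forall>i<len I.
        distinct (output_block s ''supp'' i) \<and>
        set (output_block s ''supp'' i) = int ` supp (x i) \<and>
        output_block s ''mult'' i = map (\<lambda>w. int (x i (nat w))) (output_block s ''supp'' i) \<and>
        arrs s ''z'' (int i) = z i \<and>
        r i = (if arrs s ''fin'' (int i) = 0 then - \<infinity>
               else ereal (of_int (arrs s ''r'' (int i)))))"

text \<open>Whatever the number \<open>l\<close> of bits in which the input fits, the program works with words of
  \<open>\<kappa> l\<close> bits, that is, with a constant number of machine words per value.\<close>

definition solves_within :: "com \<Rightarrow> nat \<Rightarrow> kew \<Rightarrow> real \<Rightarrow> bool" where
  "solves_within P \<kappa> I T \<longleftrightarrow>
     (\<forall>l s. fits l I \<longrightarrow> encodes_input I s \<longrightarrow>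
        (\<exists>t s' x z r.
           exec (evaluator_of I) (2 ^ (\<kappa> * l)) P s t s' \<and> real t \<le> T \<and>
           encodes_output I s' x z r \<and> kew_solution I x z r))"

text \<open>\<open>C f polylog f\<close>; the shift by one keeps the logarithm at least 1 when \<open>f = 1\<close>.\<close>

definition polylog_bound :: "real \<Rightarrow> nat \<Rightarrow> nat \<Rightarrow> real" where
  "polylog_bound C k f = C * real f * log 2 (real f + 1) ^ k"

end

theory Submission
 imports Defs
begin

text \<open>The items are coloured with \<open>K = O(b)\<close> colours such that every set \<open>S[z]\<close> has fewer than \<open>lg = O(log(bL))\<close>
 items of each colour; the colouring is found greedily by the method of conditional expectations, with the
 exponential potential \<open>2\<^sup>l\<^sup>o\<^sup>a\<^sup>d - 1\<close> kept in binary trees. The colours are processed one after the other.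
 For a fixed colour and every \<open>z\<close>, some modulus \<open>d \<le> 2 lg\<^sup>3 + 1\<close> separates the items of that colour in \<open>S[z]\<close>,
 so for every \<open>d\<close> one runs through the residue classes \<open>\<rho> < d\<close> with the indices that \<open>d\<close> isolates: each such
 index then offers at most one item. One residue class is a single left-to-right sweep over the indices:
 by strict concavity two candidates with the same item and residue cross at most once, and the
 crossing is found by binary search. A candidate may be discarded although it is locally better when it is
 beaten by another value plus a multiple of the same item; then it does not belong to any maximizer, which
 is why the weak guarantee suffices. Solutions are stored as shared linked lists. An exchange argument carries the
 invariant that every prefix of a maximizer (restricted to the colours already treated) is matched by the table.\<close>

text \<open>Strict concavity enters through strict subadditivity:
  \<open>Q (k + e) < Q k + Q e\<close> for positive \<open>k\<close> and \<open>e\<close>. Suppose a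
  candidate holding \<open>k\<close> copies of \<open>w\<close> is at index \<open>j\<close> no
  better than an entry built without \<open>w\<close>. Continuing the candidate by \<open>e\<close>
  copies is then strictly worse than adding \<open>e\<close> fresh copies to that entry. Hence one
  list of candidates of a single item per index suffices in a sweep. The table need not contain the
  better vector; that vector only has to be feasible, and its support need not obey the sets
  \<open>S[z]\<close>. So the invariants quantify over maximizers only and never claim that table
  entries are optimal. The modulus bound comes from the least common multiple of
  \<open>1, ..., n\<close>, which grows exponentially, whereas a product of at most
  \<open>lg * lg\<close> differences of numbers below \<open>2 ^ lg\<close> is at most
  \<open>2 ^ (lg ^ 3)\<close>. With \<open>D = 2 * lg ^ 3 + 1\<close> a colour takes at most
  \<open>D ^ 2\<close> sweeps; a factor \<open>(lg + 1) ^ 2\<close> covers binary searches and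
  isolation tests, so the logarithm appears with exponent 8.\<close>

abbreviation ar :: "state => string => nat => int" where "ar s a i \<equiv> arrs s a (int i)"

section \<open>Value bounds and step counting for word RAM programs\<close>

text \<open>Only stored values are bounded by \<open>M\<close>. Intermediate results may be larger
  and are controlled by the size of the expression.\<close>

definition Bd :: "int => state => bool" where
 "Bd M s \<longleftrightarrow> (\<forall>v. \<bar>vars s v\<bar> <= M) & (\<forall>a k. \<bar>arrs s a k\<bar> <= M)"

text \<open>The result of a profit query is not bounded by the contents of the memory. Queries are
  therefore excluded inside expressions; they occur only as a whole right-hand side, with a bound of
  their own. Constants up to 16 stay below every admissible \<open>M\<close>.\<close>

fun qf :: "aexp => bool" where
 "qf (Const n) = (\<bar>n\<bar> <= 16)"
| "qf (Var v) = True"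
| "qf (Read a e) = qf e"
| "qf (Op f e1 e2) = (qf e1 & qf e2)"
| "qf (Query e1 e2) = False"

fun okb :: "bexp => bool" where
 "okb (Less e1 e2) = (qf e1 & qf e2 & acost e1 <= 20 & acost e2 <= 20)"
| "okb (Equal e1 e2) = (qf e1 & qf e2 & acost e1 <= 20 & acost e2 <= 20)"
| "okb (BNot c) = okb c"
| "okb (BAnd c1 c2) = (okb c1 & okb c2)"

fun asgd :: "com => string set" where
 "asgd Skip = {}"
| "asgd (Assign v e) = {v}"
| "asgd (Write a d e) = {}"
| "asgd (Seq c1 c2) = asgd c1 \<union> asgd c2"
| "asgd (Cond b c1 c2) = asgd c1 \<union> asgd c2"
| "asgd (While b c) = asgd c"

fun wrtn :: "com => string set" where
 "wrtn Skip = {}"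
| "wrtn (Assign v e) = {}"
| "wrtn (Write a d e) = {a}"
| "wrtn (Seq c1 c2) = wrtn c1 \<union> wrtn c2"
| "wrtn (Cond b c1 c2) = wrtn c1 \<union> wrtn c2"
| "wrtn (While b c) = wrtn c"

lemma exec_frame:
 "exec Q W c s t s' ==>
   (\<forall>v. v \<notin> asgd c --> vars s' v = vars s v) & (\<forall>a. a \<notin> wrtn c --> arrs s' a = arrs s a)"
 by (induction rule: exec.induct) auto

text \<open>The quantity "absolute value plus one" is submultiplicative for all five operators, so
  the values of an expression are bounded by a power whose exponent is its size.\<close>

lemma abs_apply_op_le: "\<bar>apply_op f a b\<bar> + 1 <= (\<bar>a\<bar> + 1) * (\<bar>b\<bar> + 1)"
proof -
 have base: "\<bar>a\<bar> + \<bar>b\<bar> + 1 <= (\<bar>a\<bar> + 1) * (\<bar>b\<bar> + 1)"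
  by (simp add: algebra_simps)
 show ?thesis
 proof (cases f)
  case Add then show ?thesis using base by simp
 next
  case Sub then show ?thesis using base by simp
 next
  case Mul then show ?thesis by (simp add: algebra_simps abs_mult)
 next
  case Div
  have "\<bar>a div b\<bar> <= \<bar>a\<bar>"
  proof (cases "b = 0")
   case False
   have mod: "b * (a div b) + a mod b = a" by simp
   show ?thesis
   \<comment> \<open>A larger quotient would make \<open>a - a mod b\<close> at least
     \<open>\<bar>b\<bar> * (\<bar>a\<bar> + 1)\<close> in absolute value, hence at least
     \<open>\<bar>a\<bar> + \<bar>b\<bar>\<close>, although the remainder is smaller than
     \<open>\<bar>b\<bar>\<close>.\<close>
   proof (rule ccontr)
    assume c: "\<not> ?thesis"
    have "\<bar>a mod b\<bar> < \<bar>b\<bar>" using False by (rule abs_mod_less)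
    have "\<bar>b * (a div b)\<bar> = \<bar>b\<bar> * \<bar>a div b\<bar>" by (rule abs_mult)
    have "\<bar>a - a mod b\<bar> \<ge> \<bar>b\<bar> * (\<bar>a\<bar> + 1)"
     using c \<open>\<bar>b * (a div b)\<bar> = _\<close> mod
     by (metis add_diff_cancel_right' linorder_not_le mult_left_mono abs_ge_zero zless_imp_add1_zle)
    moreover have "\<bar>a - a mod b\<bar> < \<bar>a\<bar> + \<bar>b\<bar>" using \<open>\<bar>a mod b\<bar> < \<bar>b\<bar>\<close> by linarith
    moreover have "\<bar>b\<bar> * (\<bar>a\<bar> + 1) \<ge> \<bar>a\<bar> + \<bar>b\<bar>"
     using False mult_right_mono[of 1 "\<bar>b\<bar>" "\<bar>a\<bar>"] by (simp add: algebra_simps)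
    ultimately show False by linarith
   qed
  qed simp
  then show ?thesis using Div base by simp
 next
  case Mod
  have "\<bar>a mod b\<bar> <= \<bar>a\<bar> + \<bar>b\<bar>"
   by (cases "b = 0") (use abs_mod_less[of b a] in auto)
  then show ?thesis using Mod base by simp
 qed
qed

lemma aval_le_power:
 assumes "Bd M s" "qf e" "M \<ge> 16"
 shows "\<bar>aval Q s e\<bar> + 1 <= (M + 1) ^ acost e"
 using assms(2)
proof (induction e)
 case (Const n)
 then show ?case using assms by simp
next
 case (Var v)
 then show ?case using assms by (simp add: Bd_def)
next
 case (Read a e)
 have "1 <= (M + 1) ^ acost e" using assms by (intro one_le_power) auto
 then have "(M + 1) * 1 <= (M + 1) * (M + 1) ^ acost e"
  using assms by (intro mult_left_mono) auto
 moreover have "\<bar>aval Q s (Read a e)\<bar> <= M" using assms by (simp add: Bd_def)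
 ultimately show ?case by simp
next
 case (Op f e1 e2)
 have "\<bar>aval Q s (Op f e1 e2)\<bar> + 1 <= (\<bar>aval Q s e1\<bar> + 1) * (\<bar>aval Q s e2\<bar> + 1)"
  using abs_apply_op_le by simp
 also have "\<dots> <= (M + 1) ^ acost e1 * (M + 1) ^ acost e2"
  using Op assms by (intro mult_mono) auto
 also have "\<dots> = (M + 1) ^ (acost e1 + acost e2)" by (simp add: power_add)
 also have "\<dots> <= (M + 1) ^ acost (Op f e1 e2)"
  using assms by (intro power_increasing) auto
 finally show ?case .
qed auto

lemma subexps_qf: "qf e ==> e' \<in> subexps e ==> qf e' & acost e' <= acost e"
 by (induction e) fastforce+

text \<open>Every expression of the program has cost at most 20, so its subexpressions stay below
  \<open>(M + 1) ^ 20\<close>; this is the room that the words must offer.\<close>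

locale machine =
 fixes Q :: evaluator and W M :: int
 assumes M16: "M \<ge> 16" and MW: "(M + 1) ^ 20 <= W"
begin

lemma in_words_qf:
 assumes "Bd M s" "qf e" "acost e <= 20"
 shows "in_words Q W s (subexps e)"
 unfolding in_words_def
proof
 fix e' assume "e' \<in> subexps e"
 then have e': "qf e'" "acost e' <= 20" using subexps_qf assms by fastforce+
 have "\<bar>aval Q s e'\<bar> + 1 <= (M + 1) ^ acost e'" using aval_le_power assms(1) e'(1) M16 by blast
 also have "\<dots> <= (M + 1) ^ 20" using e' M16 by (intro power_increasing) auto
 finally show "\<bar>aval Q s e'\<bar> < W" using MW by linarith
qed

lemma in_words_okb: "Bd M s ==> okb b ==> in_words Q W s (bsubexps b)"
proof (induction b)
 case (Less e1 e2)
 then show ?case using in_words_qf[of s e1] in_words_qf[of s e2] by (auto simp: in_words_def)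
next
 case (Equal e1 e2)
 then show ?case using in_words_qf[of s e1] in_words_qf[of s e2] by (auto simp: in_words_def)
qed (auto simp: in_words_def)

fun bsz :: "bexp => nat" where
 "bsz (Less e1 e2) = 1" | "bsz (Equal e1 e2) = 1" | "bsz (BNot c) = 1 + bsz c"
| "bsz (BAnd c1 c2) = 1 + bsz c1 + bsz c2"

text \<open>A comparison costs at most \<open>1 + 20 + 20\<close>, and a connective adds 1.\<close>

lemma bcost_le: "okb b ==> bcost b <= 41 * bsz b"
 by (induction b) auto

text \<open>Total correctness with coarse time: \<open>t\<close> is the time already spent, and each
  command or test counts as one unit. A unit stands for at most 400 RAM steps, as tests have
  \<open>bsz\<close> at most 8 and hence cost at most \<open>8 * 41\<close>. The value bound is part
  of the judgement, so specifications need not repeat it.\<close>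

definition run :: "com => state => nat => (nat => state => bool) => bool" where
 "run c s t P \<longleftrightarrow> (Bd M s --> (\<exists>t' n s'. exec Q W c s t' s' & t' <= 400 * n & Bd M s' & P (t + n) s'))"

lemma runI_Bd: "(Bd M s ==> run c s t P) ==> run c s t P"
 by (auto simp: run_def)

lemma run_Seq:
 assumes "run c1 s t (\<lambda>t' s'. run c2 s' t' P)"
 shows "run (Seq c1 c2) s t P"
 unfolding run_def
proof
 assume "Bd M s"
 then obtain t1 n1 s1 where 1: "exec Q W c1 s t1 s1" "t1 <= 400 * n1" "Bd M s1" "run c2 s1 (t + n1) P"
  using assms unfolding run_def[of c1] by blast
 then obtain t2 n2 s2 where 2: "exec Q W c2 s1 t2 s2" "t2 <= 400 * n2" "Bd M s2" "P (t + n1 + n2) s2"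
  by (auto simp: run_def)
 have "exec Q W (Seq c1 c2) s (t1 + t2) s2" using 1 2 by (auto intro: exec.Seq)
 moreover have "t1 + t2 <= 400 * (n1 + n2)" using 1 2 by simp
 ultimately show "\<exists>t' n s'. exec Q W (Seq c1 c2) s t' s' & t' <= 400 * n & Bd M s' & P (t + n) s'"
  using 2(3,4) by (metis add.assoc)
qed

lemma run_Skip: "P (t + 1) s ==> run Skip s t P"
 unfolding run_def by (intro impI exI[of _ 1] exI[of _ s] conjI exec.Skip) auto

lemma run_Assign:
 assumes "qf e" "acost e <= 20" "\<bar>aval Q s e\<bar> <= M"
  "P (t + 1) (s\<lparr>vars := (vars s)(v := aval Q s e)\<rparr>)"
 shows "run (Assign v e) s t P"
 unfolding run_def
proof
 assume B: "Bd M s"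
 have "exec Q W (Assign v e) s (1 + acost e) (s\<lparr>vars := (vars s)(v := aval Q s e)\<rparr>)"
  using in_words_qf[OF B assms(1,2)] by (rule exec.Assign)
 moreover have "Bd M (s\<lparr>vars := (vars s)(v := aval Q s e)\<rparr>)" using B assms(3) by (auto simp: Bd_def)
 moreover have "1 + acost e <= 400 * 1" using assms(2) by simp
 ultimately show "\<exists>t' n s'. exec Q W (Assign v e) s t' s' & t' <= 400 * n & Bd M s' & P (t + n) s'"
  using assms(4) by blast
qed

lemma run_Query:
 assumes "qf e1" "acost e1 <= 20" "qf e2" "acost e2 <= 20" "\<bar>Q (aval Q s e1) (aval Q s e2)\<bar> <= M"
  "P (t + 1) (s\<lparr>vars := (vars s)(v := Q (aval Q s e1) (aval Q s e2))\<rparr>)"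
 shows "run (Assign v (Query e1 e2)) s t P"
 unfolding run_def
proof
 assume B: "Bd M s"
 have "M < (M + 1) ^ 20" using M16 power_increasing[of 1 20 "M + 1"] by simp
 then have MW': "M < W" using MW by linarith
 let ?s = "s\<lparr>vars := (vars s)(v := Q (aval Q s e1) (aval Q s e2))\<rparr>"
 have "in_words Q W s (subexps (Query e1 e2))"
  using in_words_qf[OF B assms(1,2)] in_words_qf[OF B assms(3,4)] assms(5) MW'
  by (auto simp: in_words_def)
 then have "exec Q W (Assign v (Query e1 e2)) s (1 + acost (Query e1 e2)) (s\<lparr>vars := (vars s)(v := aval Q s (Query e1 e2))\<rparr>)"
  by (rule exec.Assign)
 moreover have "Bd M ?s" using B assms(5) by (auto simp: Bd_def)
 moreover have "1 + acost (Query e1 e2) <= 400 * 1" using assms(2,4) by simp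
 ultimately show "\<exists>t' n s'. exec Q W (Assign v (Query e1 e2)) s t' s' & t' <= 400 * n & Bd M s' & P (t + n) s'"
  using assms(6) by (metis aval.simps(5))
qed

lemma run_Write:
 assumes "qf d" "acost d <= 20" "qf e" "acost e <= 20" "\<bar>aval Q s e\<bar> <= M"
  "P (t + 1) (s\<lparr>arrs := (arrs s)(a := (arrs s a)(aval Q s d := aval Q s e))\<rparr>)"
 shows "run (Write a d e) s t P"
 unfolding run_def
proof
 assume B: "Bd M s"
 let ?s = "s\<lparr>arrs := (arrs s)(a := (arrs s a)(aval Q s d := aval Q s e))\<rparr>"
 have "in_words Q W s (subexps d \<union> subexps e)"
  using in_words_qf[OF B assms(1,2)] in_words_qf[OF B assms(3,4)] by (auto simp: in_words_def)
 then have "exec Q W (Write a d e) s (1 + acost d + acost e) ?s"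
  by (rule exec.Write)
 moreover have "Bd M ?s" using B assms(5) by (auto simp: Bd_def)
 moreover have "1 + acost d + acost e <= 400 * 1" using assms(2,4) by simp
 ultimately show "\<exists>t' n s'. exec Q W (Write a d e) s t' s' & t' <= 400 * n & Bd M s' & P (t + n) s'"
  using assms(6) by blast
qed

lemma run_Cond:
 assumes b: "okb b" "bsz b <= 8" and "bval Q s b ==> run c1 s (t + 1) P" "\<not> bval Q s b ==> run c2 s (t + 1) P"
 shows "run (Cond b c1 c2) s t P"
 unfolding run_def
proof
 assume B: "Bd M s"
 have iw: "in_words Q W s (bsubexps b)" using in_words_okb B b by blast
 have bc: "bcost b <= 400" using bcost_le[OF b(1)] b(2) by simp
 show "\<exists>t' n s'. exec Q W (Cond b c1 c2) s t' s' & t' <= 400 * n & Bd M s' & P (t + n) s'"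
 proof (cases "bval Q s b")
  case True
  then obtain t' n s' where "exec Q W c1 s t' s'" "t' <= 400 * n" "Bd M s'" "P (t + 1 + n) s'"
   using assms(3) B by (auto simp: run_def)
  then show ?thesis using exec.CondTrue[OF iw True, of c1 t' s' c2] bc
   by (intro exI[of _ "bcost b + t'"] exI[of _ "1 + n"] exI[of _ s']) (auto simp: add.assoc)
 next
  case False
  then obtain t' n s' where "exec Q W c2 s t' s'" "t' <= 400 * n" "Bd M s'" "P (t + 1 + n) s'"
   using assms(4) B by (auto simp: run_def)
  then show ?thesis using exec.CondFalse[OF iw False, of c2 t' s' c1] bc
   by (intro exI[of _ "bcost b + t'"] exI[of _ "1 + n"] exI[of _ s']) (auto simp: add.assoc)
 qed
qed

text \<open>Consequence rule and frame rule in one: what the program text does not assign is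
  unchanged, and \<open>P'\<close> may rely on that. Specifications then mention only the cells that
  they produce.\<close>

lemma run_conseq:
 assumes "run c s t P"
  "\<And>t' s'. P t' s' ==> (\<And>v. v \<notin> asgd c ==> vars s' v = vars s v) ==>
    (\<And>a. a \<notin> wrtn c ==> arrs s' a = arrs s a) ==> Bd M s' ==> P' t' s'"
 shows "run c s t P'"
 using assms exec_frame unfolding run_def by metis

lemma run_WhileFalse:
 assumes b: "okb b" "bsz b <= 8" and "\<not> bval Q s b" "P (t + 1) s"
 shows "run (While b c) s t P"
 unfolding run_def
proof
 assume B: "Bd M s"
 have "exec Q W (While b c) s (bcost b) s"
  using in_words_okb B b assms by (intro exec.WhileFalse) auto
 moreover have "bcost b <= 400 * 1" using bcost_le[OF b(1)] b(2) by simp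
 ultimately show "\<exists>t' n s'. exec Q W (While b c) s t' s' & t' <= 400 * n & Bd M s' & P (t + n) s'"
  using B assms by blast
qed

lemma run_WhileTrue:
 assumes b: "okb b" "bsz b <= 8" and "bval Q s b" "run c s (t + 1) (\<lambda>t' s'. run (While b c) s' t' P)"
 shows "run (While b c) s t P"
 unfolding run_def
proof
 assume B: "Bd M s"
 have iw: "in_words Q W s (bsubexps b)" using in_words_okb B b by blast
 have bc: "bcost b <= 400" using bcost_le[OF b(1)] b(2) by simp
 obtain t1 n1 s1 where 1: "exec Q W c s t1 s1" "t1 <= 400 * n1" "Bd M s1" "run (While b c) s1 (t + 1 + n1) P"
  using assms B unfolding run_def[of c] by blast
 then obtain t2 n2 s2 where 2: "exec Q W (While b c) s1 t2 s2" "t2 <= 400 * n2" "Bd M s2" "P (t + 1 + n1 + n2) s2"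
  by (auto simp: run_def)
 have "exec Q W (While b c) s (bcost b + t1 + t2) s2" using iw assms(3) 1 2 by (auto intro: exec.WhileTrue)
 moreover have "bcost b + t1 + t2 <= 400 * (1 + n1 + n2)" using 1 2 bc by simp
 ultimately show "\<exists>t' n s'. exec Q W (While b c) s t' s' & t' <= 400 * n & Bd M s' & P (t + n) s'"
  using 2(3,4) by (metis add.assoc)
qed

text \<open>The invariant sees the elapsed time, so a time bound is simply a part of
  \<open>Inv\<close>; \<open>\<mu>\<close> is needed for termination only.\<close>

lemma run_While:
 fixes Inv :: "nat => state => bool" and \<mu> :: "state => nat"
 assumes b: "okb b" "bsz b <= 8" and "Inv t s"
  and step: "\<And>t s. Inv t s ==> bval Q s b ==> Bd M s ==> run c s (t + 1) (\<lambda>t' s'. Inv t' s' & \<mu> s' < \<mu> s)"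
  and fin: "\<And>t s. Inv t s ==> \<not> bval Q s b ==> Bd M s ==> P (t + 1) s"
 shows "run (While b c) s t P"
 using \<open>Inv t s\<close>
proof (induction "\<mu> s" arbitrary: s t rule: less_induct)
 case less
 show ?case
 proof (rule runI_Bd)
  assume B: "Bd M s"
  show "run (While b c) s t P"
  proof (cases "bval Q s b")
   case True
   show ?thesis
    by (rule run_WhileTrue[OF b True], rule run_conseq[OF step[OF less.prems True B]]) (use less.hyps in blast)
  next
   case False
   then show ?thesis using fin[OF less.prems False B] b by (intro run_WhileFalse)
  qed
 qed
qed

text \<open>For loops whose number of rounds is known beforehand. The round number indexes the
  invariant, which lets the time bound depend on it.\<close>

lemma run_for:
 fixes Inv :: "nat => nat => state => bool"
 assumes b: "okb b" "bsz b <= 8" and "Inv 0 t s"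
  and step: "\<And>k t s. k < n ==> Inv k t s ==> Bd M s ==> bval Q s b & run c s (t + 1) (Inv (Suc k))"
  and fin: "\<And>t s. Inv n t s ==> Bd M s ==> \<not> bval Q s b & P (t + 1) s"
 shows "run (While b c) s t P"
proof -
 have "k <= n ==> Inv k t s ==> run (While b c) s t P" for k t s
 proof (induction "n - k" arbitrary: k t s)
  case 0
  then have "Inv n t s" by simp
  show ?case by (rule runI_Bd) (use fin[OF \<open>Inv n t s\<close>] b in \<open>auto intro: run_WhileFalse\<close>)
 next
  case (Suc d)
  show ?case
  proof (rule runI_Bd)
   assume B: "Bd M s"
   have k: "k < n" using Suc by simp
   have st: "bval Q s b" "run c s (t + 1) (Inv (Suc k))" using step[OF k Suc.prems(2) B] by auto
   show "run (While b c) s t P"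
    by (rule run_WhileTrue[OF b st(1)], rule run_conseq[OF st(2)]) (use Suc.hyps k in \<open>metis Suc_diff_Suc Suc_leI diff_Suc_1\<close>)
  qed
 qed
 from this[of 0] show ?thesis using assms(3) by simp
qed

text \<open>Straight-line code is executed symbolically by simplification with these equations.
  Loops get \<open>False\<close> here, because they always go through \<open>run_While\<close> or
  \<open>run_for\<close>.\<close>

fun wp :: "com => (nat => state => bool) => nat => state => bool" where
 "wp Skip P t s = P (t + 1) s"
| "wp (Assign v (Query e1 e2)) P t s = (qf e1 & acost e1 <= 20 & qf e2 & acost e2 <= 20 &
   \<bar>Q (aval Q s e1) (aval Q s e2)\<bar> <= M & P (t + 1) (s\<lparr>vars := (vars s)(v := Q (aval Q s e1) (aval Q s e2))\<rparr>))"
| "wp (Assign v e) P t s = (qf e & acost e <= 20 & \<bar>aval Q s e\<bar> <= M &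
   P (t + 1) (s\<lparr>vars := (vars s)(v := aval Q s e)\<rparr>))"
| "wp (Write a d e) P t s = (qf d & acost d <= 20 & qf e & acost e <= 20 & \<bar>aval Q s e\<bar> <= M &
   P (t + 1) (s\<lparr>arrs := (arrs s)(a := (arrs s a)(aval Q s d := aval Q s e))\<rparr>))"
| "wp (Seq c1 c2) P t s = wp c1 (wp c2 P) t s"
| "wp (Cond b c1 c2) P t s = (okb b & bsz b <= 8 & (if bval Q s b then wp c1 P (t + 1) s else wp c2 P (t + 1) s))"
| "wp (While b c) P t s = False"

lemma run_wp0: "wp c P t s ==> run c s t P"
proof (induction c arbitrary: P t s)
 case (Assign v e)
 show ?case
 proof (cases e)
  case (Query e1 e2)
  then show ?thesis using Assign by (auto intro!: run_Query)
 qed (use Assign in \<open>auto intro!: run_Assign\<close>)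
next
 case (Seq c1 c2)
 have "run c1 s t (wp c2 P)" using Seq by simp
 then show ?case by (intro run_Seq) (auto elim!: run_conseq intro: Seq)
qed (auto intro: run_Skip run_Write run_Cond split: if_splits)

lemma run_wp: "(Bd M s ==> wp c P t s) ==> run c s t P"
 using run_wp0 runI_Bd by blast

end

section \<open>Common multiples of 1, ..., n and isolating moduli\<close>

text \<open>These numbers are the denominators of the Leibniz harmonic triangle. Its recurrence
  \<open>1 / (n C(n-1,k+1)) = 1 / ((n-1) C(n-2,k)) - 1 / (n C(n-1,k))\<close>, multiplied by
  \<open>\<Lambda>\<close>, exhibits the quotient as a difference of two integers known by
  induction.\<close>

lemma leibniz_dvd:
 fixes \<Lambda> :: nat
 assumes "\<forall>j\<in>{1..n}. j dvd \<Lambda>" "k < n"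
 shows "n * ((n - 1) choose k) dvd \<Lambda>"
 using assms
proof (induction k arbitrary: n)
 case 0
 then show ?case by auto
next
 case (Suc k)
 obtain m where n: "n = Suc (Suc m)" using Suc.prems(2) by (metis Suc_less_eq2 less_imp_Suc_add not0_implies_Suc)
 have 1: "n * ((n - 1) choose k) dvd \<Lambda>" using Suc by simp
 have 2: "(n - 1) * ((n - 2) choose k) dvd \<Lambda>"
  using Suc.IH[of "n - 1"] Suc.prems n by (auto simp: numeral_2_eq_2)
 obtain x y where x: "\<Lambda> = n * ((n - 1) choose k) * x" and y: "\<Lambda> = (n - 1) * ((n - 2) choose k) * y"
  using 1 2 by (metis dvdE)
 have km: "k <= m" using Suc.prems n by simp
 have e1: "Suc k * (Suc m choose Suc k) = Suc m * (m choose k)" by (metis Suc_times_binomial_eq mult.commute)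
 have e2: "(Suc m - k) * (Suc m choose k) = Suc m * (m choose k)"
  using binomial_absorb_comp[of "Suc m" k] by simp
 let ?c = "real (m choose k)"
 let ?A = "real (Suc m choose Suc k)" and ?B = "real (Suc m choose k)"
 have c0: "?c > 0" "?A > 0" "?B > 0" using km by (auto simp: add_pos_nonneg simp del: binomial_Suc_Suc)
 have r1: "real (Suc k) * ?A = real (Suc m) * ?c" using e1 by (metis of_nat_mult)
 have r2: "(real (Suc m) - real k) * ?B = real (Suc m) * ?c"
  using e2 km by (metis le_SucI of_nat_diff of_nat_mult)
 have rx: "real \<Lambda> = real n * ?B * real x" using x n by (simp add: algebra_simps)
 have ry: "real \<Lambda> = real (Suc m) * ?c * real y" using y n by (simp add: numeral_2_eq_2 algebra_simps)
 \<comment> \<open>This is the recurrence with cleared denominators: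
   \<open>\<Lambda> = n * B * x\<close> and \<open>\<Lambda> = (m + 1) * c * y\<close> with the
   binomials abbreviated, so \<open>y - x\<close> is the cofactor sought.\<close>
 have "real n * ?A * (real y - real x) = real \<Lambda>"
 proof -
  have "real (Suc m) * ?c * (real n * ?A * real y) = real n * ?A * real \<Lambda>" using ry by (simp add: mult_ac)
  moreover have "real n * ?A * real x * ?B = ?A * real \<Lambda>" using rx by (simp add: mult_ac)
  ultimately have "real (Suc m) * ?c * (real n * ?A * (real y - real x)) = real n * ?A * real \<Lambda> - real (Suc m) * ?c * (real n * ?A * real x)"
   by (simp add: algebra_simps)
  also have "real (Suc m) * ?c * (real n * ?A * real x) = (real (Suc m) - real k) * (real n * ?A * real x * ?B)"
   using r2 by (metis mult.commute mult.left_commute)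
  also have "\<dots> = (real (Suc m) - real k) * (?A * real \<Lambda>)" using \<open>real n * ?A * real x * ?B = _\<close> by simp
  also have "real n * ?A * real \<Lambda> - \<dots> = real (Suc k) * ?A * real \<Lambda>" using n by (simp add: algebra_simps)
  also have "\<dots> = real (Suc m) * ?c * real \<Lambda>" using r1 by simp
  finally show ?thesis using c0 by simp
 qed
 then have "real_of_int (int (n * (Suc m choose Suc k)) * (int y - int x)) = real_of_int (int \<Lambda>)"
  unfolding of_int_mult of_int_diff of_int_of_nat_eq of_nat_mult by (simp only:)
 then have "int (n * (Suc m choose Suc k)) * (int y - int x) = int \<Lambda>"
  unfolding of_int_eq_iff .
 then have "int (n * (Suc m choose Suc k)) dvd int \<Lambda>" by (metis dvd_triv_left)
 then show ?case using n by (metis diff_Suc_1 int_dvd_int_iff)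
qed

text \<open>The binomial row with sum \<open>2 ^ (2 * m)\<close> has \<open>2 * m + 1\<close>
  entries, none above the central one, and \<open>2 * m + 1\<close> times the central entry divides
  \<open>\<Lambda>\<close>. This is the elementary lower bound for the least common
  multiple.\<close>

lemma four_power_le_common_multiple:
 fixes \<Lambda> :: nat
 assumes "\<forall>j\<in>{1..2 * m + 1}. j dvd \<Lambda>" "\<Lambda> > 0"
 shows "4 ^ m <= \<Lambda>"
proof -
 have "(4::nat) ^ m = 2 ^ (2 * m)" by (simp add: power_mult)
 also have "\<dots> = (\<Sum>k\<le>2 * m. (2 * m) choose k)" by (simp add: choose_row_sum)
 also have "\<dots> <= (\<Sum>k\<le>2 * m. (2 * m) choose m)"
  by (intro sum_mono) (use binomial_maximum[of "2 * m"] in simp)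
 also have "\<dots> = (2 * m + 1) * ((2 * m) choose m)" by simp
 also have "\<dots> <= \<Lambda>"
  using leibniz_dvd[OF assms(1), of m] assms(2) by (intro dvd_imp_le) auto
 finally show ?thesis .
qed

text \<open>A modulus that is not injective on \<open>A\<close> divides a difference of two
  elements, hence the product \<open>\<Lambda>\<close> of all differences. If all moduli failed,
  \<open>\<Lambda>\<close> would be a common multiple and at least \<open>4 ^ (h * s * s)\<close>,
  yet it has at most \<open>s * s\<close> factors, each at most \<open>2 ^ h\<close>.\<close>

lemma exists_isolating_modulus:
 fixes A :: "nat set"
 assumes "finite A" "card A <= s" "\<forall>w\<in>A. w < L" "L <= 2 ^ h"
 shows "\<exists>d\<in>{1..2 * (h * s * s) + 1}. inj_on (\<lambda>w. w mod d) A"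
proof (rule ccontr)
 assume neg: "\<not> ?thesis"
 define R where "R = {(u, v). u \<in> A & v \<in> A & u < v}"
 define \<Lambda> where "\<Lambda> = (\<Prod>(u, v)\<in>R. v - u)"
 have RA: "R \<subseteq> A \<times> A" by (auto simp: R_def)
 then have finR: "finite R" using assms(1) finite_subset by blast
 have pos: "\<Lambda> > 0" by (auto simp: \<Lambda>_def R_def intro!: prod_pos)
 have dv: "\<forall>j\<in>{1..2 * (h * s * s) + 1}. j dvd \<Lambda>"
 proof
  fix j assume "j \<in> {1..2 * (h * s * s) + 1}"
  then have "\<not> inj_on (\<lambda>w. w mod j) A" using neg by blast
  then obtain u v where uv: "u \<in> A" "v \<in> A" "u \<noteq> v" "u mod j = v mod j"
   by (auto simp: inj_on_def)
  define a b where "a = min u v" and "b = max u v"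
  have ab: "(a, b) \<in> R" "a mod j = b mod j" using uv by (auto simp: a_def b_def R_def min_def max_def)
  then have "j dvd b - a" using mod_eq_dvd_iff_nat[of a b j] by (auto simp: R_def)
  moreover have "b - a dvd \<Lambda>" unfolding \<Lambda>_def using dvd_prodI[OF finR ab(1), of "\<lambda>(u, v). v - u"] by simp
  ultimately show "j dvd \<Lambda>" using dvd_trans by blast
 qed
 have "card R <= card (A \<times> A)" using RA assms(1) by (intro card_mono) auto
 then have cR: "card R <= s * s" using assms(2) by (simp add: card_cartesian_product) (meson le_trans mult_le_mono)
 have "\<Lambda> <= (\<Prod>(u, v)\<in>R. 2 ^ h)"
  unfolding \<Lambda>_def using assms(3,4) by (intro prod_mono) (fastforce simp: R_def)
 also have "\<dots> = (2 ^ h) ^ card R" by (simp add: case_prod_unfold)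
 also have "\<dots> <= (2 ^ h) ^ (s * s)" using cR by (intro power_increasing) auto
 also have "\<dots> = 2 ^ (h * s * s)" by (simp add: power_mult mult.assoc)
 finally have up: "\<Lambda> <= 2 ^ (h * s * s)" .
 have lo: "4 ^ (h * s * s) <= \<Lambda>" using four_power_le_common_multiple[OF dv pos] .
 have "(2::nat) ^ (h * s * s) * 2 ^ (h * s * s) = 4 ^ (h * s * s)" by (simp flip: power_mult_distrib)
 then have z: "h * s * s = 0"
 proof -
  have "(2::nat) ^ (h * s * s) * 2 ^ (h * s * s) <= 2 ^ (h * s * s) * 1"
   using up lo \<open>_ * _ = 4 ^ _\<close> by linarith
  then have "(2::nat) ^ (h * s * s) <= 1" by simp
  then show ?thesis by (metis one_less_numeral_iff one_less_power not_gr_zero not_le semiring_norm(76))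
 qed
 \<comment> \<open>The two bounds are compatible only for exponent 0. Then \<open>A\<close> has at
   most one element, and the modulus 1 already works.\<close>
 have "inj_on (\<lambda>w. w mod 1) A"
 proof -
  consider "h = 0" | "s = 0" using z by auto
  then have "card A <= 1"
  proof cases
   case 1
   then have "A \<subseteq> {0}" using assms(3,4) by auto
   then show ?thesis using card_mono[of "{0}" A] by simp
  qed (use assms(2) in simp)
  then show ?thesis using assms(1) by (metis card_le_Suc0_iff_eq inj_on_def One_nat_def)
 qed
 then show False using neg by force
qed

section \<open>Specification of one sweep\<close>

text \<open>Candidate \<open>z\<close> is a column: its values at the indices reached from
  \<open>z\<close> by copies of the item \<open>a z\<close>. The value \<open>a z = 0\<close> means
  that no item is offered; the separate case \<open>r = z\<close> keeps the column meaningful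
  then.\<close>

definition col_val :: "(nat => int) => (nat => nat) => (nat => nat => int) => nat => nat => int" where
 "col_val V a Qf z r = (if r = z then V z else V z + Qf (a z) ((r - z) div a z))"

text \<open>\<open>nf j\<close> is the source of the new entry at \<open>j\<close>, so the side
  condition says that this entry was made without \<open>a z\<close> in this sweep. Copies of
  \<open>a z\<close> may then be added to it with additive profit, and the strict inequality refutes
  the maximality of anything that uses column \<open>z\<close> at \<open>r\<close>.\<close>

definition beaten where
 "beaten V a Qf no nf nv z r \<longleftrightarrow> (\<exists>j<r. no j & (nf j = j \<or> a (nf j) \<noteq> a z) & a z dvd r - j &
   col_val V a Qf z r < nv j + Qf (a z) ((r - j) div a z))"

text \<open>The contract between program and combinatorics: new entries are old entries or column
  values, old values are not lost, and each column is matched at each index that it reaches unless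
  it is beaten there.\<close>

definition sweep_spec ::
 "nat => (nat => bool) => (nat => int) => (nat => nat) => (nat => nat => int) =>
  (nat => bool) => (nat => nat) => (nat => int) => bool" where
 "sweep_spec L ok V a Qf no nf nv \<longleftrightarrow> (\<forall>r<L.
   (no r --> nf r <= r & ok (nf r) & (nf r = r \<or> a (nf r) \<noteq> 0 & a (nf r) dvd r - nf r) &
    nv r = col_val V a Qf (nf r) r) &
   (ok r --> no r & V r <= nv r) &
   (\<forall>z<r. ok z & a z \<noteq> 0 & a z dvd r - z -->
    no r & col_val V a Qf z r <= nv r \<or> beaten V a Qf no nf nv z r))"

section \<open>Feasible vectors and the exchange argument\<close>

definition vadd :: "(nat => nat) => (nat => nat) => nat => nat" (infixl "\<oplus>" 65) where
 "x \<oplus> y = (\<lambda>w. x w + y w)"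

definition vsingle :: "nat => nat => nat => nat" where
 "vsingle w k = (\<lambda>v. if v = w then k else 0)"

lemma supp_vadd: "supp (x \<oplus> y) = supp x \<union> supp y"
 by (auto simp: supp_def vadd_def)

lemma supp_vsingle: "supp (vsingle w k) = (if k = 0 then {} else {w})"
 by (auto simp: supp_def vsingle_def)

lemma vadd_assoc: "x \<oplus> y \<oplus> z = x \<oplus> (y \<oplus> z)"
 by (auto simp: vadd_def)

lemma vadd_0: "x \<oplus> (\<lambda>_. 0) = x" "(\<lambda>_. 0) \<oplus> x = x"
 by (auto simp: vadd_def)

lemma supp_0: "supp (\<lambda>_. 0) = {}"
 by (auto simp: supp_def)

locale knap =
 fixes I :: kew
 assumes knst: "kew_instance I" and len1: "len I \<ge> 1"
begin

definition wt :: "(nat => nat) => nat" where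
 "wt x = (\<Sum>w\<in>items I. w * x w)"

definition gain :: "(nat => nat) => int" where
 "gain x = (\<Sum>w\<in>items I. profit I w (x w))"

definition Vl :: "nat => (nat => nat) => int" where
 "Vl i x = init I (i - wt x) + gain x"

definition feas :: "nat => (nat => nat) => bool" where
 "feas i x \<longleftrightarrow> supp x \<subseteq> items I & wt x <= i"

lemma fin_items: "finite (items I)"
 using knst finite_subset by (fastforce simp: kew_instance_def)

lemma item_pos: "w \<in> items I ==> w \<ge> 1"
 using knst by (fastforce simp: kew_instance_def)

lemma profit_0: "w \<in> items I ==> profit I w 0 = 0"
 using knst by (auto simp: kew_instance_def)

lemma profit_concave: "w \<in> items I ==> strictly_concave (profit I w)"
 using knst by (auto simp: kew_instance_def)

lemma allowed_items: "i < len I ==> allowed I i \<subseteq> items I"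
 using knst by (auto simp: kew_instance_def)

lemma wt_vadd: "wt (x \<oplus> y) = wt x + wt y"
 by (simp add: wt_def vadd_def algebra_simps sum.distrib)

lemma wt_0: "wt (\<lambda>_. 0) = 0"
 by (simp add: wt_def)

lemma gain_0: "gain (\<lambda>_. 0) = 0"
 by (simp add: gain_def profit_0)

lemma wt_vsingle: "w \<in> items I ==> wt (vsingle w k) = w * k"
 by (simp add: wt_def vsingle_def fin_items if_distrib[of "\<lambda>x. _ * x"] cong: if_cong)

lemma gain_vadd:
 assumes "supp x \<inter> supp y = {}"
 shows "gain (x \<oplus> y) = gain x + gain y"
proof -
 have "profit I w (x w + y w) = profit I w (x w) + profit I w (y w)" if "w \<in> items I" for w
 proof -
  have "x w = 0 \<or> y w = 0" using assms unfolding supp_def by blast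
  then show ?thesis using profit_0[OF that] by auto
 qed
 then show ?thesis by (simp add: gain_def vadd_def sum.distrib)
qed

lemma gain_vsingle:
 assumes "w \<in> items I"
 shows "gain (vsingle w k) = profit I w k"
proof -
 have "profit I v (vsingle w k v) = (if v = w then profit I w k else 0)" if "v \<in> items I" for v
  using profit_0[OF that] by (auto simp: vsingle_def)
 then show ?thesis using assms by (simp add: gain_def fin_items)
qed

lemma wt_ge: "w \<in> supp x ==> w \<in> items I ==> w <= wt x"
proof -
 assume "w \<in> supp x" "w \<in> items I"
 then have "w <= w * x w" by (auto simp: supp_def)
 also have "\<dots> <= wt x" unfolding wt_def using \<open>w \<in> items I\<close> fin_items by (intro member_le_sum) auto
 finally show ?thesis .
qed

lemma residual_eq: "residual I i x = int i - int (wt x)"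
 by (simp add: residual_def wt_def)

lemma objective_feas:
 assumes "i < len I" "wt x <= i"
 shows "objective I i x = ereal (of_int (Vl i x))"
 using assms by (simp add: objective_def init_ext_def residual_eq Vl_def gain_def nat_diff_distrib' flip: of_nat_diff)

lemma objective_infeas:
 assumes "i < len I" "\<not> wt x <= i"
 shows "objective I i x = - \<infinity>"
 using assms by (simp add: objective_def init_ext_def residual_eq)

lemma maximizer_iff:
 assumes "i < len I"
 shows "maximizer I i x \<longleftrightarrow> feas i x & (\<forall>y. feas i y --> Vl i y <= Vl i x)"
proof
 assume m: "maximizer I i x"
 have "(\<lambda>_. 0) \<in> vectors I" by (auto simp: vectors_def supp_def)
 then have "objective I i (\<lambda>_. 0) <= objective I i x" using m by (auto simp: maximizer_def)
 then have w: "wt x <= i" using objective_infeas[OF assms, of x] objective_feas[OF assms, of "\<lambda>_. 0"]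
  by (cases "wt x <= i") (auto simp: wt_0)
 then show "feas i x & (\<forall>y. feas i y --> Vl i y <= Vl i x)"
  using m objective_feas[OF assms] by (auto simp: maximizer_def feas_def vectors_def)
next
 assume a: "feas i x & (\<forall>y. feas i y --> Vl i y <= Vl i x)"
 have "objective I i y <= objective I i x" if "y \<in> vectors I" for y
  using a that objective_feas[OF assms] objective_infeas[OF assms]
  by (cases "wt y <= i") (auto simp: feas_def vectors_def)
 then show "maximizer I i x" using a by (auto simp: maximizer_def feas_def vectors_def)
qed

text \<open>Weights are at least 1, so no entry exceeds \<open>i\<close>. Finiteness is what
  guarantees that maximizers exist.\<close>

lemma finite_feas: "finite {x. feas i x}"
proof -
 have "x w <= i" if "feas i x" for x w
 proof (cases "w \<in> items I")
  case True
  have "x w <= w * x w" using item_pos[OF True] by simp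
  also have "\<dots> <= wt x" unfolding wt_def using True fin_items by (intro member_le_sum) auto
  finally show ?thesis using that by (simp add: feas_def)
 next
  case False
  then have "w \<notin> supp x" using that by (auto simp: feas_def)
  then show ?thesis by (simp add: supp_def)
 qed
 then have "{x. feas i x} \<subseteq> {x. \<forall>w. (w \<in> items I --> x w \<in> {..i}) & (w \<notin> items I --> x w = 0)}"
  by (auto simp: feas_def supp_def)
 then show ?thesis using finite_set_of_finite_funs[OF fin_items, of "{..i}" 0] finite_subset by auto
qed

lemma maximizer_exists:
 assumes "i < len I"
 shows "\<exists>x. maximizer I i x"
proof -
 have "feas i (\<lambda>_. 0)" by (simp add: feas_def wt_0 supp_0)
 then have ne: "{x. feas i x} \<noteq> {}" by blast
 have "Max (Vl i ` {x. feas i x}) \<in> Vl i ` {x. feas i x}"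
  using ne finite_feas by (intro Max_in) auto
 then obtain x where "x \<in> {x. feas i x}" "Vl i x = Max (Vl i ` {x. feas i x})" by (metis imageE)
 then have "feas i x & (\<forall>y. feas i y --> Vl i y <= Vl i x)"
  using finite_feas by simp
 then show ?thesis using maximizer_iff assms by blast
qed

text \<open>A maximizer at an index for which the output is required to be optimal.\<close>

definition Mx :: "nat => (nat => nat) => bool" where
 "Mx t x \<longleftrightarrow> t < len I & maximizer I t x &
   (\<forall>y. maximizer I t y --> supp y \<subseteq> allowed I (nat (residual I t y)))"

lemma Mx_allowed: "Mx t x ==> supp x \<subseteq> allowed I (t - wt x)"
proof -
 assume m: "Mx t x"
 then have "wt x <= t" using maximizer_iff by (auto simp: Mx_def feas_def)
 then have "nat (residual I t x) = t - wt x" by (simp add: residual_eq)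
 then show ?thesis using m by (metis Mx_def)
qed

lemma Mx_feas: "Mx t x ==> feas t x"
 using maximizer_iff by (auto simp: Mx_def)

lemma Mx_max: "Mx t x ==> feas t y ==> Vl t y <= Vl t x"
 using maximizer_iff by (auto simp: Mx_def)

lemma Mx_eq: "Mx t x ==> feas t y ==> Vl t x <= Vl t y ==> Mx t y"
 unfolding Mx_def using maximizer_iff by (meson order_trans)

lemma Vl_vadd:
 assumes "supp x \<inter> supp y = {}"
 shows "Vl t (x \<oplus> y) = Vl (t - wt y) x + gain y"
 by (simp add: Vl_def wt_vadd gain_vadd[OF assms] algebra_simps)

text \<open>For disjoint supports the objective is additive, so the part on \<open>P\<close> can be
  exchanged while the index \<open>t - wt y\<close> is fixed. The second conclusion carries the
  proof: an exchanged vector of equal value inherits \<open>Mx\<close>, and with it the support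
  condition at its own, possibly different, residual.\<close>

lemma exchange:
 assumes "Mx t (x \<oplus> y)" "supp x \<subseteq> P" "supp x' \<subseteq> P" "supp y \<inter> P = {}" "feas (t - wt y) x'"
 shows "Vl (t - wt y) x' <= Vl (t - wt y) x"
  and "Vl (t - wt y) x <= Vl (t - wt y) x' ==> Mx t (x' \<oplus> y)"
proof -
 have f: "feas t (x \<oplus> y)" using assms Mx_feas by blast
 have f': "feas t (x' \<oplus> y)"
  using f assms(5) by (auto simp: feas_def supp_vadd wt_vadd)
 have e: "Vl t (x \<oplus> y) = Vl (t - wt y) x + gain y" "Vl t (x' \<oplus> y) = Vl (t - wt y) x' + gain y"
  using assms by (auto intro!: Vl_vadd)
 show "Vl (t - wt y) x' <= Vl (t - wt y) x" using Mx_max[OF assms(1) f'] e by simp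
 show "Mx t (x' \<oplus> y)" if "Vl (t - wt y) x <= Vl (t - wt y) x'"
  using Mx_eq[OF assms(1) f'] e that by simp
qed

text \<open>Appending an item raises the index and the weight by the same amount, so the residual of
  an entry never changes. This is why the support condition can be maintained by looking only at the
  set \<open>S[z]\<close> of the residual.\<close>

definition wff :: "nat set => nat set => (nat => nat => nat) => bool" where
 "wff P A X \<longleftrightarrow> (\<forall>i\<in>A. i < len I -->
   supp (X i) \<subseteq> P & wt (X i) <= i & supp (X i) \<subseteq> allowed I (i - wt (X i)))"

lemma wff_feas:
 assumes "wff P A X" "i \<in> A" "i < len I"
 shows "feas i (X i)"
proof -
 have w: "wt (X i) <= i" "supp (X i) \<subseteq> allowed I (i - wt (X i))"
  using assms by (auto simp: wff_def)
 have "i - wt (X i) < len I" using assms(3) by simp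
 then show ?thesis using w allowed_items unfolding feas_def by blast
qed

text \<open>\<open>x\<close> is the part of a maximizer on the treated items and \<open>y\<close>
  the remainder. Nothing is promised at an index that no such maximizer passes through.\<close>

definition G0 :: "nat set => (nat => nat => nat) => bool" where
 "G0 P X \<longleftrightarrow> (\<forall>t x y. Mx t (x \<oplus> y) --> supp x \<subseteq> P --> supp y \<inter> P = {} -->
   Vl (t - wt y) x <= Vl (t - wt y) (X (t - wt y)))"

text \<open>The analogue inside one colour: the part on earlier items is already exchanged for the
  entry \<open>X i\<close>, and \<open>x\<close> uses items of the colour with treated residues
  \<open>R\<close>. Membership of \<open>t - wt y\<close> in \<open>A\<close> has to be claimed,
  since the working table has entries only on \<open>A\<close>.\<close>

definition G1 :: "(nat => nat => nat) => nat set => nat set => nat set => nat set => (nat => nat => nat) => bool" where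
 "G1 X A0 P R A Y \<longleftrightarrow> (\<forall>t i x y. i \<in> A0 --> supp x \<subseteq> R --> supp y \<inter> (P \<union> R) = {} -->
   Mx t (X i \<oplus> x \<oplus> y) --> t = i + wt x + wt y -->
   t - wt y \<in> A & Vl (t - wt y) (X i \<oplus> x) <= Vl (t - wt y) (Y (t - wt y)))"

lemma supp_empty: "supp x \<subseteq> {} ==> x = (\<lambda>_. 0)"
 by (auto simp: supp_def)

lemma G0_init: "G0 {} (\<lambda>_ _. 0)"
 unfolding G0_def using supp_empty by blast

lemma wff_init: "wff {} UNIV (\<lambda>_ _. 0)"
 by (auto simp: wff_def wt_0 supp_0)

lemma G1_init: "G1 X A0 P {} A0 X"
 unfolding G1_def
proof (intro allI impI)
 fix t i x y
 assume "i \<in> A0" "supp x \<subseteq> {}" "t = i + wt x + wt y"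
 then show "t - wt y \<in> A0 & Vl (t - wt y) (X i \<oplus> x) <= Vl (t - wt y) (X (t - wt y))"
  using supp_empty[of x] by (simp add: wt_0 vadd_0)
qed

text \<open>When all items are treated the remainder is zero, so the entry is as good as a maximizer
  and thus is one.\<close>

lemma G0_final: "G0 (items I) X ==> wff (items I) UNIV X ==> Mx t x ==> maximizer I t (X t)"
proof -
 assume g: "G0 (items I) X" and w: "wff (items I) UNIV X" and m: "Mx t x"
 have t: "t < len I" using m by (simp add: Mx_def)
 have "supp x \<subseteq> items I" using Mx_feas[OF m] by (simp add: feas_def)
 then have "Vl t x <= Vl t (X t)"
  using g m unfolding G0_def by (metis Diff_eq_empty_iff diff_zero inf.absorb2 inf_commute supp_0 vadd_0(1) wt_0 inf_bot_left)
 then show ?thesis using Mx_eq[OF m, of "X t"] wff_feas[OF w, of t] t by (auto simp: Mx_def)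
qed

text \<open>Different maximizers may need different moduli. Once the part on \<open>P\<close> is
  exchanged for the table entry at its index, any \<open>d\<close> that isolates that entry can be
  used, and \<open>X'\<close> dominates the results of all moduli.\<close>

lemma G0_combine:
 assumes g0: "G0 P X" and w0: "wff P UNIV X" and w1: "wff (P \<union> R) UNIV X'" and PR: "P \<inter> R = {}"
  and ge: "\<And>i d. i < len I ==> d \<in> D ==> i \<in> A d ==> Vl i (Y d i) <= Vl i (X' i)"
  and g1: "\<And>d. d \<in> D ==> G1 X (A0 d) P R (A d) (Y d)"
  and cov: "\<And>i. i < len I ==> \<exists>d\<in>D. i \<in> A0 d"
 shows "G0 (P \<union> R) X'"
 unfolding G0_def
proof (intro allI impI)
 fix t x y
 assume m: "Mx t (x \<oplus> y)" and x: "supp x \<subseteq> P \<union> R" and y: "supp y \<inter> (P \<union> R) = {}"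
 have t: "t < len I" using m by (simp add: Mx_def)
 define x0 where "x0 = (\<lambda>w. if w \<in> P then x w else 0)"
 define x1 where "x1 = (\<lambda>w. if w \<in> P then 0 else x w)"
 have x01: "x = x0 \<oplus> x1" by (auto simp: x0_def x1_def vadd_def)
 have s0: "supp x0 \<subseteq> P" by (auto simp: x0_def supp_def split: if_splits)
 have s1: "supp x1 \<subseteq> R" "supp x1 \<inter> P = {}" using x by (auto simp: x1_def supp_def split: if_splits)
 have ft: "wt x0 + wt x1 + wt y <= t" using Mx_feas[OF m] by (simp add: feas_def wt_vadd x01)
 let ?y = "x1 \<oplus> y"
 let ?i = "t - wt ?y"
 have m': "Mx t (x0 \<oplus> ?y)" using m by (simp add: x01 vadd_assoc)
 have sy: "supp ?y \<inter> P = {}" using s1 y by (auto simp: supp_vadd)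
 have i: "?i < len I" using t by simp
 have le: "Vl ?i x0 <= Vl ?i (X ?i)" using g0 m' s0 sy by (auto simp: G0_def)
 have fX: "feas ?i (X ?i)" "supp (X ?i) \<subseteq> P" using wff_feas[OF w0 UNIV_I i] w0 i by (auto simp: wff_def)
 \<comment> \<open>From here on the maximizer begins with the table entry itself, as
   \<open>G1\<close> requires.\<close>
 have mX: "Mx t (X ?i \<oplus> ?y)" using exchange(2)[OF m' s0 fX(2) sy fX(1) le] .
 obtain d where d: "d \<in> D" "?i \<in> A0 d" using cov i by blast
 have tt: "t = ?i + wt x1 + wt y" using ft by (simp add: wt_vadd)
 have "t - wt y \<in> A d & Vl (t - wt y) (X ?i \<oplus> x1) <= Vl (t - wt y) (Y d (t - wt y))"
  using g1[OF d(1)] d(2) s1 y mX tt unfolding G1_def vadd_assoc[symmetric] by blast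
 then have "Vl (t - wt y) (X ?i \<oplus> x1) <= Vl (t - wt y) (X' (t - wt y))"
  using ge[of "t - wt y" d] d t by fastforce
 moreover have "Vl (t - wt y) (x0 \<oplus> x1) <= Vl (t - wt y) (X ?i \<oplus> x1)"
 proof -
  have "t - wt y - wt x1 = ?i" by (simp add: wt_vadd)
  then show ?thesis using le fX(2) s0 s1 by (subst (1 2) Vl_vadd) auto
 qed
 ultimately show "Vl (t - wt y) x <= Vl (t - wt y) (X' (t - wt y))" using x01 by simp
qed

text \<open>Items of weight at least \<open>len I\<close> occur in no feasible vector, so they need
  not be separated.\<close>

definition iso :: "nat => nat set => nat => bool" where
 "iso d Uc z \<longleftrightarrow> inj_on (\<lambda>w. w mod d) {w \<in> allowed I z. w \<in> Uc & w < len I}"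

definition step_fam :: "(nat => nat) => (nat => nat) => (nat => nat => nat) => nat => nat => nat" where
 "step_fam a nf Y i = (if nf i = i then Y i else Y (nf i) \<oplus> vsingle (a (nf i)) ((i - nf i) div a (nf i)))"

text \<open>Let \<open>x1\<close> collect the items of a maximizer in the residue class
  \<open>N\<close>. After an exchange the part before \<open>x1\<close> is the entry
  \<open>Y j\<close>, so \<open>x1\<close> is supported in \<open>S[z]\<close> for the residual
  \<open>z\<close> of \<open>Y j\<close>. Isolation leaves a single item there, the one stored in
  \<open>a j\<close>, and \<open>x1\<close> is a column of the sweep. Either the sweep matches it,
  or its being beaten yields a feasible vector better than a maximizer.\<close>

lemma phase_step:
 fixes \<rho> d :: nat
 assumes g1: "G1 X A0 P R A Y" and w0: "wff P UNIV X" and w1: "wff (P \<union> R) A Y"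
  and PU: "P \<inter> Uc = {}" "Uc \<subseteq> items I" "R = {w \<in> Uc. w mod d < \<rho>}"
  and N: "N = {w \<in> Uc. w mod d = \<rho>}"
  and iso: "\<And>i. i \<in> A ==> i < len I ==> iso d Uc (i - wt (Y i))"
  and a1: "\<And>i. i \<in> A ==> i < len I ==> a i \<noteq> 0 ==> a i \<in> allowed I (i - wt (Y i)) & a i \<in> N & a i < len I"
  and a2: "\<And>i w. i \<in> A ==> i < len I ==> w \<in> allowed I (i - wt (Y i)) ==> w \<in> N ==> w < len I ==> a i \<noteq> 0"
  and sw: "sweep_spec (len I) (\<lambda>i. i \<in> A) (\<lambda>i. Vl i (Y i)) a (profit I) (\<lambda>i. i \<in> A') nf nv"
 shows "wff (P \<union> (R \<union> N)) A' (step_fam a nf Y)"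
  and "G1 X A0 P (R \<union> N) A' (step_fam a nf Y)"
  and "\<And>i. i \<in> A' ==> i < len I ==> i - wt (step_fam a nf Y i) = nf i - wt (Y (nf i))"
  and "\<And>i. i \<in> A' ==> i < len I ==> nv i = Vl i (step_fam a nf Y i)"
proof -
 let ?Y = "step_fam a nf Y"
 let ?V = "\<lambda>i. Vl i (Y i)"
 have RN: "N \<inter> (P \<union> R) = {}" using PU N by auto
 have fact: "nf i \<in> A & nf i < len I & nf i <= i & (nf i = i \<or> a (nf i) \<in> N & a (nf i) \<in> items I &
   a (nf i) * ((i - nf i) div a (nf i)) = i - nf i) &
   supp (?Y i) \<subseteq> P \<union> (R \<union> N) & wt (?Y i) <= i & i - wt (?Y i) = nf i - wt (Y (nf i)) &
   supp (?Y i) \<subseteq> allowed I (i - wt (?Y i)) & nv i = Vl i (?Y i) &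
   (\<forall>w\<in>N. nf i = i \<or> a (nf i) \<noteq> w --> w \<notin> supp (?Y i))"
  if i: "i \<in> A'" "i < len I" for i
 proof -
  have s: "nf i <= i" "nf i \<in> A" "nf i = i \<or> a (nf i) \<noteq> 0 & a (nf i) dvd i - nf i"
   "nv i = col_val ?V a (profit I) (nf i) i"
   using sw i unfolding sweep_spec_def by blast+
  have l: "nf i < len I" using s i by simp
  have w: "supp (Y (nf i)) \<subseteq> P \<union> R" "wt (Y (nf i)) <= nf i" "supp (Y (nf i)) \<subseteq> allowed I (nf i - wt (Y (nf i)))"
   using w1 s(2) l by (auto simp: wff_def)
  show ?thesis
  proof (cases "nf i = i")
   case True
   then show ?thesis using s w l RN by (auto simp: step_fam_def col_val_def)
  next
   case False
   define v where "v = a (nf i)"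
   define k where "k = (i - nf i) div v"
   have v: "v \<in> N" "v \<in> allowed I (nf i - wt (Y (nf i)))" "v \<noteq> 0" "v dvd i - nf i" "v * k = i - nf i"
    using a1[OF s(2) l] s(3) False by (auto simp: v_def k_def)
   have vi: "v \<in> items I" using v(1) N PU(2) by auto
   have Y: "?Y i = Y (nf i) \<oplus> vsingle v k" using False by (simp add: step_fam_def v_def k_def)
   have wY: "wt (?Y i) = wt (Y (nf i)) + v * k" by (simp add: Y wt_vadd wt_vsingle[OF vi])
   have dj: "supp (Y (nf i)) \<inter> supp (vsingle v k) = {}" using w(1) v(1) RN by (auto simp: supp_vsingle)
   have "Vl i (?Y i) = Vl (nf i) (Y (nf i)) + profit I v k"
    unfolding Y Vl_vadd[OF dj] wt_vsingle[OF vi] gain_vsingle[OF vi] using v(5) s(1) by simp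
   then have "nv i = Vl i (?Y i)" using s(4) False by (simp add: col_val_def v_def k_def)
   moreover have "i - wt (?Y i) = nf i - wt (Y (nf i))" "wt (?Y i) <= i" using wY v(5) s(1) w(2) by auto
   moreover have "supp (?Y i) \<subseteq> supp (Y (nf i)) \<union> {v}" by (auto simp: Y supp_vadd supp_vsingle split: if_splits)
   moreover have "supp (?Y i) \<subseteq> P \<union> (R \<union> N)" using w(1) v(1) calculation(4) by blast
   moreover have "supp (?Y i) \<subseteq> allowed I (i - wt (?Y i))" using w(3) v(2) calculation(2,4) by auto
   moreover have "\<forall>u\<in>N. v \<noteq> u --> u \<notin> supp (?Y i)" using w(1) RN calculation(4) by blast
   ultimately show ?thesis using s(1,2) l v(1,5) vi False
    unfolding v_def[symmetric] k_def[symmetric] by (simp only: False simp_thms)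
  qed
 qed
 show "wff (P \<union> (R \<union> N)) A' ?Y" unfolding wff_def using fact by blast
 show "i - wt (?Y i) = nf i - wt (Y (nf i))" "nv i = Vl i (?Y i)" if "i \<in> A'" "i < len I" for i
  using fact[OF that] by blast+
 show "G1 X A0 P (R \<union> N) A' ?Y"
  unfolding G1_def
 proof (intro allI impI)
  fix t i0 x y
  assume i0: "i0 \<in> A0" and x: "supp x \<subseteq> R \<union> N" and y: "supp y \<inter> (P \<union> (R \<union> N)) = {}"
   and m: "Mx t (X i0 \<oplus> x \<oplus> y)" and t: "t = i0 + wt x + wt y"
  define i where "i = t - wt y"
  have tl: "t < len I" using m by (simp add: Mx_def)
  have il: "i < len I" "i0 < len I" using tl t by (auto simp: i_def)
  have ii: "i = i0 + wt x" using t by (simp add: i_def)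
  have fX: "supp (X i0) \<subseteq> P" "feas i0 (X i0)" using wff_feas[OF w0 UNIV_I il(2)] w0 il by (auto simp: wff_def)
  define x0 where "x0 = (\<lambda>w. if w \<in> N then 0 else x w)"
  define x1 where "x1 = (\<lambda>w. if w \<in> N then x w else 0)"
  have x01: "x = x0 \<oplus> x1" by (auto simp: x0_def x1_def vadd_def)
  have s0: "supp x0 \<subseteq> R" "supp x0 \<inter> N = {}" using x by (auto simp: x0_def supp_def split: if_splits)
  have s1: "supp x1 \<subseteq> N" by (auto simp: x1_def supp_def split: if_splits)
  have m': "Mx t (X i0 \<oplus> x0 \<oplus> (x1 \<oplus> y))" using m by (simp add: x01 vadd_assoc)
  have y': "supp (x1 \<oplus> y) \<inter> (P \<union> R) = {}" using y s1 RN by (auto simp: supp_vadd)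
  have t': "t = i0 + wt x0 + wt (x1 \<oplus> y)" using t by (simp add: x01 wt_vadd)
  define j where "j = i0 + wt x0"
  have j: "t - wt (x1 \<oplus> y) = j" using t' by (simp add: j_def)
  have jl: "j < len I" using j tl by simp
  have ij: "i = j + wt x1" by (simp add: ii j_def x01 wt_vadd)
  have gj: "j \<in> A" "Vl j (X i0 \<oplus> x0) <= Vl j (Y j)"
   using g1 i0 s0(1) y' m' t' j unfolding G1_def by blast+
  have fY: "supp (Y j) \<subseteq> P \<union> R" "feas j (Y j)" "wt (Y j) <= j" using wff_feas[OF w1 gj(1) jl] w1 gj(1) jl by (auto simp: wff_def)
  have sX: "supp (X i0 \<oplus> x0) \<subseteq> P \<union> R" using fX s0 by (auto simp: supp_vadd)
  \<comment> \<open>The exchange moves the maximizer onto the actual table entry, whose residual is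
    the one known to the program.\<close>
  have mY: "Mx t (Y j \<oplus> (x1 \<oplus> y))"
   using exchange(2)[OF m' sX fY(1) y'] fY(2) gj(2) j by simp
  have resid: "t - wt (Y j \<oplus> (x1 \<oplus> y)) = j - wt (Y j)" using j by (simp add: wt_vadd)
  have sup1: "supp x1 \<subseteq> allowed I (j - wt (Y j))" using Mx_allowed[OF mY] resid by (simp add: supp_vadd)
  have lower: "Vl i (X i0 \<oplus> x) <= Vl i (Y j \<oplus> x1)"
  proof -
   have "i - wt x1 = j" by (simp add: ij)
   then show ?thesis using gj(2) sX fY(1) s1 RN unfolding x01 vadd_assoc[symmetric]
    by (subst (1 2) Vl_vadd) auto
  qed
  have swj: "j \<in> A --> j \<in> A' & ?V j <= nv j" using sw jl by (auto simp: sweep_spec_def)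
  have goal: "i \<in> A' & Vl i (Y j \<oplus> x1) <= Vl i (?Y i)"
  proof (cases "x1 = (\<lambda>_. 0)")
   case True
   then have "i = j" by (simp add: ij wt_0)
   then show ?thesis using swj gj(1) fact[of j] jl True by (simp add: vadd_0)
  next
   case False
   then obtain w where w: "x1 w \<noteq> 0" by auto
   then have wN: "w \<in> N" "w \<in> allowed I (j - wt (Y j))" using s1 sup1 by (auto simp: supp_def)
   have wi: "w \<in> items I" using wN(1) N PU(2) by auto
   have wl: "w < len I" using wt_ge[of w x1] w wi ij il by (auto simp: supp_def)
   \<comment> \<open>Items of \<open>x1\<close> have the same remainder modulo \<open>d\<close> and
     lie in the same isolated set, so only one item can occur.\<close>
   have uniq: "v = w" if "x1 v \<noteq> 0" for v
   proof -
    have v: "v \<in> N" "v \<in> allowed I (j - wt (Y j))" using that s1 sup1 by (auto simp: supp_def)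
    have vi: "v \<in> items I" using v(1) N PU(2) by auto
    have vl: "v < len I" using wt_ge[of v x1] that vi ij il by (auto simp: supp_def)
    show ?thesis using iso[OF gj(1) jl] v vl wN wl N by (auto simp: iso_def inj_on_def)
   qed
   define k where "k = x1 w"
   have x1: "x1 = vsingle w k" using uniq by (fastforce simp: vsingle_def k_def fun_eq_iff)
   have k: "k \<ge> 1" using w by (simp add: k_def)
   have aj: "a j = w"
   proof -
    have "a j \<noteq> 0" using a2[OF gj(1) jl wN(2,1) wl] .
    then show ?thesis using a1[OF gj(1) jl] iso[OF gj(1) jl] wN wl N by (auto simp: iso_def inj_on_def)
   qed
   have w0: "w > 0" using item_pos[OF wi] by simp
   have ij': "i = j + w * k" using ij x1 wt_vsingle[OF wi] by simp
   have ji: "j < i" "w dvd i - j" "(i - j) div w = k" using ij' k w0 by auto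
   have dj: "supp (Y j) \<inter> supp x1 = {}" using fY(1) s1 RN by auto
   have cv: "col_val ?V a (profit I) j i = Vl i (Y j \<oplus> x1)"
    using ji aj unfolding Vl_vadd[OF dj] by (simp add: col_val_def x1 wt_vsingle[OF wi] gain_vsingle[OF wi] ij')
   have "i \<in> A' & col_val ?V a (profit I) j i <= nv i \<or> beaten ?V a (profit I) (\<lambda>i. i \<in> A') nf nv j i"
    using sw il(1) ji gj(1) aj w0 by (simp add: sweep_spec_def)
   then show ?thesis
   proof
    assume "i \<in> A' & col_val ?V a (profit I) j i <= nv i"
    then show ?thesis using cv fact[of i] il by simp
   next
    \<comment> \<open>The vector \<open>?z\<close> below adds \<open>e\<close> copies of
      \<open>w\<close> to the entry at \<open>h\<close>. It need not satisfy the support condition;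
      feasibility is enough to contradict maximality through \<open>exchange\<close>.\<close>
    assume "beaten ?V a (profit I) (\<lambda>i. i \<in> A') nf nv j i"
    then obtain h where h: "h < i" "h \<in> A'" "nf h = h \<or> a (nf h) \<noteq> w" "w dvd i - h"
     "Vl i (Y j \<oplus> x1) < nv h + profit I w ((i - h) div w)"
     unfolding beaten_def aj cv by auto
    have hl: "h < len I" using h il by simp
    note fh = fact[OF h(2) hl]
    define e where "e = (i - h) div w"
    have he: "i - h = w * e" using h(4) by (simp add: e_def)
    let ?z = "?Y h \<oplus> vsingle w e"
    \<comment> \<open>The side condition of \<open>beaten\<close> is used here: without copies of
      \<open>w\<close> in the entry at \<open>h\<close>, the profits simply add up.\<close>
    have wh: "w \<notin> supp (?Y h)" using fh h(3) wN(1) by blast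
    have dj2: "supp (?Y h) \<inter> supp (vsingle w e) = {}" using wh by (auto simp: supp_vsingle)
    have "i - wt (vsingle w e) = h" using he h(1) by (simp add: wt_vsingle[OF wi])
    then have vz: "Vl i ?z = nv h + profit I w e" using fh unfolding Vl_vadd[OF dj2] by (simp add: gain_vsingle[OF wi])
    have fz: "feas i ?z"
    proof -
     have "supp (?Y h) \<subseteq> items I" "wt (?Y h) <= h"
      using wff_feas[OF \<open>wff (P \<union> (R \<union> N)) A' ?Y\<close> h(2) hl] by (simp_all add: feas_def)
     moreover from this have "wt (?Y h) + w * e <= i" using he h(1) by linarith
     ultimately show ?thesis using wi
      by (simp add: feas_def supp_vadd supp_vsingle wt_vadd wt_vsingle[OF wi])
    qed
    have sz: "supp ?z \<subseteq> P \<union> (R \<union> N)" using fh wN(1) by (auto simp: supp_vadd supp_vsingle)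
    have "Mx t (Y j \<oplus> x1 \<oplus> y)" using mY by (simp add: vadd_assoc)
    moreover have "supp (Y j \<oplus> x1) \<subseteq> P \<union> (R \<union> N)" using fY(1) s1 by (auto simp: supp_vadd)
    ultimately have "Vl i ?z <= Vl i (Y j \<oplus> x1)" using exchange(1)[OF _ _ sz y] fz unfolding i_def by blast
    then show ?thesis using h(5) vz e_def by simp
   qed
  qed
  show "t - wt y \<in> A' & Vl (t - wt y) (X i0 \<oplus> x) <= Vl (t - wt y) (?Y (t - wt y))"
   using goal lower unfolding i_def[symmetric] by simp
 qed
qed

end

section \<open>Concave profits and linked lists of candidate columns\<close>

lemma concave_slope_antimono:
 assumes "strictly_concave f" "k <= k'"
 shows "f (k' + m) - f k' <= f (k + m) - f k"
proof -
 have c: "f (Suc (Suc x)) - f (Suc x) < f (Suc x) - f x" for x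
  using assms(1) by (auto simp: strictly_concave_def dest: spec[of _ "Suc x"])
 have "f (Suc k + m) - f (Suc k) <= f (k + m) - f k" for k
 proof (induction m)
  case (Suc m)
  have "f (Suc (Suc (k + m))) - f (Suc (k + m)) <= f (Suc (k + m)) - f (k + m)" using c[of "k + m"] by simp
  then show ?case using Suc by simp
 qed simp
 with assms(2) show ?thesis
  by (induction k' rule: dec_induct) (auto intro: order.trans)
qed

text \<open>Strictness stems from the first copy alone: the increment from \<open>k\<close> to
  \<open>k + 1\<close> is at most the one from 1 to 2, which is strictly below the one from 0 to 1.
  The remaining increments are compared weakly.\<close>

lemma concave_subadditive:
 assumes "strictly_concave f" "f 0 = 0" "k \<ge> 1" "e \<ge> 1"
 shows "f (k + e) < f k + f (e::nat)"
proof -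
 obtain k' where k: "k = Suc k'" using assms(3) by (cases k) auto
 have "f (Suc (Suc 0)) - f (Suc 0) < f (Suc 0) - f 0"
  using assms(1) by (auto simp: strictly_concave_def dest: spec[of _ 1])
 moreover obtain e' where e: "e = Suc e'" using assms(4) by (cases e) auto
 have "f (k + e) - f (Suc k) <= f (1 + e') - f 1"
  using concave_slope_antimono[OF assms(1), of 1 "Suc k" e'] e by simp
 moreover have "f (Suc k) - f k <= f (Suc (Suc 0)) - f (Suc 0)"
  using concave_slope_antimono[OF assms(1), of 1 k 1] assms(3) by simp
 ultimately show ?thesis using assms(2) e by simp
qed

lemma dvd_diff_trans: "c <= i ==> i <= r ==> w dvd i - c ==> w dvd r - i ==> w dvd r - (c::nat)"
 using dvd_add[of w "r - i" "i - c"] by simp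

text \<open>A doubly linked list of columns: \<open>nt\<close> and \<open>pr\<close> are successor
  and predecessor, and \<open>tm\<close> holds, for each column but the first, the index at which it
  takes over from its predecessor.\<close>

fun lnk :: "(nat => nat => nat => bool) => (int => int) => (int => int) => (int => int) => nat list => bool" where
 "lnk cr nt pr tm (x # y # cs) \<longleftrightarrow> nt (int x) = int y & pr (int y) = int x &
   (\<exists>r. tm (int y) = int r & cr x y r) & lnk cr nt pr tm (y # cs)"
| "lnk cr nt pr tm _ \<longleftrightarrow> True"

lemma lnk_cong:
 "(\<And>c. c \<in> set cs ==> nt (int c) = nt' (int c) & pr (int c) = pr' (int c) & tm (int c) = tm' (int c)) ==>
  lnk cr nt pr tm cs = lnk cr nt' pr' tm' cs"
 by (induction cr nt pr tm cs rule: lnk.induct) auto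

lemma lnk_snoc:
 "lnk cr nt pr tm (cs @ [x, y]) \<longleftrightarrow> lnk cr nt pr tm (cs @ [x]) & nt (int x) = int y & pr (int y) = int x &
   (\<exists>r. tm (int y) = int r & cr x y r)"
proof (induction cs)
 case (Cons c cs)
 then show ?case by (cases cs) auto
qed auto

lemma lnk_appendD: "lnk cr nt pr tm (cs @ ds) ==> lnk cr nt pr tm cs"
proof (induction cs)
 case (Cons c cs)
 then show ?case by (cases cs) auto
qed auto

text \<open>The successor pointer of the last column is never inspected, so removing columns at the
  back needs no repair of links.\<close>

lemma lnk_nt_upd_last:
 "sorted_wrt (<) (cs @ [x]) ==> lnk cr (nt(int x := v)) pr tm (cs @ [x]) = lnk cr nt pr tm (cs @ [x])"
proof (induction cs)
 case (Cons c cs)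
 then show ?case by (cases cs) auto
qed auto

locale sweep0 =
 fixes L :: nat and ok :: "nat => bool" and V :: "nat => int" and a :: "nat => nat" and Qf :: "nat => nat => int"
 assumes conc: "\<And>z. z < L ==> ok z ==> a z \<noteq> 0 ==> strictly_concave (Qf (a z)) & Qf (a z) 0 = 0"
begin

abbreviation val :: "nat => nat => int" where "val \<equiv> col_val V a Qf"

lemma val_eq: "z < L ==> ok z ==> a z \<noteq> 0 ==> val z r = V z + Qf (a z) ((r - z) div a z)"
 using conc[of z] by (auto simp: col_val_def)

text \<open>By concavity two columns of the same item and residue change order at most once;
  \<open>r\<close> is the threshold, with ties going to the later column. It may lie beyond the
  table, and then \<open>y\<close> does not take over at all.\<close>

definition cross :: "nat => nat => nat => bool" where
 "cross x y r \<longleftrightarrow> y <= r & a y dvd r - y &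
   (\<forall>\<rho>. y <= \<rho> --> \<rho> < L --> a y dvd \<rho> - y --> (r <= \<rho> \<longleftrightarrow> val x \<rho> <= val y \<rho>))"

text \<open>A monotone queue: start indices and takeover indices both increase, and all takeovers
  lie after the current index \<open>j\<close>. The bound \<open>b\<close> says which columns have
  been read, and \<open>tm = - 1\<close> marks a popped column.\<close>

definition cc :: "(int => int) => (int => int) => (int => int) => nat => nat => nat => nat list => bool" where
 "cc nt pr tm b j w cs \<longleftrightarrow> cs \<noteq> [] & w \<noteq> 0 & lnk cross nt pr tm cs & sorted_wrt (<) cs &
   sorted_wrt (<) (map (\<lambda>c. tm (int c)) (tl cs)) & (\<forall>c\<in>set (tl cs). int j < tm (int c)) &
   (\<forall>c\<in>set cs. c < b & ok c & a c = w & c <= j & w dvd j - c & tm (int c) \<noteq> - 1)"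

text \<open>Since every takeover is still to come, each column loses at \<open>j\<close> to its
  predecessor, and so the front wins.\<close>

lemma front_best:
 assumes "cc nt pr tm b j w cs" "c \<in> set cs" "j < L"
 shows "val c j <= val (hd cs) j"
proof -
 have "lnk cross nt pr tm cs ==> (\<forall>c\<in>set (tl cs). int j < tm (int c)) ==> (\<forall>c\<in>set cs. c <= j & a c dvd j - c) ==>
   c \<in> set cs ==> val c j <= val (hd cs) j" for cs
 proof (induction cross nt pr tm cs rule: lnk.induct)
  case (1 nt pr tm x y cs)
  obtain r where r: "tm (int y) = int r" "cross x y r" using 1 by auto
  have "val y j <= val x j"
  proof -
   have "\<not> r <= j" using 1 r by simp
   moreover have "y <= j" "a y dvd j - y" using 1 by auto
   ultimately have "\<not> val x j <= val y j" using r(2) assms(3) unfolding cross_def by blast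
   then show ?thesis by simp
  qed
  moreover have "c \<noteq> x ==> val c j <= val y j"
   using 1 by simp
  ultimately show ?case by fastforce
 qed auto
 from this[of cs] show ?thesis using assms by (auto simp: cc_def)
qed

text \<open>Takeover indices after \<open>i\<close> lie in the residue class of \<open>i\<close>
  modulo \<open>w\<close>, hence not before \<open>i + w\<close>. As they strictly increase, at most
  the first is due at \<open>i + w\<close>, so dropping one front column always suffices.\<close>

lemma cc_advance:
 assumes cc: "cc nt pr tm b i w cs" and j: "j = i + w" "j < L"
  and cs': "cs' = (if tl cs \<noteq> [] & tm (int (hd (tl cs))) <= int j then tl cs else cs)"
 shows "cc nt pr tm b j w cs'" "hd cs' \<in> set cs" "last cs' = last cs" "a (hd cs') = w"
  and "\<And>c r. c \<in> set cs ==> j <= r ==> r < L ==> w dvd r - i ==> \<exists>c'\<in>set cs'. val c r <= val c' r"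
proof -
 have w0: "w > 0" using cc by (simp add: cc_def)
 obtain x xs where cs: "cs = x # xs" using cc by (cases cs) (auto simp: cc_def)
 have el: "\<And>c. c \<in> set cs ==> c < b & ok c & a c = w & c <= i & w dvd i - c & tm (int c) \<noteq> - 1"
  using cc unfolding cc_def by blast
 have el': "c <= j & w dvd j - c" if "c \<in> set cs" for c
 proof -
  have "w dvd j - c" using el[OF that] j by (intro dvd_diff_trans[of c i j w]) auto
  then show ?thesis using el[OF that] j by simp
 qed
 \<comment> \<open>The takeover index differs from \<open>i\<close> by a positive multiple of
   \<open>w\<close>.\<close>
 have tmj: "int j <= tm (int y)" if y: "y \<in> set xs" for y
 proof -
  obtain us vs where xs: "xs = us @ y # vs" using y by (meson split_list)
  have lk: "lnk cross nt pr tm (x # us @ [y])"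
   using cc lnk_appendD[of cross nt pr tm "x # us @ [y]" vs] by (simp add: cc_def cs xs)
  obtain us' z where "x # us = us' @ [z]" by (metis append_butlast_last_id list.distinct(1))
  then have "lnk cross nt pr tm (us' @ [z, y])" using lk by (metis append.assoc append_Cons append_Nil)
  then obtain r where r: "tm (int y) = int r" "cross z y r" by (auto simp: lnk_snoc)
  have "r > i" using cc y r(1) by (auto simp: cc_def cs)
  have "y \<in> set cs" using y cs by simp
  note ey = el[OF this]
  have "y <= r" "w dvd r - y" using r(2) ey by (auto simp: cross_def)
  then have "w dvd (r - y) - (i - y)" using dvd_diff_nat[of w "r - y" "i - y"] ey \<open>w dvd r - y\<close> by blast
  moreover have "(r - y) - (i - y) = r - i" using ey \<open>r > i\<close> by simp
  ultimately have "w dvd r - i" by (simp only:)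
  then have "w <= r - i" using \<open>r > i\<close> by (simp add: dvd_imp_le)
  then show ?thesis using r j \<open>r > i\<close> by simp
 qed
 have sub: "set cs' \<subseteq> set cs" "cs' \<noteq> []" using cs' cs by (auto dest: list.set_sel)
 show h: "hd cs' \<in> set cs" using sub by (metis hd_in_set subsetD)
 show aw: "a (hd cs') = w" using el[OF h] by simp
 show "last cs' = last cs" using cs' cs by (auto simp: last_tl)
 have elw: "\<forall>c\<in>set cs'. c < b & ok c & a c = w & c <= j & w dvd j - c & tm (int c) \<noteq> - 1"
 proof
  fix c assume "c \<in> set cs'"
  then have c: "c \<in> set cs" using sub by blast
  show "c < b & ok c & a c = w & c <= j & w dvd j - c & tm (int c) \<noteq> - 1"
   using el[OF c] el'[OF c] by simp
 qed
 have sw: "sorted_wrt (<) (map (\<lambda>c. tm (int c)) xs)" "sorted_wrt (<) cs" "lnk cross nt pr tm cs"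
  using cc cs by (auto simp: cc_def)
 show "cc nt pr tm b j w cs'"
 proof (cases "xs \<noteq> [] & tm (int (hd xs)) <= int j")
  case True
  then obtain y ys where xs: "xs = y # ys" by (cases xs) auto
  have c': "cs' = y # ys" using True cs' cs xs by simp
  have "\<forall>c\<in>set ys. int j < tm (int c)" using sw(1) tmj[of y] xs by fastforce
  moreover have "lnk cross nt pr tm (y # ys)" using sw(3) cs xs by simp
  moreover have "sorted_wrt (<) (y # ys)" using sw(2) cs xs by simp
  moreover have "sorted_wrt (<) (map (\<lambda>c. tm (int c)) ys)" using sw(1) xs by simp
  ultimately show ?thesis using elw aw w0 unfolding cc_def c' by simp
 next
  case False
  then have c': "cs' = x # xs" using cs' cs by auto
  have "\<forall>c\<in>set xs. int j < tm (int c)"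
  proof
   fix c assume c: "c \<in> set xs"
   then obtain y ys where xs: "xs = y # ys" by (cases xs) auto
   have "int j < tm (int y)" using False xs by simp
   moreover have "c = y \<or> tm (int y) < tm (int c)" using sw(1) xs c by auto
   ultimately show "int j < tm (int c)" by auto
  qed
  then show ?thesis using elw aw w0 sw cs unfolding cc_def c' by simp
 qed
 fix c r assume c: "c \<in> set cs" and r: "j <= r" "r < L" "w dvd r - i"
 show "\<exists>c'\<in>set cs'. val c r <= val c' r"
 proof (cases "c \<in> set cs'")
  case False
  then have T: "xs \<noteq> [] & tm (int (hd xs)) <= int j" and cx: "c = x" using cs' cs c by (auto split: if_splits)
  then obtain y ys where xs: "xs = y # ys" by (cases xs) auto
  have y: "y \<in> set cs" "y \<in> set cs'" using xs cs cs' T by auto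
  obtain q where q: "tm (int y) = int q" "cross x y q" using sw(3) cs xs by auto
  have "q <= r" using T xs q r by simp
  moreover have "y <= r" using el[OF y(1)] r j by simp
  moreover have "w dvd r - y"
   using el[OF y(1)] r j by (intro dvd_diff_trans[of y i r w]) auto
  ultimately have "val x r <= val y r" using q(2) r el[OF y(1)] unfolding cross_def by blast
  then show ?thesis using y cx by blast
 qed auto
qed

lemma cc_cong:
 assumes "cc nt pr tm b j w cs" "b <= b'"
  "\<And>c. c \<in> set cs ==> nt (int c) = nt' (int c) & pr (int c) = pr' (int c) & tm (int c) = tm' (int c)"
 shows "cc nt' pr' tm' b' j w cs"
proof -
 have t: "set (tl cs) \<subseteq> set cs" by (cases cs) auto
 have "lnk cross nt' pr' tm' cs" using lnk_cong[of cs nt nt' pr pr' tm tm' cross] assms by (simp add: cc_def)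
 moreover have m: "map (\<lambda>c. tm (int c)) (tl cs) = map (\<lambda>c. tm' (int c)) (tl cs)" using assms(3) t by auto
 moreover have "sorted_wrt (<) (map (\<lambda>c. tm' (int c)) (tl cs))" using assms(1) unfolding cc_def m by blast
 moreover have "\<forall>c\<in>set (tl cs). int j < tm' (int c)" using assms t unfolding cc_def by (metis subsetD)
 ultimately show ?thesis using assms unfolding cc_def by (auto simp: order_less_le_trans)
qed

lemma cc_prefix:
 assumes "cc nt pr tm b j w (ds @ es)" "ds \<noteq> []"
 shows "cc nt pr tm b j w ds"
 using assms lnk_appendD[of cross nt pr tm ds es] by (auto simp: cc_def sorted_wrt_append)

lemma cc_push:
 assumes cc: "cc nt pr tm i i w ds" and i: "ok i" "a i = w" and x: "cross (last ds) i r" "tl ds = [] \<or> tm (int (last ds)) < int r"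
  "i < r"
 shows "cc (nt(int (last ds) := int i)) (pr(int i := int (last ds))) (tm(int i := int r)) (Suc i) i w (ds @ [i])"
proof -
 obtain us y where ds: "ds = us @ [y]" using cc by (metis cc_def append_butlast_last_id)
 have lt: "\<forall>c\<in>set ds. c < i" using cc by (auto simp: cc_def)
 have sd: "sorted_wrt (<) (us @ [y])" using cc ds by (auto simp: cc_def)
 have "lnk cross (nt(int y := int i)) (pr(int i := int y)) (tm(int i := int r)) (us @ [y])"
 proof -
  have "lnk cross nt pr tm (us @ [y])" using cc ds by (simp add: cc_def)
  then have "lnk cross nt (pr(int i := int y)) (tm(int i := int r)) (us @ [y])"
   by (subst lnk_cong[of "us @ [y]" nt nt "pr(int i := int y)" pr "tm(int i := int r)" tm cross]) (use lt ds in auto)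
  then show ?thesis using lnk_nt_upd_last[OF sd] by blast
 qed
 then have "lnk cross (nt(int y := int i)) (pr(int i := int y)) (tm(int i := int r)) (us @ [y, i])"
  using x(1) ds by (auto simp: lnk_snoc)
 moreover have "sorted_wrt (<) (ds @ [i])" using sd lt ds by (auto simp: sorted_wrt_append)
 moreover have tl: "tl (ds @ [i]) = tl ds @ [i]" "hd (ds @ [i]) = hd ds" using ds by (cases us; simp)+
 moreover have m: "map (\<lambda>c. (tm(int i := int r)) (int c)) (tl ds) = map (\<lambda>c. tm (int c)) (tl ds)"
 proof -
  have "set (tl ds) \<subseteq> set ds" by (cases ds) auto
  then have "c \<noteq> i" if "c \<in> set (tl ds)" for c using lt that by auto
  then show ?thesis by auto
 qed
 moreover have "sorted_wrt (<) (map (\<lambda>c. (tm(int i := int r)) (int c)) (tl ds @ [i]))"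
 proof -
  have s: "sorted_wrt (<) (map (\<lambda>c. tm (int c)) (tl ds))" using cc by (simp add: cc_def)
  have "tm (int c) < int r" if c: "c \<in> set (tl ds)" for c
  proof -
   have ne: "tl ds \<noteq> []" using c by auto
   obtain vs where vs: "tl ds = vs @ [y]" using ne ds by (metis append_butlast_last_id last_snoc last_tl)
   have "c = y \<or> tm (int c) < tm (int y)" using s c vs by (auto simp: sorted_wrt_append)
   moreover have "tm (int y) < int r" using x(2) ne ds by simp
   ultimately show ?thesis by auto
  qed
  then show ?thesis unfolding map_append m sorted_wrt_append using s by auto
 qed
 moreover have "\<forall>c\<in>set (tl ds @ [i]). int i < (tm(int i := int r)) (int c)"
  using cc x(3) by (auto simp: cc_def)
 moreover have "\<forall>c\<in>set (ds @ [i]). c < Suc i & ok c & a c = w & c <= i & w dvd i - c & (tm(int i := int r)) (int c) \<noteq> - 1"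
  using cc i by (auto simp: cc_def)
 moreover have "w \<noteq> 0" using cc by (simp add: cc_def)
 ultimately show ?thesis using ds unfolding cc_def by simp
qed

lemma cc_single:
 assumes "ok i" "a i \<noteq> 0" "tm (int i) \<noteq> - 1"
 shows "cc nt pr tm (Suc i) i (a i) [i]"
 using assms by (simp add: cc_def)

text \<open>Popping the last column \<open>y\<close>: before its takeover it loses to its predecessor \<open>x\<close>, and from then on to \<open>i\<close>.\<close>

lemma pop_cover:
 assumes "cc nt pr tm i i w (us @ [x, y])" "cross y i q" "int q <= tm (int y)" "a i = w" "i <= r" "r < L" "a i dvd r - i"
 shows "val y r <= val x r \<or> val y r <= val i r"
proof -
 obtain p where p: "tm (int y) = int p" "cross x y p" using assms(1) by (auto simp: cc_def lnk_snoc)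
 have y: "y <= i" "a y dvd i - y" "a y = w" using assms(1) by (auto simp: cc_def)
 have yr: "y <= r" "a y dvd r - y"
 proof -
  show "a y dvd r - y" using y assms by (intro dvd_diff_trans[of y i r "a y"]) auto
 qed (use y assms in simp)
 show ?thesis
 proof (cases "p <= r")
  case True
  then have "q <= r" using p assms by simp
  then show ?thesis using assms unfolding cross_def by blast
 next
  case False
  then have "\<not> val x r <= val y r" using p(2) yr assms unfolding cross_def by blast
  then show ?thesis by simp
 qed
qed

end

section \<open>Invariant of the sweep\<close>

context sweep0
begin

lemma cc_elem:
 assumes "cc nt pr tm b j w cs" "c \<in> set cs"
 shows "c < b" "ok c" "a c = w" "c <= j" "w dvd j - c" "tm (int c) \<noteq> - 1"
 using assms unfolding cc_def by blast+

text \<open>\<open>beaten\<close> with a witness among the rows that are already final. The extra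
  condition \<open>z <= j\<close> says that the column holds at least as many copies as are added
  after the witness; this makes the relation stable for larger \<open>r\<close>.\<close>

definition bt :: "(nat => bool) => (nat => nat) => (nat => int) => nat => nat => nat => bool" where
 "bt no nf nv i z r \<longleftrightarrow> (\<exists>j<i. z <= j & j < r & no j & (nf j = j \<or> a (nf j) \<noteq> a z) & a z dvd r - j &
   val z r < nv j + Qf (a z) ((r - j) div a z))"

definition row_done :: "(nat => bool) => (nat => nat) => (nat => int) => nat => bool" where
 "row_done no nf nv r \<longleftrightarrow>
   (no r --> nf r <= r & ok (nf r) & (nf r = r \<or> a (nf r) \<noteq> 0 & a (nf r) dvd r - nf r) &
    nv r = val (nf r) r) &
   (ok r --> no r & V r <= nv r) &
   (\<forall>z<r. ok z & a z \<noteq> 0 & a z dvd r - z -->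
    no r & val z r <= nv r \<or> bt no nf nv r z r)"

text \<open>The front is stored plus one, so that a cleared cell means that no list is pending. The
  last condition records that the list was sent from an index below \<open>i\<close>; two
  consequences are that lists waiting at different indices share no column and that a new list meets
  only lists of heavier items.\<close>

definition pend :: "(int => int) => (int => int) => (int => int) => (int => int) => (int => int) => (int => int) =>
  nat => nat => nat => nat list => bool" where
 "pend nt pr tm pf pb pv b i j cs \<longleftrightarrow> (if cs = [] then pf (int j) = 0 else
   pf (int j) = int (hd cs) + 1 & pb (int j) = int (last cs) & pv (int j) = val (hd cs) j &
   cc nt pr tm b j (a (hd cs)) cs & j < i + a (hd cs))"

text \<open>A waiting list accounts for column \<open>z\<close> in one of two ways. With the same
  item, one of its columns is as good at the target \<open>r\<close>. With a different item, its
  front is as good at \<open>j\<close>, and \<open>z\<close> will be beaten as soon as row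
  \<open>j\<close> is fixed.\<close>

definition pcov :: "(nat => nat list) => nat => nat => nat => nat => bool" where
 "pcov C i z r j \<longleftrightarrow> i <= j & j <= r & a z dvd r - j & C j \<noteq> [] &
   (if a (hd (C j)) = a z then \<exists>c\<in>set (C j). val z r <= val c r else val z j <= val (hd (C j)) j)"

text \<open>The condition \<open>j < i + a z\<close> pins \<open>j\<close> down as the first index
  of the residue class of \<open>z\<close> that is not yet processed.\<close>

definition SInv where
 "SInv nt pr tm pf pb pv no nf nv i C \<longleftrightarrow>
   (\<forall>j. i <= j --> j < L --> pend nt pr tm pf pb pv i i j (C j)) &
   (\<forall>z<i. ok z --> a z \<noteq> 0 --> (\<forall>r. i <= r --> r < L --> a z dvd r - z -->
    bt no nf nv i z r \<or> (\<exists>j. pcov C i z r j & j < i + a z))) &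
   (\<forall>r<i. row_done no nf nv r)"

text \<open>The state after row \<open>i\<close> is fixed and before its list \<open>cs\<close> is
  sent on. A column may then be accounted for by \<open>cs\<close>, which is not stored in any
  pending cell.\<close>

definition Mid where
 "Mid nt pr tm pf pb pv no nf nv i C cs \<longleftrightarrow>
   (\<forall>j. i < j --> j < L --> pend nt pr tm pf pb pv (Suc i) i j (C j)) &
   (cs \<noteq> [] --> cc nt pr tm (Suc i) i (a (hd cs)) cs) &
   (\<forall>z<Suc i. ok z --> a z \<noteq> 0 --> (\<forall>r. i < r --> r < L --> a z dvd r - z -->
    bt no nf nv (Suc i) z r \<or> (cs \<noteq> [] & a (hd cs) = a z & a z dvd r - i & (\<exists>c\<in>set cs. val z r <= val c r)) \<or>
    (\<exists>j. pcov C (Suc i) z r j & j < i + a z))) &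
   (\<forall>r<Suc i. row_done no nf nv r)"

lemma val_split:
 assumes "z < L" "ok z" "a z \<noteq> 0" "z <= j" "j <= r" "a z dvd j - z" "a z dvd r - j"
 shows "val z r = V z + Qf (a z) ((j - z) div a z + (r - j) div a z)"
proof -
 have "r - z = (j - z) + (r - j)" using assms by simp
 then have "(r - z) div a z = (j - z) div a z + (r - j) div a z"
  using assms by (metis div_plus_div_distrib_dvd_left)
 then show ?thesis using val_eq[OF assms(1-3)] by simp
qed

text \<open>The witness uses \<open>e <= k\<close> copies where the column uses \<open>k\<close>, so
  by concavity further copies gain the witness at least as much as the column.\<close>

lemma bt_mono:
 assumes bt: "bt no nf nv i z j" and z: "z < L" "ok z" "a z \<noteq> 0" "j <= r" "a z dvd r - j" "a z dvd j - z"
 shows "bt no nf nv i z r"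
proof -
 obtain h where h: "h < i" "z <= h" "h < j" "no h" "nf h = h \<or> a (nf h) \<noteq> a z" "a z dvd j - h"
  "val z j < nv h + Qf (a z) ((j - h) div a z)"
  using bt by (auto simp: bt_def)
 define e m k where "e = (j - h) div a z" and "m = (r - j) div a z" and "k = (j - z) div a z"
 have rh: "a z dvd r - h" using h z by (intro dvd_diff_trans[of h j r]) auto
 have "r - h = (j - h) + (r - j)" using h z by simp
 then have em: "(r - h) div a z = e + m" using h z unfolding e_def m_def by (metis div_plus_div_distrib_dvd_left)
 have vz: "val z r = V z + Qf (a z) (k + m)" "val z j = V z + Qf (a z) k"
  using val_split[of z j r] val_eq[of z j] z h by (auto simp: k_def m_def)
 have "e <= k" using h unfolding e_def k_def by (intro div_le_mono) auto
 then have "Qf (a z) (k + m) - Qf (a z) k <= Qf (a z) (e + m) - Qf (a z) e"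
  using concave_slope_antimono conc[OF z(1-3)] by blast
 then have "val z r < nv h + Qf (a z) ((r - h) div a z)" using h(7) vz em e_def by simp
 then show ?thesis using h rh z unfolding bt_def by (meson order_less_le_trans)
qed

text \<open>This is the place where a column may be discarded: it arrives at \<open>i\<close> with
  at least one copy and is not better than the entry there, and strict subadditivity turns this weak
  inequality into a strict one for every further copy.\<close>

lemma bt_intro:
 assumes z: "z < L" "ok z" "a z \<noteq> 0" "z < i" "a z dvd i - z" "i < r" "a z dvd r - i"
  and w: "no i" "nf i = i \<or> a (nf i) \<noteq> a z" "val z i <= nv i"
 shows "bt no nf nv (Suc i) z r"
proof -
 define k e where "k = (i - z) div a z" and "e = (r - i) div a z"
 have k: "k \<ge> 1" "e \<ge> 1" using z by (auto simp: k_def e_def div_greater_zero_iff dvd_imp_le Suc_le_eq)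
 have "val z r = V z + Qf (a z) (k + e)" "val z i = V z + Qf (a z) k"
  using val_split[of z i r] val_eq[of z i] z by (auto simp: k_def e_def)
 moreover have "Qf (a z) (k + e) < Qf (a z) k + Qf (a z) e"
  using concave_subadditive conc[OF z(1-3)] k by blast
 ultimately have "val z r < nv i + Qf (a z) ((r - i) div a z)" using w(3) e_def by simp
 then show ?thesis using z w unfolding bt_def by (metis less_Suc_eq less_imp_le)
qed

lemma bt_cong:
 assumes "bt no nf nv i z r" "\<And>j. j < i ==> no j = no' j & nf j = nf' j & nv j = nv' j" "i <= i'"
 shows "bt no' nf' nv' i' z r"
 using assms unfolding bt_def by (metis order_less_le_trans)

lemma row_done_cong:
 assumes "row_done no nf nv r" "\<And>j. j <= r ==> no j = no' j & nf j = nf' j & nv j = nv' j"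
 shows "row_done no' nf' nv' r"
proof -
 have b: "bt no nf nv r z r ==> bt no' nf' nv' r z r" for z
  by (rule bt_cong[of no nf nv r z r]) (use assms(2) in auto)
 have e: "no r = no' r" "nf r = nf' r" "nv r = nv' r" using assms(2)[of r] by auto
 show ?thesis using assms(1) b unfolding row_done_def e by blast
qed

lemma dvd_between:
 assumes "z <= (j::nat)" "j <= r" "w dvd r - z" "w dvd r - j"
 shows "w dvd j - z"
proof -
 have "w dvd (r - z) - (r - j)" using assms dvd_diff_nat by blast
 then show ?thesis using assms by simp
qed

text \<open>One statement for all ways to fix row \<open>i\<close>: \<open>o'\<close>,
  \<open>f'\<close>, \<open>v'\<close> say whether the row has an entry, its source and its value,
  and \<open>cs\<close> is the list to be sent on. \<open>own\<close> is the case that the row keeps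
  its old entry, \<open>keep\<close> the case that it takes the front of the waiting list and
  possibly inserts column \<open>i\<close> into that list.\<close>

lemma to_mid:
 assumes S: "SInv nt pr tm pf pb pv no nf nv i C" and i: "i < L"
  and upd: "no' = no(i := o')" "nf' = nf(i := f')" "nv' = nv(i := v')"
  and src: "o' --> f' <= i & ok f' & (f' = i \<or> a f' \<noteq> 0 & a f' dvd i - f') & v' = val f' i"
  and okv: "ok i --> o' & V i <= v'"
  and pnd: "C i \<noteq> [] --> o' & val (hd (C i)) i <= v' & (f' = i \<or> f' = hd (C i))"
  and cs: "cs \<noteq> [] --> cc nt' pr' tm' (Suc i) i (a (hd cs)) cs"
  and agree: "\<And>c. c \<noteq> i ==> c \<notin> set (C i) ==> nt' (int c) = nt (int c) & pr' (int c) = pr (int c) & tm' (int c) = tm (int c)"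
  and own: "f' = i ==> o' ==> a i \<noteq> 0 ==> ok i ==> i \<in> set cs & a (hd cs) = a i"
  and keep: "o' ==> f' \<noteq> i ==> cs \<noteq> [] & C i \<noteq> [] & a (hd cs) = a (hd (C i)) & (ok i --> V i < v') & (ok i --> a i = a (hd cs) --> i \<in> set cs) &
    (\<forall>c\<in>set (C i). \<forall>r. i < r --> r < L --> a (hd cs) dvd r - i --> (\<exists>c'\<in>set cs. val c r <= val c' r))"
 shows "Mid nt' pr' tm' pf pb pv no' nf' nv' i C cs"
proof -
 have P: "pend nt pr tm pf pb pv i i j (C j)" if "i <= j" "j < L" for j using S that by (auto simp: SInv_def)
 have Cv: "bt no nf nv i z r \<or> (\<exists>j. pcov C i z r j & j < i + a z)"
  if "z < i" "ok z" "a z \<noteq> 0" "i <= r" "r < L" "a z dvd r - z" for z r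
  using S that unfolding SInv_def by blast
 have D: "row_done no nf nv r" if "r < i" for r using S that unfolding SInv_def by blast
 have Pi: "cc nt pr tm i i (a (hd (C i))) (C i)" if "C i \<noteq> []" using P[of i] i that by (simp add: pend_def)
 \<comment> \<open>A waiting list speaks for its columns at \<open>i\<close> through its front, so
   the value chosen for row \<open>i\<close> bounds all columns that arrive there and are not
   beaten.\<close>
 have at_i: "bt no nf nv i z i \<or> (o' & val z i <= v' & C i \<noteq> [])"
  if z: "z < i" "ok z" "a z \<noteq> 0" "a z dvd i - z" for z
 proof -
  consider "bt no nf nv i z i" | j where "pcov C i z i j" using Cv[OF z(1-3) order_refl i z(4)] by blast
  then show ?thesis
  proof cases
   case (2 j)
   then have j: "j = i" and ne: "C i \<noteq> []" by (auto simp: pcov_def)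
   have "val z i <= val (hd (C i)) i"
   proof (cases "a (hd (C i)) = a z")
    case True
    then obtain c where "c \<in> set (C i)" "val z i <= val c i" using 2 j unfolding pcov_def by auto
    then show ?thesis using front_best[OF Pi[OF ne] _ i] by fastforce
   qed (use 2 j in \<open>simp add: pcov_def\<close>)
   then show ?thesis using pnd ne by auto
  qed auto
 qed
 \<comment> \<open>A column in the lists of both \<open>i\<close> and \<open>j\<close> would have
   its item divide \<open>j - i\<close>, contradicting that the list at \<open>j\<close> was sent
   from below \<open>i\<close>. Changing links of the list at \<open>i\<close> thus leaves all other
   lists intact.\<close>
 have disj: "c \<noteq> i & c \<notin> set (C i)" if c: "c \<in> set (C j)" and j: "i < j" "j < L" for c j
 proof -
  have nj: "C j \<noteq> []" using c by auto
  have pj: "cc nt pr tm i j (a (hd (C j))) (C j)" "j < i + a (hd (C j))" using P[of j] j nj by (auto simp: pend_def)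
  have cj: "c < i" "a c = a (hd (C j))" "a c dvd j - c" using cc_elem[OF pj(1) c] by simp_all
  have "c \<notin> set (C i)"
  proof
   assume ci: "c \<in> set (C i)"
   then have "C i \<noteq> []" by auto
   then have "a c dvd i - c" using cc_elem[OF Pi ci] by simp
   then have "a c dvd j - i" using cj j dvd_diff_nat[of "a c" "j - c" "i - c"] by simp
   then have "a c <= j - i" using j by (simp add: dvd_imp_le)
   then show False using pj(2) cj j by simp
  qed
  then show ?thesis using cj by simp
 qed
 have M1: "pend nt' pr' tm' pf pb pv (Suc i) i j (C j)" if j: "i < j" "j < L" for j
 proof (cases "C j = []")
  case True
  then show ?thesis using P[of j] j by (simp add: pend_def)
 next
  case False
  have p: "pend nt pr tm pf pb pv i i j (C j)" using P[of j] j by simp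
  then have c: "cc nt pr tm i j (a (hd (C j))) (C j)" using False by (simp add: pend_def)
  have "cc nt' pr' tm' (Suc i) j (a (hd (C j))) (C j)"
   by (rule cc_cong[OF c]) (use agree disj j in auto)
  then show ?thesis using p False by (simp add: pend_def)
 qed
 have btS: "bt no' nf' nv' (Suc i) z r" if "bt no nf nv i z r" for z r
  by (rule bt_cong[OF that]) (auto simp: upd)
 have M2: "bt no' nf' nv' (Suc i) z r \<or> (cs \<noteq> [] & a (hd cs) = a z & a z dvd r - i & (\<exists>c\<in>set cs. val z r <= val c r)) \<or>
    (\<exists>j. pcov C (Suc i) z r j & j < i + a z)"
  if z: "z < Suc i" "ok z" "a z \<noteq> 0" "i < r" "r < L" "a z dvd r - z" for z r
 proof (cases "z = i")
  case True
  have o: "o'" "V i <= v'" using okv z True by auto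
  show ?thesis
  proof (cases "f' = i")
   case T: True
   then have "i \<in> set cs" "a (hd cs) = a i" using own o z True by auto
   then show ?thesis using True z by auto
  next
   case F: False
   note k = keep[OF o(1) F]
   show ?thesis
   proof (cases "a i = a (hd cs)")
    case T: True
    then show ?thesis using k True z by auto
   next
    case F2: False
    have fh: "f' = hd (C i)" using k pnd F by auto
    \<comment> \<open>Column \<open>i\<close> holds no copy yet, so subadditivity gives nothing.
      Strictness comes from \<open>V i < v'\<close>, which is why the program lets a row keep its
      own entry on ties.\<close>
    have "val i r = V i + Qf (a i) ((r - i) div a i)" using val_eq[OF i] z True by simp
    then have "val z r < v' + Qf (a z) ((r - i) div a z)" using k z True by simp
    moreover have "a f' \<noteq> a z" using F2 k fh True by simp
    ultimately have "bt no' nf' nv' (Suc i) z r" unfolding bt_def using z True o upd by (intro exI[of _ i]) auto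
    then show ?thesis by blast
   qed
  qed
 next
  case False
  then have zi: "z < i" using z by simp
  have zl: "z < L" using zi i by simp
  consider "bt no nf nv i z r" | j where "pcov C i z r j" "j < i + a z" using Cv[of z r] zi z by auto
  then show ?thesis
  proof cases
   case 1
   then show ?thesis using btS by blast
  next
   case (2 j)
   show ?thesis
   proof (cases "j = i")
    case F: False
    then have "pcov C (Suc i) z r j" using 2 by (auto simp: pcov_def)
    then show ?thesis using 2 by blast
   next
    case T: True
    have ri: "a z dvd r - i" and ne: "C i \<noteq> []" using 2 T by (auto simp: pcov_def)
    have iz: "a z dvd i - z" using dvd_between[of z i r "a z"] zi z ri by simp
    consider (b) "bt no nf nv i z i" | (v) "o'" "val z i <= v'" using at_i[OF zi z(2,3) iz] by blast
    then show ?thesis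
    proof cases
     case b
     then have "bt no nf nv i z r" using bt_mono[OF b zl z(2,3) _ ri iz] z by simp
     then show ?thesis using btS by blast
    next
     case v
     show ?thesis
     proof (cases "f' \<noteq> i & a (hd (C i)) = a z")
      case True
      then obtain c where c: "c \<in> set (C i)" "val z r <= val c r" using 2 T unfolding pcov_def by auto
      have k: "cs \<noteq> []" "a (hd cs) = a z" using keep[OF v(1)] True by auto
      have "\<exists>c'\<in>set cs. val c r <= val c' r" using keep[OF v(1)] True c z ri by auto
      then show ?thesis using c k ri by (meson order_trans)
     next
      \<comment> \<open>The entry of row \<open>i\<close> is either the old one or comes from a
        column of another item, so column \<open>z\<close> is beaten beyond
        \<open>i\<close>.\<close>
      case F: False
      have "bt no' nf' nv' (Suc i) z r"
       by (rule bt_intro[OF zl z(2,3) zi iz z(4) ri]) (use v F pnd ne upd in auto)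
      then show ?thesis by blast
     qed
    qed
   qed
  qed
 qed
 have M3: "row_done no' nf' nv' r" if r: "r < Suc i" for r
 proof (cases "r = i")
  case False
  then have "row_done no nf nv r" using D[of r] r by simp
  then show ?thesis by (rule row_done_cong) (use False r in \<open>auto simp: upd\<close>)
 next
  case True
  have "no' r & val z r <= nv' r \<or> bt no' nf' nv' r z r" if z: "z < r" "ok z" "a z \<noteq> 0" "a z dvd r - z" for z
  proof -
   consider "bt no nf nv i z i" | "o'" "val z i <= v'" using at_i[of z] z True by blast
   then show ?thesis
   proof cases
    case 1
    have "bt no' nf' nv' i z i" by (rule bt_cong[OF 1]) (auto simp: upd)
    then show ?thesis using True by simp
   qed (use True upd in auto)
  qed
  then show ?thesis using src okv True unfolding row_done_def by (auto simp: upd)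
 qed
 show ?thesis using M1 M2 M3 cs unfolding Mid_def by blast
qed

text \<open>If a list already waits at \<open>i + w\<close>, it belongs to a different item, and
  only the list with the better front there is kept. The other one remains accounted for through the
  second alternative of \<open>pcov\<close>, which compares values at the meeting index
  only.\<close>

lemma Mid_emit:
 assumes M: "Mid nt pr tm pf pb pv no nf nv i C cs" and i: "i < L"
  and em: "if cs = [] \<or> i + a (hd cs) \<ge> L then C' = C & pf' = pf & pb' = pb & pv' = pv
   else (let j = i + a (hd cs); cs' = (if tl cs \<noteq> [] & tm (int (hd (tl cs))) <= int j then tl cs else cs) in
    if C j = [] \<or> val (hd (C j)) j < val (hd cs') j
    then C' = C(j := cs') & pf' = pf(int j := int (hd cs') + 1) & pb' = pb(int j := int (last cs)) & pv' = pv(int j := val (hd cs') j)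
    else C' = C & pf' = pf & pb' = pb & pv' = pv)"
 shows "SInv nt pr tm pf' pb' pv' no nf nv (Suc i) C'"
proof -
 have P: "pend nt pr tm pf pb pv (Suc i) i j (C j)" if "i < j" "j < L" for j using M that by (auto simp: Mid_def)
 have Ccs: "cs \<noteq> [] ==> cc nt pr tm (Suc i) i (a (hd cs)) cs" using M by (auto simp: Mid_def)
 have Cv: "bt no nf nv (Suc i) z r \<or> (cs \<noteq> [] & a (hd cs) = a z & a z dvd r - i & (\<exists>c\<in>set cs. val z r <= val c r)) \<or>
    (\<exists>j. pcov C (Suc i) z r j & j < i + a z)"
  if "z < Suc i" "ok z" "a z \<noteq> 0" "i < r" "r < L" "a z dvd r - z" for z r
  using M that unfolding Mid_def by blast
 have D: "\<forall>r<Suc i. row_done no nf nv r" using M unfolding Mid_def by blast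
 have P': "pend nt pr tm pf pb pv (Suc i) (Suc i) j (C j)" if "i < j" "j < L" for j
  using P[OF that] by (auto simp: pend_def)
 show ?thesis
 proof (cases "cs = [] \<or> i + a (hd cs) \<ge> L")
  case True
  then have eq: "C' = C" "pf' = pf" "pb' = pb" "pv' = pv" using em by auto
  have "bt no nf nv (Suc i) z r \<or> (\<exists>j. pcov C (Suc i) z r j & j < Suc i + a z)"
   if z: "z < Suc i" "ok z" "a z \<noteq> 0" "Suc i <= r" "r < L" "a z dvd r - z" for z r
  proof -
   have "\<not> (cs \<noteq> [] & a (hd cs) = a z & a z dvd r - i)"
   proof
    assume h: "cs \<noteq> [] & a (hd cs) = a z & a z dvd r - i"
    then have "a z <= r - i" using z by (intro dvd_imp_le) auto
    then show False using h True z by simp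
   qed
   then show ?thesis using Cv[of z r] z by (metis Suc_le_eq less_Suc_eq_le less_or_eq_imp_le add_Suc)
  qed
  then show ?thesis using P' D eq unfolding SInv_def by (metis Suc_le_eq)
 next
  case False
  define w where "w = a (hd cs)"
  define j where "j = i + w"
  define cs' where "cs' = (if tl cs \<noteq> [] & tm (int (hd (tl cs))) <= int j then tl cs else cs)"
  have ne: "cs \<noteq> []" and jl: "j < L" using False by (auto simp: j_def w_def)
  have c: "cc nt pr tm (Suc i) i w cs" using Ccs ne w_def by simp
  have w0: "w > 0" using c by (simp add: cc_def)
  note adv = cc_advance[OF c j_def jl cs'_def]
  have ne': "cs' \<noteq> []" using adv(1) by (simp add: cc_def)
  \<comment> \<open>The waiting list was sent from an index before \<open>i\<close> and arrives at
    \<open>i + w\<close>, so its step is longer than \<open>w\<close>.\<close>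
  have old_w: "a (hd (C j)) > w" if "C j \<noteq> []" using P[of j] that jl w0 by (auto simp: pend_def j_def)
  let ?better = "C j = [] \<or> val (hd (C j)) j < val (hd cs') j"
  have em': "if ?better then C' = C(j := cs') & pf' = pf(int j := int (hd cs') + 1) & pb' = pb(int j := int (last cs)) & pv' = pv(int j := val (hd cs') j)
    else C' = C & pf' = pf & pb' = pb & pv' = pv"
  proof -
   from em False show ?thesis unfolding Let_def w_def[symmetric] j_def[symmetric] cs'_def[symmetric] by (simp only: if_False)
  qed
  have C'j: "C' j \<noteq> []" "val (hd cs') j <= val (hd (C' j)) j" "C j \<noteq> [] ==> val (hd (C j)) j <= val (hd (C' j)) j"
   "C' j = cs' \<or> a (hd (C' j)) > w"
   using em' ne' old_w by (auto split: if_splits)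
  have C'o: "C' h = C h" if "h \<noteq> j" for h using em' that by (auto split: if_splits)
  have I1: "pend nt pr tm pf' pb' pv' (Suc i) (Suc i) h (C' h)" if h: "i < h" "h < L" for h
  proof (cases "h = j & ?better")
   case True
   then show ?thesis using em' adv ne' by (auto simp: pend_def j_def)
  next
   case F: False
   then have "C' h = C h" "pf' (int h) = pf (int h)" "pb' (int h) = pb (int h)" "pv' (int h) = pv (int h)"
    using em' by (auto split: if_splits)
   then show ?thesis using P'[OF h] unfolding pend_def by (simp only:)
  qed
  \<comment> \<open>Whatever reaches \<open>j\<close> is dominated there by the front of the list
    that is finally kept, unless it is beaten.\<close>
  have at_j: "bt no nf nv (Suc i) z j \<or> val z j <= val (hd (C' j)) j"
   if z: "z < Suc i" "ok z" "a z \<noteq> 0" "a z dvd j - z" and jz: "j < i + a z \<or> a z = w" for z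
  proof -
   have ij: "i < j" using w0 by (simp add: j_def)
   consider "bt no nf nv (Suc i) z j" | d where "a (hd cs) = a z" "d \<in> set cs" "val z j <= val d j" |
    h where "pcov C (Suc i) z j h" "h < i + a z"
    using Cv[OF z(1-3) ij jl z(4)] by blast
   then show ?thesis
   proof cases
    case 1
    then show ?thesis by simp
   next
    case (2 d)
    have "w dvd j - i" by (simp add: j_def)
    then obtain d' where d': "d' \<in> set cs'" "val d j <= val d' j" using adv(5)[OF 2(2) order_refl jl] by blast
    then show ?thesis using front_best[OF adv(1) d'(1) jl] 2 C'j(2) by linarith
   next
    case (3 h)
    \<comment> \<open>An earlier covering index would differ from \<open>j\<close> by at least
      \<open>a z\<close>, but it lies after \<open>i\<close>, and either \<open>a z\<close> equals
      \<open>w\<close> or \<open>j < i + a z\<close>.\<close>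
    have "h = j"
    proof (rule ccontr)
     assume "h \<noteq> j"
     then have h: "i < h" "h < j" "a z dvd j - h" using 3 by (auto simp: pcov_def)
     then have "a z <= j - h" by (simp add: dvd_imp_le)
     then show False using jz h by (auto simp: j_def)
    qed
    then have cj: "C j \<noteq> []" using 3 by (simp add: pcov_def)
    have "val z j <= val (hd (C j)) j"
    proof (cases "a (hd (C j)) = a z")
     case True
     then obtain d where d: "d \<in> set (C j)" "val z j <= val d j" using 3 \<open>h = j\<close> unfolding pcov_def by auto
     have "cc nt pr tm (Suc i) j (a (hd (C j))) (C j)" using P[OF ij jl] cj by (simp add: pend_def)
     then show ?thesis using front_best d jl by fastforce
    qed (use 3 \<open>h = j\<close> in \<open>simp add: pcov_def\<close>)
    then show ?thesis using C'j(3)[OF cj] by linarith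
   qed
  qed
  have I2: "bt no nf nv (Suc i) z r \<or> (\<exists>h. pcov C' (Suc i) z r h & h < Suc i + a z)"
   if z: "z < Suc i" "ok z" "a z \<noteq> 0" "Suc i <= r" "r < L" "a z dvd r - z" for z r
  proof -
   have zl: "z < L" using z i by simp
   \<comment> \<open>If the list kept at \<open>j\<close> has another item, the comparison of values
     at \<open>j\<close> is all that is needed to cover \<open>z\<close> there.\<close>
   have viaj: ?thesis if jr: "j <= r" "a z dvd r - j" "j < i + a z \<or> a z = w" "a (hd (C' j)) \<noteq> a z"
   proof -
    have zj: "a z dvd j - z" using dvd_between[of z j r "a z"] jr z by (simp add: j_def)
    consider "bt no nf nv (Suc i) z j" | "val z j <= val (hd (C' j)) j" using at_j[OF z(1-3) zj jr(3)] by blast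
    then show ?thesis
    proof cases
     case 1
     then show ?thesis using bt_mono[OF 1 zl z(2,3) jr(1,2) zj] by blast
    next
     case 2
     then have "pcov C' (Suc i) z r j" using jr C'j(1) w0 by (simp add: pcov_def j_def)
     then show ?thesis using jr(3) by (intro disjI2 exI[of _ j]) (auto simp: j_def)
    qed
   qed
   consider "bt no nf nv (Suc i) z r" | d where "a (hd cs) = a z" "a z dvd r - i" "d \<in> set cs" "val z r <= val d r" |
    h where "pcov C (Suc i) z r h" "h < i + a z"
    using Cv[of z r] z by auto
   then show ?thesis
   proof cases
    case 1
    then show ?thesis by simp
   next
    case (2 d)
    have wz: "a z = w" using 2 w_def by simp
    have "w <= r - i" using 2 z wz by (intro dvd_imp_le) auto
    then have jr: "j <= r" using z by (simp add: j_def)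
    have "w dvd (r - i) - w" using 2(2) wz dvd_diff_nat[of w "r - i" w] by simp
    moreover have "(r - i) - w = r - j" by (simp add: j_def)
    ultimately have rj: "a z dvd r - j" using wz by (simp only:)
    show ?thesis
    proof (cases "C' j = cs'")
     case True
     obtain d' where "d' \<in> set cs'" "val d r <= val d' r" using adv(5)[OF 2(3) jr z(5)] 2 wz by auto
     then have "pcov C' (Suc i) z r j" using True jr rj wz adv(4) ne' 2(4) w0 by (auto simp: pcov_def j_def intro: order_trans)
     then show ?thesis using wz by (intro disjI2 exI[of _ j]) (auto simp: j_def)
    next
     case F: False
     then show ?thesis using viaj jr rj wz C'j(4) by auto
    qed
   next
    case (3 h)
    show ?thesis
    proof (cases "h = j")
     case F: False
     then have "pcov C' (Suc i) z r h" using 3 C'o unfolding pcov_def by simp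
     then show ?thesis using 3 by (metis add_Suc less_SucI)
    next
     case T: True
     have jr: "j <= r" "a z dvd r - j" "j < i + a z" using 3 T by (auto simp: pcov_def)
     have zw: "a z > w" using jr by (simp add: j_def)
     show ?thesis
     proof (cases "C' j = C j")
      case True
      then have "pcov C' (Suc i) z r j" using 3(1) unfolding pcov_def T True by blast
      then show ?thesis using jr by (intro disjI2 exI[of _ j]) simp
     next
      case F: False
      then have "C' j = cs'" using em' by (auto split: if_splits)
      then show ?thesis using viaj jr zw adv(4) by auto
     qed
    qed
   qed
  qed
  show ?thesis using I1 I2 D unfolding SInv_def by (meson Suc_le_eq)
 qed
qed

lemma SInv_0: "(\<And>j. j < L ==> pf (int j) = 0) ==> SInv nt pr tm pf pb pv no nf nv 0 (\<lambda>_. [])"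
 by (simp add: SInv_def pend_def)

lemma SInv_L: "SInv nt pr tm pf pb pv no nf nv L C ==> sweep_spec L ok V a Qf no nf nv"
proof -
 assume "SInv nt pr tm pf pb pv no nf nv L C"
 then have "\<forall>r<L. row_done no nf nv r" by (simp add: SInv_def)
 moreover have "bt no nf nv r z r ==> beaten V a Qf no nf nv z r" for z r
  unfolding bt_def beaten_def by blast
 ultimately show ?thesis unfolding sweep_spec_def row_done_def by metis
qed

end

section \<open>The sweep as a program\<close>

abbreviation Plus (infixl "+." 65) where "e1 +. e2 \<equiv> Op Add e1 e2"
abbreviation Minus (infixl "-." 65) where "e1 -. e2 \<equiv> Op Sub e1 e2"
abbreviation Times (infixl "*." 70) where "e1 *. e2 \<equiv> Op Mul e1 e2"
abbreviation Quot (infixl "\<div>" 70) where "e1 \<div> e2 \<equiv> Op Div e1 e2"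
notation Assign (infix "::=" 61)
notation Seq (infixr ";;" 60)
notation Var ("$_" [100] 100)
notation Const ("#_" [100] 100)

context machine
begin

lemma run_SeqI:
 assumes "run c1 s t P1"
  "\<And>t' s'. P1 t' s' ==> (\<And>v. v \<notin> asgd c1 ==> vars s' v = vars s v) ==>
    (\<And>a. a \<notin> wrtn c1 ==> arrs s' a = arrs s a) ==> Bd M s' ==> run c2 s' t' P"
 shows "run (Seq c1 c2) s t P"
 by (rule run_Seq, rule run_conseq[OF assms(1)], rule assms(2))

lemma BdD: "Bd M s ==> \<bar>vars s v\<bar> <= M" "Bd M s ==> \<bar>arrs s a k\<bar> <= M"
 by (auto simp: Bd_def)

end

text \<open>Binary search for the least number of copies with which column \<open>i\<close> catches
  up with column \<open>p\<close>. At index \<open>i\<close> the older column already holds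
  \<open>m0\<close> copies.\<close>

definition cross_com :: com where
 "cross_com =
  ((''lo'' ::= #0;; ''hi'' ::= (($''L'' -. #1 -. $''i'') \<div> $''w'') +. #1;;
  ''m0'' ::= ($''i'' -. $''p'') \<div> $''w'');;
  While (Less ($''lo'') ($''hi''))
   (''md'' ::= ($''lo'' +. $''hi'') \<div> #2;; ''qa'' ::= Query ($''w'') ($''md'');;
    ''qb'' ::= Query ($''w'') ($''md'' +. $''m0'');;
    Cond (Less (Read ''cv'' ($''i'') +. $''qa'') (Read ''cv'' ($''p'') +. $''qb''))
     (''lo'' ::= $''md'' +. #1) (''hi'' ::= $''md''));;
  ''x'' ::= $''i'' +. $''w'' *. $''lo'')"

lemma asgd_cross_com: "asgd cross_com = {''x'', ''hi'', ''lo'', ''qb'', ''qa'', ''md'', ''m0'', ''hi'', ''lo''}"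
 and wrtn_cross_com: "wrtn cross_com = {}"
 by (simp_all add: cross_com_def)

text \<open>\<open>h\<close> bounds the depth of the binary search. A takeover beyond the table can
  reach \<open>2 * L\<close>, which is one reason for the slack between \<open>L\<close> and
  \<open>M\<close>.\<close>

locale sweep = machine Q W M + sweep0 L ok V a Qf for Q W M L ok V a Qf +
 fixes h :: nat
 assumes LM: "4 * int L + 16 <= M" and Lh: "L < 2 ^ h"
  and aL: "\<And>z. z < L ==> ok z ==> a z <= L"
  and QQ: "\<And>z k. z < L ==> ok z ==> a z \<noteq> 0 ==> k <= L ==> Q (int (a z)) (int k) = Qf (a z) k & \<bar>Qf (a z) k\<bar> <= M"
  and valM: "\<And>z r. z < L ==> ok z ==> a z \<noteq> 0 ==> z <= r ==> r < L ==> a z dvd r - z ==> \<bar>val z r\<bar> <= M"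
begin

definition inp :: "state => bool" where
 "inp s \<longleftrightarrow> vars s ''L'' = int L & (\<forall>i<L. ar s ''ok'' i = (if ok i then 1 else 0) &
   ar s ''cv'' i = V i & ar s ''aa'' i = int (a i))"

text \<open>By concavity the predicate \<open>Pk\<close> below is upward closed in the number of
  copies, since column \<open>p\<close> is always \<open>m\<close> copies ahead; a binary search
  therefore finds the threshold.\<close>

lemma cross_run:
 assumes inp: "inp s" and v: "vars s ''i'' = int i" "vars s ''p'' = int p" "vars s ''w'' = int w"
  and pi: "p < i" "i < L" "ok p" "ok i" "a p = w" "a i = w" "w \<noteq> 0" "w dvd i - p"
 shows "run cross_com s t (\<lambda>t' s'. t' <= t + 7 * (h + 1) & (\<exists>r. vars s' ''x'' = int r & cross p i r))"
proof -
 let ?c1 = "(''md'' ::= ($''lo'' +. $''hi'') \<div> #2;; ''qa'' ::= Query ($''w'') ($''md'');; ''qb'' ::= Query ($''w'') ($''md'' +. $''m0'');; Cond (Less (Read ''cv'' ($''i'') +. $''qa'') (Read ''cv'' ($''p'') +. $''qb'')) (''lo'' ::= $''md'' +. #1) (''hi'' ::= $''md''))"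
 define km where "km = (L - 1 - i) div w"
 define m where "m = (i - p) div w"
 define Pk where "Pk k \<longleftrightarrow> V p + Qf w (k + m) <= V i + Qf w k" for k
 have w0: "w > 0" using pi by simp
 have pl: "p < L" using pi by simp
 have wm: "w * m = i - p" using pi by (simp add: m_def)
 have ic: "int i - int p = int (i - p)" "int L - 1 - int i = int (L - 1 - i)" using pi by auto
 have em: "(int i - int p) div int w = int m" unfolding ic m_def by (simp add: zdiv_int)
 have ekm: "(int L - 1 - int i) div int w = int km" unfolding ic km_def by (simp add: zdiv_int)
 have kmL: "i + w * km <= L - 1"
 proof -
  have "w * km <= L - 1 - i" by (simp add: km_def)
  then show ?thesis using pi by simp
 qed
 have kml: "km < L"
 proof -
  have "km <= w * km" using w0 by simp
  then show ?thesis using kmL pi(2) by linarith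
 qed
 have mL: "m <= i" using wm w0 by (metis diff_le_self le_trans mult_le_mono1 mult_1 Suc_leI One_nat_def)
 \<comment> \<open>Profits are known to fit into words only up to \<open>L\<close> copies, so the
   queried arguments must not exceed \<open>L\<close>.\<close>
 have kmm: "k + m <= L" if "k <= km" for k
 proof -
  have "k + m <= w * (k + m)" using w0 by simp
  also have "\<dots> = w * k + (i - p)" by (simp add: distrib_left wm)
  also have "\<dots> <= w * km + (i - p)" using that by simp
  also have "\<dots> <= L" using kmL pi by simp
  finally show ?thesis .
 qed
 have vali: "val i (i + w * k) = V i + Qf w k" for k using val_eq[of i "i + w * k"] pi by simp
 have valp: "val p (i + w * k) = V p + Qf w (k + m)" for k
 proof -
  have "i + w * k - p = w * (k + m)" using wm pi by (simp add: algebra_simps)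
  then show ?thesis using val_eq[of p "i + w * k"] pi by simp
 qed
 have mono: "Pk k ==> k <= k' ==> Pk k'" for k k'
  using concave_slope_antimono[of "Qf w" k k' m] conc[of i] pi by (fastforce simp: Pk_def)
 have Qk: "Q (int w) (int k) = Qf w k" "\<bar>Qf w k\<bar> <= M" if "k <= L" for k using QQ[of i k] pi that by auto
 \<comment> \<open>\<open>n\<close> bounds the remaining rounds, because each round halves the
   interval; a round takes 6 units, and \<open>6 * n\<close> reserves time for those to
   come.\<close>
 define Inv :: "nat => state => bool" where "Inv = (\<lambda>t' s'. \<exists>n lo hi. t' + 6 * n <= t + 6 * h + 3 & lo <= hi & hi <= km + 1 & hi - lo < 2 ^ n &
   vars s' ''lo'' = int lo & vars s' ''hi'' = int hi & vars s' ''m0'' = int m & vars s' ''i'' = int i &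
   vars s' ''p'' = int p & vars s' ''w'' = int w & arrs s' = arrs s & (\<forall>k<lo. \<not> Pk k) & (\<forall>k. hi <= k --> k <= km --> Pk k))"
 have InvI: "Inv t' s'" if "t' + 6 * n <= t + 6 * h + 3" "lo <= hi" "hi <= km + 1" "hi - lo < 2 ^ n"
   "vars s' ''lo'' = int lo" "vars s' ''hi'' = int hi" "vars s' ''m0'' = int m" "vars s' ''i'' = int i"
   "vars s' ''p'' = int p" "vars s' ''w'' = int w" "arrs s' = arrs s" "\<And>k. k < lo ==> \<not> Pk k"
   "\<And>k. hi <= k ==> k <= km ==> Pk k" for t' :: nat and s' :: state and n lo hi
  unfolding Inv_def by (intro exI[of _ n] exI[of _ lo] exI[of _ hi] conjI allI impI that)
 have cvi: "ar s ''cv'' i = V i" "ar s ''cv'' p = V p" using inp pi by (auto simp: inp_def)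
 have h0: "Inv (t + 3) s1" if "t' = t + 3" "arrs s1 = arrs s" "vars s1 ''lo'' = 0" "vars s1 ''hi'' = int km + 1" "vars s1 ''m0'' = int m"
   "vars s1 ''i'' = int i" "vars s1 ''p'' = int p" "vars s1 ''w'' = int w" for t' :: nat and s1 :: state
  unfolding Inv_def using that kml Lh by (intro exI[of _ h] exI[of _ 0] exI[of _ "km + 1"]) auto
 show ?thesis
  unfolding cross_com_def
 proof (rule run_SeqI[where ?P1.0 = "\<lambda>t' s1. t' = t + 3 & arrs s1 = arrs s & vars s1 ''lo'' = 0 & vars s1 ''hi'' = int km + 1 & vars s1 ''m0'' = int m &
   vars s1 ''i'' = int i & vars s1 ''p'' = int p & vars s1 ''w'' = int w"])
  show "run (''lo'' ::= #0;; ''hi'' ::= ($''L'' -. #1 -. $''i'') \<div> $''w'' +. #1;;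
    ''m0'' ::= ($''i'' -. $''p'') \<div> $''w'') s t
   (\<lambda>t' s1. t' = t + 3 & arrs s1 = arrs s & vars s1 ''lo'' = 0 & vars s1 ''hi'' = int km + 1 & vars s1 ''m0'' = int m &
   vars s1 ''i'' = int i & vars s1 ''p'' = int p & vars s1 ''w'' = int w)"
   by (rule run_wp) (use inp kml mL pi LM M16 in \<open>simp add: v em ekm inp_def\<close>)
 next
  fix t1 :: nat and s1 :: state
  assume a1: "t1 = t + 3 & arrs s1 = arrs s & vars s1 ''lo'' = 0 & vars s1 ''hi'' = int km + 1 & vars s1 ''m0'' = int m &
   vars s1 ''i'' = int i & vars s1 ''p'' = int p & vars s1 ''w'' = int w"
  show "run (While (Less ($''lo'') ($''hi''))
   ?c1;;
  ''x'' ::= $''i'' +. $''w'' *. $''lo'') s1 t1 (\<lambda>t' s'. t' <= t + 7 * (h + 1) & (\<exists>r. vars s' ''x'' = int r & cross p i r))"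
  proof (rule run_Seq, rule run_While[where Inv = Inv and \<mu> = "\<lambda>s. nat (vars s ''hi'' - vars s ''lo'')"])
   show "Inv t1 s1" using h0[of t1 s1] a1 by simp
  next
   fix t2 :: nat and s2 :: state
   assume I: "Inv t2 s2" and b: "bval Q s2 (Less ($''lo'') ($''hi''))"
   obtain n lo hi where k: "t2 + 6 * n <= t + 6 * h + 3" "lo <= hi" "hi <= km + 1" "hi - lo < 2 ^ n"
    "vars s2 ''lo'' = int lo" "vars s2 ''hi'' = int hi" "vars s2 ''m0'' = int m" "vars s2 ''i'' = int i"
    "vars s2 ''p'' = int p" "vars s2 ''w'' = int w" "arrs s2 = arrs s" "\<forall>k<lo. \<not> Pk k" "\<forall>k. hi <= k --> k <= km --> Pk k"
    using I unfolding Inv_def by blast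
   have lh: "lo < hi" using b k by simp
   obtain n' where n: "n = Suc n'" using k(4) lh by (cases n) auto
   define md where "md = (lo + hi) div 2"
   have md: "lo <= md" "md < hi" "md <= km" using lh k by (auto simp: md_def)
   have emd: "(int lo + int hi) div 2 = int md" by (simp add: md_def zdiv_int)
   have emm: "Q (int w) (int md + int m) = Qf w (md + m)" using Qk(1)[OF kmm[OF md(3)]] by simp
   have mdL: "md <= L" "md + m <= L" using md kml kmm by auto
   have half: "md - lo < 2 ^ n'" "hi - Suc md < 2 ^ n'" using k(4) n md by (auto simp: md_def)
   have lo: "Inv t' s'" if "\<not> Pk md" "t' = t2 + 6" "vars s' ''lo'' = int md + 1" "vars s' ''hi'' = int hi" "vars s' ''m0'' = int m" "vars s' ''i'' = int i"
    "vars s' ''p'' = int p" "vars s' ''w'' = int w" "arrs s' = arrs s" for t' :: nat and s' :: state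
   proof -
    have "\<not> Pk j" if "j < Suc md" for j using mono[of j md] that \<open>\<not> Pk md\<close> by auto
    then show ?thesis using that k(1,3,13) n half(2) md(2) by (intro InvI[of t' n' "Suc md" hi s']) simp_all
   qed
   have hi: "Inv t' s'" if "Pk md" "t' = t2 + 6" "vars s' ''lo'' = int lo" "vars s' ''hi'' = int md" "vars s' ''m0'' = int m" "vars s' ''i'' = int i"
    "vars s' ''p'' = int p" "vars s' ''w'' = int w" "arrs s' = arrs s" for t' :: nat and s' :: state
   proof -
    have "Pk j" if "md <= j" for j using mono[of md j] that \<open>Pk md\<close> by auto
    then show ?thesis using that k(1,12) n half(1) md by (intro InvI[of t' n' lo md s']) simp_all
   qed
   show "run ?c1 s2 (t2 + 1)
     (\<lambda>t' s'. Inv t' s' & nat (vars s' ''hi'' - vars s' ''lo'') < nat (vars s2 ''hi'' - vars s2 ''lo''))"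
   proof (cases "Pk md")
    case True
    then have "\<not> V i + Qf w md < V p + Qf w (md + m)" by (simp add: Pk_def)
    then show ?thesis using md mdL LM M16 Qk[OF mdL(1)] Qk(2)[OF mdL(2)]
     by (intro run_wp) (auto simp: k emd emm cvi intro!: hi[OF True])
   next
    case False
    then have "V i + Qf w md < V p + Qf w (md + m)" by (simp add: Pk_def)
    then show ?thesis using md mdL LM M16 Qk[OF mdL(1)] Qk(2)[OF mdL(2)]
     by (intro run_wp) (auto simp: k emd emm cvi intro!: lo[OF False])
   qed
  next
   fix t2 :: nat and s2 :: state
   assume I: "Inv t2 s2" and b: "\<not> bval Q s2 (Less ($''lo'') ($''hi''))"
   obtain n lo hi where k: "t2 + 6 * n <= t + 6 * h + 3" "lo <= hi" "hi <= km + 1" "hi - lo < 2 ^ n"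
    "vars s2 ''lo'' = int lo" "vars s2 ''hi'' = int hi" "vars s2 ''m0'' = int m" "vars s2 ''i'' = int i"
    "vars s2 ''p'' = int p" "vars s2 ''w'' = int w" "arrs s2 = arrs s" "\<forall>k<lo. \<not> Pk k" "\<forall>k. hi <= k --> k <= km --> Pk k"
    using I unfolding Inv_def by blast
   have lh: "lo = hi" using b k by simp
   have cr: "cross p i (i + w * lo)"
    unfolding cross_def pi(6)
   proof (intro conjI allI impI)
    fix \<rho> assume r: "i <= \<rho>" "\<rho> < L" "w dvd \<rho> - i"
    then obtain q where "\<rho> - i = w * q" by (meson dvdE)
    then have q: "\<rho> = i + w * q" using r by simp
    have "q <= km" unfolding km_def using q r w0 by (simp add: less_eq_div_iff_mult_less_eq mult.commute)
    then have "lo <= q \<longleftrightarrow> Pk q" using k(12,13) lh by (meson leI)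
    then show "(i + w * lo <= \<rho>) = (val p \<rho> <= val i \<rho>)" using w0 unfolding q vali valp Pk_def by simp
   qed auto
   \<comment> \<open>The result may be one step past the last index of the class, which encodes "no
     takeover"; the step is at most \<open>L\<close>.\<close>
   have "w * lo <= w * (km + 1)" using k lh by (intro mult_le_mono) auto
   then have "i + w * lo <= 2 * L" using kmL aL[of i] pi by simp
   then have "int i + int w * int lo <= 2 * int L" by (metis of_nat_add of_nat_le_iff of_nat_mult of_nat_numeral)
   then have "\<bar>int i + int w * int lo\<bar> <= M" using LM by simp
   then show "run (''x'' ::= $''i'' +. $''w'' *. $''lo'') s2 (t2 + 1) (\<lambda>t' s'. t' <= t + 7 * (h + 1) & (\<exists>r. vars s' ''x'' = int r & cross p i r))"
    using cr k(1) by (intro run_wp) (auto simp: k(5-11) intro!: exI[of _ "i + w * lo"])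
  qed auto
 qed
qed

end

definition push_com :: com where
 "push_com =
  (''p'' ::= $''bk'';; cross_com;;
  While (BAnd (BNot (Equal ($''p'') ($''f''))) (BNot (Less (Read ''tm'' ($''p'')) ($''x''))))
   ((Write ''tm'' ($''p'') (#(- 1));; ''p'' ::= Read ''pr'' ($''p''));; cross_com);;
  (Write ''tm'' ($''i'') ($''x'');; Write ''pr'' ($''i'') ($''p'');;
   Write ''nt'' ($''p'') ($''i'');; ''bk'' ::= $''i''))"

definition own_com :: com where
 "own_com = Cond (Equal (Read ''ok'' ($''i'')) (#1))
   (Write ''no'' ($''i'') (#1);; Write ''nv'' ($''i'') (Read ''cv'' ($''i''));; Write ''nf'' ($''i'') ($''i'');;
   ''f'' ::= $''i'';; ''bk'' ::= $''i'';; ''w'' ::= Read ''aa'' ($''i'');;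
   Cond (Equal ($''w'') (#0)) (''go'' ::= #0) (''go'' ::= #1))
   (Write ''no'' ($''i'') (#0);; ''go'' ::= #0)"

definition take_com :: com where
 "take_com =
   (''f'' ::= Read ''pf'' ($''i'') -. #1;; ''bk'' ::= Read ''pb'' ($''i'');; ''w'' ::= Read ''aa'' ($''f'');;
   Write ''no'' ($''i'') (#1);; Write ''nv'' ($''i'') (Read ''pv'' ($''i''));; Write ''nf'' ($''i'') ($''f'');;
   ''go'' ::= #1)"

text \<open>The waiting front is taken only if it is strictly better than an existing own entry. The
  tie goes to the own entry because only a column that already holds a copy can be discarded on
  equality.\<close>

definition row_com :: com where
 "row_com = Cond (BAnd (BNot (Equal (Read ''pf'' ($''i'')) (#0)))
    (BNot (BAnd (Equal (Read ''ok'' ($''i'')) (#1)) (BNot (Less (Read ''cv'' ($''i'')) (Read ''pv'' ($''i'')))))))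
   (take_com;; Cond (BAnd (Equal (Read ''ok'' ($''i'')) (#1)) (Equal (Read ''aa'' ($''i'')) ($''w''))) push_com Skip)
   own_com"

text \<open>\<open>f = bk\<close> recognises a one-element list, whose successor pointer is
  meaningless. In a longer list a single test of the second column updates the front.\<close>

definition emit_com :: com where
 "emit_com = Cond (Equal ($''go'') (#1))
   (''j'' ::= $''i'' +. $''w'';;
   Cond (Less ($''j'') ($''L''))
    (Cond (Equal ($''f'') ($''bk'')) Skip
     (''g'' ::= Read ''nt'' ($''f'');; Cond (Less ($''j'') (Read ''tm'' ($''g''))) Skip (''f'' ::= $''g''));;
    ''y'' ::= Query ($''w'') (($''j'' -. $''f'') \<div> $''w'');; ''y'' ::= Read ''cv'' ($''f'') +. $''y'';;
    Cond (BAnd (BNot (Equal (Read ''pf'' ($''j'')) (#0))) (BNot (Less (Read ''pv'' ($''j'')) ($''y'')))) Skip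
     (Write ''pf'' ($''j'') ($''f'' +. #1);; Write ''pb'' ($''j'') ($''bk'');; Write ''pv'' ($''j'') ($''y''))) Skip) Skip"

text \<open>Only \<open>pf\<close> and \<open>tm\<close> are reset. The other arrays may contain
  data of earlier sweeps: they are read only after \<open>pf\<close> has announced a list, or along
  the links of a list.\<close>

definition sweep_com :: com where
 "sweep_com =
  (''i'' ::= #0;;
   While (Less ($''i'') ($''L''))
    (Write ''pf'' ($''i'') (#0);; Write ''tm'' ($''i'') (#0);; ''i'' ::= $''i'' +. #1);;
   ''i'' ::= #0;;
   While (Less ($''i'') ($''L'')) (row_com;; emit_com;; ''i'' ::= $''i'' +. #1))"

context sweep
begin

text \<open>The potential of the amortised analysis. A popped column is marked by \<open>- 1\<close>
  and cannot be popped a second time.\<close>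

definition live :: "(int => int) => nat" where
 "live tm = card {j. j < L & tm (int j) \<noteq> - 1}"

lemma live_pop: "p < L ==> tm (int p) \<noteq> - 1 ==> live tm = Suc (live (tm(int p := - 1)))"
proof -
 assume p: "p < L" "tm (int p) \<noteq> - 1"
 have "{j. j < L & tm (int j) \<noteq> - 1} = insert p {j. j < L & (tm(int p := - 1)) (int j) \<noteq> - 1}" using p by auto
 then show ?thesis unfolding live_def by simp
qed

lemma live_upd: "tm (int p) \<noteq> - 1 ==> v \<noteq> - 1 ==> live (tm(int p := v)) = live tm"
 unfolding live_def by (rule arg_cong[where f = card]) auto

lemma live_le: "live tm <= L"
 unfolding live_def using card_mono[of "{..<L}" "{j. j < L & tm (int j) \<noteq> - 1}"] by auto

abbreviation "noS s \<equiv> (\<lambda>r. ar s ''no'' r = 1)"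
abbreviation "nfS s \<equiv> (\<lambda>r. nat (ar s ''nf'' r))"
abbreviation "nvS s \<equiv> (\<lambda>r. ar s ''nv'' r)"

text \<open>While columns are popped, every popped column is dominated row-wise by the remaining ones and \<open>i\<close>.\<close>

lemma push_run:
 assumes inp: "inp s" and v: "vars s ''i'' = int i" "vars s ''w'' = int w" "vars s ''f'' = int (hd ds0)" "vars s ''bk'' = int (last ds0)"
  and cc: "cc (arrs s ''nt'') (arrs s ''pr'') (arrs s ''tm'') i i w ds0"
  and i: "i < L" "ok i" "a i = w" "V i < val (hd ds0) i" "ar s ''tm'' i \<noteq> - 1"
 shows "run push_com s t (\<lambda>t' s'. t' + 12 * (h + 1) * live (arrs s' ''tm'') <= t + 12 * (h + 1) * live (arrs s ''tm'') + 14 * (h + 1) &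
   (\<exists>cs. cs \<noteq> [] & cc (arrs s' ''nt'') (arrs s' ''pr'') (arrs s' ''tm'') (Suc i) i w cs & vars s' ''f'' = int (hd cs) &
    vars s' ''bk'' = int (last cs) & i \<in> set cs &
    (\<forall>c. c \<noteq> i --> c \<notin> set ds0 --> ar s' ''nt'' c = ar s ''nt'' c & ar s' ''pr'' c = ar s ''pr'' c &
      ar s' ''tm'' c = ar s ''tm'' c) &
    (\<forall>c\<in>set ds0. \<forall>r. i < r --> r < L --> w dvd r - i --> (\<exists>c'\<in>set cs. val c r <= val c' r))))"
  (is "run _ _ _ ?post")
proof -
 let ?c3 = "(Write ''tm'' ($''p'') (#(- 1));; ''p'' ::= Read ''pr'' ($''p''))"
 let ?c2 = "(?c3;; cross_com)"
 let ?c1 = "(Write ''tm'' ($''i'') ($''x'');; Write ''pr'' ($''i'') ($''p'');; Write ''nt'' ($''p'') ($''i'');; ''bk'' ::= $''i'')"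
 define PP :: "nat => state => bool" where "PP = ?post"
 \<comment> \<open>Every pop lowers \<open>live\<close> by one, and the released
   \<open>12 * (h + 1)\<close> units pay for the next binary search.\<close>
 define J :: "nat list => nat => state => bool" where "J = (\<lambda>ds t' s'. t' + 12 * (h + 1) * live (arrs s' ''tm'') <= t + 12 * (h + 1) * live (arrs s ''tm'') + 7 * (h + 1) + 1 &
   ds \<noteq> [] & hd ds = hd ds0 & set ds \<subseteq> set ds0 & cc (arrs s ''nt'') (arrs s ''pr'') (arrs s' ''tm'') i i w ds &
   inp s' & vars s' ''i'' = int i & vars s' ''w'' = int w & vars s' ''f'' = int (hd ds0) & vars s' ''p'' = int (last ds) &
   arrs s' ''nt'' = arrs s ''nt'' & arrs s' ''pr'' = arrs s ''pr'' &
   (\<exists>r. vars s' ''x'' = int r & cross (last ds) i r) &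
   (\<forall>c. c \<notin> set ds0 --> ar s' ''tm'' c = ar s ''tm'' c) &
   (\<forall>c\<in>set ds0. \<forall>r. i < r --> r < L --> w dvd r - i --> (\<exists>c'\<in>insert i (set ds). val c r <= val c' r)))"
 define Inv :: "nat => state => bool" where "Inv = (\<lambda>t' s'. \<exists>ds. J ds t' s')"
 have el: "c < i & ok c & a c = w & w dvd i - c" if "c \<in> set ds0" for c using cc_elem[OF cc that] by simp
 have w0: "w \<noteq> 0" using cc by (simp add: cc_def)
 have ne0: "ds0 \<noteq> []" using cc by (simp add: cc_def)
 have LM': "int i <= M" using i LM by simp
 have pre: "run (''p'' ::= $''bk'') s t (\<lambda>t' s'. t' = t + 1 & arrs s' = arrs s & vars s' ''p'' = int (last ds0) & (\<forall>u. u \<noteq> ''p'' --> vars s' u = vars s u))"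
  by (rule run_wp) (use BdD(1)[of s "''bk''"] in \<open>auto simp: v\<close>)
 have crs: "run cross_com s' t' (\<lambda>t'' s''. (t'' <= t' + 7 * (h + 1) & (\<exists>r. vars s'' ''x'' = int r & cross (last ds) i r)) &
   arrs s'' = arrs s' & (\<forall>u. u \<notin> asgd cross_com --> vars s'' u = vars s' u))"
  if "inp s'" "ds \<noteq> []" "set ds \<subseteq> set ds0" "vars s' ''i'' = int i" "vars s' ''w'' = int w" "vars s' ''p'' = int (last ds)" for s' :: state and t' :: nat and ds
 proof -
  have "last ds \<in> set ds0" using that by auto
  then show ?thesis using el i w0 that
   by (intro run_conseq[OF cross_run[of s' i "last ds" w t']]) (auto simp: wrtn_cross_com)
 qed
 have stp: "run ?c2 s2 (t2 + 1)
    (\<lambda>t' s'. Inv t' s' & nat (vars s' ''p'') < nat (vars s2 ''p''))"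
  if I: "Inv t2 s2" and b: "vars s2 ''p'' \<noteq> vars s2 ''f''" "vars s2 ''x'' <= arrs s2 ''tm'' (vars s2 ''p'')" for t2 :: nat and s2 :: state
 proof -
  obtain ds where k: "t2 + 12 * (h + 1) * live (arrs s2 ''tm'') <= t + 12 * (h + 1) * live (arrs s ''tm'') + 7 * (h + 1) + 1"
   "ds \<noteq> []" "hd ds = hd ds0" "set ds \<subseteq> set ds0" "cc (arrs s ''nt'') (arrs s ''pr'') (arrs s2 ''tm'') i i w ds"
   "inp s2" "vars s2 ''i'' = int i" "vars s2 ''w'' = int w" "vars s2 ''f'' = int (hd ds0)" "vars s2 ''p'' = int (last ds)"
   "arrs s2 ''nt'' = arrs s ''nt''" "arrs s2 ''pr'' = arrs s ''pr''"
   "\<exists>r. vars s2 ''x'' = int r & cross (last ds) i r"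
   "\<forall>c. c \<notin> set ds0 --> ar s2 ''tm'' c = ar s ''tm'' c"
   "\<forall>c\<in>set ds0. \<forall>r. i < r --> r < L --> w dvd r - i --> (\<exists>c'\<in>insert i (set ds). val c r <= val c' r)"
   using I unfolding Inv_def J_def by blast
  obtain q where q: "vars s2 ''x'' = int q" "cross (last ds) i q" using k(13) by blast
  have "last ds \<noteq> hd ds" using b k by simp
  then obtain us x y where ds: "ds = us @ [x, y]"
  proof -
   assume hyp: "\<And>us x y. ds = us @ [x, y] ==> thesis"
   obtain es y where es: "ds = es @ [y]" using k(2) by (metis append_butlast_last_id)
   then have "es \<noteq> []" using \<open>last ds \<noteq> hd ds\<close> by auto
   then obtain us x where "es = us @ [x]" by (metis append_butlast_last_id)
   then show thesis using hyp es by simp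
  qed
  let ?d = "us @ [x]"
  have cy: "cc (arrs s ''nt'') (arrs s ''pr'') (arrs s2 ''tm'') i i w (us @ [x, y])" using k(5) ds by simp
  have y: "y \<in> set ds" "y < i" "y \<in> set ds0" "ar s2 ''tm'' y \<noteq> - 1" using cc_elem[OF k(5), of y] ds k(4) by auto
  have pry: "ar s ''pr'' y = int x" using cy by (simp add: cc_def lnk_snoc)
  have srt: "sorted_wrt (<) (us @ [x, y])" using cy by (simp add: cc_def)
  have xy: "x < y" "y \<notin> set ?d" using srt by (auto simp: sorted_wrt_append)
  have cd0: "cc (arrs s ''nt'') (arrs s ''pr'') (arrs s2 ''tm'') i i w ?d" using cc_prefix[of _ _ _ _ _ _ ?d "[y]"] cy by simp
  have cd: "cc (arrs s ''nt'') (arrs s ''pr'') ((arrs s2 ''tm'')(int y := - 1)) i i w ?d"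
   by (rule cc_cong[OF cd0]) (use xy in auto)
  have lv: "live (arrs s2 ''tm'') = Suc (live ((arrs s2 ''tm'')(int y := - 1)))" using live_pop y i by simp
  have cov: "\<exists>c'\<in>insert i (set ?d). val c r <= val c' r" if c: "c \<in> set ds0" "i < r" "r < L" "w dvd r - i" for c r
  proof -
   obtain c' where c': "c' \<in> insert i (set ds)" "val c r <= val c' r" using k(15) c by blast
   show ?thesis
   proof (cases "c' = y")
    case True
    have "val y r <= val x r \<or> val y r <= val i r"
     using pop_cover[OF cy, of q r] q(2) b(2) k(10) q(1) ds i c by simp
    then show ?thesis using c' True by fastforce
   qed (use c' ds in auto)
  qed
  have hdd: "hd ?d = hd ds0" using k(3) ds by (cases us) auto
  show ?thesis
  proof (rule run_SeqI[where ?P1.0 = "\<lambda>t' s'. t' = t2 + 3 & arrs s' = (arrs s2)(''tm'' := (arrs s2 ''tm'')(int y := - 1)) &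
     vars s' = (vars s2)(''p'' := int x)"])
   show "run ?c3 s2 (t2 + 1)
    (\<lambda>t' s'. t' = t2 + 3 & arrs s' = (arrs s2)(''tm'' := (arrs s2 ''tm'')(int y := - 1)) & vars s' = (vars s2)(''p'' := int x))"
    by (rule run_wp) (use M16 LM' xy y in \<open>simp add: k(10) ds k(12) pry\<close>)
  next
   fix t3 :: nat and s3 :: state
   assume a3: "t3 = t2 + 3 & arrs s3 = (arrs s2)(''tm'' := (arrs s2 ''tm'')(int y := - 1)) & vars s3 = (vars s2)(''p'' := int x)"
   have i3: "inp s3" using k(6) a3 by (simp add: inp_def)
   have sb: "set ?d \<subseteq> set ds0" using k(4) ds by auto
   show "run cross_com s3 t3 (\<lambda>t' s'. Inv t' s' & nat (vars s' ''p'') < nat (vars s2 ''p''))"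
   proof (rule run_conseq[OF crs[of s3 ?d]])
    fix t4 :: nat and s4 :: state
    assume h4: "(t4 <= t3 + 7 * (h + 1) & (\<exists>r. vars s4 ''x'' = int r & cross (last ?d) i r)) & arrs s4 = arrs s3 &
     (\<forall>u. u \<notin> asgd cross_com --> vars s4 u = vars s3 u)"
    have "J ?d t4 s4"
     unfolding J_def
    proof (intro conjI)
     show "t4 + 12 * (h + 1) * live (arrs s4 ''tm'') <= t + 12 * (h + 1) * live (arrs s ''tm'') + 7 * (h + 1) + 1"
      using h4 a3 k(1) lv by (simp add: algebra_simps)
     show "\<forall>c\<in>set ds0. \<forall>r>i. r < L --> w dvd r - i --> (\<exists>c'\<in>insert i (set ?d). val c r <= val c' r)" using cov by blast
     show "inp s4" using i3 h4 by (simp add: inp_def asgd_cross_com)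
     show "\<forall>c. c \<notin> set ds0 --> ar s4 ''tm'' c = ar s ''tm'' c" using h4 a3 k(14) y by auto
    qed (use h4 a3 k cd hdd sb in \<open>auto simp: asgd_cross_com\<close>)
    then show "Inv t4 s4 & nat (vars s4 ''p'') < nat (vars s2 ''p'')"
     using h4 a3 xy k(10) ds unfolding Inv_def by (auto simp: asgd_cross_com)
   qed (use i3 sb a3 k in auto)
  qed
 qed
 have fin: "run ?c1 s2 (t2 + 1) PP"
  if I: "Inv t2 s2" and b: "\<not> (vars s2 ''p'' \<noteq> vars s2 ''f'' & vars s2 ''x'' <= arrs s2 ''tm'' (vars s2 ''p''))" and B: "Bd M s2" for t2 :: nat and s2 :: state
 proof -
  obtain ds where k: "t2 + 12 * (h + 1) * live (arrs s2 ''tm'') <= t + 12 * (h + 1) * live (arrs s ''tm'') + 7 * (h + 1) + 1"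
   "ds \<noteq> []" "hd ds = hd ds0" "set ds \<subseteq> set ds0" "cc (arrs s ''nt'') (arrs s ''pr'') (arrs s2 ''tm'') i i w ds"
   "inp s2" "vars s2 ''i'' = int i" "vars s2 ''w'' = int w" "vars s2 ''f'' = int (hd ds0)" "vars s2 ''p'' = int (last ds)"
   "arrs s2 ''nt'' = arrs s ''nt''" "arrs s2 ''pr'' = arrs s ''pr''"
   "\<exists>r. vars s2 ''x'' = int r & cross (last ds) i r"
   "\<forall>c. c \<notin> set ds0 --> ar s2 ''tm'' c = ar s ''tm'' c"
   "\<forall>c\<in>set ds0. \<forall>r. i < r --> r < L --> w dvd r - i --> (\<exists>c'\<in>insert i (set ds). val c r <= val c' r)"
   using I unfolding Inv_def J_def by blast
  obtain q where q: "vars s2 ''x'' = int q" "cross (last ds) i q" using k(13) by blast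
  have b': "last ds = hd ds \<or> ar s2 ''tm'' (last ds) < int q" using b k q by auto
  have tlds: "tl ds = [] \<or> ar s2 ''tm'' (last ds) < int q"
  proof (cases "tl ds = []")
   case False
   have "last ds \<in> set (tl ds)" using False by (metis last_in_set last_tl)
   moreover have "sorted_wrt (<) ds" using k(5) by (simp add: cc_def)
   ultimately have "hd ds < last ds" by (cases ds) auto
   then show ?thesis using b' by simp
  qed simp
  \<comment> \<open>Against the front this holds because \<open>i\<close> is strictly worse than the
    front at \<open>i\<close> itself; otherwise because the new takeover is later than one that
    already lies after \<open>i\<close>.\<close>
  have qi: "i < q"
  proof (cases "tl ds = []")
   case True
   then have "last ds = hd ds0" using k(2,3) by (cases ds) auto
   moreover have "i <= q" using q(2) by (simp add: cross_def)
   moreover have "q \<noteq> i"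
   proof
    assume "q = i"
    then have "i <= i \<longleftrightarrow> val (last ds) i <= val i i" using q(2) i(1) unfolding cross_def by (metis diff_self_eq_0 dvd_0_right order_refl)
    moreover have "val i i = V i" by (simp add: col_val_def)
    ultimately show False using i(4) \<open>last ds = hd ds0\<close> by simp
   qed
   ultimately show ?thesis by simp
  next
   case False
   then have "last ds \<in> set (tl ds)" by (metis last_in_set last_tl)
   then have "int i < ar s2 ''tm'' (last ds)" using k(5) unfolding cc_def by blast
   then show ?thesis using tlds False by simp
  qed
  have ii: "i \<notin> set ds0" using el by auto
  have tmi: "ar s2 ''tm'' i \<noteq> - 1" using k(14) ii i by simp
  have push: "cc ((arrs s ''nt'')(int (last ds) := int i)) ((arrs s ''pr'')(int i := int (last ds))) ((arrs s2 ''tm'')(int i := int q)) (Suc i) i w (ds @ [i])"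
   using cc_push[OF k(5) i(2,3) q(2) tlds qi] .
  have lv: "live ((arrs s2 ''tm'')(int i := int q)) = live (arrs s2 ''tm'')" using live_upd tmi by simp
  have xb: "int q <= M" using BdD(1)[OF B, of "''x''"] q by simp
  have ldi0: "last ds \<in> set ds0" using k(2,4) by auto
  have ldi: "last ds < i" "last ds \<in> set ds0" using el[OF ldi0] ldi0 by auto
  have R: "PP t' s'" if "t' = t2 + 5" "arrs s' = (arrs s2)(''tm'' := (arrs s2 ''tm'')(int i := int q), ''pr'' := (arrs s ''pr'')(int i := int (last ds)),
    ''nt'' := (arrs s ''nt'')(int (last ds) := int i))" "vars s' = (vars s2)(''bk'' := int i)" for t' :: nat and s' :: state
   unfolding PP_def
  proof (intro conjI exI[of _ "ds @ [i]"])
   show "t' + 12 * (h + 1) * live (arrs s' ''tm'') <= t + 12 * (h + 1) * live (arrs s ''tm'') + 14 * (h + 1)"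
    using k(1) by (simp add: that lv algebra_simps)
   show "cc (arrs s' ''nt'') (arrs s' ''pr'') (arrs s' ''tm'') (Suc i) i w (ds @ [i])" using push by (simp add: that)
   show "\<forall>c. c \<noteq> i --> c \<notin> set ds0 --> ar s' ''nt'' c = ar s ''nt'' c & ar s' ''pr'' c = ar s ''pr'' c &
      ar s' ''tm'' c = ar s ''tm'' c" using k(14) ldi by (auto simp: that)
   show "\<forall>c\<in>set ds0. \<forall>r. i < r --> r < L --> w dvd r - i --> (\<exists>c'\<in>set (ds @ [i]). val c r <= val c' r)" using k(15) by simp
  qed (use k in \<open>simp_all add: that\<close>)
  have "int (last ds) <= M" using ldi LM' by simp
  then show ?thesis using LM' xb
   by (intro run_wp) (simp add: k(7-12) q(1), rule R, simp_all add: fun_upd_twist k(11,12))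
 qed
 show ?thesis
  unfolding push_com_def PP_def[symmetric]
 proof (rule run_SeqI[OF pre])
  fix t1 :: nat and s1 :: state
  assume a1: "t1 = t + 1 & arrs s1 = arrs s & vars s1 ''p'' = int (last ds0) & (\<forall>u. u \<noteq> ''p'' --> vars s1 u = vars s u)"
  have i1: "inp s1" using inp a1 by (simp add: inp_def)
  show "run (cross_com;; While (BAnd (BNot (Equal ($''p'') ($''f''))) (BNot (Less (Read ''tm'' ($''p'')) ($''x''))))
   ?c2;;
  ?c1) s1 t1 PP"
  proof (rule run_SeqI[OF crs[of s1 ds0]])
   fix t2 :: nat and s2 :: state
   assume a2: "(t2 <= t1 + 7 * (h + 1) & (\<exists>r. vars s2 ''x'' = int r & cross (last ds0) i r)) & arrs s2 = arrs s1 &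
     (\<forall>u. u \<notin> asgd cross_com --> vars s2 u = vars s1 u)"
   have i2: "inp s2" using i1 a2 by (simp add: inp_def asgd_cross_com)
   have "J ds0 t2 s2" unfolding J_def using a1 a2 i2 cc ne0 v by (auto simp: asgd_cross_com)
   then have I2: "Inv t2 s2" unfolding Inv_def by blast
   show "run (While (BAnd (BNot (Equal ($''p'') ($''f''))) (BNot (Less (Read ''tm'' ($''p'')) ($''x''))))
   ?c2;;
  ?c1) s2 t2 PP"
    apply (rule run_Seq, rule run_While[where Inv = Inv and \<mu> = "\<lambda>s. nat (vars s ''p'')", OF _ _ I2])
    subgoal by simp
    subgoal by simp
    subgoal for t s by (rule stp[of t s]) simp_all
    subgoal for t s by (rule fin[of t s]) (simp_all add: not_le)
    done
  qed (use i1 ne0 a1 v in auto)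
 qed
qed

end

context sweep
begin

abbreviation "MidS s i C cs \<equiv> Mid (arrs s ''nt'') (arrs s ''pr'') (arrs s ''tm'') (arrs s ''pf'') (arrs s ''pb'') (arrs s ''pv'')
  (noS s) (nfS s) (nvS s) i C cs"
abbreviation "SInvS s i C \<equiv> SInv (arrs s ''nt'') (arrs s ''pr'') (arrs s ''tm'') (arrs s ''pf'') (arrs s ''pb'') (arrs s ''pv'')
  (noS s) (nfS s) (nvS s) i C"

definition rowpost :: "state => nat => nat => (nat => nat list) => nat => state => bool" where
 "rowpost s t i C t' s' \<longleftrightarrow> t' + 12 * (h + 1) * live (arrs s' ''tm'') <= t + 12 * (h + 1) * live (arrs s ''tm'') + 14 * (h + 1) + 12 &
   (\<forall>j>i. ar s' ''tm'' j = ar s ''tm'' j) &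
   (\<exists>cs. MidS s' i C cs & vars s' ''go'' = (if cs = [] then 0 else 1) &
    (cs \<noteq> [] --> vars s' ''f'' = int (hd cs) & vars s' ''bk'' = int (last cs) & vars s' ''w'' = int (a (hd cs))))"

lemma own_run:
 assumes inp: "inp s" and v: "vars s ''i'' = int i" and i: "i < L" and S: "SInvS s i C"
  and tm: "ar s ''tm'' i \<noteq> - 1"
  and own: "C i = [] \<or> ok i & val (hd (C i)) i <= V i"
 shows "run own_com s (t + 1) (rowpost s t i C)"
proof -
 let ?c1 = "(Cond (Equal (Read ''ok'' ($''i'')) (#1)) (Write ''no'' ($''i'') (#1);; Write ''nv'' ($''i'') (Read ''cv'' ($''i''));; Write ''nf'' ($''i'') ($''i'');; ''f'' ::= $''i'';; ''bk'' ::= $''i'';; ''w'' ::= Read ''aa'' ($''i'');; Cond (Equal ($''w'') (#0)) (''go'' ::= #0) (''go'' ::= #1)) (Write ''no'' ($''i'') (#0);; ''go'' ::= #0))"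
 have e: "ar s ''ok'' i = (if ok i then 1 else 0)" "ar s ''cv'' i = V i" "ar s ''aa'' i = int (a i)"
  using inp i by (auto simp: inp_def)
 have iM: "int i <= M" using i LM by simp
 show ?thesis
 proof (cases "ok i")
  case True
  have vi: "val i i = V i" by (simp add: col_val_def)
  define cs where "cs = (if a i = 0 then [] else [i])"
  have mid: "Mid (arrs s ''nt'') (arrs s ''pr'') (arrs s ''tm'') (arrs s ''pf'') (arrs s ''pb'') (arrs s ''pv'')
    ((noS s)(i := True)) ((nfS s)(i := i)) ((nvS s)(i := V i)) i C cs"
   by (rule to_mid[OF S i refl refl refl])
    (use True own vi cc_single[of i "arrs s ''tm''"] tm in \<open>auto simp: cs_def\<close>)
  have aM: "int (a i) <= M" using aL[OF i True] LM by simp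
  have R: "rowpost s t i C t' s'" if "t' <= t + 12" "arrs s' = (arrs s)(''no'' := (arrs s ''no'')(int i := 1), ''nv'' := (arrs s ''nv'')(int i := V i), ''nf'' := (arrs s ''nf'')(int i := int i))"
   "vars s' ''go'' = (if a i = 0 then 0 else 1)" "vars s' ''f'' = int i" "vars s' ''bk'' = int i" "vars s' ''w'' = int (a i)" for t' :: nat and s' :: state
   unfolding rowpost_def
  proof (intro conjI exI[of _ cs])
   have "noS s' = (noS s)(i := True)" "nfS s' = (nfS s)(i := i)" "nvS s' = (nvS s)(i := V i)"
    by (auto simp: that(2) fun_eq_iff)
   then show "MidS s' i C cs" using mid by (simp add: that(2))
  qed (use that in \<open>auto simp: cs_def\<close>)
  show ?thesis unfolding own_com_def
  proof (cases "a i = 0")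
   case T: True
   show "run ?c1 s (t + 1) (rowpost s t i C)"
    using iM M16 BdD(2)[of s "''cv''" "int i"] T by (intro run_wp) (simp add: v e True, rule R, simp_all)
  next
   case F: False
   show "run ?c1 s (t + 1) (rowpost s t i C)"
    using iM aM M16 BdD(2)[of s "''cv''" "int i"] F by (intro run_wp) (simp add: v e True, rule R, simp_all)
  qed
 next
  case False
  have mid: "Mid (arrs s ''nt'') (arrs s ''pr'') (arrs s ''tm'') (arrs s ''pf'') (arrs s ''pb'') (arrs s ''pv'')
    ((noS s)(i := False)) ((nfS s)(i := nfS s i)) ((nvS s)(i := nvS s i)) i C []"
   by (rule to_mid[OF S i refl refl refl]) (use False own in auto)
  have R: "rowpost s t i C t' s'" if "t' <= t + 12" "arrs s' = (arrs s)(''no'' := (arrs s ''no'')(int i := 0))"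
   "vars s' ''go'' = 0" for t' :: nat and s' :: state
   unfolding rowpost_def
  proof (intro conjI exI[of _ "[]"])
   have "noS s' = (noS s)(i := False)" "nfS s' = (nfS s)(i := nfS s i)" "nvS s' = (nvS s)(i := nvS s i)"
    by (auto simp: that(2) fun_eq_iff)
   then show "MidS s' i C []" using mid by (simp add: that(2))
  qed (use that in auto)
  show ?thesis unfolding own_com_def
   using M16 by (intro run_wp) (simp add: v e False, rule R, simp_all)
 qed
qed

lemma row_run:
 assumes inp: "inp s" and v: "vars s ''i'' = int i" and i: "i < L" and S: "SInvS s i C"
  and tm: "ar s ''tm'' i \<noteq> - 1"
 shows "run row_com s t (rowpost s t i C)"
proof -
 have e: "ar s ''ok'' i = (if ok i then 1 else 0)" "ar s ''cv'' i = V i" "ar s ''aa'' i = int (a i)"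
  using inp i by (auto simp: inp_def)
 have P: "pend (arrs s ''nt'') (arrs s ''pr'') (arrs s ''tm'') (arrs s ''pf'') (arrs s ''pb'') (arrs s ''pv'') i i i (C i)"
  using S i by (simp add: SInv_def)
 have iM: "int i <= M" using i LM by simp
 show ?thesis
  unfolding row_com_def
 proof (rule run_Cond, simp, simp)
  assume "\<not> bval Q s (BAnd (BNot (Equal (Read ''pf'' ($''i'')) (#0)))
    (BNot (BAnd (Equal (Read ''ok'' ($''i'')) (#1)) (BNot (Less (Read ''cv'' ($''i'')) (Read ''pv'' ($''i'')))))))"
  then have "C i = [] \<or> ok i & val (hd (C i)) i <= V i" using P by (auto simp: v e pend_def split: if_splits)
  then show "run own_com s (t + 1) (rowpost s t i C)" using own_run assms by blast
 next
  assume "bval Q s (BAnd (BNot (Equal (Read ''pf'' ($''i'')) (#0)))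
    (BNot (BAnd (Equal (Read ''ok'' ($''i'')) (#1)) (BNot (Less (Read ''cv'' ($''i'')) (Read ''pv'' ($''i'')))))))"
  then have ne: "C i \<noteq> []" and less: "ok i --> V i < val (hd (C i)) i"
   using P by (auto simp: v e pend_def split: if_splits)
  define w where "w = a (hd (C i))"
  have p: "ar s ''pf'' i = int (hd (C i)) + 1" "ar s ''pb'' i = int (last (C i))" "ar s ''pv'' i = val (hd (C i)) i"
   "cc (arrs s ''nt'') (arrs s ''pr'') (arrs s ''tm'') i i w (C i)"
   using P ne by (auto simp: pend_def w_def)
  have hC: "hd (C i) \<in> set (C i)" "last (C i) \<in> set (C i)" using ne by auto
  note hd_el = cc_elem[OF p(4) hC(1)]
  have hL: "hd (C i) < L" using hd_el i by simp
  have eh: "ar s ''aa'' (hd (C i)) = int w" using inp hL by (simp add: inp_def w_def)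
  have lM: "int (last (C i)) <= M" "int (hd (C i)) <= M" using cc_elem(1)[OF p(4) hC(2)] hd_el iM by auto
  have w0: "w \<noteq> 0" using p(4) by (simp add: cc_def)
  have wM: "int w <= M" using aL[OF hL hd_el(2)] hd_el(3) LM by simp
  define A where "A = (arrs s)(''no'' := (arrs s ''no'')(int i := 1), ''nv'' := (arrs s ''nv'')(int i := val (hd (C i)) i),
   ''nf'' := (arrs s ''nf'')(int i := int (hd (C i))))"
  have midI: "Mid nt' pr' tm' (arrs s ''pf'') (arrs s ''pb'') (arrs s ''pv'')
    ((noS s)(i := True)) ((nfS s)(i := hd (C i))) ((nvS s)(i := val (hd (C i)) i)) i C cs"
   if "cs \<noteq> []" "cc nt' pr' tm' (Suc i) i w cs" 
    "\<And>c. c \<noteq> i ==> c \<notin> set (C i) ==> nt' (int c) = ar s ''nt'' c & pr' (int c) = ar s ''pr'' c & tm' (int c) = ar s ''tm'' c"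
    "ok i --> a i = w --> i \<in> set cs"
    "\<forall>c\<in>set (C i). \<forall>r. i < r --> r < L --> w dvd r - i --> (\<exists>c'\<in>set cs. val c r <= val c' r)" for nt' pr' tm' cs
  proof -
   have ah: "a (hd cs) = w" using cc_elem(3)[OF that(2), of "hd cs"] that(1) by simp
   show ?thesis
    by (rule to_mid[OF S i refl refl refl])
     (use that ah hd_el less ne w0 in \<open>auto simp: w_def[symmetric]\<close>)
  qed
  have take: "run take_com s (t + 1) (\<lambda>t' s'. t' = t + 8 & arrs s' = A & vars s' = (vars s)(''f'' := int (hd (C i)), ''bk'' := int (last (C i)), ''w'' := int w, ''go'' := 1))"
   unfolding take_com_def using M16 lM wM BdD(2)[of s "''pv''" "int i"] iM
   by (intro run_wp) (simp add: v p(1-3) eh A_def fun_upd_twist)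
  show "run (take_com;; Cond (BAnd (Equal (Read ''ok'' ($''i'')) (#1)) (Equal (Read ''aa'' ($''i'')) ($''w''))) push_com Skip) s (t + 1) (rowpost s t i C)"
  proof (rule run_SeqI[OF take])
   fix t1 :: nat and s1 :: state
   assume a1: "t1 = t + 8 & arrs s1 = A & vars s1 = (vars s)(''f'' := int (hd (C i)), ''bk'' := int (last (C i)), ''w'' := int w, ''go'' := 1)"
   have A1: "arrs s1 ''nt'' = arrs s ''nt''" "arrs s1 ''pr'' = arrs s ''pr''" "arrs s1 ''tm'' = arrs s ''tm''" "arrs s1 ''pf'' = arrs s ''pf''"
    "arrs s1 ''pb'' = arrs s ''pb''" "arrs s1 ''pv'' = arrs s ''pv''" "arrs s1 ''ok'' = arrs s ''ok''" "arrs s1 ''cv'' = arrs s ''cv''" "arrs s1 ''aa'' = arrs s ''aa''"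
    using a1 by (simp_all add: A_def)
   have v1: "vars s1 ''i'' = int i" "vars s1 ''w'' = int w" "vars s1 ''f'' = int (hd (C i))" "vars s1 ''bk'' = int (last (C i))" "vars s1 ''L'' = vars s ''L''"
    "vars s1 ''go'' = 1"
    using a1 v by simp_all
   have i1: "inp s1" using inp A1 v1 by (simp add: inp_def)
   have nn: "noS s1 = (noS s)(i := True)" "nfS s1 = (nfS s)(i := hd (C i))" "nvS s1 = (nvS s)(i := val (hd (C i)) i)"
    using a1 by (auto simp: A_def fun_eq_iff)
   show "run (Cond (BAnd (Equal (Read ''ok'' ($''i'')) (#1)) (Equal (Read ''aa'' ($''i'')) ($''w''))) push_com Skip) s1 t1 (rowpost s t i C)"
   proof (rule run_Cond, simp, simp)
    assume "\<not> bval Q s1 (BAnd (Equal (Read ''ok'' ($''i'')) (#1)) (Equal (Read ''aa'' ($''i'')) ($''w'')))"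
    then have no: "\<not> (ok i & a i = w)" by (auto simp: A1 v1 e)
    have c': "cc (arrs s ''nt'') (arrs s ''pr'') (arrs s ''tm'') (Suc i) i w (C i)" by (rule cc_cong[OF p(4)]) auto
    have "MidS s1 i C (C i)" unfolding A1 nn by (rule midI[OF ne c']) (use no in auto)
    then show "run Skip s1 (t1 + 1) (rowpost s t i C)"
     using ne a1 v1 by (intro run_Skip) (auto simp: rowpost_def A1 w_def)
   next
    assume "bval Q s1 (BAnd (Equal (Read ''ok'' ($''i'')) (#1)) (Equal (Read ''aa'' ($''i'')) ($''w'')))"
    then have yes: "ok i" "a i = w" by (auto simp: A1 v1 e split: if_splits)
    have psh: "run push_com s1 (t1 + 1) (\<lambda>t' s'. t' + 12 * (h + 1) * live (arrs s' ''tm'') <= t1 + 1 + 12 * (h + 1) * live (arrs s1 ''tm'') + 14 * (h + 1) &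
   (\<exists>cs. cs \<noteq> [] & cc (arrs s' ''nt'') (arrs s' ''pr'') (arrs s' ''tm'') (Suc i) i w cs & vars s' ''f'' = int (hd cs) &
    vars s' ''bk'' = int (last cs) & i \<in> set cs &
    (\<forall>c. c \<noteq> i --> c \<notin> set (C i) --> ar s' ''nt'' c = ar s1 ''nt'' c & ar s' ''pr'' c = ar s1 ''pr'' c &
      ar s' ''tm'' c = ar s1 ''tm'' c) &
    (\<forall>c\<in>set (C i). \<forall>r. i < r --> r < L --> w dvd r - i --> (\<exists>c'\<in>set cs. val c r <= val c' r))))"
     by (rule push_run[OF i1 v1(1-4)]) (use p(4) A1 i yes less tm in simp_all)
    show "run push_com s1 (t1 + 1) (rowpost s t i C)"
    proof (rule run_conseq[OF psh])
     fix t2 :: nat and s2 :: state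
     assume post: "t2 + 12 * (h + 1) * live (arrs s2 ''tm'') <= t1 + 1 + 12 * (h + 1) * live (arrs s1 ''tm'') + 14 * (h + 1) &
   (\<exists>cs. cs \<noteq> [] & cc (arrs s2 ''nt'') (arrs s2 ''pr'') (arrs s2 ''tm'') (Suc i) i w cs & vars s2 ''f'' = int (hd cs) &
    vars s2 ''bk'' = int (last cs) & i \<in> set cs &
    (\<forall>c. c \<noteq> i --> c \<notin> set (C i) --> ar s2 ''nt'' c = ar s1 ''nt'' c & ar s2 ''pr'' c = ar s1 ''pr'' c &
      ar s2 ''tm'' c = ar s1 ''tm'' c) &
    (\<forall>c\<in>set (C i). \<forall>r. i < r --> r < L --> w dvd r - i --> (\<exists>c'\<in>set cs. val c r <= val c' r)))"
      and fv: "\<And>v. v \<notin> asgd push_com ==> vars s2 v = vars s1 v" and fa: "\<And>a. a \<notin> wrtn push_com ==> arrs s2 a = arrs s1 a"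
     obtain cs where cs: "cs \<noteq> []" "cc (arrs s2 ''nt'') (arrs s2 ''pr'') (arrs s2 ''tm'') (Suc i) i w cs" "vars s2 ''f'' = int (hd cs)"
       "vars s2 ''bk'' = int (last cs)" "i \<in> set cs"
       "\<forall>c. c \<noteq> i --> c \<notin> set (C i) --> ar s2 ''nt'' c = ar s1 ''nt'' c & ar s2 ''pr'' c = ar s1 ''pr'' c &
        ar s2 ''tm'' c = ar s1 ''tm'' c"
       "\<forall>c\<in>set (C i). \<forall>r. i < r --> r < L --> w dvd r - i --> (\<exists>c'\<in>set cs. val c r <= val c' r)"
      using post by blast
     have f2: "arrs s2 ''pf'' = arrs s ''pf''" "arrs s2 ''pb'' = arrs s ''pb''" "arrs s2 ''pv'' = arrs s ''pv''" "arrs s2 ''no'' = arrs s1 ''no''"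
       "arrs s2 ''nf'' = arrs s1 ''nf''" "arrs s2 ''nv'' = arrs s1 ''nv''"
      using fa A1 by (simp_all add: push_com_def wrtn_cross_com)
     have g2: "vars s2 ''go'' = 1" "vars s2 ''w'' = int w" using fv v1 by (simp_all add: push_com_def asgd_cross_com)
     have "MidS s2 i C cs" unfolding f2 nn by (rule midI[OF cs(1,2)]) (use cs A1 in auto)
     moreover have "a (hd cs) = w" using cc_elem(3)[OF cs(2), of "hd cs"] cs(1) by simp
     moreover have "ar s2 ''tm'' j = ar s ''tm'' j" if "j > i" for j
     proof -
      have "j \<notin> set (C i)" using cc_elem(1)[OF p(4), of j] that by auto
      then show ?thesis using cs(6) that A1 by auto
     qed
     moreover have "t2 + 12 * (h + 1) * live (arrs s2 ''tm'') <= t + 12 * (h + 1) * live (arrs s ''tm'') + 14 * (h + 1) + 12"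
      using post a1 A1 by simp
     ultimately show "rowpost s t i C t2 s2" unfolding rowpost_def using cs(1,3,4) g2
      by (intro conjI exI[of _ cs]) simp_all
    qed
   qed
  qed
 qed
qed

lemma emit_run:
 assumes inp: "inp s" and v: "vars s ''i'' = int i" and i: "i < L" and Md: "MidS s i C cs"
  and go: "vars s ''go'' = (if cs = [] then 0 else 1)"
  and fb: "cs \<noteq> [] --> vars s ''f'' = int (hd cs) & vars s ''bk'' = int (last cs) & vars s ''w'' = int (a (hd cs))"
 shows "run emit_com s t (\<lambda>t' s'. t' <= t + 16 & (\<exists>C'. SInvS s' (Suc i) C'))"
proof (cases "cs = []")
 case True
 have "SInvS s (Suc i) C" by (rule Mid_emit[OF Md i]) (simp add: True)
 then show ?thesis unfolding emit_com_def using go True M16 by (intro run_wp) (auto)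
next
 case ne: False
 define w where "w = a (hd cs)"
 define j where "j = i + w"
 have c: "cc (arrs s ''nt'') (arrs s ''pr'') (arrs s ''tm'') (Suc i) i w cs" using Md ne by (simp add: Mid_def w_def)
 have w0: "w > 0" using c by (simp add: cc_def)
 have vL: "vars s ''L'' = int L" using inp by (simp add: inp_def)
 have hd_in: "hd cs \<in> set cs" "last cs \<in> set cs" using ne by auto
 note hd_el = cc_elem[OF c hd_in(1)] and last_el = cc_elem[OF c hd_in(2)]
 have hL: "hd cs < L" using hd_el i by simp
 have wL: "w <= L" using aL[OF hL hd_el(2)] hd_el(3) by simp
 have vs: "vars s ''f'' = int (hd cs)" "vars s ''bk'' = int (last cs)" "vars s ''w'' = int w" "vars s ''go'' = 1"
  using fb ne go by (auto simp: w_def)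
 have jj: "int i + int w = int j" by (simp add: j_def)
 have jM: "int j <= M" using i wL LM by (simp add: j_def)
 show ?thesis
 proof (cases "j < L")
  case False
  have "SInvS s (Suc i) C" by (rule Mid_emit[OF Md i]) (use False in \<open>simp add: j_def w_def\<close>)
  then show ?thesis unfolding emit_com_def using False M16 jM by (intro run_wp) (simp add: v vs vL jj, blast)
 next
  case jl: True
  define cs' where "cs' = (if tl cs \<noteq> [] & ar s ''tm'' (hd (tl cs)) <= int j then tl cs else cs)"
  note adv = cc_advance[OF c j_def jl cs'_def]
  have ne': "cs' \<noteq> []" using adv(1) by (simp add: cc_def)
  define f where "f = hd cs'"
  note f_el = cc_elem[OF adv(1), of f, unfolded f_def, OF hd_in_set[OF ne'], folded f_def]
  have fL: "f < L" using f_el i by simp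
  define k where "k = (j - f) div w"
  have kL: "k <= L" using div_le_dividend[of "j - f" w] jl unfolding k_def by linarith
  have q: "Q (int w) (int k) = Qf w k" "\<bar>Qf w k\<bar> <= M" using QQ[OF fL f_el(2) _ kL] f_el(3) w0 by auto
  have ek: "(int j - int f) div int w = int k" using f_el(4) by (simp add: k_def zdiv_int of_nat_diff)
  have vf: "val f j = V f + Qf w k" using val_eq[OF fL f_el(2)] f_el(3) w0 by (simp add: k_def)
  have vM: "\<bar>V f + Qf w k\<bar> <= M" using valM[OF fL f_el(2) _ f_el(4) jl] f_el w0 vf by simp
  have cvf: "ar s ''cv'' f = V f" using inp fL by (simp add: inp_def)
  have P: "pend (arrs s ''nt'') (arrs s ''pr'') (arrs s ''tm'') (arrs s ''pf'') (arrs s ''pb'') (arrs s ''pv'') (Suc i) i j (C j)"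
   using Md jl w0 by (simp add: Mid_def j_def)
  have bet: "(ar s ''pf'' j \<noteq> 0 & \<not> ar s ''pv'' j < V f + Qf w k) \<longleftrightarrow> \<not> (C j = [] \<or> val (hd (C j)) j < val f j)"
   using P vf by (auto simp: pend_def split: if_splits)
  have fM: "int f + 1 <= M" "int (last cs) <= M" using fL last_el i LM by auto
  define PP :: "nat => state => bool" where "PP = (\<lambda>t' s'. t' <= t + 16 & (\<exists>C'. SInvS s' (Suc i) C'))"
  have R1: "PP t' s'" if "C j = [] \<or> val (hd (C j)) j < val f j"
   "arrs s' = (arrs s)(''pf'' := (arrs s ''pf'')(int j := int f + 1), ''pb'' := (arrs s ''pb'')(int j := int (last cs)), ''pv'' := (arrs s ''pv'')(int j := V f + Qf w k))" "t' <= t + 16" for s' :: state and t'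
  proof -
   have "SInv (arrs s ''nt'') (arrs s ''pr'') (arrs s ''tm'') ((arrs s ''pf'')(int j := int f + 1)) ((arrs s ''pb'')(int j := int (last cs)))
     ((arrs s ''pv'')(int j := V f + Qf w k)) (noS s) (nfS s) (nvS s) (Suc i) (C(j := cs'))"
    by (rule Mid_emit[OF Md i]) (use that(1) jl ne in \<open>simp add: w_def[symmetric] j_def[symmetric] cs'_def[symmetric] f_def[symmetric] vf Let_def\<close>)
   then show ?thesis using that(3) unfolding PP_def that(2) by (intro conjI exI[of _ "C(j := cs')"]) simp_all
  qed
  have R2: "PP t' s'" if n: "\<not> (C j = [] \<or> val (hd (C j)) j < val f j)" and s': "arrs s' = arrs s" "t' <= t + 16" for s' :: state and t'
  proof -
   have "SInvS s (Suc i) C"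
    by (rule Mid_emit[OF Md i]) (use n jl ne in \<open>simp add: w_def[symmetric] j_def[symmetric] cs'_def[symmetric] f_def[symmetric] vf Let_def\<close>)
   then show ?thesis using s' unfolding PP_def by auto
  qed
  have blk1: "run (Cond (Equal ($''f'') ($''bk'')) Skip
     (''g'' ::= Read ''nt'' ($''f'');; Cond (Less ($''j'') (Read ''tm'' ($''g''))) Skip (''f'' ::= $''g''))) s1 t1
    (\<lambda>t' s'. t' <= t1 + 4 & arrs s' = arrs s & vars s' ''f'' = int f & (\<forall>u. u \<noteq> ''f'' --> u \<noteq> ''g'' --> vars s' u = vars s1 u))"
   if "arrs s1 = arrs s" "vars s1 ''f'' = int (hd cs)" "vars s1 ''bk'' = int (last cs)" "vars s1 ''j'' = int j" for s1 :: state and t1 :: nat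
  proof (cases "tl cs = []")
   case True
   then have "hd cs = last cs" "f = hd cs" using ne by (cases cs; simp add: f_def cs'_def)+
   then show ?thesis using that by (intro run_wp) simp
  next
   case False
   obtain y z zs where yz: "cs = y # z # zs" using False ne by (cases cs; cases "tl cs") auto
   have ntf: "ar s ''nt'' y = int z" using c yz by (simp add: cc_def)
   have "sorted_wrt (<) cs" using c by (simp add: cc_def)
   then have nl: "y \<noteq> last cs" using yz by (metis last.simps last_in_set list.distinct(1) list.set_intros(1) nat_neq_iff sorted_wrt.simps(2))
   have zM: "int z <= M" using cc_elem(1)[OF c, of z] yz i LM by simp
   show ?thesis
   proof (cases "ar s ''tm'' z <= int j")
    case T: True
    then have "f = z" using yz by (simp add: f_def cs'_def)
    then show ?thesis using that T nl zM yz by (intro run_wp) (simp add: ntf)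
   next
    case F: False
    then have "f = y" using yz by (simp add: f_def cs'_def)
    then show ?thesis using that F nl zM yz by (intro run_wp) (simp add: ntf)
   qed
  qed
  show ?thesis unfolding emit_com_def PP_def[symmetric]
  proof (rule run_Cond, simp, simp, rule run_SeqI[where ?P1.0 = "\<lambda>t' s'. t' = t + 2 & arrs s' = arrs s & vars s' = (vars s)(''j'' := int j)"])
   show "run (''j'' ::= $''i'' +. $''w'') s (t + 1) (\<lambda>t' s'. t' = t + 2 & arrs s' = arrs s & vars s' = (vars s)(''j'' := int j))"
    using jM by (intro run_wp) (simp add: v vs jj)
  next
   fix t1 :: nat and s1 :: state
   assume a1: "t1 = t + 2 & arrs s1 = arrs s & vars s1 = (vars s)(''j'' := int j)"
   show "run (Cond (Less ($''j'') ($''L''))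
    (Cond (Equal ($''f'') ($''bk'')) Skip
     (''g'' ::= Read ''nt'' ($''f'');; Cond (Less ($''j'') (Read ''tm'' ($''g''))) Skip (''f'' ::= $''g''));;
    ''y'' ::= Query ($''w'') (($''j'' -. $''f'') \<div> $''w'');; ''y'' ::= Read ''cv'' ($''f'') +. $''y'';;
    Cond (BAnd (BNot (Equal (Read ''pf'' ($''j'')) (#0))) (BNot (Less (Read ''pv'' ($''j'')) ($''y'')))) Skip
     (Write ''pf'' ($''j'') ($''f'' +. #1);; Write ''pb'' ($''j'') ($''bk'');; Write ''pv'' ($''j'') ($''y''))) Skip) s1 t1
     PP"
   proof (rule run_Cond, simp, simp, rule run_SeqI[OF blk1])
    fix t2 :: nat and s2 :: state
    assume a2: "t2 <= t1 + 1 + 4 & arrs s2 = arrs s & vars s2 ''f'' = int f & (\<forall>u. u \<noteq> ''f'' --> u \<noteq> ''g'' --> vars s2 u = vars s1 u)"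
    have v2: "vars s2 ''w'' = int w" "vars s2 ''j'' = int j" "vars s2 ''f'' = int f" "vars s2 ''bk'' = int (last cs)" using a1 a2 vs by simp_all
    show "run (''y'' ::= Query ($''w'') (($''j'' -. $''f'') \<div> $''w'');; ''y'' ::= Read ''cv'' ($''f'') +. $''y'';;
    Cond (BAnd (BNot (Equal (Read ''pf'' ($''j'')) (#0))) (BNot (Less (Read ''pv'' ($''j'')) ($''y'')))) Skip
     (Write ''pf'' ($''j'') ($''f'' +. #1);; Write ''pb'' ($''j'') ($''bk'');; Write ''pv'' ($''j'') ($''y''))) s2 t2
     PP"
    proof (cases "C j = [] \<or> val (hd (C j)) j < val f j")
     case True
     then have b: "ar s ''pf'' j = 0 \<or> ar s ''pv'' j < V f + Qf w k" using bet by blast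
     from b show ?thesis
     proof (elim disjE)
      assume "ar s ''pf'' j = 0"
      then show ?thesis using a1 a2 q vM fM
       by (intro run_wp) (simp add: v2 ek cvf, rule R1[OF True], simp_all add: fun_upd_twist)
     next
      assume "ar s ''pv'' j < V f + Qf w k"
      then show ?thesis using a1 a2 q vM fM
       by (intro run_wp) (simp add: v2 ek cvf, rule R1[OF True], simp_all add: fun_upd_twist)
     qed
    next
     case False
     then have b: "ar s ''pf'' j \<noteq> 0 & \<not> ar s ''pv'' j < V f + Qf w k" using bet by blast
     show ?thesis using a1 a2 b q vM
      by (intro run_wp) (simp add: v2 ek cvf, rule R2[OF False], simp_all)
    qed
   qed (use a1 jl vs vL in simp_all)
  qed (use vs in simp)
 qed
qed

text \<open>Each row is charged \<open>14 * (h + 1) + 30\<close> units, and its pops are paid from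
  the potential. The potential starts with at most \<open>L\<close> columns worth
  \<open>12 * (h + 1)\<close> each, so the whole sweep is linear up to the factor
  \<open>h + 1\<close>.\<close>

lemma sweep_run:
 assumes inp: "inp s"
 shows "run sweep_com s t (\<lambda>t' s'. t' <= t + 100 * (h + 1) * (L + 1) &
   sweep_spec L ok V a Qf (noS s') (nfS s') (nvS s'))"
  (is "run _ _ _ ?post")
proof -
 let ?c2 = "(While (Less ($''i'') ($''L'')) (row_com;; emit_com;; ''i'' ::= $''i'' +. #1))"
 let ?c1 = "(Write ''pf'' ($''i'') (#0);; Write ''tm'' ($''i'') (#0);; ''i'' ::= $''i'' +. #1)"
 have vL: "vars s ''L'' = int L" using inp by (simp add: inp_def)
 have A: "run (''i'' ::= #0) s' t' (\<lambda>t'' s''. t'' = t' + 1 & arrs s'' = arrs s' & vars s'' = (vars s')(''i'' := 0))" for s' t'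
  using M16 by (intro run_wp) simp
 define J1 :: "nat => nat => state => bool" where "J1 = (\<lambda>k t' s'. t' <= t + 1 + 4 * k & vars s' ''i'' = int k & inp s' &
   (\<forall>j<k. ar s' ''pf'' j = 0 & ar s' ''tm'' j = 0))"
 define J2 :: "nat => nat => state => bool" where "J2 = (\<lambda>k t' s'. t' + 12 * (h + 1) * live (arrs s' ''tm'') <= t + 4 * L + 3 + 12 * (h + 1) * L + (14 * (h + 1) + 30) * k &
   vars s' ''i'' = int k & inp s' & (\<exists>C. SInvS s' k C) & (\<forall>j\<ge>k. j < L --> ar s' ''tm'' j \<noteq> - 1))"
 have kM: "int k + 1 <= M" if "k < L" for k using that LM by simp
 have inp_L: "inp s' ==> vars s' ''L'' = int L" for s' by (simp add: inp_def)
 have inp_fr: "inp s''" if "inp s'" "vars s'' ''L'' = vars s' ''L''" "arrs s'' ''ok'' = arrs s' ''ok''" "arrs s'' ''cv'' = arrs s' ''cv''" "arrs s'' ''aa'' = arrs s' ''aa''" for s' s''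
  using that by (simp add: inp_def)
 have W1: "run (While (Less ($''i'') ($''L''))
    ?c1) s1 t1
    (\<lambda>t' s'. J1 L (t' - 1) s' & t' \<ge> 1)" if "J1 0 t1 s1" for s1 :: state and t1 :: nat
 proof (rule run_for[where Inv = J1 and n = L, OF _ _ that])
  fix k t2 :: nat and s2 :: state
  assume k: "k < L" and I: "J1 k t2 s2"
  have R: "J1 (Suc k) t3 s3" if "t3 = t2 + 4" "arrs s3 = (arrs s2)(''pf'' := (arrs s2 ''pf'')(int k := 0), ''tm'' := (arrs s2 ''tm'')(int k := 0))"
   "vars s3 = (vars s2)(''i'' := int k + 1)" for s3 :: state and t3
  proof -
   have "inp s3" by (rule inp_fr[of s2]) (use I that in \<open>simp_all add: J1_def\<close>)
   then show ?thesis using I by (auto simp: J1_def that less_Suc_eq)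
  qed
  have "run ?c1 s2 (t2 + 1) (J1 (Suc k))"
  proof -
   have "vars s2 ''i'' = int k" using I by (simp add: J1_def)
   then show ?thesis using kM[OF k] M16 by (intro run_wp) (simp, rule R, simp_all)
  qed
  then show "bval Q s2 (Less ($''i'') ($''L'')) & run ?c1 s2 (t2 + 1) (J1 (Suc k))"
   using I k by (simp add: J1_def inp_L)
 qed (auto simp: J1_def inp_L)
 have W2: "run ?c2 s1 t1
   ?post" if "J2 0 t1 s1" for s1 :: state and t1 :: nat
 proof (rule run_for[where Inv = J2 and n = L, OF _ _ that])
  fix k t2 :: nat and s2 :: state
  assume k: "k < L" and I: "J2 k t2 s2"
  obtain C where C: "SInvS s2 k C" using I by (auto simp: J2_def)
  have I': "t2 + 12 * (h + 1) * live (arrs s2 ''tm'') <= t + 4 * L + 3 + 12 * (h + 1) * L + (14 * (h + 1) + 30) * k" "vars s2 ''i'' = int k"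
    "inp s2" "\<forall>j\<ge>k. j < L --> ar s2 ''tm'' j \<noteq> - 1" using I by (simp_all add: J2_def)
  have "run (row_com;; emit_com;; ''i'' ::= $''i'' +. #1) s2 (t2 + 1) (J2 (Suc k))"
  proof (rule run_SeqI[OF row_run[OF I'(3,2) k C]])
   show "ar s2 ''tm'' k \<noteq> - 1" using I'(4) k by simp
   fix t3 :: nat and s3 :: state
   assume rp: "rowpost s2 (t2 + 1) k C t3 s3" and fv: "\<And>v. v \<notin> asgd row_com ==> vars s3 v = vars s2 v" and fa: "\<And>a. a \<notin> wrtn row_com ==> arrs s3 a = arrs s2 a"
   have i3: "inp s3" by (rule inp_fr[OF I'(3)])
     (use fv fa in \<open>simp_all add: row_com_def take_com_def push_com_def own_com_def asgd_cross_com wrtn_cross_com\<close>)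
   have v3: "vars s3 ''i'' = int k" using fv[of "''i''"] I'(2) by (simp add: row_com_def take_com_def push_com_def own_com_def asgd_cross_com)
   obtain cs where cs: "MidS s3 k C cs" "vars s3 ''go'' = (if cs = [] then 0 else 1)"
    "cs \<noteq> [] --> vars s3 ''f'' = int (hd cs) & vars s3 ''bk'' = int (last cs) & vars s3 ''w'' = int (a (hd cs))"
    using rp unfolding rowpost_def by blast
   have tb: "t3 + 12 * (h + 1) * live (arrs s3 ''tm'') <= t2 + 1 + 12 * (h + 1) * live (arrs s2 ''tm'') + 14 * (h + 1) + 12"
    "\<forall>j>k. ar s3 ''tm'' j = ar s2 ''tm'' j" using rp by (simp_all add: rowpost_def)
   show "run (emit_com;; ''i'' ::= $''i'' +. #1) s3 t3 (J2 (Suc k))"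
   proof (rule run_SeqI[OF emit_run[OF i3 v3 k cs]])
    fix t4 :: nat and s4 :: state
    assume ep: "t4 <= t3 + 16 & (\<exists>C'. SInvS s4 (Suc k) C')" and fv4: "\<And>v. v \<notin> asgd emit_com ==> vars s4 v = vars s3 v" and fa4: "\<And>a. a \<notin> wrtn emit_com ==> arrs s4 a = arrs s3 a"
    have i4: "inp s4" by (rule inp_fr[OF i3]) (use fv4 fa4 in \<open>simp_all add: emit_com_def\<close>)
    have v4: "vars s4 ''i'' = int k" "arrs s4 ''tm'' = arrs s3 ''tm''" using fv4[of "''i''"] fa4[of "''tm''"] v3 by (simp_all add: emit_com_def)
    have R: "J2 (Suc k) t5 s5" if "t5 = t4 + 1" "arrs s5 = arrs s4" "vars s5 = (vars s4)(''i'' := int k + 1)" for s5 :: state and t5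
    proof -
     have "inp s5" by (rule inp_fr[OF i4]) (use that in simp_all)
     moreover have "t4 + 1 + 12 * (h + 1) * live (arrs s5 ''tm'') <= t + 4 * L + 3 + 12 * (h + 1) * L + (14 * (h + 1) + 30) * Suc k"
      using tb(1) I'(1) ep v4 by (simp add: that)
     moreover have "\<forall>j\<ge>Suc k. j < L --> ar s5 ''tm'' j \<noteq> - 1" using tb(2) I'(4) v4 that by auto
     ultimately show ?thesis using ep by (simp add: J2_def that)
    qed
    show "run (''i'' ::= $''i'' +. #1) s4 t4 (J2 (Suc k))"
     using kM[OF k] by (intro run_Assign) (simp_all add: v4(1), rule R, simp_all)
   qed
  qed
  then show "bval Q s2 (Less ($''i'') ($''L'')) & run (row_com;; emit_com;; ''i'' ::= $''i'' +. #1) s2 (t2 + 1) (J2 (Suc k))"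
   using I' k by (simp add: inp_L)
 next
  fix t2 :: nat and s2 :: state
  assume I: "J2 L t2 s2"
  have "t2 <= t + 4 * L + 3 + 12 * (h + 1) * L + (14 * (h + 1) + 30) * L" using I by (simp add: J2_def)
  also have "\<dots> + 1 <= t + 100 * (h + 1) * (L + 1)" by (simp add: algebra_simps)
  finally have "t2 + 1 <= t + 100 * (h + 1) * (L + 1)" by simp
  moreover have "sweep_spec L ok V a Qf (noS s2) (nfS s2) (nvS s2)" using I SInv_L unfolding J2_def by blast
  ultimately show "\<not> bval Q s2 (Less ($''i'') ($''L'')) & ?post (t2 + 1) s2"
   using I by (simp add: J2_def inp_L)
 qed auto
 show ?thesis unfolding sweep_com_def
 proof (rule run_SeqI[OF A])
  fix t1 :: nat and s1 :: state
  assume a1: "t1 = t + 1 & arrs s1 = arrs s & vars s1 = (vars s)(''i'' := 0)"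
  have "inp s1" by (rule inp_fr[OF inp]) (use a1 in simp_all)
  then have J0: "J1 0 t1 s1" using a1 by (simp add: J1_def)
  show "run (While (Less ($''i'') ($''L''))
    ?c1;;
   ''i'' ::= #0;;
   While (Less ($''i'') ($''L'')) (row_com;; emit_com;; ''i'' ::= $''i'' +. #1)) s1 t1 ?post"
  proof (rule run_SeqI[OF W1[OF J0]], rule run_SeqI[OF A])
   fix t2 t3 :: nat and s2 s3 :: state
   assume j: "J1 L (t2 - 1) s2 & t2 \<ge> 1" and a3: "t3 = t2 + 1 & arrs s3 = arrs s2 & vars s3 = (vars s2)(''i'' := 0)"
   have "inp s3" by (rule inp_fr[of s2]) (use a3 j in \<open>simp_all add: J1_def\<close>)
   moreover have "SInvS s3 0 (\<lambda>_. [])" by (rule SInv_0) (use j a3 in \<open>simp add: J1_def\<close>)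
   moreover have "t3 + 12 * (h + 1) * live (arrs s3 ''tm'') <= (t + 4 * L + 3) + 12 * (h + 1) * L"
    using live_le j a3 by (intro add_mono mult_le_mono) (auto simp: J1_def)
   moreover have "\<forall>j\<ge>0. j < L --> ar s3 ''tm'' j \<noteq> - 1" using j a3 by (simp add: J1_def)
   moreover have "vars s3 ''i'' = int 0" using a3 by simp
   ultimately have "J2 0 t3 s3" unfolding J2_def by (intro conjI exI[of _ "\<lambda>_. []"]) simp_all
   then show "run ?c2 s3 t3 ?post" by (rule W2)
  qed
 qed
qed

end

section \<open>Linked chains, heap-numbered trees and the colouring potential\<close>

fun chn :: "(int => int) => int => nat list => bool" where
 "chn nx p [] \<longleftrightarrow> p = 0"
| "chn nx p (q # qs) \<longleftrightarrow> p = int q & q \<noteq> 0 & chn nx (nx (int q)) qs"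

lemma chn_upd: "q \<notin> set ps ==> chn (nx(int q := v)) p ps = chn nx p ps"
 by (induction ps arbitrary: p) auto

text \<open>Heap numbering: node \<open>n\<close> has children \<open>2 * n\<close> and
  \<open>2 * n + 1\<close>, so repeated halving walks to the root 1.\<close>

function ancs :: "nat => nat list" where
 "ancs m = (if m = 0 then [] else m # ancs (m div 2))"
 by auto
termination by (relation "measure id") auto

declare ancs.simps[simp del]

lemma ancs_le: "x \<in> set (ancs m) ==> 1 <= x & x <= m"
proof (induction m rule: ancs.induct)
 case (1 m)
 then show ?case by (subst (asm) ancs.simps) (fastforce split: if_splits)
qed

text \<open>Above its start a path passes through exactly one child of each of its nodes and through
  no child of the other nodes. Adding the same amount along the path therefore preserves all sums
  over children.\<close>

lemma ancs_children:
 assumes "1 <= n" "n \<noteq> m"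
 shows "(n \<in> set (ancs m) \<longleftrightarrow> 2 * n \<in> set (ancs m) \<or> 2 * n + 1 \<in> set (ancs m)) &
   \<not> (2 * n \<in> set (ancs m) & 2 * n + 1 \<in> set (ancs m))"
 using assms
proof (induction m rule: ancs.induct)
 case (1 m)
 show ?case
 proof (cases "m = 0")
  case True
  then show ?thesis by (simp add: ancs.simps)
 next
  case False
  have s: "set (ancs m) = insert m (set (ancs (m div 2)))" using False by (subst ancs.simps) simp
  show ?thesis
  proof (cases "n = m div 2")
   case True
   have "n \<in> set (ancs (m div 2))" using True 1 by (subst ancs.simps) auto
   moreover have "2 * n \<notin> set (ancs (m div 2))" "2 * n + 1 \<notin> set (ancs (m div 2))"
    using ancs_le[of _ "m div 2"] True 1 by fastforce+
   moreover have "m = 2 * n \<or> m = 2 * n + 1" using True by presburger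
   ultimately show ?thesis unfolding s by auto
  next
   case F: False
   have "m \<noteq> 2 * n" "m \<noteq> 2 * n + 1" using F by auto
   then show ?thesis using 1 False F unfolding s by simp
  qed
 qed
qed

lemma ancs_root: "m \<noteq> 0 ==> 1 \<in> set (ancs m)"
proof (induction m rule: ancs.induct)
 case (1 m)
 show ?case
 proof (cases "m div 2 = 0")
  case True
  then have "m = 1" using 1 by simp
  then show ?thesis by (simp add: ancs.simps)
 next
  case False
  then show ?thesis using 1 by (subst ancs.simps) simp
 qed
qed

lemma ancs_self: "m \<noteq> 0 ==> m \<in> set (ancs m)"
 by (subst ancs.simps) simp

lemma ancs_distinct: "distinct (ancs m)"
proof (induction m rule: ancs.induct)
 case (1 m)
 have "m \<noteq> 0 ==> m \<notin> set (ancs (m div 2))" using ancs_le[of m "m div 2"] by fastforce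
 then show ?case using 1 by (subst ancs.simps) simp
qed

lemma ancs_length: "m < 2 ^ n ==> length (ancs m) <= n"
proof (induction n arbitrary: m)
 case 0
 then show ?case by (simp add: ancs.simps)
next
 case (Suc n)
 then have "m div 2 < 2 ^ n" by simp
 then show ?case using Suc.IH[of "m div 2"] by (subst ancs.simps) simp
qed

text \<open>Leaf \<open>K + c\<close> belongs to colour \<open>c\<close>. Storing
  \<open>2 ^ ld c - 1\<close> instead of \<open>2 ^ ld c\<close> makes the zero memory a correct
  initial tree.\<close>

definition tree :: "nat => (nat => int) => (nat => nat) => bool" where
 "tree K E ld \<longleftrightarrow> (\<forall>n. 1 <= n --> n < K --> E n = E (2 * n) + E (2 * n + 1)) & (\<forall>c<K. E (K + c) = 2 ^ ld c - 1)"

lemma tree_nonneg: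
 assumes "tree K E ld" "1 <= n" "n < 2 * K"
 shows "0 <= E n"
 using assms(2,3)
proof (induction "2 * K - n" arbitrary: n rule: less_induct)
 case less
 show ?case
 proof (cases "n < K")
  case True
  then have "0 <= E (2 * n)" "0 <= E (2 * n + 1)" using less.hyps[of "2 * n"] less.hyps[of "2 * n + 1"] less.prems by auto
  then show ?thesis using assms(1) True less.prems by (simp add: tree_def)
 next
  case False
  then obtain c where c: "n = K + c" "c < K" using less.prems by (metis add_diff_inverse_nat less_diff_conv2 mult_2 not_less nat_add_left_cancel_less)
  then have "E n = 2 ^ ld c - 1" using assms(1) unfolding tree_def by blast
  then show ?thesis by simp
 qed
qed

lemma tree_le_root:
 assumes "tree K E ld" "1 <= n" "n < 2 * K"
 shows "E n <= E 1"
 using assms(2,3)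
proof (induction n rule: less_induct)
 case (less n)
 show ?case
 proof (cases "n = 1")
  case False
  define p where "p = n div 2"
  have p: "1 <= p" "p < n" "p < K" using False less.prems by (auto simp: p_def)
  have np: "n = 2 * p \<or> n = 2 * p + 1" by (auto simp: p_def)
  have "E p = E (2 * p) + E (2 * p + 1)" using assms(1) p by (simp add: tree_def)
  moreover have "0 <= E (2 * p)" "0 <= E (2 * p + 1)" using tree_nonneg[OF assms(1)] p by auto
  ultimately have "E n <= E p" using np by auto
  then show ?thesis using less.IH[of p] p by simp
 qed simp
qed

text \<open>One more item raises a leaf from \<open>2 ^ l - 1\<close> to
  \<open>2 ^ (l + 1) - 1\<close>; the increment \<open>2 ^ l\<close> is added on the whole path to
  the root.\<close>

lemma tree_upd:
 assumes t: "tree K E ld" and c: "c < K" and E': "\<And>n. 1 <= n ==> n < 2 * K ==> E' n = E n + (if n \<in> set (ancs (K + c)) then 2 ^ ld c else 0)"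
  and ld': "\<And>c'. c' < K ==> ld' c' = ld c' + (if c' = c then 1 else 0)"
 shows "tree K E' ld'"
 unfolding tree_def
proof (intro conjI allI impI)
 fix n assume n: "1 <= n" "n < K"
 have "E n = E (2 * n) + E (2 * n + 1)" using t n by (simp add: tree_def)
 moreover have "E' n = E n + (if n \<in> set (ancs (K + c)) then 2 ^ ld c else 0)" using E'[of n] n by simp
 moreover have "E' (2 * n) = E (2 * n) + (if 2 * n \<in> set (ancs (K + c)) then 2 ^ ld c else 0)" using E'[of "2 * n"] n by simp
 moreover have "E' (2 * n + 1) = E (2 * n + 1) + (if 2 * n + 1 \<in> set (ancs (K + c)) then 2 ^ ld c else 0)" using E'[of "2 * n + 1"] n by simp
 moreover have "n \<noteq> K + c" using n by simp
 ultimately show "E' n = E' (2 * n) + E' (2 * n + 1)" using ancs_children[of n "K + c"] n by auto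
next
 fix c' assume c': "c' < K"
 have "K + c' \<in> set (ancs (K + c)) \<longleftrightarrow> c' = c"
 proof
  assume a: "K + c' \<in> set (ancs (K + c))"
  show "c' = c"
  proof (rule ccontr)
   assume "c' \<noteq> c"
   then have "K + c' \<in> set (ancs ((K + c) div 2))" using a c by (subst (asm) ancs.simps) auto
   then show False using ancs_le[of "K + c'" "(K + c) div 2"] c by simp
  qed
 qed (use ancs_self c in auto)
 then have "E' (K + c') = E (K + c') + (if c' = c then 2 ^ ld c else 0)" using E'[of "K + c'"] c' by simp
 then show "E' (K + c') = 2 ^ ld' c' - 1" using t c' ld'[OF c'] by (auto simp: tree_def)
qed

text \<open>The weight \<open>b + rem\<close> lies between \<open>b\<close> and \<open>2b\<close>; since \<open>K \<ge> 2b\<close>, its decrease pays for the growth of the load.\<close>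

lemma potential_step:
 fixes \<Phi> \<Phi>' \<delta> :: "nat => int" and rm rm' :: "nat => nat"
 assumes fin: "finite A" "B \<subseteq> A" and K: "2 * b <= K"
  and upd: "\<And>z. z \<in> B ==> \<Phi>' z = \<Phi> z + \<delta> z & rm z = Suc (rm' z) & rm z <= b & 0 <= \<delta> z"
  and same: "\<And>z. z \<in> A - B ==> \<Phi>' z = \<Phi> z & rm z = rm' z"
  and avg: "int K * (\<Sum>z\<in>B. \<delta> z) <= (\<Sum>z\<in>B. \<Phi> z)"
 shows "(\<Sum>z\<in>A. \<Phi>' z * (int b + int (rm' z))) <= (\<Sum>z\<in>A. \<Phi> z * (int b + int (rm z)))"
proof -
 have finB: "finite B" using fin finite_subset by blast
 have split: "(\<Sum>z\<in>A. f z) = (\<Sum>z\<in>B. f z) + (\<Sum>z\<in>A - B. f z)" for f :: "nat => int"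
  using sum.subset_diff[OF fin(2,1), of f] by simp
 have "(\<Sum>z\<in>B. \<Phi>' z * (int b + int (rm' z))) <= (\<Sum>z\<in>B. \<Phi> z * (int b + int (rm z)) + (int K * \<delta> z - \<Phi> z))"
 proof (rule sum_mono)
  fix z assume z: "z \<in> B"
  note u = upd[OF z]
  have "\<delta> z * (int b + int (rm' z)) <= int K * \<delta> z"
   using u K by (subst mult.commute, intro mult_right_mono) auto
  then show "\<Phi>' z * (int b + int (rm' z)) <= \<Phi> z * (int b + int (rm z)) + (int K * \<delta> z - \<Phi> z)"
   using u by (simp add: algebra_simps)
 qed
 also have "\<dots> = (\<Sum>z\<in>B. \<Phi> z * (int b + int (rm z))) + (int K * (\<Sum>z\<in>B. \<delta> z) - (\<Sum>z\<in>B. \<Phi> z))"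
  by (simp add: sum.distrib sum_subtractf sum_distrib_left)
 finally have 1: "(\<Sum>z\<in>B. \<Phi>' z * (int b + int (rm' z))) <= (\<Sum>z\<in>B. \<Phi> z * (int b + int (rm z)))"
  using avg by linarith
 have 2: "(\<Sum>z\<in>A - B. \<Phi>' z * (int b + int (rm' z))) = (\<Sum>z\<in>A - B. \<Phi> z * (int b + int (rm z)))"
  using same by (intro sum.cong) auto
 show ?thesis unfolding split[of "\<lambda>z. \<Phi>' z * (int b + int (rm' z))"] split[of "\<lambda>z. \<Phi> z * (int b + int (rm z))"]
  using 1 2 by linarith
qed

locale kp = knap I + machine "evaluator_of I" W M for I W M +
 fixes ss :: "nat list list"
 assumes lenss: "length ss = len I"
  and ssd: "\<And>i. i < len I ==> distinct (ss ! i) & set (ss ! i) = allowed I i"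
begin

abbreviation "L \<equiv> len I"

definition "NN = length (concat ss)"
definition "oz z = length (concat (take z ss))"
definition "pS p = concat ss ! p"
definition "zo p = (LEAST z. p < oz (Suc z))"

lemma oz_Suc: "z < L ==> oz (Suc z) = oz z + length (ss ! z)"
 using lenss by (simp add: oz_def take_Suc_conv_app_nth)

lemma oz_0: "oz 0 = 0" by (simp add: oz_def)

lemma oz_L: "oz L = NN" using lenss by (simp add: oz_def NN_def)

lemma oz_mono: "z <= z' ==> oz z <= oz z'"
proof -
 assume "z <= z'"
 then have "take z' ss = take z ss @ take (z' - z) (drop z ss)" by (metis le_add_diff_inverse take_add)
 then show ?thesis by (simp add: oz_def)
qed

lemma pS_nth: "z < L ==> k < length (ss ! z) ==> pS (oz z + k) = ss ! z ! k"
proof -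
 assume a: "z < L" "k < length (ss ! z)"
 have "concat ss = concat (take z ss) @ ss ! z @ concat (drop (Suc z) ss)"
  using a lenss by (metis append_take_drop_id concat.simps(2) concat_append Cons_nth_drop_Suc)
 then show ?thesis using a by (simp add: pS_def oz_def nth_append)
qed

lemma zo_eq: "z < L ==> oz z <= p ==> p < oz (Suc z) ==> zo p = z"
 unfolding zo_def
proof (rule Least_equality)
 fix y assume "z < L" "oz z <= p" "p < oz (Suc z)" "p < oz (Suc y)"
 then show "z <= y" using oz_mono[of "Suc y" z] by (cases "Suc y <= z") simp_all
qed

lemma zo_props: "p < NN ==> zo p < L & oz (zo p) <= p & p < oz (Suc (zo p))"
proof -
 assume p: "p < NN"
 have L0: "L \<ge> 1" using len1 .
 have ex: "p < oz (Suc (L - 1))" using p oz_L L0 by simp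
 have 1: "p < oz (Suc (zo p))" unfolding zo_def by (rule LeastI[of "\<lambda>z. p < oz (Suc z)", OF ex])
 have 2: "zo p <= L - 1" unfolding zo_def by (rule Least_le[of "\<lambda>z. p < oz (Suc z)", OF ex])
 have 3: "oz (zo p) <= p"
 proof (cases "zo p")
  case 0
  then show ?thesis by (simp add: oz_0)
 next
  case (Suc y)
  then have "\<not> p < oz (Suc y)" unfolding zo_def using not_less_Least[of y "\<lambda>z. p < oz (Suc z)"] by simp
  then show ?thesis using Suc by simp
 qed
 show ?thesis using 1 2 3 L0 by simp
qed

definition "occ w = [p\<leftarrow>[0..<NN]. pS p = w]"

lemma pS_allowed: "p < NN ==> pS p \<in> allowed I (zo p)"
proof -
 assume p: "p < NN"
 note z = zo_props[OF p]
 define k where "k = p - oz (zo p)"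
 have k: "k < length (ss ! zo p)" "p = oz (zo p) + k" using z oz_Suc[of "zo p"] by (auto simp: k_def)
 then have "pS p = ss ! zo p ! k" using pS_nth z by metis
 then show ?thesis using ssd[of "zo p"] z k by (metis nth_mem)
qed

lemma allowed_pos: "z < L ==> w \<in> allowed I z ==> \<exists>p<NN. pS p = w & zo p = z"
proof -
 assume z: "z < L" and w: "w \<in> allowed I z"
 obtain k where k: "k < length (ss ! z)" "ss ! z ! k = w" using ssd[OF z] w by (metis in_set_conv_nth)
 have 1: "oz z + k < oz (Suc z)" using k oz_Suc[OF z] by simp
 moreover have "oz (Suc z) <= NN" using oz_mono[of "Suc z" L] z oz_L by simp
 ultimately show ?thesis using pS_nth[OF z k(1)] k zo_eq[OF z _ 1] by (intro exI[of _ "oz z + k"]) auto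
qed

lemma pS_inj: "p < NN ==> p' < NN ==> pS p = pS p' ==> zo p = zo p' ==> p = p'"
proof -
 assume a: "p < NN" "p' < NN" "pS p = pS p'" "zo p = zo p'"
 note z = zo_props[OF a(1)] and z' = zo_props[OF a(2)]
 define k k' where "k = p - oz (zo p)" and "k' = p' - oz (zo p)"
 have k: "k < length (ss ! zo p)" "p = oz (zo p) + k" using z oz_Suc[of "zo p"] by (auto simp: k_def)
 have k': "k' < length (ss ! zo p)" "p' = oz (zo p) + k'" using z' a(4) oz_Suc[of "zo p"] by (auto simp: k'_def)
 have "ss ! zo p ! k = ss ! zo p ! k'" using a(3) k k' pS_nth z by metis
 then have "k = k'" using ssd[of "zo p"] z k k' by (metis nth_eq_iff_index_eq)
 then show ?thesis using k k' by simp
qed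

lemma occ_set: "set (occ w) = {p. p < NN & pS p = w}" by (auto simp: occ_def)

lemma occ_distinct: "distinct (occ w)" by (simp add: occ_def)

lemma occ_zo_inj: "inj_on zo (set (occ w))"
 using pS_inj by (auto simp: inj_on_def occ_set)

lemma occ_zo_image: "zo ` set (occ w) = {z. z < L & w \<in> allowed I z}"
 using zo_props pS_allowed allowed_pos by (force simp: occ_set image_iff)

text \<open>Each position holds one item. Hence visiting the occurrences of all items costs no more
  than the length of the input lists.\<close>

lemma occ_length_sum: "(\<Sum>w<n. length (occ w)) <= NN"
proof -
 have "(\<Sum>w<n. length (occ w)) = (\<Sum>w<n. card (set (occ w)))" using occ_distinct distinct_card by (metis (mono_tags, lifting))
 also have "\<dots> = card (\<Union>w<n. set (occ w))" by (rule card_UN_disjoint[symmetric]) (auto simp: occ_set)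
 also have "\<dots> <= card {..<NN}" by (intro card_mono) (auto simp: occ_set)
 finally show ?thesis by simp
qed

lemma allowed_card: "z < L ==> card (allowed I z) = oz (Suc z) - oz z"
 using ssd[of z] distinct_card[of "ss ! z"] oz_Suc[of z] by simp

lemma allowed_fin: "z < L ==> finite (allowed I z)"
 using ssd by (metis List.finite_set)

text \<open>The items below \<open>w\<close> are those coloured so far. The order is descending
  because a bucket grows at its head.\<close>

definition wl :: "(nat => nat) => nat => nat => nat => nat list" where
 "wl cl w z c = rev [u\<leftarrow>[1..<w]. u \<in> allowed I z & cl u = c]"

definition rmn :: "nat => nat => nat" where
 "rmn w z = card {u \<in> allowed I z. w <= u & u < L}"

text \<open>\<open>E z 1 + K\<close> is the sum of \<open>2 ^ load\<close> over all colours for the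
  set of \<open>z\<close>. Its weight \<open>b + rmn w z\<close> falls by one whenever an item of
  that set is coloured.\<close>

definition Psi :: "(nat => nat => int) => nat => nat => nat => int" where
 "Psi E K b w = (\<Sum>z<L. (E z 1 + int K) * (int b + int (rmn w z)))"

lemma wl_Suc: "1 <= w ==> wl (cl(w := c0)) (Suc w) z c = (if w \<in> allowed I z & c = c0 then w # wl cl w z c else wl cl w z c)"
proof -
 assume w: "1 <= w"
 have "[u\<leftarrow>[1..<w]. u \<in> allowed I z & (cl(w := c0)) u = c] = [u\<leftarrow>[1..<w]. u \<in> allowed I z & cl u = c]"
  by (rule filter_cong) auto
 then show ?thesis using w by (simp add: wl_def)
qed

lemma rmn_Suc: "z < L ==> w < L ==> rmn w z = rmn (Suc w) z + (if w \<in> allowed I z then 1 else 0)"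
proof -
 assume z: "z < L" "w < L"
 have "{u \<in> allowed I z. w <= u & u < L} = (if w \<in> allowed I z then insert w {u \<in> allowed I z. Suc w <= u & u < L} else {u \<in> allowed I z. Suc w <= u & u < L})"
  using z by (auto simp: Suc_le_eq order_le_less)
 then show ?thesis using allowed_fin[OF z(1)] by (simp add: rmn_def)
qed

lemma rmn_le: "z < L ==> rmn w z <= card (allowed I z)"
 unfolding rmn_def using allowed_fin by (intro card_mono) auto

definition colst :: "nat => nat => (nat => nat => int) => (nat => nat) => nat => bool" where
 "colst K b E cl w \<longleftrightarrow> (\<forall>z<L. tree K (E z) (\<lambda>c. length (wl cl w z c))) & Psi E K b w <= 2 * int L * int K * int b"

lemma colst_init:
 assumes "\<And>z n. z < L ==> 1 <= n ==> n < 2 * K ==> E z n = 0" "K \<ge> 1" "\<And>z. z < L ==> card (allowed I z) <= b"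
 shows "colst K b E cl 1"
proof -
 have "tree K (E z) (\<lambda>c. length (wl cl 1 z c))" if "z < L" for z
  using assms(1)[OF that] by (auto simp: tree_def wl_def)
 moreover have "Psi E K b 1 <= (\<Sum>z<L. int K * (int b + int b))"
  unfolding Psi_def
 proof (rule sum_mono)
  fix z assume "z \<in> {..<L}"
  then have "E z 1 = 0" "rmn 1 z <= b" using assms rmn_le[of z 1] by (auto intro: order_trans)
  then show "(E z 1 + int K) * (int b + int (rmn 1 z)) <= int K * (int b + int b)"
   by (intro mult_mono) auto
 qed
 ultimately show ?thesis by (simp add: colst_def algebra_simps)
qed

text \<open>Every summand of the potential is nonnegative and has a weight of at least
  \<open>b\<close>, so \<open>b\<close> can be cancelled from the bound on the potential.\<close>

lemma colst_root:
 assumes "colst K b E cl w" "K \<ge> 1" "z < L" and b: "\<And>z. z < L ==> card (allowed I z) <= b"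
 shows "E z 1 + int K <= 2 * int L * int K"
proof (cases "b = 0")
 \<comment> \<open>For \<open>b = 0\<close> nothing can be cancelled, but then the set is empty and
   all nodes of its tree are 0.\<close>
 case True
 have tr: "tree K (E z) (\<lambda>c. length (wl cl w z c))" using assms by (simp add: colst_def)
 have "allowed I z = {}" using b[OF assms(3)] True allowed_fin[OF assms(3)] by simp
 then have wl0: "wl cl w z c = []" for c by (simp add: wl_def)
 have "E z n = 0" if "1 <= n" "n < 2 * K" for n using that
 proof (induction "2 * K - n" arbitrary: n rule: less_induct)
  case less
  show ?case
  proof (cases "n < K")
   case True
   then show ?thesis using less tr by (simp add: tree_def)
  next
   case False
   then obtain c where "n = K + c" "c < K" using less.prems by (metis add_diff_inverse_nat less_diff_conv2 mult_2 not_less nat_add_left_cancel_less)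
   then show ?thesis using tr wl0 by (simp add: tree_def)
  qed
 qed
 then have "E z 1 = 0" using assms(2) by simp
 moreover have "int K <= 2 * int L * int K" using len1 mult_right_mono[of 1 "2 * int L" "int K"] by simp
 ultimately show ?thesis by simp
next
 case False
 have nn: "0 <= E y 1 + int K" if "y < L" for y
  using tree_nonneg[of K "E y" _ 1] assms that by (fastforce simp: colst_def)
 have "(E z 1 + int K) * int b <= (E z 1 + int K) * (int b + int (rmn w z))"
  using nn[OF assms(3)] by (intro mult_left_mono) auto
 also have "\<dots> <= Psi E K b w"
  unfolding Psi_def using nn assms(3) by (intro member_le_sum) auto
 also have "\<dots> <= 2 * int L * int K * int b" using assms(1) by (simp add: colst_def)
 finally show ?thesis using False by simp
qed

text \<open>\<open>avg\<close> says that the chosen colour costs at most the average over all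
  \<open>K\<close> colours, summed over the sets that contain \<open>w\<close>. This is the
  derandomised choice under which the potential does not grow.\<close>

lemma colst_step:
 assumes st: "colst K b E cl w" and K: "2 * b <= K" "K \<ge> 1" and w: "1 <= w" "w < L" and c0: "c0 < K"
  and b: "\<And>z. z < L ==> card (allowed I z) <= b"
  and E': "\<And>z n. z < L ==> 1 <= n ==> n < 2 * K ==> E' z n = E z n + (if w \<in> allowed I z & n \<in> set (ancs (K + c0)) then E z (K + c0) + 1 else 0)"
  and avg: "int K * (\<Sum>z | z < L & w \<in> allowed I z. E z (K + c0)) <= (\<Sum>z | z < L & w \<in> allowed I z. E z 1)"
 shows "colst K b E' (cl(w := c0)) (Suc w)"
proof -
 have tr: "tree K (E z) (\<lambda>c. length (wl cl w z c))" if "z < L" for z using st that by (simp add: colst_def)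
 have leaf: "E z (K + c0) + 1 = 2 ^ length (wl cl w z c0)" if "z < L" for z using tr[OF that] c0 by (simp add: tree_def)
 have T: "tree K (E' z) (\<lambda>c. length (wl (cl(w := c0)) (Suc w) z c))" if z: "z < L" for z
 proof (cases "w \<in> allowed I z")
  case True
  show ?thesis
   by (rule tree_upd[OF tr[OF z] c0]) (use E'[OF z] True leaf[OF z] wl_Suc[OF w(1)] in auto)
 next
  case False
  have e: "E' z n = E z n" if "1 <= n" "n < 2 * K" for n using E'[OF z that] False by simp
  have l: "wl (cl(w := c0)) (Suc w) z c = wl cl w z c" for c using wl_Suc[OF w(1)] False by simp
  have "E' z n = E' z (2 * n) + E' z (2 * n + 1)" if "1 <= n" "n < K" for n
   using tr[OF z] that e[of n] e[of "2 * n"] e[of "2 * n + 1"] by (simp add: tree_def)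
  moreover have "E' z (K + c) = 2 ^ length (wl cl w z c) - 1" if "c < K" for c
   using tr[OF z] that e[of "K + c"] K by (simp add: tree_def)
  ultimately show ?thesis unfolding tree_def l by blast
 qed
 let ?B = "{z. z < L & w \<in> allowed I z}"
 have root: "E' z 1 = E z 1 + (if w \<in> allowed I z then E z (K + c0) + 1 else 0)" if z: "z < L" for z
  using E'[OF z, of 1] ancs_root[of "K + c0"] K by simp
 have "Psi E' K b (Suc w) <= Psi E K b w"
  unfolding Psi_def
 proof (rule potential_step[where B = ?B and \<delta> = "\<lambda>z. E z (K + c0) + 1" and K = K])
  fix z assume z: "z \<in> ?B"
  have "0 <= E z (K + c0) + 1" using leaf z by simp
  then show "E' z 1 + int K = E z 1 + int K + (E z (K + c0) + 1) & rmn w z = Suc (rmn (Suc w) z) & rmn w z <= b & 0 <= E z (K + c0) + 1"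
   using z root rmn_Suc[of z w] w rmn_le[of z w] b[of z] by auto
 next
  fix z assume "z \<in> {..<L} - ?B"
  then show "E' z 1 + int K = E z 1 + int K & rmn w z = rmn (Suc w) z" using root rmn_Suc[of z w] w by auto
 next
  \<comment> \<open>The additional 1 at the leaf and the additional \<open>K\<close> at the root
    contribute the same amount to both sides for each set.\<close>
  show "int K * (\<Sum>z\<in>?B. E z (K + c0) + 1) <= (\<Sum>z\<in>?B. E z 1 + int K)"
   using avg by (simp add: sum.distrib distrib_left)
 qed (use K in auto)
 then show ?thesis using T st by (simp add: colst_def)
qed

text \<open>A single leaf is at most the root, so \<open>2 ^ load\<close> is at most
  \<open>2 * L * K\<close>, which is below \<open>2 ^ lg\<close>.\<close>

lemma colst_load:
 assumes "colst K b E cl w" "K \<ge> 1" "z < L" "c < K" and b: "\<And>z. z < L ==> card (allowed I z) <= b"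
  and lg: "2 * L * K < 2 ^ lg"
 shows "length (wl cl w z c) < lg"
proof -
 have tr: "tree K (E z) (\<lambda>c. length (wl cl w z c))" using assms by (simp add: colst_def)
 have "2 ^ length (wl cl w z c) - 1 = E z (K + c)" using tr assms(4) by (simp add: tree_def)
 also have "\<dots> <= E z 1" using tree_le_root[OF tr, of "K + c"] assms by simp
 finally have "2 ^ length (wl cl w z c) <= 2 * int L * int K" using colst_root[OF assms(1-3) b] assms(2) by simp
 then have "int (2 ^ length (wl cl w z c)) <= int (2 * L * K)" by simp
 then have "2 ^ length (wl cl w z c) <= 2 * L * K" by (simp only: of_nat_le_iff)
 then have "(2::nat) ^ length (wl cl w z c) < 2 ^ lg" using lg by (rule order_le_less_trans)
 then show ?thesis by simp
qed

end

section \<open>Programs for occurrence lists and the colouring\<close>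

text \<open>Inverts the input: each item below \<open>L\<close> gets the list of its positions, and
  \<open>ow\<close> tells which set a position belongs to. Position \<open>p\<close> becomes node
  \<open>p + 1\<close>, because 0 ends a list.\<close>

definition idx_com :: com where
 "idx_com =
  (''z'' ::= #0;;
  While (Less ($''z'') ($''L''))
   (''p'' ::= Read ''off'' ($''z'');;
    While (Less ($''p'') (Read ''off'' ($''z'' +. #1)))
     (''w'' ::= Read ''S'' ($''p'');;
     Cond (Less ($''w'') ($''L''))
      (Write ''nx'' ($''p'' +. #1) (Read ''hd'' ($''w''));; Write ''ow'' ($''p'' +. #1) ($''z'');;
       Write ''hd'' ($''w'') ($''p'' +. #1)) Skip;;
     ''p'' ::= $''p'' +. #1);;
    ''z'' ::= $''z'' +. #1))"

abbreviation cellE :: "aexp => aexp => aexp" where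
 "cellE z n \<equiv> z *. (#2 *. $''K'') +. n"

definition sum_com :: com where
 "sum_com =
  ((''sl'' ::= #0;; ''sr'' ::= #0;; ''p'' ::= Read ''hd'' ($''w''));;
  While (BNot (Equal ($''p'') (#0)))
   (''sl'' ::= $''sl'' +. Read ''E'' (cellE (Read ''ow'' ($''p'')) (#2 *. $''nd''));;
    ''sr'' ::= $''sr'' +. Read ''E'' (cellE (Read ''ow'' ($''p'')) (#2 *. $''nd'' +. #1));;
    ''p'' ::= Read ''nx'' ($''p'')))"

text \<open>The search for a cheap colour follows the trees of all sets that contain
  \<open>w\<close> simultaneously and always enters the child with the smaller total.\<close>

definition desc_com :: com where
 "desc_com =
  (''nd'' ::= #1;;
  While (Less ($''nd'') ($''K''))
   (sum_com;; Cond (Less ($''sr'') ($''sl'')) (''nd'' ::= #2 *. $''nd'' +. #1) (''nd'' ::= #2 *. $''nd'')))"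

definition anc_com :: com where
 "anc_com =
  (''n'' ::= $''nd'';;
  While (Less (#0) ($''n''))
   (Write ''E'' (cellE ($''z'') ($''n'')) (Read ''E'' (cellE ($''z'') ($''n'')) +. $''inc'');;
    ''n'' ::= $''n'' \<div> #2))"

text \<open>A position lies in exactly one set, and its item gets exactly one colour, so a single
  link array \<open>nx2\<close> serves the buckets of all pairs of a set and a colour.\<close>

definition upd_com :: com where
 "upd_com =
  (''p'' ::= Read ''hd'' ($''w'');;
  While (BNot (Equal ($''p'') (#0)))
   ((''z'' ::= Read ''ow'' ($''p'');; ''inc'' ::= Read ''E'' (cellE ($''z'') ($''nd'')) +. #1);;
    anc_com;;
    (''k'' ::= $''z'' *. $''K'' +. ($''nd'' -. $''K'');;
    Write ''nx2'' ($''p'') (Read ''h2'' ($''k''));; Write ''h2'' ($''k'') ($''p'');;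
    ''p'' ::= Read ''nx'' ($''p''))))"

definition color_com :: com where
 "color_com =
  (''w'' ::= #1;;
  While (Less ($''w'') ($''L'')) (desc_com;; upd_com;; ''w'' ::= $''w'' +. #1))"

lemma frames_color:
 "asgd sum_com = {''p'', ''sr'', ''sl''}" "wrtn sum_com = {}"
 "asgd anc_com = {''n''}" "wrtn anc_com = {''E''}"
 by (simp_all add: sum_com_def anc_com_def)

lemma cell_inj: "n < m ==> n' < m ==> int z * int m + int n = int z' * int m + int n' \<longleftrightarrow> z = z' & n = n'"
proof -
 assume a: "n < m" "n' < m"
 have "int z * int m + int n = int z' * int m + int n' \<longleftrightarrow> z * m + n = z' * m + n'"
  by (metis of_nat_add of_nat_eq_iff of_nat_mult)
 also have "\<dots> \<longleftrightarrow> z = z' & n = n'"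
 proof
  assume e: "z * m + n = z' * m + n'"
  have "z = (z * m + n) div m" "z' = (z' * m + n') div m" "n = (z * m + n) mod m" "n' = (z' * m + n') mod m" using a by auto
  then show "z = z' & n = n'" using e by metis
 qed auto
 finally show ?thesis .
qed

context kp
begin

definition inA :: "state => bool" where
 "inA s \<longleftrightarrow> vars s ''L'' = int L & (\<forall>z\<le>L. ar s ''off'' z = int (oz z)) & (\<forall>p<NN. ar s ''S'' p = int (pS p))"

lemma inA_off: "inA s ==> z < L ==> arrs s ''off'' (int z + 1) = int (oz (Suc z))"
 unfolding inA_def by (metis Suc_leI of_nat_Suc add.commute)

definition ixd :: "nat => state => bool" where
 "ixd p0 s \<longleftrightarrow> (\<forall>w<L. chn (arrs s ''nx'') (ar s ''hd'' w) (map Suc (rev [p\<leftarrow>[0..<p0]. pS p = w]))) &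
   (\<forall>p<p0. pS p < L --> arrs s ''ow'' (int p + 1) = int (zo p))"

lemma idx_step:
 assumes x: "ixd p s" and p: "p < NN" and z: "zo p = z" and w: "pS p < L"
  and s': "arrs s' = (arrs s)(''nx'' := (arrs s ''nx'')(int p + 1 := ar s ''hd'' (pS p)), ''ow'' := (arrs s ''ow'')(int p + 1 := int z),
    ''hd'' := (arrs s ''hd'')(int (pS p) := int p + 1))"
 shows "ixd (Suc p) s'"
 unfolding ixd_def
proof (intro conjI allI impI)
 fix u assume u: "u < L"
 let ?l = "map Suc (rev [p\<leftarrow>[0..<p]. pS p = u])"
 have c: "chn (arrs s ''nx'') (ar s ''hd'' u) ?l" using x u by (simp add: ixd_def)
 have sp: "int p + 1 = int (Suc p)" by simp
 have "Suc p \<notin> set ?l" by auto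
 then have c': "chn ((arrs s ''nx'')(int (Suc p) := v)) (ar s ''hd'' u) ?l" for v using chn_upd c by blast
 show "chn (arrs s' ''nx'') (ar s' ''hd'' u) (map Suc (rev [p\<leftarrow>[0..<Suc p]. pS p = u]))"
 proof (cases "u = pS p")
  case True
  then show ?thesis using c' unfolding s' sp by simp
 next
  case False
  then show ?thesis using c' unfolding s' sp by simp
 qed
next
 fix p' assume "p' < Suc p" "pS p' < L"
 then show "arrs s' ''ow'' (int p' + 1) = int (zo p')" using x z unfolding s' ixd_def by (auto simp: less_Suc_eq)
qed

lemma idx_skip: "ixd p s ==> \<not> pS p < L ==> arrs s' = arrs s ==> ixd (Suc p) s'"
 unfolding ixd_def by (auto simp: less_Suc_eq)

lemma idx_run:
 assumes inA: "inA s" and z0: "\<And>k. arrs s ''hd'' k = 0" and Mb: "int L + 1 <= M" "int NN + 1 <= M"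
 shows "run idx_com s t (\<lambda>t' s'. t' <= t + 9 * NN + 5 * L + 5 & ixd NN s')"
proof -
 let ?c1 = "(''w'' ::= Read ''S'' ($''p'');; Cond (Less ($''w'') ($''L'')) (Write ''nx'' ($''p'' +. #1) (Read ''hd'' ($''w''));; Write ''ow'' ($''p'' +. #1) ($''z'');; Write ''hd'' ($''w'') ($''p'' +. #1)) Skip;; ''p'' ::= $''p'' +. #1)"
 have inA_fr: "inA s''" if "inA s'" "vars s'' ''L'' = vars s' ''L''" "arrs s'' ''off'' = arrs s' ''off''" "arrs s'' ''S'' = arrs s' ''S''" for s' s''
  using that by (simp add: inA_def)
 define J where "J = (\<lambda>p z t' s'. t' <= t + 1 + 9 * p + 4 * z & inA s' & vars s' ''z'' = int z & ixd p s')"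
 have pre: "run (''z'' ::= #0) s t (J 0 0)"
 proof -
  have "J 0 0 t' s'" if "t' = t + 1" "arrs s' = arrs s" "vars s' = (vars s)(''z'' := 0)" for t' s'
   using that inA z0 by (auto simp: J_def inA_def ixd_def)
  then show ?thesis using M16 by (intro run_wp) simp
 qed
 define J2 where "J2 = (\<lambda>z p t' s'. t' <= t + 3 + 9 * p + 4 * z & inA s' & vars s' ''z'' = int z & vars s' ''p'' = int p & ixd p s')"
 have inner: "run (While (Less ($''p'') (Read ''off'' ($''z'' +. #1)))
     ?c1) s1 t1 (\<lambda>t' s'. J2 z (oz (Suc z)) (t' - 1) s' & t' \<ge> 1)"
  if z: "z < L" and J: "J2 z (oz z) t1 s1" for z s1 t1
 proof (rule run_for[where Inv = "\<lambda>k. J2 z (oz z + k)" and n = "oz (Suc z) - oz z"])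
  show "J2 z (oz z + 0) t1 s1" using J by simp
 next
  fix k t2 s2
  assume k: "k < oz (Suc z) - oz z" and I: "J2 z (oz z + k) t2 s2"
  define p where "p = oz z + k"
  have p: "p < NN" "zo p = z" using k oz_mono[of "Suc z" L] z oz_L zo_eq[OF z, of p] by (auto simp: p_def)
  have f: "vars s2 ''p'' = int p" "vars s2 ''z'' = int z" "vars s2 ''L'' = int L" "ar s2 ''S'' p = int (pS p)"
   "arrs s2 ''off'' (int z + 1) = int (oz (Suc z))" "t2 <= t + 3 + 9 * p + 4 * z" "inA s2" "ixd p s2"
   using I p z inA_off[OF _ z, of s2] unfolding J2_def p_def[symmetric] by (auto simp: inA_def)
  have R: "J2 z (Suc p) t3 s3" if "t3 <= t2 + 8" "vars s3 = (vars s2)(''w'' := int (pS p), ''p'' := int p + 1)"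
    "pS p < L & arrs s3 = (arrs s2)(''nx'' := (arrs s2 ''nx'')(int p + 1 := ar s2 ''hd'' (pS p)), ''ow'' := (arrs s2 ''ow'')(int p + 1 := int z),
    ''hd'' := (arrs s2 ''hd'')(int (pS p) := int p + 1)) \<or> \<not> pS p < L & arrs s3 = arrs s2" for t3 s3
  proof -
   have "ixd (Suc p) s3" using that(3) idx_step[OF f(8) p] idx_skip[OF f(8)] by blast
   moreover have "inA s3" by (rule inA_fr[OF f(7)]) (use that in auto)
   ultimately show ?thesis using that(1,2) f by (simp add: J2_def)
  qed
  have pSM: "\<bar>int (pS p)\<bar> <= M" if "Bd M s2" using BdD(2)[OF that, of "''S''" "int p"] f(4) by simp
  have "run ?c1 s2 (t2 + 1) (J2 z (Suc p))"
  proof (cases "pS p < L")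
   case True
   show ?thesis using True f(1-5) p z Mb BdD(2)[of s2 "''hd''" "int (pS p)"]
    by (intro run_wp) (simp, rule R, simp_all)
  next
   case False
   show ?thesis using False f(1-5) p z Mb pSM
    by (intro run_wp) (simp, rule R, simp_all)
  qed
  then show "bval (evaluator_of I) s2 (Less ($''p'') (Read ''off'' ($''z'' +. #1))) & run ?c1 s2 (t2 + 1) (J2 z (oz z + Suc k))"
   using f k by (simp add: p_def)
 next
  fix t2 s2 assume I: "J2 z (oz z + (oz (Suc z) - oz z)) t2 s2"
  have e: "oz z + (oz (Suc z) - oz z) = oz (Suc z)" using oz_mono[of z "Suc z"] by simp
  have "arrs s2 ''off'' (int z + 1) = int (oz (Suc z))" using I inA_off[OF _ z] unfolding J2_def by blast
  then show "\<not> bval (evaluator_of I) s2 (Less ($''p'') (Read ''off'' ($''z'' +. #1))) & J2 z (oz (Suc z)) (t2 + 1 - 1) s2 & t2 + 1 \<ge> 1"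
   using I unfolding e by (simp add: J2_def)
 qed auto
 show ?thesis unfolding idx_com_def
 proof (rule run_SeqI[OF pre], rule run_for[where Inv = "\<lambda>z. J (oz z) z" and n = L])
  fix z t2 s2
  assume z: "z < L" and I: "J (oz z) z t2 s2"
  have f: "vars s2 ''z'' = int z" "vars s2 ''L'' = int L" "ar s2 ''off'' z = int (oz z)"
   using I z by (auto simp: J_def inA_def)
  have ozN: "int (oz z) <= M" using oz_mono[of z L] oz_L z Mb by simp
  have "run (''p'' ::= Read ''off'' ($''z'')) s2 (t2 + 1) (J2 z (oz z))"
  proof -
   have "J2 z (oz z) t' s'" if "t' = t2 + 2" "arrs s' = arrs s2" "vars s' = (vars s2)(''p'' := int (oz z))" for t' s'
    using that I by (simp add: J_def J2_def inA_def ixd_def)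
   then show ?thesis using f ozN by (intro run_wp) simp
  qed
  note R1 = this
  have R2: "run (''z'' ::= $''z'' +. #1) s3 t3 (J (oz (Suc z)) (Suc z))" if "J2 z (oz (Suc z)) (t3 - 1) s3 & t3 \<ge> 1" for s3 t3
  proof -
   have "J (oz (Suc z)) (Suc z) t' s'" if "t' = t3 + 1" "arrs s' = arrs s3" "vars s' = (vars s3)(''z'' := int z + 1)" for t' s'
    using that \<open>J2 z (oz (Suc z)) (t3 - 1) s3 & t3 \<ge> 1\<close> by (auto simp: J_def J2_def inA_def ixd_def)
   moreover have "vars s3 ''z'' = int z" using that by (simp add: J2_def)
   ultimately show ?thesis using z Mb by (intro run_wp) simp
  qed
  show "bval (evaluator_of I) s2 (Less ($''z'') ($''L'')) & run (''p'' ::= Read ''off'' ($''z'');;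
    While (Less ($''p'') (Read ''off'' ($''z'' +. #1)))
     ?c1;;
    ''z'' ::= $''z'' +. #1) s2 (t2 + 1) (J (oz (Suc z)) (Suc z))"
   using f z by (intro conjI, simp) (rule run_SeqI[OF R1], rule run_SeqI[OF inner[OF z]], assumption, rule R2, assumption)
 next
  fix t2 s2 assume "J (oz L) L t2 s2"
  then show "\<not> bval (evaluator_of I) s2 (Less ($''z'') ($''L'')) & t2 + 1 <= t + 9 * NN + 5 * L + 5 & ixd NN s2"
   by (auto simp: J_def inA_def oz_L)
 qed (simp_all add: oz_0)
qed

end

lemma sum_list_distinct: "distinct zs ==> sum_list (map f zs) = (\<Sum>z\<in>set zs. f z)"
 by (simp add: sum_list_distinct_conv_sum_set)

context kp
begin

definition "zs w = map zo (rev (occ w))"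

lemma zs_props: "distinct (zs w)" "set (zs w) = {z. z < L & w \<in> allowed I z}" "length (zs w) <= L"
proof -
 show 1: "distinct (zs w)" using occ_zo_inj occ_distinct by (simp add: zs_def distinct_map)
 show 2: "set (zs w) = {z. z < L & w \<in> allowed I z}" using occ_zo_image by (simp add: zs_def)
 have "card (set (zs w)) <= card {..<L}" by (intro card_mono) (auto simp: 2)
 then show "length (zs w) <= L" using 1 distinct_card by fastforce
qed

definition Ef :: "nat => state => nat => nat => int" where
 "Ef K s z n = arrs s ''E'' (int z * (2 * int K) + int n)"

lemma chn_drop: "chn nx p (drop k ps) ==> k < length ps ==> p = int (ps ! k) & ps ! k \<noteq> 0 & chn nx (nx p) (drop (Suc k) ps)"
 by (auto simp: Cons_nth_drop_Suc[symmetric])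

definition lst :: "nat => nat list" where "lst w = map Suc (rev (occ w))"

lemma lst_nth: "k < length (lst w) ==> \<exists>p. lst w ! k = Suc p & p < NN & pS p = w & zs w ! k = zo p"
proof -
 assume k: "k < length (lst w)"
 define p where "p = rev (occ w) ! k"
 have kl: "k < length (rev (occ w))" using k by (simp add: lst_def)
 have "p \<in> set (rev (occ w))" unfolding p_def using kl by (rule nth_mem)
 then have "p < NN & pS p = w" by (simp add: occ_set)
 then show ?thesis using kl by (intro exI[of _ p]) (simp add: lst_def zs_def p_def)
qed

lemma len_lst: "length (lst w) = length (zs w)" "length (lst w) = length (occ w)" by (simp_all add: lst_def zs_def)

text \<open>One generous product that dominates all addresses and sums occurring during the
  colouring.\<close>

definition capK :: "nat => bool" where
 "capK K \<longleftrightarrow> 8 * (int L + 2) * (int L + 2) * (int K + 2) <= M"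

lemma capK_D:
 assumes "capK K"
 shows "2 * int L * int L * int K + 8 <= M" "4 * int K + 8 <= M" "4 * int L + 8 <= M" "2 * int L * int K + 8 <= M" "int L * int K + int K <= M"
proof -
 have e: "8 * (int L + 2) * (int L + 2) * (int K + 2) = 8 * (int L * int L * int K) + 16 * (int L * int L) + 32 * (int L * int K) + 64 * int L + 32 * int K + 64"
  by (simp add: algebra_simps)
 have nn: "0 <= int L * int L * int K" "0 <= int L * int L" "0 <= int L * int K" by simp_all
 note h = assms[unfolded capK_def e]
 show "2 * int L * int L * int K + 8 <= M" using h nn by linarith
 show "4 * int K + 8 <= M" using h nn by linarith
 show "4 * int L + 8 <= M" using h nn by linarith
 show "2 * int L * int K + 8 <= M" using h nn by linarith
 show "int L * int K + int K <= M" using h nn by linarith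
qed

lemma sum_run:
 assumes x: "ixd NN s" and w: "w < L" "vars s ''w'' = int w" and K: "vars s ''K'' = int K" "capK K" and nd: "vars s ''nd'' = int nd" "1 <= nd" "nd < K"
  and E: "\<And>z n. z < L ==> 1 <= n ==> n < 2 * K ==> 0 <= Ef K s z n & Ef K s z n <= 2 * int L * int K"
 shows "run sum_com s t (\<lambda>t' s'. t' <= t + 4 + 4 * length (zs w) & vars s' ''sl'' = (\<Sum>z | z < L & w \<in> allowed I z. Ef K s z (2 * nd)) &
   vars s' ''sr'' = (\<Sum>z | z < L & w \<in> allowed I z. Ef K s z (2 * nd + 1)))"
  (is "run _ _ _ ?post")
proof -
 have c0: "chn (arrs s ''nx'') (ar s ''hd'' w) (lst w)" using x w by (simp add: ixd_def lst_def occ_def)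
 define f where "f = (\<lambda>b k. sum_list (map (\<lambda>z. Ef K s z (2 * nd + b)) (take k (zs w))))"
 have fb: "0 <= f b k & f b k <= 2 * int L * int L * int K" if b: "b <= 1" for b k
 proof -
  have el: "0 <= Ef K s z (2 * nd + b) & Ef K s z (2 * nd + b) <= 2 * int L * int K" if "z \<in> set (take k (zs w))" for z
   using E[of z "2 * nd + b"] that zs_props(2)[of w] nd b in_set_takeD[OF that] by auto
  have "f b k <= sum_list (map (\<lambda>z. 2 * int L * int K) (take k (zs w)))"
   unfolding f_def using el by (intro sum_list_mono) auto
  also have "\<dots> = int (length (take k (zs w))) * (2 * int L * int K)" by (simp add: sum_list_triv)
  also have "\<dots> <= int L * (2 * int L * int K)"
   using zs_props(3)[of w] by (intro mult_right_mono) auto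
  finally have "f b k <= 2 * int L * int L * int K" by (simp add: algebra_simps)
  moreover have "0 <= f b k" unfolding f_def using el by (intro sum_list_nonneg) auto
  ultimately show ?thesis by simp
 qed
 define J :: "nat => nat => state => bool" where "J = (\<lambda>k t' s'. t' <= t + 3 + 4 * k & arrs s' = arrs s & vars s' ''sl'' = f 0 k & vars s' ''sr'' = f 1 k &
   chn (arrs s ''nx'') (vars s' ''p'') (drop k (lst w)) & vars s' ''K'' = int K & vars s' ''nd'' = int nd)"
 have pre: "run (''sl'' ::= #0;; ''sr'' ::= #0;; ''p'' ::= Read ''hd'' ($''w'')) s t (J 0)"
 proof -
  have "J 0 t' s'" if "t' = t + 3" "arrs s' = arrs s" "vars s' = (vars s)(''sl'' := 0, ''sr'' := 0, ''p'' := ar s ''hd'' w)" for t' :: nat and s' :: state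
   using that c0 K nd by (simp add: J_def f_def)
  note P0 = this
  show ?thesis using M16 w BdD(2)[of s "''hd''" "int w"] by (intro run_wp) (simp, rule P0, simp_all)
 qed
 show ?thesis unfolding sum_com_def
 proof (rule run_SeqI[OF pre], rule run_for[where Inv = J and n = "length (lst w)"])
  fix k t2 :: nat and s2 :: state
  assume k: "k < length (lst w)" and I: "J k t2 s2"
  obtain p where p: "lst w ! k = Suc p" "p < NN" "pS p = w" "zs w ! k = zo p" using lst_nth[OF k] by blast
  have kz: "k < length (zs w)" using k len_lst by simp
  have ch: "vars s2 ''p'' = int (Suc p)" "chn (arrs s ''nx'') (ar s ''nx'' (Suc p)) (drop (Suc k) (lst w))"
   using I chn_drop[OF _ k, of "arrs s ''nx''" "vars s2 ''p''"] p by (auto simp: J_def)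
  have ow: "ar s ''ow'' (Suc p) = int (zo p)" using x p w by (simp add: ixd_def add.commute)
  have fS: "f b (Suc k) = f b k + Ef K s (zo p) (2 * nd + b)" for b using kz p by (simp add: f_def take_Suc_conv_app_nth)
  have f2: "arrs s2 = arrs s" "vars s2 ''sl'' = f 0 k" "vars s2 ''sr'' = f 1 k" "vars s2 ''K'' = int K" "vars s2 ''nd'' = int nd" "t2 <= t + 3 + 4 * k"
   using I by (simp_all add: J_def)
  have e0: "arrs s ''E'' (int (zo p) * (2 * int K) + 2 * int nd) = Ef K s (zo p) (2 * nd + 0)"
   "arrs s ''E'' (int (zo p) * (2 * int K) + (2 * int nd + 1)) = Ef K s (zo p) (2 * nd + 1)"
   by (simp_all add: Ef_def algebra_simps)
  have bn: "\<bar>f 0 k + Ef K s (zo p) (2 * nd + 0)\<bar> <= M" "\<bar>f 1 k + Ef K s (zo p) (2 * nd + 1)\<bar> <= M"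
   using fb[of 0 "Suc k"] fb[of 1 "Suc k"] fS capK_D(1)[OF K(2)] by auto
  have R: "J (Suc k) t3 s3" if "t3 = t2 + 4" "arrs s3 = arrs s" "vars s3 = (vars s2)(''sl'' := f 0 k + Ef K s (zo p) (2 * nd + 0),
   ''sr'' := f 1 k + Ef K s (zo p) (2 * nd + 1), ''p'' := ar s ''nx'' (Suc p))" for t3 :: nat and s3 :: state
   using that f2 ch fS unfolding J_def by simp
  have "run (''sl'' ::= $''sl'' +. Read ''E'' (cellE (Read ''ow'' ($''p'')) (#2 *. $''nd''));;
    ''sr'' ::= $''sr'' +. Read ''E'' (cellE (Read ''ow'' ($''p'')) (#2 *. $''nd'' +. #1));;
    ''p'' ::= Read ''nx'' ($''p'')) s2 (t2 + 1) (J (Suc k))"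
   using bn BdD(2)[of s2 "''nx''" "int (Suc p)"]
   by (intro run_wp) (simp only: wp.simps qf.simps acost.simps aval.simps apply_op.simps f2 ch(1) ow e0 state.simps fun_upd_apply, simp add: f2 ch(1) ow e0 del: of_nat_Suc, rule R, simp_all add: f2 del: of_nat_Suc)
  then show "bval (evaluator_of I) s2 (BNot (Equal ($''p'') (#0))) & run (''sl'' ::= $''sl'' +. Read ''E'' (cellE (Read ''ow'' ($''p'')) (#2 *. $''nd''));;
    ''sr'' ::= $''sr'' +. Read ''E'' (cellE (Read ''ow'' ($''p'')) (#2 *. $''nd'' +. #1));;
    ''p'' ::= Read ''nx'' ($''p'')) s2 (t2 + 1) (J (Suc k))" using ch(1) by simp
 next
  fix t2 :: nat and s2 :: state assume I: "J (length (lst w)) t2 s2"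
  have tk: "take (length (lst w)) (zs w) = zs w" using len_lst by simp
  have "f b (length (lst w)) = (\<Sum>z | z < L & w \<in> allowed I z. Ef K s z (2 * nd + b))" for b
   unfolding f_def tk sum_list_distinct[OF zs_props(1)] zs_props(2) ..
  from this[of 0] this[of 1]
  show "\<not> bval (evaluator_of I) s2 (BNot (Equal ($''p'') (#0))) & ?post (t2 + 1) s2"
   using I len_lst by (simp add: J_def)
 qed auto
qed

text \<open>The totals of two siblings add up to that of their parent, so the smaller one is at most
  half of it. After \<open>H\<close> levels the leaf total is at most a \<open>2 ^ H\<close>-th,
  that is a \<open>K\<close>-th, of the root total.\<close>

lemma desc_run:
 assumes x: "ixd NN s" and w: "w < L" "vars s ''w'' = int w" and K: "vars s ''K'' = int K" "capK K" "K = 2 ^ H"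
  and tr: "\<And>z. z < L ==> tree K (Ef K s z) (ld z)"
  and E: "\<And>z. z < L ==> Ef K s z 1 <= 2 * int L * int K"
 shows "run desc_com s t (\<lambda>t' s'. t' <= t + 2 + (4 * length (zs w) + 8) * H & (\<exists>c<K. vars s' ''nd'' = int (K + c) &
   int K * (\<Sum>z | z < L & w \<in> allowed I z. Ef K s z (K + c)) <= (\<Sum>z | z < L & w \<in> allowed I z. Ef K s z 1)))"
proof -
 let ?c1 = "(sum_com;; Cond (Less ($''sr'') ($''sl'')) (''nd'' ::= #2 *. $''nd'' +. #1) (''nd'' ::= #2 *. $''nd''))"
 let ?Z = "{z. z < L & w \<in> allowed I z}"
 have Ebd: "0 <= Ef K s z n & Ef K s z n <= 2 * int L * int K" if "z < L" "1 <= n" "n < 2 * K" for z n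
  using tree_nonneg[OF tr[OF that(1)] that(2,3)] tree_le_root[OF tr[OF that(1)] that(2,3)] E[OF that(1)] by simp
 have K1: "K \<ge> 1" using K by simp
 define J :: "nat => nat => state => bool" where "J = (\<lambda>k t' s'. t' <= t + 1 + (4 * length (zs w) + 8) * k & arrs s' = arrs s & vars s' ''w'' = int w & vars s' ''K'' = int K &
   (\<exists>nd. vars s' ''nd'' = int nd & 2 ^ k <= nd & nd < 2 ^ Suc k & 2 ^ k * (\<Sum>z\<in>?Z. Ef K s z nd) <= (\<Sum>z\<in>?Z. Ef K s z 1)))"
 have pre: "run (''nd'' ::= #1) s t (J 0)"
 proof -
  have "J 0 t' s'" if "t' = t + 1" "arrs s' = arrs s" "vars s' = (vars s)(''nd'' := 1)" for t' :: nat and s' :: state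
   using that w K unfolding J_def by (auto intro!: exI[of _ 1])
  then show ?thesis using M16 by (intro run_wp) simp
 qed
 show ?thesis unfolding desc_com_def
 proof (rule run_SeqI[OF pre], rule run_for[where Inv = J and n = H])
  fix k t2 :: nat and s2 :: state
  assume k: "k < H" and I: "J k t2 s2"
  obtain nd where nd: "vars s2 ''nd'' = int nd" "2 ^ k <= nd" "nd < 2 ^ Suc k" "2 ^ k * (\<Sum>z\<in>?Z. Ef K s z nd) <= (\<Sum>z\<in>?Z. Ef K s z 1)"
   using I unfolding J_def by blast
  have f: "t2 <= t + 1 + (4 * length (zs w) + 8) * k" "arrs s2 = arrs s" "vars s2 ''w'' = int w" "vars s2 ''K'' = int K" using I by (simp_all add: J_def)
  have "(2::nat) ^ Suc k <= 2 ^ H" using k by (intro power_increasing) auto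
  then have ndK: "nd < K" "1 <= nd" using nd K(3) by (auto intro: order_trans[OF one_le_power])
  have Ee: "Ef K s2 = Ef K s" using f by (simp add: Ef_def fun_eq_iff)
  have x2: "ixd NN s2" using x f by (simp add: ixd_def)
  have node: "Ef K s z nd = Ef K s z (2 * nd) + Ef K s z (2 * nd + 1)" if "z < L" for z using tr[OF that] ndK by (simp add: tree_def)
  have ns: "(\<Sum>z\<in>?Z. Ef K s z nd) = (\<Sum>z\<in>?Z. Ef K s z (2 * nd)) + (\<Sum>z\<in>?Z. Ef K s z (2 * nd + 1))"
   using node by (subst sum.distrib[symmetric]) (auto intro!: sum.cong)
  have SR: "run sum_com s2 (t2 + 1) (\<lambda>t' s'. t' <= t2 + 1 + 4 + 4 * length (zs w) & vars s' ''sl'' = (\<Sum>z\<in>?Z. Ef K s z (2 * nd)) &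
   vars s' ''sr'' = (\<Sum>z\<in>?Z. Ef K s z (2 * nd + 1)))"
   using sum_run[OF x2 w(1) f(3,4) K(2) nd(1) ndK(2,1), unfolded Ee, OF Ebd, of "t2 + 1"] by simp
  have kM: "4 * int nd + 8 <= M" using capK_D(2)[OF K(2)] ndK by simp
  have "run ?c1 s2 (t2 + 1) (J (Suc k))"
  proof (rule run_SeqI[OF SR])
   fix t3 :: nat and s3 :: state
   assume a3: "t3 <= t2 + 1 + 4 + 4 * length (zs w) & vars s3 ''sl'' = (\<Sum>z\<in>?Z. Ef K s z (2 * nd)) & vars s3 ''sr'' = (\<Sum>z\<in>?Z. Ef K s z (2 * nd + 1))"
    and fv: "\<And>v. v \<notin> asgd sum_com ==> vars s3 v = vars s2 v" and fa: "\<And>a. a \<notin> wrtn sum_com ==> arrs s3 a = arrs s2 a"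
   have v3: "vars s3 ''nd'' = int nd" "vars s3 ''w'' = int w" "vars s3 ''K'' = int K" using fv nd f by (simp_all add: frames_color)
   have a3': "arrs s3 = arrs s" using fa f by (auto simp: frames_color fun_eq_iff)
   have R: "J (Suc k) t4 s4" if "t4 <= t2 + 8 + 4 * length (zs w)" "arrs s4 = arrs s3" "b <= 1" "vars s4 = (vars s3)(''nd'' := int (2 * nd + b))"
    "2 * (\<Sum>z\<in>?Z. Ef K s z (2 * nd + b)) <= (\<Sum>z\<in>?Z. Ef K s z nd)" for t4 :: nat and s4 :: state and b
   proof -
    have "2 ^ Suc k * (\<Sum>z\<in>?Z. Ef K s z (2 * nd + b)) = 2 ^ k * (2 * (\<Sum>z\<in>?Z. Ef K s z (2 * nd + b)))" by simp
    also have "\<dots> <= 2 ^ k * (\<Sum>z\<in>?Z. Ef K s z nd)" using that(5) by (intro mult_left_mono) auto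
    finally have "2 ^ Suc k * (\<Sum>z\<in>?Z. Ef K s z (2 * nd + b)) <= (\<Sum>z\<in>?Z. Ef K s z 1)" using nd(4) by linarith
    moreover have "2 ^ Suc k <= 2 * nd + b" "2 * nd + b < 2 ^ Suc (Suc k)" using nd(2,3) that(3) by auto
    moreover have "t4 <= t + 1 + (4 * length (zs w) + 8) * Suc k" using that(1) f(1) by simp
    ultimately show ?thesis unfolding J_def using that(2,4) v3 a3' by (intro conjI exI[of _ "2 * nd + b"]) simp_all
   qed
   show "run (Cond (Less ($''sr'') ($''sl'')) (''nd'' ::= #2 *. $''nd'' +. #1) (''nd'' ::= #2 *. $''nd'')) s3 t3 (J (Suc k))"
   proof (cases "(\<Sum>z\<in>?Z. Ef K s z (2 * nd + 1)) < (\<Sum>z\<in>?Z. Ef K s z (2 * nd))")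
    case True
    show ?thesis using a3 True kM ns v3(1)
     by (intro run_wp) (simp, rule R[where b = 1], simp_all add: add.commute)
   next
    case False
    show ?thesis using a3 False kM ns v3(1)
     by (intro run_wp) (simp, rule R[where b = 0], simp_all)
   qed
  qed
  then show "bval (evaluator_of I) s2 (Less ($''nd'') ($''K'')) & run ?c1 s2 (t2 + 1) (J (Suc k))"
   using nd f ndK by simp
 next
  fix t2 :: nat and s2 :: state assume I: "J H t2 s2"
  obtain nd where nd: "vars s2 ''nd'' = int nd" "2 ^ H <= nd" "nd < 2 ^ Suc H" "2 ^ H * (\<Sum>z\<in>?Z. Ef K s z nd) <= (\<Sum>z\<in>?Z. Ef K s z 1)"
   using I unfolding J_def by blast
  define c where "c = nd - K"
  have c: "nd = K + c" "c < K" using nd K(3) by (auto simp: c_def)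
  have "int K = 2 ^ H" using K(3) by simp
  then have "int K * (\<Sum>z\<in>?Z. Ef K s z (K + c)) <= (\<Sum>z\<in>?Z. Ef K s z 1)" using nd(4) c by simp
  then show "\<not> bval (evaluator_of I) s2 (Less ($''nd'') ($''K'')) & t2 + 1 <= t + 2 + (4 * length (zs w) + 8) * H &
   (\<exists>c<K. vars s2 ''nd'' = int (K + c) & int K * (\<Sum>z\<in>?Z. Ef K s z (K + c)) <= (\<Sum>z\<in>?Z. Ef K s z 1))"
   using I nd(1) c by (auto simp: J_def)
 qed auto
qed

lemma anc_run:
 assumes v: "vars s ''z'' = int z" "vars s ''K'' = int K" "vars s ''nd'' = int nd" "vars s ''inc'' = inc" "nd < 2 * K"
  and bd: "\<And>n. n \<in> set (ancs nd) ==> \<bar>Ef K s z n + inc\<bar> <= M"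
  and ndM: "int nd <= M"
 shows "run anc_com s t (\<lambda>t' s'. t' <= t + 2 + 3 * length (ancs nd) &
   arrs s' ''E'' = (\<lambda>k. arrs s ''E'' k + (if \<exists>n\<in>set (ancs nd). k = int z * (2 * int K) + int n then inc else 0)))"
proof -
 define J :: "nat => nat => state => bool" where "J = (\<lambda>k t' s'. t' <= t + 1 + 3 * k & vars s' ''z'' = int z & vars s' ''K'' = int K & vars s' ''inc'' = inc &
   (\<exists>m. vars s' ''n'' = int m & ancs m = drop k (ancs nd)) &
   arrs s' ''E'' = (\<lambda>j. arrs s ''E'' j + (if \<exists>n\<in>set (take k (ancs nd)). j = int z * (2 * int K) + int n then inc else 0)))"
 have pre: "run (''n'' ::= $''nd'') s t (J 0)"
 proof -
  have "J 0 t' s'" if "t' = t + 1" "arrs s' = arrs s" "vars s' = (vars s)(''n'' := int nd)" for t' :: nat and s' :: state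
   using that v unfolding J_def by auto
  then show ?thesis using ndM v by (intro run_wp) simp
 qed
 show ?thesis unfolding anc_com_def
 proof (rule run_SeqI[OF pre], rule run_for[where Inv = J and n = "length (ancs nd)"])
  fix k t2 :: nat and s2 :: state
  assume k: "k < length (ancs nd)" and I: "J k t2 s2"
  obtain m where m: "vars s2 ''n'' = int m" "ancs m = drop k (ancs nd)" using I unfolding J_def by blast
  have "ancs m \<noteq> []" using m k by simp
  then have m0: "m \<noteq> 0" by (metis ancs.simps)
  have am: "ancs m = m # ancs (m div 2)" using m0 by (subst ancs.simps) simp
  have mk: "ancs nd ! k = m" "ancs (m div 2) = drop (Suc k) (ancs nd)"
   using m(2) am k by (metis Cons_nth_drop_Suc list.inject)+
  have min: "m \<in> set (ancs nd)" using mk(1) k nth_mem by metis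
  \<comment> \<open>No node repeats on the path, so the cell still has its old value when its turn
    comes.\<close>
  have mtk: "m \<notin> set (take k (ancs nd))"
   using ancs_distinct[of nd] mk(1) k by (metis distinct_take in_set_conv_nth id_take_nth_drop not_distinct_conv_prefix take_Suc_conv_app_nth)
  have mb: "m < 2 * K" using ancs_le[OF min] v(5) by simp
  have f: "t2 <= t + 1 + 3 * k" "vars s2 ''z'' = int z" "vars s2 ''K'' = int K" "vars s2 ''inc'' = inc"
   "arrs s2 ''E'' = (\<lambda>j. arrs s ''E'' j + (if \<exists>n\<in>set (take k (ancs nd)). j = int z * (2 * int K) + int n then inc else 0))"
   using I by (simp_all add: J_def)
  define cell where "cell = int z * (2 * int K) + int m"
  have cin: "(\<exists>n\<in>set (take k (ancs nd)). cell = int z * (2 * int K) + int n) = False"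
   using mtk by (auto simp: cell_def)
  have Ec: "arrs s2 ''E'' cell = Ef K s z m" unfolding f(5) cin by (simp add: Ef_def cell_def)
  have R: "J (Suc k) t3 s3" if "t3 = t2 + 3" "arrs s3 = (arrs s2)(''E'' := (arrs s2 ''E'')(cell := Ef K s z m + inc))" "vars s3 = (vars s2)(''n'' := int (m div 2))" for t3 :: nat and s3 :: state
  proof -
   have "(arrs s2 ''E'')(cell := Ef K s z m + inc) = (\<lambda>j. arrs s ''E'' j + (if \<exists>n\<in>set (take (Suc k) (ancs nd)). j = int z * (2 * int K) + int n then inc else 0))"
   proof
    fix j
    have st: "set (take (Suc k) (ancs nd)) = insert m (set (take k (ancs nd)))" using k mk(1) by (simp add: take_Suc_conv_app_nth)
    show "((arrs s2 ''E'')(cell := Ef K s z m + inc)) j = arrs s ''E'' j + (if \<exists>n\<in>set (take (Suc k) (ancs nd)). j = int z * (2 * int K) + int n then inc else 0)"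
    proof (cases "j = cell")
     case True
     then show ?thesis unfolding st by (simp add: cell_def Ef_def)
    next
     case False
     then show ?thesis unfolding st f(5) by (auto simp: cell_def)
    qed
   qed
   then show ?thesis unfolding J_def using that f mk(2) by auto
  qed
  have md: "int m div 2 = int (m div 2)" by (simp add: zdiv_int)
  have mM: "int (m div 2) <= M" using ancs_le[OF min] ndM by (meson div_le_dividend le_trans of_nat_le_iff order_trans)
  have "run (Write ''E'' (cellE ($''z'') ($''n'')) (Read ''E'' (cellE ($''z'') ($''n'')) +. $''inc'');;
    ''n'' ::= $''n'' \<div> #2) s2 (t2 + 1) (J (Suc k))"
   using bd[OF min] mM f(2-4) m(1)
   by (intro run_wp) (simp add: cell_def[symmetric] Ec md, rule R, simp_all)
  then show "bval (evaluator_of I) s2 (Less (#0) ($''n'')) & run (Write ''E'' (cellE ($''z'') ($''n'')) (Read ''E'' (cellE ($''z'') ($''n'')) +. $''inc'');;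
    ''n'' ::= $''n'' \<div> #2) s2 (t2 + 1) (J (Suc k))" using m m0 by simp
 next
  fix t2 :: nat and s2 :: state assume I: "J (length (ancs nd)) t2 s2"
  then obtain m where m: "vars s2 ''n'' = int m" "ancs m = []" unfolding J_def by auto
  then have "m = 0" by (subst (asm) ancs.simps) (simp split: if_splits)
  then show "\<not> bval (evaluator_of I) s2 (Less (#0) ($''n'')) & t2 + 1 <= t + 2 + 3 * length (ancs nd) &
   arrs s2 ''E'' = (\<lambda>k. arrs s ''E'' k + (if \<exists>n\<in>set (ancs nd). k = int z * (2 * int K) + int n then inc else 0))"
   using I m unfolding J_def by simp
 qed auto
qed

end

section \<open>Choice of the parameters and the colouring loop\<close>

text \<open>\<open>K\<close> is a power of two so that the colour trees are complete, and it is at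
  least twice the largest set size as the potential argument demands. \<open>2 ^ lg\<close> exceeds
  \<open>2 * L * K\<close>, the bound on the exponential loads, and \<open>D\<close> is the modulus
  bound for \<open>lg\<close> items with \<open>lg\<close> bits.\<close>

definition setup_com :: com where
 "setup_com =
  ((''z'' ::= #0;; ''bm'' ::= #0);;
  While (Less ($''z'') ($''L''))
   (''d'' ::= Read ''off'' ($''z'' +. #1) -. Read ''off'' ($''z'');;
    Cond (Less ($''bm'') ($''d'')) (''bm'' ::= $''d'') Skip;;
    ''z'' ::= $''z'' +. #1);;
  ''K'' ::= #1;;
  While (Less ($''K'') (#2 *. $''bm'')) (''K'' ::= #2 *. $''K'');;
  (''lg'' ::= #1;; ''pw'' ::= #2);;
  While (Less ($''pw'') (#2 *. $''L'' *. $''K'' +. #1)) (''pw'' ::= #2 *. $''pw'';; ''lg'' ::= $''lg'' +. #1);;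
  ''D'' ::= #2 *. ($''lg'' *. $''lg'' *. $''lg'') +. #1)"

lemma frames_color2:
 "asgd desc_com = {''nd'', ''p'', ''sr'', ''sl'', ''nd''}" "wrtn desc_com = {}"
 "asgd upd_com = {''p'', ''k'', ''n'', ''inc'', ''z'', ''p''}" "wrtn upd_com = {''h2'', ''nx2'', ''E''}"
 by (simp_all add: desc_com_def upd_com_def frames_color)

context kp
begin

definition bkt :: "state => nat => nat => nat => nat list => bool" where
 "bkt s K z c l \<longleftrightarrow> (\<exists>qs. chn (arrs s ''nx2'') (arrs s ''h2'' (int z * int K + int c)) qs & map (\<lambda>q. pS (q - 1)) qs = l &
   (\<forall>q\<in>set qs. 1 <= q & q <= NN & zo (q - 1) = z))"

lemma capK_D6: "capK K ==> 8 * int L * int K + 8 <= M"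
proof -
 assume h: "capK K"
 have e: "8 * (int L + 2) * (int L + 2) * (int K + 2) = 8 * (int L * int L * int K) + 16 * (int L * int L) + 32 * (int L * int K) + 64 * int L + 32 * int K + 64"
  by (simp add: algebra_simps)
 have nn: "0 <= int L * int L * int K" "0 <= int L * int L" "0 <= int L * int K" by simp_all
 show ?thesis using h[unfolded capK_def e] nn by linarith
qed

lemma upd_run:
 assumes x: "ixd NN s" and w: "1 <= w" "w < L" "vars s ''w'' = int w" and K: "vars s ''K'' = int K" "capK K" "K = 2 ^ H" and c0: "c0 < K" "vars s ''nd'' = int (K + c0)"
  and E: "\<And>z n. z < L ==> 1 <= n ==> n < 2 * K ==> 0 <= Ef K s z n & Ef K s z n <= 2 * int L * int K"
  and bk: "\<And>z c. z < L ==> c < K ==> bkt s K z c (wl cl w z c)"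
 shows "run upd_com s t (\<lambda>t' s'. t' <= t + 2 + (3 * H + 20) * length (zs w) &
   (\<forall>z n. z < L --> 1 <= n --> n < 2 * K --> Ef K s' z n = Ef K s z n + (if w \<in> allowed I z & n \<in> set (ancs (K + c0)) then Ef K s z (K + c0) + 1 else 0)) &
   (\<forall>z<L. \<forall>c<K. bkt s' K z c (wl (cl(w := c0)) (Suc w) z c)))"
  (is "run _ _ _ ?post")
proof -
 let ?c1 = "(''k'' ::= $''z'' *. $''K'' +. ($''nd'' -. $''K'');; Write ''nx2'' ($''p'') (Read ''h2'' ($''k''));; Write ''h2'' ($''k'') ($''p'');; ''p'' ::= Read ''nx'' ($''p''))"
 have c00: "chn (arrs s ''nx'') (ar s ''hd'' w) (lst w)" using x w by (simp add: ixd_def lst_def occ_def)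
 have al: "length (ancs (K + c0)) <= H + 1" using ancs_length[of "K + c0" "H + 1"] c0 K(3) by simp
 have ar: "1 <= n & n < 2 * K" if "n \<in> set (ancs (K + c0))" for n using ancs_le[OF that] c0 by simp
 define J :: "nat => nat => state => bool" where "J = (\<lambda>k t' s'. t' <= t + 1 + (3 * H + 20) * k &
   vars s' ''K'' = int K & vars s' ''nd'' = int (K + c0) & arrs s' ''nx'' = arrs s ''nx'' & arrs s' ''ow'' = arrs s ''ow'' &
   chn (arrs s ''nx'') (vars s' ''p'') (drop k (lst w)) &
   (\<forall>z n. z < L --> 1 <= n --> n < 2 * K --> Ef K s' z n = Ef K s z n + (if z \<in> set (take k (zs w)) & n \<in> set (ancs (K + c0)) then Ef K s z (K + c0) + 1 else 0)) &
   (\<forall>z<L. \<forall>c<K. bkt s' K z c (if z \<in> set (take k (zs w)) & c = c0 then w # wl cl w z c else wl cl w z c)))"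
 have JI: "J k t' s'" if "t' <= t + 1 + (3 * H + 20) * k" "vars s' ''K'' = int K" "vars s' ''nd'' = int (K + c0)" "arrs s' ''nx'' = arrs s ''nx''" "arrs s' ''ow'' = arrs s ''ow''"
   "chn (arrs s ''nx'') (vars s' ''p'') (drop k (lst w))"
   "\<And>z n. z < L ==> 1 <= n ==> n < 2 * K ==> Ef K s' z n = Ef K s z n + (if z \<in> set (take k (zs w)) & n \<in> set (ancs (K + c0)) then Ef K s z (K + c0) + 1 else 0)"
   "\<And>z c. z < L ==> c < K ==> bkt s' K z c (if z \<in> set (take k (zs w)) & c = c0 then w # wl cl w z c else wl cl w z c)" for k t' :: nat and s' :: state
  unfolding J_def using that by blast
 have pre: "run (''p'' ::= Read ''hd'' ($''w'')) s t (J 0)"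
 proof -
  have P0: "J 0 t' s'" if "t' = t + 1" "arrs s' = arrs s" "vars s' = (vars s)(''p'' := ar s ''hd'' w)" for t' :: nat and s' :: state
   by (rule JI) (use that K c0 c00 bk in \<open>simp_all add: Ef_def bkt_def\<close>)
  show ?thesis using w BdD(2)[of s "''hd''" "int w"] by (intro run_wp) (simp, rule P0, simp_all)
 qed
 show ?thesis unfolding upd_com_def
 proof (rule run_SeqI[OF pre], rule run_for[where Inv = J and n = "length (lst w)"])
  fix k t2 :: nat and s2 :: state
  assume k: "k < length (lst w)" and I: "J k t2 s2"
  have f: "t2 <= t + 1 + (3 * H + 20) * k" "vars s2 ''K'' = int K" "vars s2 ''nd'' = int (K + c0)" "arrs s2 ''nx'' = arrs s ''nx''" "arrs s2 ''ow'' = arrs s ''ow''"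
   "chn (arrs s ''nx'') (vars s2 ''p'') (drop k (lst w))"
   "\<And>z n. z < L ==> 1 <= n ==> n < 2 * K ==> Ef K s2 z n = Ef K s z n + (if z \<in> set (take k (zs w)) & n \<in> set (ancs (K + c0)) then Ef K s z (K + c0) + 1 else 0)"
   "\<And>z c. z < L ==> c < K ==> bkt s2 K z c (if z \<in> set (take k (zs w)) & c = c0 then w # wl cl w z c else wl cl w z c)"
   using I unfolding J_def by blast+
  obtain p where p: "lst w ! k = Suc p" "p < NN" "pS p = w" "zs w ! k = zo p" using lst_nth[OF k] by blast
  have kz: "k < length (zs w)" using k len_lst by simp
  define z where "z = zo p"
  have zL: "z < L" using zo_props[OF p(2)] by (simp add: z_def)
  have zn: "z \<notin> set (take k (zs w))"
   using zs_props(1)[of w] p(4) kz unfolding z_def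
   by (metis distinct_take in_set_conv_nth not_distinct_conv_prefix take_Suc_conv_app_nth)
  have ch: "vars s2 ''p'' = int (Suc p)" "chn (arrs s ''nx'') (ar s ''nx'' (Suc p)) (drop (Suc k) (lst w))"
   using chn_drop[OF f(6) k] p by auto
  have ow: "ar s ''ow'' (Suc p) = int z" using x p w by (simp add: ixd_def add.commute z_def)
  have tk: "set (take (Suc k) (zs w)) = insert z (set (take k (zs w)))" using kz p by (simp add: take_Suc_conv_app_nth z_def)
  have Ez: "Ef K s2 z n = Ef K s z n" if "1 <= n" "n < 2 * K" for n using f(7)[OF zL that] zn by simp
  define inc where "inc = Ef K s z (K + c0) + 1"
  have rd: "arrs s2 ''E'' (int z * (2 * int K) + (int K + int c0)) = Ef K s z (K + c0)" using Ez[of "K + c0"] c0 by (simp add: Ef_def)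
  have incb: "0 <= inc" "inc <= 2 * int L * int K + 1" using E[OF zL, of "K + c0"] c0 by (auto simp: inc_def)
  have LK: "8 * int L * int K + 8 <= M" using capK_D6[OF K(2)] .
  have LKn: "0 <= int L * int K" by simp
  have zM: "int z <= M" "int (K + c0) <= M" "inc <= M" using capK_D(2,3)[OF K(2)] zL c0 incb LK LKn by auto
  let ?A3 = "\<lambda>k. arrs s2 ''E'' k + (if \<exists>n\<in>set (ancs (K + c0)). k = int z * (2 * int K) + int n then inc else 0)"
  have b1: "run (''z'' ::= Read ''ow'' ($''p'');; ''inc'' ::= Read ''E'' (cellE ($''z'') ($''nd'')) +. #1) s2 (t2 + 1)
    (\<lambda>t' s'. t' = t2 + 3 & arrs s' = arrs s2 & vars s' = (vars s2)(''z'' := int z, ''inc'' := inc))"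
   using zM incb by (intro run_wp) (simp add: f(2,3,5) ch(1) ow[simplified] rd inc_def)
  have step: "run ((''z'' ::= Read ''ow'' ($''p'');; ''inc'' ::= Read ''E'' (cellE ($''z'') ($''nd'')) +. #1);;
    anc_com;;
    ?c1) s2 (t2 + 1) (J (Suc k))"
  proof (rule run_SeqI[OF b1])
   fix t3 :: nat and s3 :: state
   assume a3: "t3 = t2 + 3 & arrs s3 = arrs s2 & vars s3 = (vars s2)(''z'' := int z, ''inc'' := inc)"
   have AR: "run anc_com s3 t3 (\<lambda>t' s'. t' <= t3 + 2 + 3 * length (ancs (K + c0)) &
     arrs s' ''E'' = (\<lambda>k. arrs s3 ''E'' k + (if \<exists>n\<in>set (ancs (K + c0)). k = int z * (2 * int K) + int n then inc else 0)))"
   proof (rule anc_run)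
    fix n assume n: "n \<in> set (ancs (K + c0))"
    have "Ef K s3 z n = Ef K s z n" using Ez ar[OF n] a3 by (simp add: Ef_def)
    then show "\<bar>Ef K s3 z n + inc\<bar> <= M" using E[OF zL] ar[OF n] incb LK LKn by fastforce
   qed (use a3 f zM c0 in simp_all)
   show "run (anc_com;; ?c1) s3 t3 (J (Suc k))"
   proof (rule run_SeqI[OF AR])
    fix t4 :: nat and s4 :: state
    assume a4: "t4 <= t3 + 2 + 3 * length (ancs (K + c0)) &
      arrs s4 ''E'' = (\<lambda>k. arrs s3 ''E'' k + (if \<exists>n\<in>set (ancs (K + c0)). k = int z * (2 * int K) + int n then inc else 0))"
     and fv: "\<And>v. v \<notin> asgd anc_com ==> vars s4 v = vars s3 v" and fa: "\<And>a. a \<notin> wrtn anc_com ==> arrs s4 a = arrs s3 a"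
    have v4: "vars s4 ''z'' = int z" "vars s4 ''K'' = int K" "vars s4 ''nd'' = int K + int c0" "vars s4 ''p'' = int (Suc p)"
     using fv a3 f ch(1) by (simp_all add: frames_color)
    have A4: "arrs s4 ''nx2'' = arrs s2 ''nx2''" "arrs s4 ''h2'' = arrs s2 ''h2''" "arrs s4 ''nx'' = arrs s ''nx''" "arrs s4 ''ow'' = arrs s ''ow''"
     using fa a3 f by (simp_all add: frames_color)
    have E4: "arrs s4 ''E'' = ?A3" using a4 a3 by simp
    define cell where "cell = int z * int K + int c0"
    have cellM: "\<bar>cell\<bar> <= M"
    proof -
     have "int z * int K <= int L * int K" using zL by (intro mult_right_mono) auto
     then have "cell <= M" using capK_D(5)[OF K(2)] c0(1) unfolding cell_def by linarith
     moreover have "0 <= cell" by (simp add: cell_def)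
     ultimately show ?thesis by simp
    qed
    have R: "J (Suc k) t5 s5" if "t5 = t4 + 4" "vars s5 = (vars s4)(''k'' := cell, ''p'' := ar s ''nx'' (Suc p))"
     "arrs s5 = (arrs s4)(''nx2'' := (arrs s2 ''nx2'')(int (Suc p) := arrs s2 ''h2'' cell), ''h2'' := (arrs s2 ''h2'')(cell := int (Suc p)))" for t5 :: nat and s5 :: state
    proof (rule JI)
     show "t5 <= t + 1 + (3 * H + 20) * Suc k" using that(1) a4 a3 f(1) al by simp
     show "chn (arrs s ''nx'') (vars s5 ''p'') (drop (Suc k) (lst w))" using ch(2) that by simp
     fix z' n assume z': "z' < L" "1 <= n" "n < 2 * K"
     have cl: "(\<exists>n'\<in>set (ancs (K + c0)). int z' * (2 * int K) + int n = int z * (2 * int K) + int n') \<longleftrightarrow> z' = z & n \<in> set (ancs (K + c0))"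
      using cell_inj[of n "2 * K" _ z' z] ar z' by auto
     have "Ef K s5 z' n = Ef K s2 z' n + (if z' = z & n \<in> set (ancs (K + c0)) then inc else 0)"
      using that(3) cl by (simp add: Ef_def E4)
     then show "Ef K s5 z' n = Ef K s z' n + (if z' \<in> set (take (Suc k) (zs w)) & n \<in> set (ancs (K + c0)) then Ef K s z' (K + c0) + 1 else 0)"
      using f(7)[OF z'] zn unfolding tk by (auto simp: inc_def)
    next
     fix z' c assume z': "z' < L" "c < K"
     let ?l = "if z' \<in> set (take k (zs w)) & c = c0 then w # wl cl w z' c else wl cl w z' c"
     obtain qs where qs: "chn (arrs s2 ''nx2'') (arrs s2 ''h2'' (int z' * int K + int c)) qs" "map (\<lambda>q. pS (q - 1)) qs = ?l"
       "\<forall>q\<in>set qs. 1 <= q & q <= NN & zo (q - 1) = z'"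
      using f(8)[OF z'] unfolding bkt_def by blast
     \<comment> \<open>The bucket so far holds only items below \<open>w\<close>, whereas position
       \<open>p\<close> holds \<open>w\<close>. Reusing \<open>p\<close> as a list node is therefore
       safe.\<close>
     have np: "Suc p \<notin> set qs"
     proof
      assume a: "Suc p \<in> set qs"
      then have zz: "z' = z" using qs(3) z_def by fastforce
      then have "pS (Suc p - 1) \<in> set (wl cl w z' c)" using qs(2) a zn by (metis image_eqI list.set_map)
      then show False using p by (auto simp: wl_def)
     qed
     have ce: "int z' * int K + int c = cell \<longleftrightarrow> z' = z & c = c0" unfolding cell_def using cell_inj[of c K c0 z' z] z' c0 by simp
     show "bkt s5 K z' c (if z' \<in> set (take (Suc k) (zs w)) & c = c0 then w # wl cl w z' c else wl cl w z' c)"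
     proof (cases "z' = z & c = c0")
      case True
      have "chn (arrs s5 ''nx2'') (arrs s5 ''h2'' (int z' * int K + int c)) (Suc p # qs)"
       using that(3) ce True qs(1) np by (simp add: chn_upd del: of_nat_Suc)
      moreover have "map (\<lambda>q. pS (q - 1)) (Suc p # qs) = w # wl cl w z' c" using qs(2) p zn True by simp
      moreover have "\<forall>q\<in>set (Suc p # qs). 1 <= q & q <= NN & zo (q - 1) = z'" using qs(3) p True z_def by auto
      moreover have "(if z' \<in> set (take (Suc k) (zs w)) & c = c0 then w # wl cl w z' c else wl cl w z' c) = w # wl cl w z' c" using True tk by simp
      ultimately show ?thesis unfolding bkt_def by metis
     next
      case False
      have "chn (arrs s5 ''nx2'') (arrs s5 ''h2'' (int z' * int K + int c)) qs"
       using that(3) ce False qs(1) np by (simp add: chn_upd del: of_nat_Suc)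
      moreover have "(if z' \<in> set (take (Suc k) (zs w)) & c = c0 then w # wl cl w z' c else wl cl w z' c) = ?l" using False tk by auto
      ultimately show ?thesis unfolding bkt_def using qs(2,3) by auto
     qed
    qed (use that v4 A4 in simp_all)
    have pM: "\<bar>int (Suc p)\<bar> <= M" if "Bd M s4" using BdD(1)[OF that, of "''p''"] v4 by simp
    show "run ?c1 s4 t4 (J (Suc k))"
     using cellM pM BdD(2)[of s4 "''h2''" cell] BdD(2)[of s4 "''nx''" "int (Suc p)"]
     by (intro run_wp) (simp add: v4 A4 cell_def[symmetric] del: of_nat_Suc, rule R, simp_all add: A4 fun_upd_twist del: of_nat_Suc)
   qed
  qed
  then show "bval (evaluator_of I) s2 (BNot (Equal ($''p'') (#0))) & run ((''z'' ::= Read ''ow'' ($''p'');; ''inc'' ::= Read ''E'' (cellE ($''z'') ($''nd'')) +. #1);;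
    anc_com;;
    ?c1) s2 (t2 + 1) (J (Suc k))" using ch(1) by simp
 next
  fix t2 :: nat and s2 :: state assume I: "J (length (lst w)) t2 s2"
  have tk: "set (take (length (lst w)) (zs w)) = {z. z < L & w \<in> allowed I z}" using len_lst zs_props(2) by simp
  show "\<not> bval (evaluator_of I) s2 (BNot (Equal ($''p'') (#0))) & ?post (t2 + 1) s2"
   using I len_lst unfolding J_def tk wl_Suc[OF w(1)] by auto
 qed auto
qed

lemma color_run:
 assumes x: "ixd NN s" "inA s" and K: "vars s ''K'' = int K" "capK K" "K = 2 ^ H" "2 * b <= K" and b: "\<And>z. z < L ==> card (allowed I z) <= b"
  and z0: "\<And>k. arrs s ''E'' k = 0" "\<And>k. arrs s ''h2'' k = 0"
 shows "run color_com s t (\<lambda>t' s'. t' <= t + 20 * (H + 2) * (NN + L + 1) & (\<exists>cl E. colst K b E cl L & (\<forall>u. cl u < K) & (\<forall>z<L. \<forall>c<K. bkt s' K z c (wl cl L z c))))"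
proof -
 have K1: "K \<ge> 1" using K by simp
 \<comment> \<open>\<open>20 * (H + 1)\<close> units for each occurrence of an item and the same
   once for the item itself; all occurrences together number at most \<open>NN\<close>.\<close>
 define A where "A k = 1 + (\<Sum>u<Suc k. (length (occ u) + 1)) * (20 * (H + 1))" for k
 define J :: "nat => nat => state => bool" where "J = (\<lambda>k t' s'. t' <= t + A k & ixd NN s' & vars s' ''w'' = int (Suc k) & vars s' ''K'' = int K & vars s' ''L'' = int L &
   (\<exists>cl. colst K b (Ef K s') cl (Suc k) & (\<forall>u. cl u < K) & (\<forall>z<L. \<forall>c<K. bkt s' K z c (wl cl (Suc k) z c))))"
 have pre: "run (''w'' ::= #1) s t (J 0)"
 proof -
  have P0: "J 0 t' s'" if s': "t' = t + 1" "arrs s' = arrs s" "vars s' = (vars s)(''w'' := 1)" for t' :: nat and s' :: state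
  proof -
   have "colst K b (Ef K s') (\<lambda>_. 0) 1" by (rule colst_init) (use s' z0 K1 b in \<open>simp_all add: Ef_def\<close>)
   moreover have "bkt s' K z c (wl (\<lambda>_. 0) 1 z c)" for z c unfolding bkt_def using s' z0 by (intro exI[of _ "[]"]) (simp add: wl_def)
   ultimately show ?thesis unfolding J_def using s' x K1 K(1) by (intro conjI exI[of _ "\<lambda>_. 0"]) (simp_all add: A_def ixd_def inA_def)
  qed
  show ?thesis using M16 by (intro run_wp) (simp, rule P0, simp_all)
 qed
 show ?thesis unfolding color_com_def
 proof (rule run_SeqI[OF pre], rule run_for[where Inv = J and n = "L - 1"])
  fix k t2 :: nat and s2 :: state
  assume k: "k < L - 1" and I: "J k t2 s2"
  define w where "w = Suc k"
  have w: "1 <= w" "w < L" using k by (auto simp: w_def)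
  obtain cl where cl: "colst K b (Ef K s2) cl w" "\<And>u. cl u < K" "\<And>z c. z < L ==> c < K ==> bkt s2 K z c (wl cl w z c)"
   using I unfolding J_def w_def by blast
  have f: "t2 <= t + A k" "ixd NN s2" "vars s2 ''w'' = int w" "vars s2 ''K'' = int K" "vars s2 ''L'' = int L" using I by (simp_all add: J_def w_def)
  have tr: "tree K (Ef K s2 z) (\<lambda>c. length (wl cl w z c))" if "z < L" for z using cl(1) that by (simp add: colst_def)
  have root: "Ef K s2 z 1 <= 2 * int L * int K" if "z < L" for z using colst_root[OF cl(1) K1 that b] by simp
  have Ebd: "0 <= Ef K s2 z n & Ef K s2 z n <= 2 * int L * int K" if "z < L" "1 <= n" "n < 2 * K" for z n
   using tree_nonneg[OF tr[OF that(1)] that(2,3)] tree_le_root[OF tr[OF that(1)] that(2,3)] root[OF that(1)] by simp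
  have AS: "A (Suc k) = A k + (length (zs w) + 1) * (20 * (H + 1))"
   by (simp add: A_def w_def zs_def add_mult_distrib)
  have "run (desc_com;; upd_com;; ''w'' ::= $''w'' +. #1) s2 (t2 + 1) (J (Suc k))"
  proof (rule run_SeqI[OF desc_run[OF f(2) w(2) f(3,4) K(2,3) tr root]])
   fix t3 :: nat and s3 :: state
   assume a3: "t3 <= t2 + 1 + 2 + (4 * length (zs w) + 8) * H & (\<exists>c<K. vars s3 ''nd'' = int (K + c) &
     int K * (\<Sum>z | z < L & w \<in> allowed I z. Ef K s2 z (K + c)) <= (\<Sum>z | z < L & w \<in> allowed I z. Ef K s2 z 1))"
    and fv: "\<And>v. v \<notin> asgd desc_com ==> vars s3 v = vars s2 v" and fa: "\<And>a. a \<notin> wrtn desc_com ==> arrs s3 a = arrs s2 a"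
   obtain c0 where c0: "c0 < K" "vars s3 ''nd'' = int (K + c0)" "int K * (\<Sum>z | z < L & w \<in> allowed I z. Ef K s2 z (K + c0)) <= (\<Sum>z | z < L & w \<in> allowed I z. Ef K s2 z 1)"
    using a3 by blast
   have A3: "arrs s3 = arrs s2" using fa by (auto simp: frames_color2 fun_eq_iff)
   have E3: "Ef K s3 = Ef K s2" using A3 by (simp add: Ef_def fun_eq_iff)
   have v3: "vars s3 ''w'' = int w" "vars s3 ''K'' = int K" "vars s3 ''L'' = int L" using fv f by (simp_all add: frames_color2)
   have x3: "ixd NN s3" using f(2) A3 by (simp add: ixd_def)
   have bk3: "bkt s3 K z c (wl cl w z c)" if "z < L" "c < K" for z c using cl(3)[OF that] A3 by (simp add: bkt_def)
   show "run (upd_com;; ''w'' ::= $''w'' +. #1) s3 t3 (J (Suc k))"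
   proof (rule run_SeqI[OF upd_run[OF x3 w v3(1,2) K(2,3) c0(1,2), unfolded E3, OF Ebd bk3]])
    fix t4 :: nat and s4 :: state
    assume a4: "t4 <= t3 + 2 + (3 * H + 20) * length (zs w) &
     (\<forall>z n. z < L --> 1 <= n --> n < 2 * K --> Ef K s4 z n = Ef K s2 z n + (if w \<in> allowed I z & n \<in> set (ancs (K + c0)) then Ef K s2 z (K + c0) + 1 else 0)) &
     (\<forall>z<L. \<forall>c<K. bkt s4 K z c (wl (cl(w := c0)) (Suc w) z c))"
     and fv4: "\<And>v. v \<notin> asgd upd_com ==> vars s4 v = vars s3 v" and fa4: "\<And>a. a \<notin> wrtn upd_com ==> arrs s4 a = arrs s3 a"
    have cs: "colst K b (Ef K s4) (cl(w := c0)) (Suc w)"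
     by (rule colst_step[OF cl(1) K(4) K1 w c0(1) b _ c0(3)]) (use a4 in auto)
    have v4: "vars s4 ''w'' = int w" "vars s4 ''K'' = int K" "vars s4 ''L'' = int L" using fv4 v3 by (simp_all add: frames_color2)
    have x4: "ixd NN s4" using x3 fa4 by (simp add: ixd_def frames_color2)
    have tm: "t4 + 1 <= t + A (Suc k)"
    proof -
     have "t4 + 1 <= t2 + 6 + (4 * length (zs w) + 8) * H + (3 * H + 20) * length (zs w)" using a4 a3 by simp
     also have "\<dots> <= t2 + (length (zs w) + 1) * (20 * (H + 1))" by (simp add: algebra_simps)
     also have "\<dots> <= t + A (Suc k)" using f(1) AS by simp
     finally show ?thesis .
    qed
    have R: "J (Suc k) t5 s5" if s5: "t5 = t4 + 1" "arrs s5 = arrs s4" "vars s5 = (vars s4)(''w'' := int w + 1)" for t5 :: nat and s5 :: state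
    proof -
     have "colst K b (Ef K s5) (cl(w := c0)) (Suc (Suc k))" using cs s5 by (simp add: Ef_def[abs_def] w_def)
     moreover have "\<forall>z<L. \<forall>c<K. bkt s5 K z c (wl (cl(w := c0)) (Suc (Suc k)) z c)" using a4 s5 unfolding bkt_def w_def by simp
     ultimately show ?thesis unfolding J_def using s5 tm x4 v4 cl(2) c0(1)
      by (intro conjI exI[of _ "cl(w := c0)"]) (simp_all add: ixd_def w_def)
    qed
    have "int w + 1 <= M" using w capK_D(3)[OF K(2)] by simp
    then show "run (''w'' ::= $''w'' +. #1) s4 t4 (J (Suc k))"
     using v4(1) by (intro run_wp) (simp, rule R, simp_all)
   qed
  qed
  then show "bval (evaluator_of I) s2 (Less ($''w'') ($''L'')) & run (desc_com;; upd_com;; ''w'' ::= $''w'' +. #1) s2 (t2 + 1) (J (Suc k))"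
   using f w by simp
 next
  fix t2 :: nat and s2 :: state assume I: "J (L - 1) t2 s2"
  have L: "Suc (L - 1) = L" using len1 by simp
  have "(\<Sum>u<L. (length (occ u) + 1)) <= NN + L" using occ_length_sum[of L] sum.distrib[of "\<lambda>u. length (occ u)" "\<lambda>_. 1" "{..<L}"] by simp
  then have "(\<Sum>u<L. (length (occ u) + 1)) * (20 * (H + 1)) <= (NN + L) * (20 * (H + 1))" by (rule mult_le_mono1)
  then have "A (L - 1) + 1 <= 20 * (H + 2) * (NN + L + 1)" unfolding A_def L by (simp add: algebra_simps)
  then show "\<not> bval (evaluator_of I) s2 (Less ($''w'') ($''L'')) & t2 + 1 <= t + 20 * (H + 2) * (NN + L + 1) &
    (\<exists>cl E. colst K b E cl L & (\<forall>u. cl u < K) & (\<forall>z<L. \<forall>c<K. bkt s2 K z c (wl cl L z c)))"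
   using I unfolding J_def L by auto
 qed auto
qed

end

locale kb = kp I W M ss for I W M ss +
 fixes bb :: nat
 assumes bb1: "1 <= bb" and bbc: "\<And>z. z < L ==> card (allowed I z) <= bb"
  and MZ: "int ((32 * len I * bb + 32) ^ 20) <= M"
begin

text \<open>All counters and addresses are polynomials in \<open>L\<close> and \<open>bb\<close>.
  Measured in powers of \<open>ZZ\<close>, their constant factors are absorbed, and staying within
  words becomes a comparison of exponents with 20.\<close>

definition "ZZ = 32 * L * bb + 32"

lemma ZM: "x <= ZZ ^ k ==> k <= 20 ==> int x <= M"
proof -
 assume "x <= ZZ ^ k" "k <= 20"
 moreover have "ZZ ^ k <= ZZ ^ 20" if "k <= 20" using that by (intro power_increasing) (auto simp: ZZ_def)
 ultimately have "x <= ZZ ^ 20" by simp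
 then have "int x <= int (ZZ ^ 20)" by (simp only: of_nat_le_iff)
 then show ?thesis using MZ unfolding ZZ_def by linarith
qed

lemma Z_mult: "a <= ZZ ^ i ==> b <= ZZ ^ j ==> a * b <= ZZ ^ (i + j)"
 by (simp add: power_add mult_le_mono)

lemma L_bb: "L <= L * bb" "bb <= L * bb" using bb1 len1 by auto

lemma Z_basic: "L + 2 <= ZZ" "4 * bb + 2 <= ZZ" "32 * (L * bb) + 32 <= ZZ" "32 <= ZZ"
proof -
 have e: "ZZ = 32 * (L * bb) + 32" by (simp add: ZZ_def)
 show "L + 2 <= ZZ" "4 * bb + 2 <= ZZ" "32 * (L * bb) + 32 <= ZZ" "32 <= ZZ" using L_bb e by linarith+
qed

lemma oz_le: "z <= L ==> oz z <= bb * z"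
proof (induction z)
 case (Suc z)
 have "oz (Suc z) = oz z + card (allowed I z)" using allowed_card[of z] oz_mono[of z "Suc z"] Suc.prems by simp
 then show ?case using Suc bbc[of z] by simp
qed (simp add: oz_0)

lemma NN_le: "NN <= L * bb" using oz_le[of L] oz_L by (simp add: mult.commute)

lemma capK_ok: "K <= 4 * bb ==> capK K"
proof -
 assume K: "K <= 4 * bb"
 have "8 * (L + 2) * (L + 2) * (K + 2) <= ZZ * ZZ * ZZ * ZZ"
  using Z_basic K by (intro mult_le_mono) auto
 then have "8 * (L + 2) * (L + 2) * (K + 2) <= ZZ ^ 4" by (simp add: power4_eq_xxxx)
 then have "int (8 * (L + 2) * (L + 2) * (K + 2)) <= M" by (rule ZM) simp
 then show ?thesis by (simp add: capK_def algebra_simps)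
qed

text \<open>\<open>b\<close> bounds the set sizes as found by the program and may be 0, in contrast
  to \<open>bb\<close>. The lower bound on \<open>K\<close> serves the potential, its upper bound
  the running time; the upper bound on \<open>2 ^ lg\<close> makes \<open>lg\<close>
  logarithmic.\<close>

definition params :: "nat => nat => nat => nat => bool" where
 "params b H K lg \<longleftrightarrow> (\<forall>z<L. card (allowed I z) <= b) & b <= bb & K = 2 ^ H & 2 * b <= K & K <= 4 * bb & 2 * L * K < 2 ^ lg & 2 ^ lg <= 4 * L * K & H <= lg"

lemma params_lg: "params b H K lg ==> lg <= ZZ & 2 ^ lg <= ZZ"
proof -
 assume p: "params b H K lg"
 have "2 ^ lg <= 4 * L * K" using p unfolding params_def by blast
 also have "\<dots> <= 4 * L * (4 * bb)" using p by (intro mult_le_mono) (auto simp: params_def)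
 also have "\<dots> <= ZZ" using Z_basic(3) by simp
 finally have 1: "2 ^ lg <= ZZ" .
 then show ?thesis using less_exp[of lg] by linarith
qed

lemma setup_run:
 assumes inA: "inA s"
 shows "run setup_com s t (\<lambda>t' s'. \<exists>b H K lg. params b H K lg & t' <= t + 20 * (L + lg + 1) & vars s' ''K'' = int K & vars s' ''lg'' = int lg &
   vars s' ''D'' = int (2 * (lg * lg * lg) + 1))"
  (is "run _ _ _ ?post")
proof -
 let ?c2 = "(''pw'' ::= #2 *. $''pw'';; ''lg'' ::= $''lg'' +. #1)"
 let ?c1 = "(''d'' ::= Read ''off'' ($''z'' +. #1) -. Read ''off'' ($''z'');; Cond (Less ($''bm'') ($''d'')) (''bm'' ::= $''d'') Skip;; ''z'' ::= $''z'' +. #1)"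
 have LM: "4 * int L + 8 <= M" "8 * int bb + 8 <= M" "16 * int L * int bb + 32 <= M"
 proof -
  have "16 * (L * bb) + 4 * L + 8 * bb + 32 <= ZZ ^ 1" using Z_basic(3) L_bb unfolding power_one_right by linarith
  then have h: "int (16 * (L * bb) + 4 * L + 8 * bb + 32) <= M" by (rule ZM) simp
  have n: "0 <= int L * int bb" by simp
  show "4 * int L + 8 <= M" "8 * int bb + 8 <= M" "16 * int L * int bb + 32 <= M" using h n unfolding of_nat_add of_nat_mult of_nat_numeral mult.assoc by linarith+
 qed
 define J1 :: "nat => nat => state => bool" where "J1 = (\<lambda>k t' s'. t' <= t + 2 + 5 * k & inA s' & vars s' ''z'' = int k &
   (\<exists>b\<le>bb. vars s' ''bm'' = int b & (\<forall>z<k. card (allowed I z) <= b)))"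
 have inA_fr: "inA s''" if "inA s'" "arrs s'' = arrs s'" "vars s'' ''L'' = vars s' ''L''" for s' s'' using that by (simp add: inA_def)
 have pre: "run (''z'' ::= #0;; ''bm'' ::= #0) s t (J1 0)"
 proof -
  have P0: "J1 0 t' s'" if "t' = t + 2" "arrs s' = arrs s" "vars s' = (vars s)(''z'' := 0, ''bm'' := 0)" for t' :: nat and s' :: state
   using that inA_fr[OF inA, of s'] by (simp add: J1_def)
  show ?thesis using M16 by (intro run_wp) (simp, rule P0, simp_all)
 qed
 have W1: "run (While (Less ($''z'') ($''L''))
   ?c1) s1 t1 (\<lambda>t' s'. J1 L (t' - 1) s' & 1 <= t')" if "J1 0 t1 s1" for s1 :: state and t1 :: nat
 proof (rule run_for[where Inv = J1 and n = L, OF _ _ that])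
  fix k t2 :: nat and s2 :: state
  assume k: "k < L" and I: "J1 k t2 s2"
  obtain b where b: "b <= bb" "vars s2 ''bm'' = int b" "\<forall>z<k. card (allowed I z) <= b" using I unfolding J1_def by blast
  have f: "t2 <= t + 2 + 5 * k" "inA s2" "vars s2 ''z'' = int k" "vars s2 ''L'' = int L" using I by (auto simp: J1_def inA_def)
  have o: "arrs s2 ''off'' (int k + 1) = int (oz (Suc k))" "ar s2 ''off'' k = int (oz k)" using inA_off[OF f(2) k] f(2) k by (auto simp: inA_def)
  have d: "int (oz (Suc k)) - int (oz k) = int (card (allowed I k))" using allowed_card[OF k] oz_mono[of k "Suc k"] by simp
  have R: "J1 (Suc k) t3 s3" if "t3 <= t2 + 5" "arrs s3 = arrs s2" "vars s3 ''z'' = int k + 1" "vars s3 ''L'' = vars s2 ''L''" "vars s3 ''bm'' = int (max b (card (allowed I k)))" for t3 :: nat and s3 :: state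
   unfolding J1_def using that f(1) inA_fr[OF f(2), of s3] b bbc[OF k] by (intro conjI exI[of _ "max b (card (allowed I k))"]) (auto simp: less_Suc_eq)
  have "run ?c1 s2 (t2 + 1) (J1 (Suc k))"
  proof (cases "b < card (allowed I k)")
   case True
   then show ?thesis using LM bbc[OF k] k b(2) f(3) o d by (intro run_wp) (simp, rule R, simp_all)
  next
   case False
   then show ?thesis using LM bbc[OF k] k b(2) f(3) o d by (intro run_wp) (simp, rule R, simp_all)
  qed
  then show "bval (evaluator_of I) s2 (Less ($''z'') ($''L'')) & run ?c1 s2 (t2 + 1) (J1 (Suc k))" using f k by simp
 next
  fix t2 :: nat and s2 :: state assume I: "J1 L t2 s2"
  then have "inA s2" "vars s2 ''z'' = int L" by (simp_all add: J1_def)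
  then show "\<not> bval (evaluator_of I) s2 (Less ($''z'') ($''L'')) & J1 L (t2 + 1 - 1) s2 & 1 <= t2 + 1" using I by (simp add: inA_def)
 qed auto
 show ?thesis unfolding setup_com_def
 proof (rule run_SeqI[OF pre], rule run_SeqI[OF W1], assumption)
  fix t1 :: nat and s1 :: state
  assume j1: "J1 L (t1 - 1) s1 & 1 <= t1"
  then obtain b where b: "b <= bb" "vars s1 ''bm'' = int b" "\<forall>z<L. card (allowed I z) <= b" unfolding J1_def by blast
  have f1: "t1 <= t + 3 + 5 * L" "inA s1" using j1 by (auto simp: J1_def)
  define J2 :: "nat => state => bool" where "J2 = (\<lambda>t' s'. inA s' & vars s' ''bm'' = int b & (\<exists>H. t' <= t + 4 + 5 * L + 2 * H & vars s' ''K'' = 2 ^ H & 2 ^ H <= 4 * bb))"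
  have pK: "run (''K'' ::= #1) s1 t1 J2"
  proof -
   have P0: "J2 t' s'" if "t' = t1 + 1" "arrs s' = arrs s1" "vars s' = (vars s1)(''K'' := 1)" for t' :: nat and s' :: state
    unfolding J2_def using that f1 inA_fr[OF f1(2), of s'] b bb1 by (intro conjI exI[of _ 0]) simp_all
   show ?thesis using M16 by (intro run_wp) (simp, rule P0, simp_all)
  qed
  define K2 :: "nat => state => bool" where "K2 = (\<lambda>t' s'. J2 (t' - 1) s' & 1 <= t' & 2 * int b <= vars s' ''K'')"
  have W2: "run (While (Less ($''K'') (#2 *. $''bm'')) (''K'' ::= #2 *. $''K'')) s2 t2 K2" if "J2 t2 s2" for s2 :: state and t2 :: nat
  proof (rule run_While[where Inv = J2 and \<mu> = "\<lambda>s. nat (2 * int bb - vars s ''K'')", OF _ _ that])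
   fix t3 :: nat and s3 :: state
   assume I: "J2 t3 s3" and c: "bval (evaluator_of I) s3 (Less ($''K'') (#2 *. $''bm''))"
   obtain H where H: "t3 <= t + 4 + 5 * L + 2 * H" "vars s3 ''K'' = 2 ^ H" "2 ^ H <= 4 * bb" using I unfolding J2_def by blast
   have f: "inA s3" "vars s3 ''bm'' = int b" using I by (simp_all add: J2_def)
   have lt: "(2::int) ^ H < 2 * int b" using c H f by simp
   then have "int (2 ^ H) < int (2 * b)" by simp
   then have lt': "2 ^ H < 2 * b" by (simp only: of_nat_less_iff)
   have R: "J2 t4 s4 & nat (2 * int bb - vars s4 ''K'') < nat (2 * int bb - vars s3 ''K'')" if "t4 = t3 + 2" "arrs s4 = arrs s3" "vars s4 = (vars s3)(''K'' := 2 * 2 ^ H)" for t4 :: nat and s4 :: state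
   proof
    show "J2 t4 s4" unfolding J2_def using that f H inA_fr[OF f(1), of s4] lt' b by (intro conjI exI[of _ "Suc H"]) simp_all
    have "(0::int) < 2 ^ H" by simp
    then show "nat (2 * int bb - vars s4 ''K'') < nat (2 * int bb - vars s3 ''K'')" using that H lt b(1) by simp
   qed
   have m: "2 * 2 ^ H <= M" using lt b(1) LM by linarith
   show "run (''K'' ::= #2 *. $''K'') s3 (t3 + 1) (\<lambda>t' s'. J2 t' s' & nat (2 * int bb - vars s' ''K'') < nat (2 * int bb - vars s3 ''K''))"
    by (rule run_conseq[where P = "\<lambda>t' s'. t' = t3 + 2 & arrs s' = arrs s3 & vars s' = (vars s3)(''K'' := 2 * 2 ^ H)"])
     (rule run_wp, use m H(2) in simp, rule R, auto)
  next
   fix t3 :: nat and s3 :: state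
   assume I: "J2 t3 s3" and c: "\<not> bval (evaluator_of I) s3 (Less ($''K'') (#2 *. $''bm''))"
   then show "K2 (t3 + 1) s3" by (auto simp: K2_def J2_def)
  qed auto
  show "run (''K'' ::= #1;;
  While (Less ($''K'') (#2 *. $''bm'')) (''K'' ::= #2 *. $''K'');;
  (''lg'' ::= #1;; ''pw'' ::= #2);;
  While (Less ($''pw'') (#2 *. $''L'' *. $''K'' +. #1)) ?c2;;
  ''D'' ::= #2 *. ($''lg'' *. $''lg'' *. $''lg'') +. #1) s1 t1 ?post"
  proof (rule run_SeqI[OF pK], rule run_SeqI[OF W2], assumption)
   fix t2 :: nat and s2 :: state
   assume k2: "K2 t2 s2"
   then obtain H where H: "t2 <= t + 5 + 5 * L + 2 * H" "vars s2 ''K'' = 2 ^ H" "2 ^ H <= 4 * bb" unfolding K2_def J2_def by fastforce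
   define K where "K = (2::nat) ^ H"
   have vK: "vars s2 ''K'' = int K" using H by (simp add: K_def)
   have f2: "inA s2" "2 * b <= K" using k2 vK by (auto simp: K2_def J2_def)
   have vL: "vars s2 ''L'' = int L" using f2 by (simp add: inA_def)
   have K4: "K <= 4 * bb" "1 <= K" using H by (simp_all add: K_def)
   have LK: "L * K <= 4 * (L * bb)" using K4 by (metis mult.left_commute mult_le_mono2)
   define J3 :: "nat => state => bool" where "J3 = (\<lambda>t' s'. vars s' ''K'' = int K & vars s' ''L'' = int L &
     (\<exists>lg\<ge>1. t' <= t + 7 + 5 * L + 2 * H + 3 * lg & vars s' ''pw'' = 2 ^ lg & vars s' ''lg'' = int lg & 2 ^ lg <= 4 * L * K))"
   have p3: "run (''lg'' ::= #1;; ''pw'' ::= #2) s2 t2 J3"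
   proof -
    have P0: "J3 t' s'" if "t' = t2 + 2" "vars s' = (vars s2)(''lg'' := 1, ''pw'' := 2)" for t' :: nat and s' :: state
     unfolding J3_def using that H(1) vK vL K4 len1 by (intro conjI exI[of _ 1]) simp_all
    show ?thesis using M16 by (intro run_wp) (simp, rule P0, simp_all)
   qed
   have LK1: "1 <= L * K" using K4 len1 by simp
   have LKM: "16 * int (L * K) + 8 <= M"
   proof -
    have "L * K + 1 <= ZZ" using LK Z_basic(3) by linarith
    then have "32 * (L * K + 1) <= ZZ * ZZ" using Z_basic(4) by (intro mult_le_mono)
    moreover have "16 * (L * K) + 8 <= 32 * (L * K + 1)" by simp
    ultimately have "16 * (L * K) + 8 <= ZZ * ZZ" by (rule order_trans[rotated])
    then have "16 * (L * K) + 8 <= ZZ ^ 2" by (simp add: power2_eq_square)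
    from ZM[OF this] show ?thesis by simp
   qed
   define K3 :: "nat => state => bool" where "K3 = (\<lambda>t' s'. J3 (t' - 1) s' & 1 <= t' & 2 * int L * int K < vars s' ''pw'')"
   have W3: "run (While (Less ($''pw'') (#2 *. $''L'' *. $''K'' +. #1)) ?c2) s3 t3 K3"
    if "J3 t3 s3" for s3 :: state and t3 :: nat
   proof (rule run_While[where Inv = J3 and \<mu> = "\<lambda>s. nat (4 * int (L * K) - vars s ''pw'')", OF _ _ that])
    fix t4 :: nat and s4 :: state
    assume I: "J3 t4 s4" and c: "bval (evaluator_of I) s4 (Less ($''pw'') (#2 *. $''L'' *. $''K'' +. #1))"
    obtain lg where lg: "1 <= lg" "t4 <= t + 7 + 5 * L + 2 * H + 3 * lg" "vars s4 ''pw'' = 2 ^ lg" "vars s4 ''lg'' = int lg" "2 ^ lg <= 4 * L * K" using I unfolding J3_def by blast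
    have f: "vars s4 ''K'' = int K" "vars s4 ''L'' = int L" using I by (simp_all add: J3_def)
    have lt: "(2::int) ^ lg <= 2 * int (L * K)" using c lg f by (simp add: mult.assoc)
    then have "int (2 ^ lg) <= int (2 * (L * K))" by simp
    then have lt': "2 ^ lg <= 2 * (L * K)" by (simp only: of_nat_le_iff)
    have R: "J3 t5 s5 & nat (4 * int (L * K) - vars s5 ''pw'') < nat (4 * int (L * K) - vars s4 ''pw'')" if "t5 = t4 + 3" "vars s5 = (vars s4)(''pw'' := 2 * 2 ^ lg, ''lg'' := int lg + 1)" for t5 :: nat and s5 :: state
    proof
     have "2 ^ Suc lg <= 4 * L * K" using lt' by (simp add: mult.assoc mult.commute[of K L])
     then show "J3 t5 s5" unfolding J3_def using that f lg(1,2,4) by (intro conjI exI[of _ "Suc lg"]) simp_all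
     have "1 <= int (L * K)" using LK1 by linarith
     then have "(2::int) ^ lg < 4 * int (L * K)" using lt by linarith
     moreover have "(0::int) < 2 ^ lg" by simp
     ultimately show "nat (4 * int (L * K) - vars s5 ''pw'') < nat (4 * int (L * K) - vars s4 ''pw'')" using that lg(3) by simp
    qed
    have "lg < 2 ^ lg" by (rule less_exp)
    then have "int lg < 2 ^ lg" by (metis of_nat_less_iff of_nat_numeral of_nat_power)
    then have m: "2 * 2 ^ lg <= M" "int lg + 1 <= M" using lt LKM by linarith+
    show "run ?c2 s4 (t4 + 1) (\<lambda>t' s'. J3 t' s' & nat (4 * int (L * K) - vars s' ''pw'') < nat (4 * int (L * K) - vars s4 ''pw''))"
     by (rule run_conseq[where P = "\<lambda>t' s'. t' = t4 + 3 & vars s' = (vars s4)(''pw'' := 2 * 2 ^ lg, ''lg'' := int lg + 1)"])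
      (rule run_wp, use m lg(3,4) in simp, rule R, auto)
   next
    fix t4 :: nat and s4 :: state
    assume I: "J3 t4 s4" and c: "\<not> bval (evaluator_of I) s4 (Less ($''pw'') (#2 *. $''L'' *. $''K'' +. #1))"
    then show "K3 (t4 + 1) s4" by (auto simp: K3_def J3_def)
   qed auto
   show "run ((''lg'' ::= #1;; ''pw'' ::= #2);;
  While (Less ($''pw'') (#2 *. $''L'' *. $''K'' +. #1)) ?c2;;
  ''D'' ::= #2 *. ($''lg'' *. $''lg'' *. $''lg'') +. #1) s2 t2 ?post"
   proof (rule run_SeqI[OF p3], rule run_SeqI[OF W3], assumption)
    fix t3 :: nat and s3 :: state
    assume k3: "K3 t3 s3"
    then obtain lg where lg: "1 <= lg" "t3 <= t + 8 + 5 * L + 2 * H + 3 * lg" "vars s3 ''pw'' = 2 ^ lg" "vars s3 ''lg'' = int lg" "2 ^ lg <= 4 * L * K"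
     unfolding K3_def J3_def by fastforce
    have f3: "vars s3 ''K'' = int K" "2 * int L * int K < 2 ^ lg" using k3 lg by (simp_all add: K3_def J3_def)
    have "int (2 * L * K) < int (2 ^ lg)" using f3(2) by simp
    then have gt: "2 * L * K < 2 ^ lg" by (simp only: of_nat_less_iff)
    have "2 ^ H < (2::nat) ^ lg" using gt len1 K4 unfolding K_def[symmetric] by (metis le_less_trans le_trans mult_le_mono1 mult_1 one_le_mult_iff one_le_numeral)
    then have Hlg: "H <= lg" by simp
    have P: "params b H K lg" unfolding params_def using b f2 K4 gt lg(5) Hlg by (simp add: K_def)
    have "2 * (lg * lg * lg) + 1 <= ZZ * (ZZ * ZZ * ZZ)"
    proof -
     have "lg * lg * lg <= ZZ * ZZ * ZZ" using params_lg[OF P] by (intro mult_le_mono) auto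
     moreover have "1 <= ZZ * ZZ * ZZ" using Z_basic(4) by simp
     ultimately have "2 * (lg * lg * lg) + 1 <= 3 * (ZZ * ZZ * ZZ)" by linarith
     also have "\<dots> <= ZZ * (ZZ * ZZ * ZZ)" using Z_basic(4) by (intro mult_le_mono1) simp
     finally show ?thesis .
    qed
    then have "2 * (lg * lg * lg) + 1 <= ZZ ^ 4" by (simp add: power4_eq_xxxx mult.assoc)
    from ZM[OF this] have DM: "int (2 * (lg * lg * lg) + 1) <= M" by simp
    have de: "2 * (int lg * int lg * int lg) + 1 = int (2 * (lg * lg * lg) + 1)" by simp
    have R: "?post t4 s4"
     if "t4 = t3 + 1" "vars s4 = (vars s3)(''D'' := int (2 * (lg * lg * lg) + 1))" for t4 :: nat and s4 :: state
     by (rule exI[of _ b], rule exI[of _ H], rule exI[of _ K], rule exI[of _ lg]) (use P lg that f3 Hlg in simp)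
    show "run (''D'' ::= #2 *. ($''lg'' *. $''lg'' *. $''lg'') +. #1) s3 t3 ?post"
     by (rule run_conseq[where P = "\<lambda>t' s'. t' = t3 + 1 & vars s' = (vars s3)(''D'' := int (2 * (lg * lg * lg) + 1))"])
      (rule run_wp, simp only: wp.simps aval.simps apply_op.simps lg(4) de, use DM in simp, rule R, auto)
   qed
  qed
 qed
qed

end

section \<open>Isolation tests and the items offered by the indices\<close>

text \<open>Comparing all pairs is affordable, since a bucket has fewer than \<open>lg\<close>
  items.\<close>

definition iso_com :: com where
 "iso_com =
  ((''b'' ::= #1;; ''p'' ::= Read ''h2'' (Read ''bz'' ($''i'') *. $''K'' +. $''c''));;
  While (BNot (Equal ($''p'') (#0)))
   (''u'' ::= Read ''nx2'' ($''p'');;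
    While (BNot (Equal ($''u'') (#0)))
     (Cond (Equal (Op Mod (Read ''S'' ($''p'' -. #1)) ($''d'')) (Op Mod (Read ''S'' ($''u'' -. #1)) ($''d'')))
      (''b'' ::= #0) Skip;;
     ''u'' ::= Read ''nx2'' ($''u''));;
    ''p'' ::= Read ''nx2'' ($''p'')))"

definition start_com :: com where
 "start_com =
  (''i'' ::= #0;;
  While (Less ($''i'') ($''L''))
   (iso_com;;
    (Write ''ok'' ($''i'') ($''b'');; Write ''cv'' ($''i'') (Read ''bv'' ($''i''));; Write ''cz'' ($''i'') (Read ''bz'' ($''i''));;
    Write ''cl'' ($''i'') (Read ''bl'' ($''i''));; ''i'' ::= $''i'' +. #1)))"

definition pick_com :: com where
 "pick_com =
  (''i'' ::= #0;;
  While (Less ($''i'') ($''L''))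
   ((Write ''aa'' ($''i'') (#0);;
    Cond (Equal (Read ''ok'' ($''i'')) (#1)) (''p'' ::= Read ''h2'' (Read ''cz'' ($''i'') *. $''K'' +. $''c'')) (''p'' ::= #0));;
    While (BNot (Equal ($''p'') (#0)))
     (Cond (Equal (Op Mod (Read ''S'' ($''p'' -. #1)) ($''d'')) ($''rh''))
      (Write ''aa'' ($''i'') (Read ''S'' ($''p'' -. #1))) Skip;;
     ''p'' ::= Read ''nx2'' ($''p''));;
    ''i'' ::= $''i'' +. #1))"

lemma frames_main1: "asgd iso_com = {''p'', ''u'', ''b'', ''u'', ''p'', ''b''}" "wrtn iso_com = {}"
 by (simp_all add: iso_com_def)

context kb
begin

text \<open>The outcome of the colouring on which all later programs rely: the buckets, and the
  bound on their lengths.\<close>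

definition static :: "nat => nat => (nat => nat) => state => bool" where
 "static K lg clr s \<longleftrightarrow> inA s & vars s ''K'' = int K & (\<forall>z<L. \<forall>c<K. bkt s K z c (wl clr L z c) & length (wl clr L z c) < lg) & (\<forall>u. clr u < K)"

lemma static_cong:
 assumes "static K lg clr s" "vars s' ''L'' = vars s ''L''" "vars s' ''K'' = vars s ''K''" "arrs s' ''off'' = arrs s ''off''" "arrs s' ''S'' = arrs s ''S''"
  "arrs s' ''nx2'' = arrs s ''nx2''" "arrs s' ''h2'' = arrs s ''h2''"
 shows "static K lg clr s'"
 using assms unfolding static_def inA_def bkt_def by simp

lemma wl_set: "set (wl clr L z c) = {u \<in> allowed I z. 1 <= u & u < L & clr u = c}" by (auto simp: wl_def)
lemma wl_distinct: "distinct (wl clr L z c)" by (simp add: wl_def)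

lemma bkt_obtain:
 assumes "static K lg clr s" "z < L" "c < K"
 obtains qs where "chn (arrs s ''nx2'') (arrs s ''h2'' (int z * int K + int c)) qs" "length qs < lg" "length qs = length (wl clr L z c)"
  "\<And>k. k < length qs ==> 1 <= qs ! k & qs ! k <= NN & arrs s ''S'' (int (qs ! k) - 1) = int (wl clr L z c ! k)"
proof -
 obtain qs where q: "chn (arrs s ''nx2'') (arrs s ''h2'' (int z * int K + int c)) qs" "map (\<lambda>q. pS (q - 1)) qs = wl clr L z c" "\<forall>q\<in>set qs. 1 <= q & q <= NN & zo (q - 1) = z"
  using assms unfolding static_def bkt_def by blast
 have l: "length qs = length (wl clr L z c)" using q(2) by (metis length_map)
 have lg: "length qs < lg" using l assms by (simp add: static_def)
 have "1 <= qs ! k & qs ! k <= NN & arrs s ''S'' (int (qs ! k) - 1) = int (wl clr L z c ! k)" if k: "k < length qs" for k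
 proof -
  have qk: "1 <= qs ! k" "qs ! k <= NN" using q(3) k by auto
  have "wl clr L z c ! k = pS (qs ! k - 1)" using k by (simp flip: q(2))
  moreover have "int (qs ! k) - 1 = int (qs ! k - 1)" using qk by simp
  moreover have "qs ! k - 1 < NN" using qk by simp
  moreover from this have "ar s ''S'' (qs ! k - 1) = int (pS (qs ! k - 1))" using assms(1) unfolding static_def inA_def by blast
  ultimately show ?thesis using qk by simp
 qed
 then show ?thesis using that q(1) l lg by blast
qed

lemma iso_run:
 assumes st: "static K lg clr s" and v: "vars s ''i'' = int i" "vars s ''c'' = int c" "vars s ''d'' = int d" "c < K" "1 <= d"
  and z: "ar s ''bz'' i = int z" "z < L"
 shows "run iso_com s t (\<lambda>t' s'. t' <= t + 4 + lg * (4 * lg + 5) & vars s' ''b'' = (if inj_on (\<lambda>w. w mod d) (set (wl clr L z c)) then 1 else 0))"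
proof -
 let ?c1 = "(Cond (Equal (Op Mod (Read ''S'' ($''p'' -. #1)) ($''d'')) (Op Mod (Read ''S'' ($''u'' -. #1)) ($''d''))) (''b'' ::= #0) Skip;; ''u'' ::= Read ''nx2'' ($''u''))"
 obtain qs where qs: "chn (arrs s ''nx2'') (arrs s ''h2'' (int z * int K + int c)) qs" "length qs < lg" "length qs = length (wl clr L z c)"
  "\<And>k. k < length qs ==> 1 <= qs ! k & qs ! k <= NN & arrs s ''S'' (int (qs ! k) - 1) = int (wl clr L z c ! k)"
  using bkt_obtain[OF st z(2) v(4)] by blast
 define ws where "ws = wl clr L z c"
 define n where "n = length qs"
 have vK: "vars s ''K'' = int K" using st by (simp add: static_def)
 have Sq: "arrs s ''S'' (int (qs ! k) - 1) mod int d = int (ws ! k mod d)" if "k < n" for k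
  using qs(4)[of k] that by (simp add: ws_def n_def zmod_int)
 \<comment> \<open>All pairs that precede \<open>(k, k')\<close> lexicographically have different
   remainders; the two nested loops visit the pairs in this order.\<close>
 define good where "good = (\<lambda>k k'. \<forall>x y. x < y --> y < n --> (x < k \<or> x = k & y < k') --> ws ! x mod d \<noteq> ws ! y mod d)"
 define J :: "nat => nat => nat => state => bool" where "J = (\<lambda>k k' t' s'. arrs s' = arrs s & vars s' ''d'' = int d & vars s' ''b'' = (if good k k' then 1 else 0) &
   chn (arrs s ''nx2'') (vars s' ''p'') (drop k qs))"
 have pre: "run (''b'' ::= #1;; ''p'' ::= Read ''h2'' (Read ''bz'' ($''i'') *. $''K'' +. $''c'')) s t (\<lambda>t' s'. t' <= t + 2 & J 0 0 t' s')"
 proof -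
  have P0: "t' <= t + 2 & J 0 0 t' s'" if "t' = t + 2" "arrs s' = arrs s" "vars s' = (vars s)(''b'' := 1, ''p'' := arrs s ''h2'' (int z * int K + int c))" for t' :: nat and s' :: state
   using that qs(1) v unfolding J_def by (simp add: good_def)
  show ?thesis
   by (rule run_conseq[where P = "\<lambda>t' s'. t' = t + 2 & arrs s' = arrs s & vars s' = (vars s)(''b'' := 1, ''p'' := arrs s ''h2'' (int z * int K + int c))"])
    (rule run_wp, use M16 BdD(2)[of s "''h2''" "int z * int K + int c"] v z vK in simp, rule P0, auto)
 qed
 show ?thesis unfolding iso_com_def
 proof (rule run_SeqI[OF pre], rule run_for[where Inv = "\<lambda>k t' s'. t' <= t + 2 + k * (4 * lg + 5) & J k 0 t' s'" and n = n])
  fix k t2 :: nat and s2 :: state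
  assume k: "k < n" and I: "t2 <= t + 2 + k * (4 * lg + 5) & J k 0 t2 s2"
  define q where "q = qs ! k"
  have ch: "vars s2 ''p'' = int q" "q \<noteq> 0" "chn (arrs s ''nx2'') (ar s ''nx2'' q) (drop (Suc k) qs)"
   using I chn_drop[of "arrs s ''nx2''" "vars s2 ''p''" k qs] k unfolding J_def n_def q_def by auto
  define J2 :: "nat => nat => state => bool" where "J2 = (\<lambda>k' t' s'. t' <= t2 + 2 + 4 * k' & arrs s' = arrs s & vars s' ''d'' = int d & vars s' ''p'' = int q &
    vars s' ''b'' = (if good k (Suc k + k') then 1 else 0) & chn (arrs s ''nx2'') (vars s' ''u'') (drop (Suc k + k') qs))"
  have good0: "good k (Suc k) = good k 0" unfolding good_def by auto
  have p2: "run (''u'' ::= Read ''nx2'' ($''p'')) s2 (t2 + 1) (J2 0)"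
  proof -
   have P0: "J2 0 t' s'" if "t' = t2 + 2" "arrs s' = arrs s" "vars s' = (vars s2)(''u'' := ar s ''nx2'' q)" for t' :: nat and s' :: state
    using that I ch good0 unfolding J2_def J_def by simp
   have "arrs s2 = arrs s" using I by (simp add: J_def)
   then show ?thesis using ch(1) BdD(2)[of s2 "''nx2''" "int q"] by (intro run_wp) (simp, rule P0, simp_all)
  qed
  have w2: "run (While (BNot (Equal ($''u'') (#0)))
     ?c1) s3 t3 (\<lambda>t' s'. J2 (n - Suc k) (t' - 1) s' & 1 <= t')" if "J2 0 t3 s3" for s3 :: state and t3 :: nat
  proof (rule run_for[where Inv = J2 and n = "n - Suc k", OF _ _ that])
   fix k' t4 :: nat and s4 :: state
   assume k': "k' < n - Suc k" and I4: "J2 k' t4 s4"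
   define y where "y = Suc k + k'"
   have y: "k < y" "y < n" using k' k by (auto simp: y_def)
   have ch4: "vars s4 ''u'' = int (qs ! y)" "qs ! y \<noteq> 0" "chn (arrs s ''nx2'') (ar s ''nx2'' (qs ! y)) (drop (Suc y) qs)"
    using I4 chn_drop[of "arrs s ''nx2''" "vars s4 ''u''" y qs] y unfolding J2_def n_def y_def[symmetric] by auto
   have f4: "t4 <= t2 + 2 + 4 * k'" "arrs s4 = arrs s" "vars s4 ''d'' = int d" "vars s4 ''p'' = int q" "vars s4 ''b'' = (if good k y then 1 else 0)"
    using I4 unfolding J2_def y_def by simp_all
   have gS: "good k (Suc y) \<longleftrightarrow> good k y & ws ! k mod d \<noteq> ws ! y mod d"
    unfolding good_def using y by (auto simp: less_Suc_eq)
   have R: "J2 (Suc k') t5 s5" if "t5 <= t4 + 4" "arrs s5 = arrs s" "vars s5 ''d'' = int d" "vars s5 ''p'' = int q" "vars s5 ''u'' = ar s ''nx2'' (qs ! y)"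
     "vars s5 ''b'' = (if ws ! k mod d = ws ! y mod d then 0 else vars s4 ''b'')" for t5 :: nat and s5 :: state
    using that f4 ch4(3) gS unfolding J2_def y_def[symmetric] by (auto simp: y_def)
   have e: "arrs s ''S'' (int q - 1) mod int d = int (ws ! k mod d)" "arrs s ''S'' (int (qs ! y) - 1) mod int d = int (ws ! y mod d)" using Sq[OF k] Sq[OF y(2)] by (simp_all add: q_def)
   have "run ?c1 s4 (t4 + 1) (J2 (Suc k'))"
   proof (cases "ws ! k mod d = ws ! y mod d")
    case True
    then show ?thesis using M16 BdD(2)[of s4 "''nx2''" "int (qs ! y)"] f4(2-4) ch4(1) by (intro run_wp) (simp add: e del: of_nat_mod, rule R, simp_all)
   next
    case False
    then show ?thesis using M16 BdD(2)[of s4 "''nx2''" "int (qs ! y)"] f4(2-4) ch4(1) by (intro run_wp) (simp add: e del: of_nat_mod, rule R, simp_all)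
   qed
   then show "bval (evaluator_of I) s4 (BNot (Equal ($''u'') (#0))) & run ?c1 s4 (t4 + 1) (J2 (Suc k'))" using ch4 by simp
  next
   fix t4 :: nat and s4 :: state assume I4: "J2 (n - Suc k) t4 s4"
   then have "vars s4 ''u'' = 0" using k unfolding J2_def n_def by simp
   then show "\<not> bval (evaluator_of I) s4 (BNot (Equal ($''u'') (#0))) & J2 (n - Suc k) (t4 + 1 - 1) s4 & 1 <= t4 + 1" using I4 by simp
  qed auto
  have p3: "run (''p'' ::= Read ''nx2'' ($''p'')) s3 t3 (\<lambda>t' s'. t' <= t + 2 + Suc k * (4 * lg + 5) & J (Suc k) 0 t' s')" if j: "J2 (n - Suc k) (t3 - 1) s3 & 1 <= t3" for s3 :: state and t3 :: nat
  proof -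
   have f3: "t3 <= t2 + 3 + 4 * (n - Suc k)" "arrs s3 = arrs s" "vars s3 ''d'' = int d" "vars s3 ''p'' = int q" "vars s3 ''b'' = (if good k n then 1 else 0)"
    using j k unfolding J2_def by auto
   have "good k n = good (Suc k) 0" unfolding good_def by (auto simp: less_Suc_eq)
   then have P0: "J (Suc k) 0 t' s'" if "arrs s' = arrs s" "vars s' = (vars s3)(''p'' := ar s ''nx2'' q)" for t' :: nat and s' :: state
    using that f3 ch(3) unfolding J_def by simp
   have tt: "t3 + 1 <= t + 2 + Suc k * (4 * lg + 5)" using f3(1) conjunct1[OF I] qs(2) by (simp add: n_def)
   show ?thesis
    by (rule run_conseq[where P = "\<lambda>t' s'. t' = t3 + 1 & arrs s' = arrs s & vars s' = (vars s3)(''p'' := ar s ''nx2'' q)"])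
     (rule run_wp, use BdD(2)[of s3 "''nx2''" "int q"] f3(2,4) in simp, use tt P0 in auto)
  qed
  show "bval (evaluator_of I) s2 (BNot (Equal ($''p'') (#0))) & run (''u'' ::= Read ''nx2'' ($''p'');;
    While (BNot (Equal ($''u'') (#0)))
     ?c1;;
    ''p'' ::= Read ''nx2'' ($''p'')) s2 (t2 + 1) (\<lambda>t' s'. t' <= t + 2 + Suc k * (4 * lg + 5) & J (Suc k) 0 t' s')"
   using ch(1,2) by (intro conjI, simp) (rule run_SeqI[OF p2], rule run_SeqI[OF w2], assumption, rule p3, assumption)
 next
  fix t2 :: nat and s2 :: state assume I: "t2 <= t + 2 + n * (4 * lg + 5) & J n 0 t2 s2"
  have p0: "vars s2 ''p'' = 0" using I unfolding J_def n_def by simp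
  have "good n 0 \<longleftrightarrow> inj_on (\<lambda>w. w mod d) (set ws)"
  proof
   assume g: "good n 0"
   show "inj_on (\<lambda>w. w mod d) (set ws)"
   proof (rule inj_onI)
    fix a b assume ab: "a \<in> set ws" "b \<in> set ws" "a mod d = b mod d"
    obtain x y where xy: "x < n" "ws ! x = a" "y < n" "ws ! y = b" using ab qs(3) by (metis in_set_conv_nth n_def ws_def)
    then have "\<not> x < y" "\<not> y < x" using g ab(3) unfolding good_def by metis+
    then show "a = b" using xy by (metis linorder_neqE_nat)
   qed
  next
   assume inj: "inj_on (\<lambda>w. w mod d) (set ws)"
   show "good n 0" unfolding good_def
   proof (intro allI impI)
    fix x y assume xy: "x < y" "y < n"
    have l: "length ws = n" using qs(3) by (simp add: n_def ws_def)
    have "ws ! x \<noteq> ws ! y" using xy l wl_distinct[of clr z c] nth_eq_iff_index_eq[of ws x y] by (simp add: ws_def)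
    then show "ws ! x mod d \<noteq> ws ! y mod d" using inj xy l unfolding inj_on_def by (metis less_trans nth_mem)
   qed
  qed
  moreover have nle: "n * (4 * lg + 5) <= lg * (4 * lg + 5)" using qs(2) by (intro mult_le_mono1) (simp add: n_def)
  moreover have "t2 + 1 <= t + 4 + lg * (4 * lg + 5)" using conjunct1[OF I] nle by linarith
  ultimately show "\<not> bval (evaluator_of I) s2 (BNot (Equal ($''p'') (#0))) & t2 + 1 <= t + 4 + lg * (4 * lg + 5) & vars s2 ''b'' = (if inj_on (\<lambda>w. w mod d) (set (wl clr L z c)) then 1 else 0)"
   using I p0 unfolding J_def ws_def by simp
 qed auto
qed

definition pickpost :: "nat => nat => nat => nat => int => (nat => nat) => bool" where
 "pickpost z c d \<rho> av clr \<longleftrightarrow> (\<exists>a. av = int a & (a \<noteq> 0 --> a \<in> set (wl clr L z c) & a mod d = \<rho>) &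
   ((\<exists>w\<in>set (wl clr L z c). w mod d = \<rho>) --> a \<noteq> 0))"

lemma pick_run:
 assumes st: "static K lg clr s" and v: "vars s ''c'' = int c" "vars s ''d'' = int d" "vars s ''rh'' = int \<rho>" "c < K" "1 <= d"
  and z: "\<And>i. i < L ==> ar s ''ok'' i = 1 ==> ar s ''cz'' i = int (z i) & z i < L"
 shows "run pick_com s t (\<lambda>t' s'. t' <= t + 3 + L * (4 * lg + 8) & (\<forall>i<L. ar s' ''aa'' i \<ge> 0 & (ar s ''ok'' i = 1 --> pickpost (z i) c d \<rho> (ar s' ''aa'' i) clr)))"
proof -
 let ?c2 = "(Write ''aa'' ($''i'') (#0);; Cond (Equal (Read ''ok'' ($''i'')) (#1)) (''p'' ::= Read ''h2'' (Read ''cz'' ($''i'') *. $''K'' +. $''c'')) (''p'' ::= #0))"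
 let ?c1 = "(Cond (Equal (Op Mod (Read ''S'' ($''p'' -. #1)) ($''d'')) ($''rh'')) (Write ''aa'' ($''i'') (Read ''S'' ($''p'' -. #1))) Skip;; ''p'' ::= Read ''nx2'' ($''p''))"
 have LM: "4 * int L + 8 <= M" using capK_D(3)[OF capK_ok[of 0]] by simp
 have vK: "vars s ''K'' = int K" "vars s ''L'' = int L" using st by (simp_all add: static_def inA_def)
 define fr :: "state => bool" where "fr = (\<lambda>s'. (\<forall>v. v \<notin> {''i'', ''p''} --> vars s' v = vars s v) & (\<forall>a. a \<noteq> ''aa'' --> arrs s' a = arrs s a))"
 define G where "G = (\<lambda>i av. av \<ge> 0 & (ar s ''ok'' i = 1 --> pickpost (z i) c d \<rho> av clr))"
 define J :: "nat => nat => state => bool" where "J = (\<lambda>k t' s'. t' <= t + 1 + k * (4 * lg + 8) & fr s' & vars s' ''i'' = int k & (\<forall>i<k. G i (ar s' ''aa'' i)))"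
 have pre: "run (''i'' ::= #0) s t (J 0)"
 proof -
  have P0: "J 0 t' s'" if "t' = t + 1" "arrs s' = arrs s" "vars s' = (vars s)(''i'' := 0)" for t' :: nat and s' :: state
   using that by (simp add: J_def fr_def)
  show ?thesis using M16 by (intro run_wp) (simp, rule P0, simp_all)
 qed
 show ?thesis unfolding pick_com_def
 proof (rule run_SeqI[OF pre], rule run_for[where Inv = J and n = L])
  fix i t2 :: nat and s2 :: state
  assume i: "i < L" and I: "J i t2 s2"
  have f2: "t2 <= t + 1 + i * (4 * lg + 8)" "fr s2" "vars s2 ''i'' = int i" "\<forall>j<i. G j (ar s2 ''aa'' j)" using I by (simp_all add: J_def)
  have g2: "vars s2 ''c'' = int c" "vars s2 ''d'' = int d" "vars s2 ''rh'' = int \<rho>" "vars s2 ''K'' = int K" "vars s2 ''L'' = int L" "arrs s2 ''ok'' = arrs s ''ok''" "arrs s2 ''cz'' = arrs s ''cz''"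
    "arrs s2 ''h2'' = arrs s ''h2''" using f2(2) v vK by (simp_all add: fr_def)
  define ws where "ws = (if ar s ''ok'' i = 1 then wl clr L (z i) c else [])"
  obtain qs where qs: "chn (arrs s ''nx2'') (if ar s ''ok'' i = 1 then arrs s ''h2'' (int (z i) * int K + int c) else 0) qs" "length qs < lg \<or> qs = []" "length qs = length ws"
   "\<And>k. k < length qs ==> 1 <= qs ! k & qs ! k <= NN & arrs s ''S'' (int (qs ! k) - 1) = int (ws ! k)"
  proof (cases "ar s ''ok'' i = 1")
   case True
   have zi: "z i < L" using z[OF i True] by simp
   show ?thesis
   proof (rule bkt_obtain[OF st zi v(4)])
    fix rs
    assume "chn (arrs s ''nx2'') (arrs s ''h2'' (int (z i) * int K + int c)) rs" "length rs < lg" "length rs = length (wl clr L (z i) c)"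
     "\<And>k. k < length rs ==> 1 <= rs ! k & rs ! k <= NN & arrs s ''S'' (int (rs ! k) - 1) = int (wl clr L (z i) c ! k)"
    then show ?thesis using True by (intro that[of rs]) (simp_all add: ws_def)
   qed
  next
   case False
   show ?thesis by (rule that[of "[]"]) (use False in \<open>simp_all add: ws_def\<close>)
  qed
  define JJ :: "nat => nat => state => bool" where "JJ = (\<lambda>k t' s'. t' <= t2 + 4 + 4 * k & fr s' & vars s' ''i'' = int i & (\<forall>j<i. G j (ar s' ''aa'' j)) &
    chn (arrs s ''nx2'') (vars s' ''p'') (drop k qs) &
    (\<exists>a. ar s' ''aa'' i = int a & (a \<noteq> 0 --> a \<in> set ws & a mod d = \<rho>) & ((\<exists>w\<in>set (take k ws). w mod d = \<rho>) --> a \<noteq> 0)))"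
  have p1: "run ?c2 s2 (t2 + 1) (JJ 0)"
  proof -
   have P0: "JJ 0 t' s'" if s': "t' <= t2 + 4" "arrs s' = (arrs s2)(''aa'' := (arrs s2 ''aa'')(int i := 0))"
     "vars s' = (vars s2)(''p'' := (if ar s ''ok'' i = 1 then arrs s ''h2'' (int (z i) * int K + int c) else 0))" for t' :: nat and s' :: state
   proof -
    have "fr s'" using f2(2) s' by (simp add: fr_def)
    moreover have "\<forall>j<i. G j (ar s' ''aa'' j)" using f2(4) s' by simp
    ultimately show ?thesis unfolding JJ_def using s' qs(1) f2(3) by simp
   qed
   show ?thesis
   proof (cases "ar s ''ok'' i = 1")
    case True
    have cz: "ar s ''cz'' i = int (z i)" using z[OF i True] by simp
    show ?thesis using M16 True BdD(2)[of s2 "''h2''" "int (z i) * int K + int c"] f2(3) g2 cz by (intro run_wp) (simp, rule P0, simp_all)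
   next
    case False
    show ?thesis using M16 False f2(3) g2 by (intro run_wp) (simp, rule P0, simp_all)
   qed
  qed
  have w2: "run (While (BNot (Equal ($''p'') (#0)))
     ?c1) s3 t3 (\<lambda>t' s'. JJ (length qs) (t' - 1) s' & 1 <= t')" if "JJ 0 t3 s3" for s3 :: state and t3 :: nat
  proof (rule run_for[where Inv = JJ and n = "length qs", OF _ _ that])
   fix k t4 :: nat and s4 :: state
   assume k: "k < length qs" and I4: "JJ k t4 s4"
   define q where "q = qs ! k"
   define u where "u = ws ! k"
   have ch: "vars s4 ''p'' = int q" "q \<noteq> 0" "chn (arrs s ''nx2'') (ar s ''nx2'' q) (drop (Suc k) qs)"
    using I4 chn_drop[of "arrs s ''nx2''" "vars s4 ''p''" k qs] k unfolding JJ_def q_def by auto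
   obtain a where a: "ar s4 ''aa'' i = int a" "a \<noteq> 0 --> a \<in> set ws & a mod d = \<rho>" "(\<exists>w\<in>set (take k ws). w mod d = \<rho>) --> a \<noteq> 0"
    using I4 unfolding JJ_def by blast
   have f4: "t4 <= t2 + 4 + 4 * k" "fr s4" "vars s4 ''i'' = int i" "\<forall>j<i. G j (ar s4 ''aa'' j)" using I4 by (simp_all add: JJ_def)
   have g4: "vars s4 ''d'' = int d" "vars s4 ''rh'' = int \<rho>" "arrs s4 ''S'' (int q - 1) = int u" "arrs s4 ''nx2'' = arrs s ''nx2''"
    using f4(2) v qs(4)[OF k] by (simp_all add: fr_def q_def u_def)
   have uw: "u \<in> set ws" "set (take (Suc k) ws) = insert u (set (take k ws))" using k qs(3) by (simp_all add: u_def take_Suc_conv_app_nth)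
   have u0: "u \<noteq> 0" using uw(1) by (auto simp: ws_def wl_set split: if_splits)
   have md: "int u mod int d = int \<rho> \<longleftrightarrow> u mod d = \<rho>" by (metis of_nat_eq_iff zmod_int)
   have R: "JJ (Suc k) t5 s5" if s5: "t5 <= t4 + 4" "vars s5 = (vars s4)(''p'' := ar s ''nx2'' q)"
     "u mod d = \<rho> & arrs s5 = (arrs s4)(''aa'' := (arrs s4 ''aa'')(int i := int u)) \<or> u mod d \<noteq> \<rho> & arrs s5 = arrs s4" for t5 :: nat and s5 :: state
   proof -
    have e5: "\<forall>a. a \<noteq> ''aa'' --> arrs s5 a = arrs s4 a" using s5(3) by (elim disjE conjE) simp_all
    have "fr s5" using f4(2) e5 by (simp add: fr_def s5(2))
    moreover have "\<forall>j<i. G j (ar s5 ''aa'' j)" using s5(3) f4(4) by (elim disjE conjE) simp_all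
    moreover have "\<exists>a. ar s5 ''aa'' i = int a & (a \<noteq> 0 --> a \<in> set ws & a mod d = \<rho>) & ((\<exists>w\<in>set (take (Suc k) ws). w mod d = \<rho>) --> a \<noteq> 0)"
     using s5(3)
    proof
     assume h: "u mod d = \<rho> & arrs s5 = (arrs s4)(''aa'' := (arrs s4 ''aa'')(int i := int u))"
     then have "ar s5 ''aa'' i = int u" by simp
     then show ?thesis using uw u0 h by (intro exI[of _ u]) simp
    next
     assume h: "u mod d \<noteq> \<rho> & arrs s5 = arrs s4"
     then have "ar s5 ''aa'' i = int a" using a(1) by simp
     then show ?thesis using a(2,3) uw(2) h by (intro exI[of _ a]) simp
    qed
    ultimately show ?thesis unfolding JJ_def using s5(1,2) f4(1,3) ch(3) by simp
   qed
   have uM: "\<bar>int u\<bar> <= M" if "Bd M s4" using BdD(2)[OF that, of "''S''" "int q - 1"] g4(3) by simp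
   have "run ?c1 s4 (t4 + 1) (JJ (Suc k))"
   proof (cases "u mod d = \<rho>")
    case True
    show ?thesis using True uM BdD(2)[of s4 "''nx2''" "int q"] f4(3) g4 ch(1) md by (intro run_wp) (simp del: of_nat_mod, rule R, simp_all)
   next
    case False
    show ?thesis using False BdD(2)[of s4 "''nx2''" "int q"] f4(3) g4 ch(1) md by (intro run_wp) (simp del: of_nat_mod, rule R, simp_all)
   qed
   then show "bval (evaluator_of I) s4 (BNot (Equal ($''p'') (#0))) & run ?c1 s4 (t4 + 1) (JJ (Suc k))" using ch by simp
  next
   fix t4 :: nat and s4 :: state assume I4: "JJ (length qs) t4 s4"
   then have "vars s4 ''p'' = 0" unfolding JJ_def by simp
   then show "\<not> bval (evaluator_of I) s4 (BNot (Equal ($''p'') (#0))) & JJ (length qs) (t4 + 1 - 1) s4 & 1 <= t4 + 1" using I4 by simp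
  qed auto
  have p3: "run (''i'' ::= $''i'' +. #1) s3 t3 (J (Suc i))" if j: "JJ (length qs) (t3 - 1) s3 & 1 <= t3" for s3 :: state and t3 :: nat
  proof -
   have f3: "t3 <= t2 + 5 + 4 * length qs" "fr s3" "vars s3 ''i'' = int i" "\<forall>j<i. G j (ar s3 ''aa'' j)" using j unfolding JJ_def by auto
   have "take (length qs) ws = ws" using qs(3) by simp
   then have "G i (ar s3 ''aa'' i)" using j unfolding JJ_def G_def pickpost_def ws_def by (auto split: if_splits)
   then have g: "\<forall>j<Suc i. G j (ar s3 ''aa'' j)" using f3(4) by (auto simp: less_Suc_eq)
   have lq: "4 * length qs <= 4 * lg" using qs(2) by auto
   have R: "J (Suc i) t4 s4" if "t4 = t3 + 1" "arrs s4 = arrs s3" "vars s4 = (vars s3)(''i'' := int i + 1)" for t4 :: nat and s4 :: state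
    unfolding J_def using that f3(1,2) f2(1) g lq by (simp add: fr_def)
   show ?thesis using f3(3) i LM by (intro run_wp) (simp, rule R, simp_all)
  qed
  show "bval (evaluator_of I) s2 (Less ($''i'') ($''L'')) & run (?c2;;
    While (BNot (Equal ($''p'') (#0)))
     ?c1;;
    ''i'' ::= $''i'' +. #1) s2 (t2 + 1) (J (Suc i))"
   using f2(3) g2(5) i by (intro conjI, simp) (rule run_SeqI[OF p1], rule run_SeqI[OF w2], assumption, rule p3, assumption)
 next
  fix t2 :: nat and s2 :: state assume I: "J L t2 s2"
  then have "vars s2 ''L'' = int L" using vK by (simp add: J_def fr_def)
  then show "\<not> bval (evaluator_of I) s2 (Less ($''i'') ($''L'')) & t2 + 1 <= t + 3 + L * (4 * lg + 8) & (\<forall>i<L. ar s2 ''aa'' i \<ge> 0 & (ar s ''ok'' i = 1 --> pickpost (z i) c d \<rho> (ar s2 ''aa'' i) clr))"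
   using I by (simp add: J_def G_def)
 qed auto
qed

end

section \<open>Writing the result of a sweep into shared lists\<close>

text \<open>The loop runs downwards and updates the table in place: the source of an entry is not
  larger than its index, so it still holds the old data. A new entry costs one list node, whose tail
  is the list of the source.\<close>

definition step_com :: com where
 "step_com =
  (''i'' ::= $''L'';;
  While (Less (#0) ($''i''))
   (''i'' ::= $''i'' -. #1;;
    Cond (Equal (Read ''no'' ($''i'')) (#1))
     (''f'' ::= Read ''nf'' ($''i'');; Cond (Less ($''f'') (#0)) (''f'' ::= #0) Skip;;
     Write ''cv'' ($''i'') (Read ''nv'' ($''i''));; Write ''cz'' ($''i'') (Read ''cz'' ($''f''));;
     Write ''ok'' ($''i'') (#1);;
     Cond (Equal ($''f'') ($''i'')) Skip
      (''cnt'' ::= $''cnt'' +. #1;; Write ''ni'' ($''cnt'') (Read ''aa'' ($''f''));;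
       Write ''nm'' ($''cnt'') (($''i'' -. $''f'') \<div> Read ''aa'' ($''f''));;
       Write ''nn'' ($''cnt'') (Read ''cl'' ($''f''));; Write ''cl'' ($''i'') ($''cnt'')))
     (Write ''ok'' ($''i'') (#0))))"

definition merge_com :: com where
 "merge_com =
  (''i'' ::= #0;;
  While (Less ($''i'') ($''L''))
   (Cond (BAnd (Equal (Read ''ok'' ($''i'')) (#1)) (Less (Read ''av'' ($''i'')) (Read ''cv'' ($''i''))))
     (Write ''av'' ($''i'') (Read ''cv'' ($''i''));; Write ''az'' ($''i'') (Read ''cz'' ($''i''));; Write ''al'' ($''i'') (Read ''cl'' ($''i''))) Skip;;
    ''i'' ::= $''i'' +. #1))"

definition flush_com :: com where
 "flush_com =
  (''i'' ::= #0;;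
  While (Less ($''i'') ($''L''))
   (Write ''bv'' ($''i'') (Read ''av'' ($''i''));; Write ''bz'' ($''i'') (Read ''az'' ($''i''));; Write ''bl'' ($''i'') (Read ''al'' ($''i''));;
    ''i'' ::= $''i'' +. #1))"

context machine
begin

text \<open>Sequences associate to the right; regrouping lets an initial block be specified as a
  single command.\<close>

lemma run_Seq_assoc:
 assumes r: "run (Seq (Seq c1 c2) c3) s t P"
 shows "run (Seq c1 (Seq c2 c3)) s t P"
 unfolding run_def
proof
 assume "Bd M s"
 then obtain t' n s' where e: "exec Q W (Seq (Seq c1 c2) c3) s t' s'" "t' <= 400 * n" "Bd M s'" "P (t + n) s'" using r unfolding run_def by blast
 from e(1) obtain ta sa tb where a: "exec Q W (Seq c1 c2) s ta sa" "exec Q W c3 sa tb s'" "t' = ta + tb" by (auto elim: SeqE)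
 from a(1) obtain t1 s1 t2 where b: "exec Q W c1 s t1 s1" "exec Q W c2 s1 t2 sa" "ta = t1 + t2" by (auto elim: SeqE)
 have "exec Q W (Seq c1 (Seq c2 c3)) s t' s'" using exec.Seq[OF b(1) exec.Seq[OF b(2) a(2)]] a(3) b(3) by (simp add: add.assoc)
 then show "\<exists>t' n s'. exec Q W (Seq c1 (Seq c2 c3)) s t' s' & t' <= 400 * n & Bd M s' & P (t + n) s'" using e by blast
qed

end

lemma chn_cong: "(\<And>q. q \<in> set ps ==> nx (int q) = nx' (int q)) ==> chn nx p ps = chn nx' p ps"
 by (induction ps arbitrary: p) auto

text \<open>Nodes up to \<open>cn\<close> are in use. The supports need not be sorted;
  \<open>ws\<close> is the order in which the items were appended, latest first.\<close>

definition vrep :: "state => nat => int => (nat => nat) => bool" where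
 "vrep s cn p x \<longleftrightarrow> (\<exists>ps ws. chn (arrs s ''nn'') p ps & (\<forall>q\<in>set ps. q <= cn) & length ws = length ps & distinct ws & set ws = supp x &
   (\<forall>k<length ps. ar s ''ni'' (ps ! k) = int (ws ! k) & ar s ''nm'' (ps ! k) = int (x (ws ! k))))"

text \<open>Nodes are never overwritten once allocated. This is what makes sharing of tails between
  entries and between tables safe.\<close>

definition nagree :: "nat => state => state => bool" where
 "nagree cn s s' \<longleftrightarrow> (\<forall>q\<le>cn. ar s' ''nn'' q = ar s ''nn'' q & ar s' ''ni'' q = ar s ''ni'' q & ar s' ''nm'' q = ar s ''nm'' q)"

lemma vrep_cong:
 assumes "vrep s cn p x" "nagree cn s s'" "cn <= cn'"
 shows "vrep s' cn' p x"
proof -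
 obtain ps ws where h: "chn (arrs s ''nn'') p ps" "\<forall>q\<in>set ps. q <= cn" "length ws = length ps" "distinct ws" "set ws = supp x"
   "\<forall>k<length ps. ar s ''ni'' (ps ! k) = int (ws ! k) & ar s ''nm'' (ps ! k) = int (x (ws ! k))"
  using assms(1) unfolding vrep_def by blast
 have "chn (arrs s' ''nn'') p ps" using h(1,2) assms(2) chn_cong[of ps "arrs s ''nn''" "arrs s' ''nn''" p] unfolding nagree_def by auto
 moreover have "\<forall>k<length ps. ar s' ''ni'' (ps ! k) = int (ws ! k) & ar s' ''nm'' (ps ! k) = int (x (ws ! k))"
  using h(2,6) assms(2) unfolding nagree_def by simp
 moreover have "\<forall>q\<in>set ps. q <= cn'" using h(2) assms(3) by auto
 ultimately show ?thesis unfolding vrep_def using h(3-5) by blast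
qed

lemma vrep_cons:
 assumes "vrep s cn p x" "nagree cn s s'" "w \<notin> supp x" "k > 0" "ar s' ''nn'' (Suc cn) = p" "ar s' ''ni'' (Suc cn) = int w" "ar s' ''nm'' (Suc cn) = int k"
 shows "vrep s' (Suc cn) (int (Suc cn)) (x \<oplus> vsingle w k)"
proof -
 have "vrep s' cn p x" using vrep_cong[OF assms(1,2)] by simp
 then obtain ps ws where h: "chn (arrs s' ''nn'') p ps" "\<forall>q\<in>set ps. q <= cn" "length ws = length ps" "distinct ws" "set ws = supp x"
   "\<forall>k<length ps. ar s' ''ni'' (ps ! k) = int (ws ! k) & ar s' ''nm'' (ps ! k) = int (x (ws ! k))"
  unfolding vrep_def by blast
 have xw: "x w = 0" using assms(3) by (simp add: supp_def)
 have "chn (arrs s' ''nn'') (int (Suc cn)) (Suc cn # ps)" using h(1) assms(5) by simp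
 moreover have "\<forall>q\<in>set (Suc cn # ps). q <= Suc cn" using h(2) by auto
 moreover have "distinct (w # ws)" "set (w # ws) = supp (x \<oplus> vsingle w k)" using h(4,5) assms(3,4) by (auto simp: supp_vadd supp_vsingle)
 moreover have "ar s' ''ni'' ((Suc cn # ps) ! j) = int ((w # ws) ! j) & ar s' ''nm'' ((Suc cn # ps) ! j) = int ((x \<oplus> vsingle w k) ((w # ws) ! j))"
  if "j < length (Suc cn # ps)" for j
 proof (cases j)
  case 0
  then show ?thesis using assms(6,7) xw by (simp add: vadd_def vsingle_def)
 next
  case (Suc j')
  then have j': "j' < length ps" using that by simp
  then have "ws ! j' \<in> supp x" using h(3,5) nth_mem by metis
  then have "ws ! j' \<noteq> w" using assms(3) by auto
  then show ?thesis using Suc h(6) j' by (simp add: vadd_def vsingle_def)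
 qed
 moreover have "length (w # ws) = length (Suc cn # ps)" using h(3) by simp
 ultimately show ?thesis unfolding vrep_def by blast
qed

lemma vrep_nil: "vrep s cn 0 (\<lambda>_. 0)"
 unfolding vrep_def by (intro exI[of _ "[]"]) (simp add: supp_0)

locale kv = kb I W M ss bb for I W M ss bb +
 fixes B :: int
 assumes B0: "0 <= B" and initB: "\<And>i. i < L ==> \<bar>init I i\<bar> <= B"
  and profB: "\<And>w k. w \<in> items I ==> k <= L ==> \<bar>profit I w k\<bar> <= B"
  and BM: "(int L + 2) * B <= M"
begin

definition rep :: "state => nat => string => string => string => nat set => (nat => nat => nat) => bool" where
 "rep s cn vv zz ll A X \<longleftrightarrow> (\<forall>i\<in>A. i < L --> ar s vv i = Vl i (X i) & ar s zz i = int (i - wt (X i)) & vrep s cn (ar s ll i) (X i))"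

lemma rep_cong:
 assumes "rep s cn vv zz ll A X" "nagree cn s s'" "cn <= cn'" "arrs s' vv = arrs s vv" "arrs s' zz = arrs s zz" "arrs s' ll = arrs s ll"
 shows "rep s' cn' vv zz ll A X"
 using assms vrep_cong unfolding rep_def by metis

lemma nagree_same: "arrs s' ''nn'' = arrs s ''nn'' ==> arrs s' ''ni'' = arrs s ''ni'' ==> arrs s' ''nm'' = arrs s ''nm'' ==> nagree cn s s'"
 by (simp add: nagree_def)

text \<open>Every nonzero entry of a vector uses at least one unit of weight, so at most
  \<open>L\<close> profits contribute, each of size at most \<open>B\<close>.\<close>

lemma Vl_bound:
 assumes "feas i x" "i < L"
 shows "\<bar>Vl i x\<bar> <= M"
proof -
 have wt: "wt x <= i" using assms by (simp add: feas_def)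
 have xw: "x w <= L" if "w \<in> items I" for w
 proof -
  have "x w <= w * x w" using item_pos[OF that] by simp
  also have "\<dots> <= wt x" unfolding wt_def using that fin_items by (intro member_le_sum) auto
  finally show ?thesis using wt assms by simp
 qed
 have "\<bar>gain x\<bar> <= (\<Sum>w\<in>items I. \<bar>profit I w (x w)\<bar>)" unfolding gain_def by (rule sum_abs)
 also have "\<dots> <= (\<Sum>w\<in>items I. int (w * x w) * B)"
 proof (rule sum_mono)
  fix w assume w: "w \<in> items I"
  show "\<bar>profit I w (x w)\<bar> <= int (w * x w) * B"
  proof (cases "x w = 0")
   case True
   then show ?thesis using profit_0[OF w] by simp
  next
   case False
   then have "1 <= w * x w" using item_pos[OF w] by simp
   then have "1 <= int (w * x w)" by linarith
   then have "1 * B <= int (w * x w) * B" using B0 by (intro mult_right_mono) auto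
   then show ?thesis using profB[OF w xw[OF w]] by linarith
  qed
 qed
 also have "\<dots> = int (wt x) * B" by (simp add: wt_def sum_distrib_right)
 also have "\<dots> <= int L * B" using wt assms B0 by (intro mult_right_mono) auto
 finally have g: "\<bar>gain x\<bar> <= int L * B" .
 have "\<bar>init I (i - wt x)\<bar> <= B" using initB assms by simp
 then have "\<bar>Vl i x\<bar> <= B + int L * B" using g unfolding Vl_def by linarith
 also have "\<dots> <= M" using BM B0 by (simp add: algebra_simps)
 finally show ?thesis .
qed

lemma LM4: "4 * int L + 16 <= M"
proof -
 have "4 * L + 16 <= ZZ * ZZ" using mult_le_mono[of 16 ZZ "L + 2" ZZ] Z_basic by simp
 then have "4 * L + 16 <= ZZ ^ 2" by (simp add: power2_eq_square)
 from ZM[OF this] show ?thesis by simp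
qed

definition phase_ok :: "nat set => (nat => nat => nat) => (nat => nat) => nat set => (nat => nat) => (nat => int) => bool" where
 "phase_ok A Y a A' nf nv \<longleftrightarrow> (\<forall>i\<in>A'. i < L --> nf i <= i & nf i \<in> A & nv i = Vl i (step_fam a nf Y i) & i - wt (step_fam a nf Y i) = nf i - wt (Y (nf i)) &
   (nf i \<noteq> i --> a (nf i) \<notin> supp (Y (nf i)) & 0 < (i - nf i) div a (nf i)))"

lemma step_run:
 assumes vL: "vars s ''L'' = int L" and cn: "vars s ''cnt'' = int cn" "int (cn + L + 1) <= M"
  and rp: "rep s cn ''cv'' ''cz'' ''cl'' A Y"
  and no: "\<And>i. i < L ==> ar s ''no'' i = 1 \<longleftrightarrow> i \<in> A'"
  and nf: "\<And>i. i < L ==> nat (ar s ''nf'' i) = nf i" and nv: "\<And>i. i < L ==> ar s ''nv'' i = nv i"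
  and aa: "\<And>i. i < L ==> ar s ''aa'' i = int (a i)"
  and ph: "phase_ok A Y a A' nf nv"
 shows "run step_com s t (\<lambda>t' s'. t' <= t + 3 + 16 * L & (\<exists>cn'. cn <= cn' & cn' <= cn + L & vars s' ''cnt'' = int cn' & nagree cn s s' &
   (\<forall>i<L. ar s' ''ok'' i = (if i \<in> A' then 1 else 0)) & rep s' cn' ''cv'' ''cz'' ''cl'' A' (step_fam a nf Y)))"
proof -
 let ?c4 = "(''f'' ::= Read ''nf'' ($''i'');; Cond (Less ($''f'') (#0)) (''f'' ::= #0) Skip)"
 let ?c3 = "(''cnt'' ::= $''cnt'' +. #1;; Write ''ni'' ($''cnt'') (Read ''aa'' ($''f''));; Write ''nm'' ($''cnt'') (($''i'' -. $''f'') \<div> Read ''aa'' ($''f''));; Write ''nn'' ($''cnt'') (Read ''cl'' ($''f''));; Write ''cl'' ($''i'') ($''cnt''))"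
 let ?c2 = "(''f'' ::= Read ''nf'' ($''i'');; Cond (Less ($''f'') (#0)) (''f'' ::= #0) Skip;; Write ''cv'' ($''i'') (Read ''nv'' ($''i''));; Write ''cz'' ($''i'') (Read ''cz'' ($''f''));; Write ''ok'' ($''i'') (#1);; Cond (Equal ($''f'') ($''i'')) Skip ?c3)"
 let ?c1 = "(''i'' ::= $''i'' -. #1;; Cond (Equal (Read ''no'' ($''i'')) (#1)) ?c2 (Write ''ok'' ($''i'') (#0)))"
 let ?Y = "step_fam a nf Y"
 \<comment> \<open>After \<open>k\<close> rounds the indices from \<open>L - k\<close> on carry new
   entries, while all smaller ones are untouched.\<close>
 define J :: "nat => nat => state => bool" where "J = (\<lambda>k t' s'. t' <= t + 1 + 16 * k & vars s' ''i'' = int (L - k) &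
   arrs s' ''no'' = arrs s ''no'' & arrs s' ''nf'' = arrs s ''nf'' & arrs s' ''nv'' = arrs s ''nv'' & arrs s' ''aa'' = arrs s ''aa'' &
   (\<exists>cn'. cn <= cn' & cn' <= cn + k & vars s' ''cnt'' = int cn' & nagree cn s s' &
    (\<forall>i<L - k. ar s' ''cv'' i = ar s ''cv'' i & ar s' ''cz'' i = ar s ''cz'' i & ar s' ''cl'' i = ar s ''cl'' i) &
    (\<forall>i. L - k <= i --> i < L --> ar s' ''ok'' i = (if i \<in> A' then 1 else 0)) &
    rep s' cn' ''cv'' ''cz'' ''cl'' (A' \<inter> {i. L - k <= i}) ?Y))"
 have pre: "run (''i'' ::= $''L'') s t (J 0)"
 proof -
  have P0: "J 0 t' s'" if "t' = t + 1" "arrs s' = arrs s" "vars s' = (vars s)(''i'' := int L)" for t' :: nat and s' :: state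
   unfolding J_def using that cn by (intro conjI exI[of _ cn]) (simp_all add: nagree_def rep_def)
  show ?thesis using LM4 vL by (intro run_wp) (simp, rule P0, simp_all)
 qed
 show ?thesis unfolding step_com_def
 proof (rule run_SeqI[OF pre], rule run_for[where Inv = J and n = L])
  fix k t2 :: nat and s2 :: state
  assume k: "k < L" and I: "J k t2 s2"
  define i where "i = L - Suc k"
  have i: "i < L" "L - k = Suc i" "int (L - k) - 1 = int i" using k by (auto simp: i_def)
  obtain c2 where c2: "cn <= c2" "c2 <= cn + k" "vars s2 ''cnt'' = int c2" "nagree cn s s2"
    "\<forall>j<Suc i. ar s2 ''cv'' j = ar s ''cv'' j & ar s2 ''cz'' j = ar s ''cz'' j & ar s2 ''cl'' j = ar s ''cl'' j"
    "\<forall>j. Suc i <= j --> j < L --> ar s2 ''ok'' j = (if j \<in> A' then 1 else 0)"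
    "rep s2 c2 ''cv'' ''cz'' ''cl'' (A' \<inter> {j. Suc i <= j}) ?Y"
   using I unfolding J_def i(2) by blast
  have f2: "t2 <= t + 1 + 16 * k" "vars s2 ''i'' = int (Suc i)" "arrs s2 ''no'' = arrs s ''no''" "arrs s2 ''nf'' = arrs s ''nf''" "arrs s2 ''nv'' = arrs s ''nv''" "arrs s2 ''aa'' = arrs s ''aa''"
   using I unfolding J_def i(2) by simp_all
  have Li: "L - Suc k = i" by (simp add: i_def)
  have JI: "J (Suc k) t3 s3" if "t3 <= t2 + 16" "vars s3 ''i'' = int i" "arrs s3 ''no'' = arrs s ''no''" "arrs s3 ''nf'' = arrs s ''nf''" "arrs s3 ''nv'' = arrs s ''nv''" "arrs s3 ''aa'' = arrs s ''aa''"
    "cn <= c3" "c3 <= cn + Suc k" "vars s3 ''cnt'' = int c3" "nagree cn s s3"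
    "\<And>j. j < i ==> ar s3 ''cv'' j = ar s2 ''cv'' j & ar s3 ''cz'' j = ar s2 ''cz'' j & ar s3 ''cl'' j = ar s2 ''cl'' j"
    "arrs s3 ''ok'' = (arrs s2 ''ok'')(int i := (if i \<in> A' then 1 else 0))" "rep s3 c3 ''cv'' ''cz'' ''cl'' (A' \<inter> {j. i <= j}) ?Y" for t3 c3 :: nat and s3 :: state
  proof -
   have tt: "t3 <= t + 1 + 16 * Suc k" using that(1) f2(1) by simp
   have oks: "\<forall>j. i <= j --> j < L --> ar s3 ''ok'' j = (if j \<in> A' then 1 else 0)"
   proof (intro allI impI)
    fix j assume "i <= j" "j < L"
    then show "ar s3 ''ok'' j = (if j \<in> A' then 1 else 0)" using that(12) c2(6) by (cases "j = i") simp_all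
   qed
   have lo: "\<forall>j<i. ar s3 ''cv'' j = ar s ''cv'' j & ar s3 ''cz'' j = ar s ''cz'' j & ar s3 ''cl'' j = ar s ''cl'' j"
    using that(11) c2(5) by simp
   show ?thesis unfolding J_def Li using tt that(2-10) lo oks that(13) by (intro conjI exI[of _ c3]) assumption+
  qed
  have rep2: "ar s2 ''cv'' j = Vl j (?Y j) & ar s2 ''cz'' j = int (j - wt (?Y j)) & vrep s2 c2 (ar s2 ''cl'' j) (?Y j)" if "j \<in> A'" "i < j" "j < L" for j
   using c2(7) that unfolding rep_def by auto
  have body: "run ?c1 s2 (t2 + 1) (J (Suc k))"
  proof (cases "i \<in> A'")
   case False
   have n0: "ar s ''no'' i \<noteq> 1" using no[OF i(1)] False by simp
   have R: "J (Suc k) t3 s3" if s3: "t3 <= t2 + 16" "vars s3 = (vars s2)(''i'' := int i)" "arrs s3 = (arrs s2)(''ok'' := (arrs s2 ''ok'')(int i := 0))" for t3 :: nat and s3 :: state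
   proof (rule JI[of t3 s3 c2])
    have "A' \<inter> {j. i <= j} = A' \<inter> {j. Suc i <= j}" using False by (auto simp: le_eq_less_or_eq Suc_le_eq)
    moreover have "nagree c2 s2 s3" using s3 by (simp add: nagree_def)
    ultimately show "rep s3 c2 ''cv'' ''cz'' ''cl'' (A' \<inter> {j. i <= j}) ?Y" using rep_cong[OF c2(7)] s3 by simp
    show "nagree cn s s3" using c2(4) s3 by (simp add: nagree_def)
   qed (use s3 f2 c2(1-3) False in simp_all)
   have iM: "int i <= M" using i LM4 by simp
   show ?thesis using f2(2,3) n0 iM M16 by (intro run_wp) (simp, rule R, simp_all)
  next
   case True
   define f where "f = nf i"
   have ph_i: "f <= i" "f \<in> A" "nv i = Vl i (?Y i)" "i - wt (?Y i) = f - wt (Y f)" "f \<noteq> i --> a f \<notin> supp (Y f) & 0 < (i - f) div a f"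
    using ph True i(1) unfolding phase_ok_def f_def by blast+
   have fL: "f < L" using ph_i(1) i(1) by simp
   have n1: "ar s ''no'' i = 1" using no[OF i(1)] True by simp
   have nfi: "nat (ar s ''nf'' i) = f" using nf[OF i(1)] f_def by simp
   have rf: "ar s ''cz'' f = int (f - wt (Y f))" "vrep s cn (ar s ''cl'' f) (Y f)" using rp ph_i(2) fL unfolding rep_def by blast+
   have f_s2: "ar s2 ''cz'' f = int (f - wt (Y f))" "ar s2 ''cl'' f = ar s ''cl'' f" using c2(5) ph_i(1) rf by (simp_all add: less_Suc_eq_le)
   have vf: "vrep s2 c2 (ar s ''cl'' f) (Y f)" using vrep_cong[OF rf(2) c2(4) c2(1)] .
   have iM: "int i <= M" "int f <= M" using i fL LM4 by simp_all
   have cM: "int c2 + 1 <= M" using cn(2) c2(2) k by simp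
   \<comment> \<open>The specification reads the source through \<open>nat\<close>; clamping
     negative values at 0 makes the program agree with it without knowing the sign.\<close>
   have blkF: "run ?c4 s3 t3
     (\<lambda>t' s'. t' <= t3 + 3 & arrs s' = arrs s3 & vars s' = (vars s3)(''f'' := int f))" if "arrs s3 = arrs s2" "vars s3 ''i'' = int i" for s3 :: state and t3 :: nat
   proof (cases "ar s ''nf'' i < 0")
    case T: True
    then have "f = 0" using nfi by simp
    then show ?thesis using that T BdD(2)[of s3 "''nf''" "int i"] M16 f2(4) by (intro run_wp) simp
   next
    case F: False
    then have "ar s ''nf'' i = int f" using nfi by simp
    then show ?thesis using that BdD(2)[of s3 "''nf''" "int i"] M16 f2(4) by (intro run_wp) simp
   qed
   have R1: "J (Suc k) t3 s3" if fi: "f = i" and s3: "t3 <= t2 + 16" "vars s3 = (vars s2)(''i'' := int i, ''f'' := int f)"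
     "arrs s3 = (arrs s2)(''cv'' := (arrs s2 ''cv'')(int i := nv i), ''cz'' := (arrs s2 ''cz'')(int i := int (f - wt (Y f))), ''ok'' := (arrs s2 ''ok'')(int i := 1))" for t3 :: nat and s3 :: state
   proof (rule JI[of t3 s3 c2])
    have na: "nagree c2 s2 s3" using s3 by (simp add: nagree_def)
    have Yi: "?Y i = Y i" using fi by (simp add: step_fam_def f_def)
    show "rep s3 c2 ''cv'' ''cz'' ''cl'' (A' \<inter> {j. i <= j}) ?Y"
     unfolding rep_def
    proof (intro ballI impI)
     fix j assume j: "j \<in> A' \<inter> {j. i <= j}" "j < L"
     show "ar s3 ''cv'' j = Vl j (?Y j) & ar s3 ''cz'' j = int (j - wt (?Y j)) & vrep s3 c2 (ar s3 ''cl'' j) (?Y j)"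
     proof (cases "j = i")
      case True
      have "vrep s3 c2 (ar s ''cl'' f) (Y f)" using vrep_cong[OF vf na] by simp
      then show ?thesis using True s3(3) ph_i(3,4) f_s2(2) fi Yi by simp
     next
      case False
      then have j': "j \<in> A'" "i < j" using j by auto
      show ?thesis using rep2[OF j' j(2)] vrep_cong[OF _ na] s3(3) False by simp
     qed
    qed
    show "nagree cn s s3" using c2(4) s3 by (simp add: nagree_def)
   qed (use s3 f2 c2(1-3) True in simp_all)
   have kk: "(int i - int f) div int (a f) = int ((i - f) div a f)" using ph_i(1) by (simp add: zdiv_int of_nat_diff)
   have R2: "J (Suc k) t3 s3" if fi: "f \<noteq> i" and s3: "t3 <= t2 + 16" "vars s3 = (vars s2)(''i'' := int i, ''f'' := int f, ''cnt'' := int c2 + 1)"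
     "arrs s3 = (arrs s2)(''cv'' := (arrs s2 ''cv'')(int i := nv i), ''cz'' := (arrs s2 ''cz'')(int i := int (f - wt (Y f))), ''ok'' := (arrs s2 ''ok'')(int i := 1),
      ''ni'' := (arrs s2 ''ni'')(int c2 + 1 := int (a f)), ''nm'' := (arrs s2 ''nm'')(int c2 + 1 := int ((i - f) div a f)),
      ''nn'' := (arrs s2 ''nn'')(int c2 + 1 := ar s ''cl'' f), ''cl'' := (arrs s2 ''cl'')(int i := int c2 + 1))" for t3 :: nat and s3 :: state
   proof (rule JI[of t3 s3 "Suc c2"])
    have na: "nagree c2 s2 s3" using s3 by (simp add: nagree_def)
    have Yi: "?Y i = Y f \<oplus> vsingle (a f) ((i - f) div a f)" using fi by (simp add: step_fam_def f_def)
    have vc: "vrep s3 (Suc c2) (int (Suc c2)) (?Y i)" unfolding Yi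
     by (rule vrep_cons[OF vf na]) (use ph_i(5) fi s3(3) in \<open>simp_all add: add.commute\<close>)
    show "rep s3 (Suc c2) ''cv'' ''cz'' ''cl'' (A' \<inter> {j. i <= j}) ?Y"
     unfolding rep_def
    proof (intro ballI impI)
     fix j assume j: "j \<in> A' \<inter> {j. i <= j}" "j < L"
     show "ar s3 ''cv'' j = Vl j (?Y j) & ar s3 ''cz'' j = int (j - wt (?Y j)) & vrep s3 (Suc c2) (ar s3 ''cl'' j) (?Y j)"
     proof (cases "j = i")
      case True
      then show ?thesis using s3(3) ph_i(3,4) vc by (simp add: add.commute)
     next
      case False
      then have j': "j \<in> A'" "i < j" using j by auto
      show ?thesis using rep2[OF j' j(2)] vrep_cong[OF _ na, of _ _ "Suc c2"] s3(3) False by simp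
     qed
    qed
    show "nagree cn s s3" using c2(1,4) s3 by (simp add: nagree_def)
   qed (use s3 f2 c2(1-3) True in simp_all)
   have qM: "int ((i - f) div a f) <= M" using iM(1) div_le_dividend[of "i - f" "a f"] by linarith
   have czM: "int (f - wt (Y f)) <= M" using iM(2) by linarith
   have blk0: "run (''i'' ::= $''i'' -. #1) s2 (t2 + 1) (\<lambda>t' s'. t' = t2 + 2 & arrs s' = arrs s2 & vars s' = (vars s2)(''i'' := int i))"
    using f2(2) iM by (intro run_wp) simp
   show ?thesis
   proof (rule run_SeqI[OF blk0], rule run_Cond)
    fix t3 :: nat and s3 :: state
    assume a3: "t3 = t2 + 2 & arrs s3 = arrs s2 & vars s3 = (vars s2)(''i'' := int i)" and "Bd M s3"
    have nvM: "\<bar>nv i\<bar> <= M" using BdD(2)[OF \<open>Bd M s3\<close>, of "''nv''" "int i"] nv[OF i(1)] f2(5) a3 by simp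
    have aM: "\<bar>int (a f)\<bar> <= M" using BdD(2)[OF \<open>Bd M s3\<close>, of "''aa''" "int f"] aa[OF fL] f2(6) a3 by simp
    have clM: "\<bar>ar s ''cl'' f\<bar> <= M" using BdD(2)[OF \<open>Bd M s3\<close>, of "''cl''" "int f"] f_s2 a3 by simp
    have b1: "run ?c4 s3 (t3 + 1)
     (\<lambda>t' s'. t' <= t3 + 1 + 3 & arrs s' = arrs s3 & vars s' = (vars s3)(''f'' := int f))" by (rule blkF) (use a3 in simp_all)
    have b2: "run (Write ''cv'' ($''i'') (Read ''nv'' ($''i''));; Write ''cz'' ($''i'') (Read ''cz'' ($''f''));;
     Write ''ok'' ($''i'') (#1);;
     Cond (Equal ($''f'') ($''i'')) Skip
      ?c3) s4 t4 (J (Suc k))"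
     if "t4 <= t3 + 4" "arrs s4 = arrs s2" "vars s4 = (vars s2)(''i'' := int i, ''f'' := int f)" for s4 :: state and t4 :: nat
    proof (cases "f = i")
     case T: True
     have nvi: "ar s ''nv'' i = nv i" using nv[OF i(1)] .
     show ?thesis using T that a3 nvM czM M16 f2(5) nvi f_s2 by (intro run_wp) (simp, rule R1, simp_all add: fun_upd_twist)
    next
     case F: False
     have nvi: "ar s ''nv'' i = nv i" using nv[OF i(1)] .
     have af: "ar s ''aa'' f = int (a f)" using aa[OF fL] .
     show ?thesis using F that a3 nvM czM aM clM qM cM M16 f2(5,6) nvi af f_s2 c2(3) by (intro run_wp) (simp add: kk, rule R2, simp_all add: fun_upd_twist)
    qed
    show "run ?c2 s3 (t3 + 1) (J (Suc k))"
     by (rule run_Seq_assoc, rule run_SeqI[OF b1], rule b2) (use a3 in simp_all)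
   qed (use f2(3) n1 in simp_all)
  qed
  show "bval (evaluator_of I) s2 (Less (#0) ($''i'')) & run ?c1 s2 (t2 + 1) (J (Suc k))" using f2(2) by (intro conjI body) simp
 next
  fix t2 :: nat and s2 :: state assume I: "J L t2 s2"
  have LL: "L - L = 0" by simp
  obtain c2 where c2: "cn <= c2" "c2 <= cn + L" "vars s2 ''cnt'' = int c2" "nagree cn s s2"
    "\<forall>j. 0 <= j --> j < L --> ar s2 ''ok'' j = (if j \<in> A' then 1 else 0)"
    "rep s2 c2 ''cv'' ''cz'' ''cl'' (A' \<inter> {j. 0 <= j}) ?Y"
   using I unfolding J_def LL by blast
  have f: "t2 <= t + 1 + 16 * L" "vars s2 ''i'' = int 0" using I unfolding J_def LL by blast+
  have "A' \<inter> {j. 0 <= j} = A'" by auto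
  then have "rep s2 c2 ''cv'' ''cz'' ''cl'' A' ?Y" using c2(6) by (simp only:)
  moreover have "\<forall>i<L. ar s2 ''ok'' i = (if i \<in> A' then 1 else 0)" using c2(5) by blast
  moreover have "t2 + 1 <= t + 3 + 16 * L" using f(1) by linarith
  moreover have "\<not> bval (evaluator_of I) s2 (Less (#0) ($''i''))" using f(2) by simp
  ultimately show "\<not> bval (evaluator_of I) s2 (Less (#0) ($''i'')) & t2 + 1 <= t + 3 + 16 * L & (\<exists>cn'. cn <= cn' & cn' <= cn + L & vars s2 ''cnt'' = int cn' & nagree cn s s2 &
   (\<forall>i<L. ar s2 ''ok'' i = (if i \<in> A' then 1 else 0)) & rep s2 cn' ''cv'' ''cz'' ''cl'' A' ?Y)"
   using c2(1-4) by blast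
 qed auto
qed

end

section \<open>One residue class of one modulus\<close>

definition phase_com :: com where
 "phase_com = (pick_com;; sweep_com;; step_com;; ''rh'' ::= $''rh'' +. #1)"

lemma frames_phase:
 "v \<in> {''L'', ''K'', ''c'', ''d'', ''D'', ''lg''} ==> v \<notin> asgd phase_com"
 "a \<in> {''off'', ''S'', ''nx2'', ''h2'', ''q'', ''bv'', ''bz'', ''bl'', ''av'', ''az'', ''al''} ==> a \<notin> wrtn phase_com"
 "v \<in> {''L'', ''K'', ''c'', ''d'', ''rh'', ''cnt'', ''D'', ''lg''} ==> v \<notin> asgd pick_com"
 "a \<noteq> ''aa'' ==> a \<notin> wrtn pick_com"
 "v \<in> {''L'', ''K'', ''c'', ''d'', ''rh'', ''cnt'', ''D'', ''lg''} ==> v \<notin> asgd sweep_com"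
 "a \<in> {''off'', ''S'', ''nx2'', ''h2'', ''q'', ''bv'', ''bz'', ''bl'', ''av'', ''az'', ''al'', ''cv'', ''cz'', ''cl'', ''ok'', ''aa'', ''ni'', ''nm'', ''nn''} ==> a \<notin> wrtn sweep_com"
 "v \<in> {''L'', ''K'', ''c'', ''d'', ''rh'', ''D'', ''lg''} ==> v \<notin> asgd step_com"
 by (auto simp: phase_com_def pick_com_def sweep_com_def step_com_def row_com_def take_com_def push_com_def own_com_def emit_com_def asgd_cross_com wrtn_cross_com)

lemma frames_loops:
 "asgd start_com \<subseteq> {''i'', ''p'', ''u'', ''b''}" "wrtn start_com \<subseteq> {''ok'', ''cv'', ''cz'', ''cl''}"
 "asgd merge_com \<subseteq> {''i''}" "wrtn merge_com \<subseteq> {''av'', ''az'', ''al''}"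
 "asgd flush_com \<subseteq> {''i''}" "wrtn flush_com \<subseteq> {''bv'', ''bz'', ''bl''}"
 by (auto simp: start_com_def merge_com_def flush_com_def frames_main1)

lemma sweep_spec_cong:
 assumes "sweep_spec L ok V a Qf no nf nv" "\<And>i. i < L ==> ok i ==> V i = V' i"
 shows "sweep_spec L ok V' a Qf no nf nv"
proof -
 have c: "col_val V a Qf z r = col_val V' a Qf z r" if "ok z" "z < L" for z r
  using that assms(2) by (simp add: col_val_def)
 have b: "beaten V a Qf no nf nv z r = beaten V' a Qf no nf nv z r" if "ok z" "z < L" for z r
  using c[OF that] by (simp add: beaten_def)
 show ?thesis unfolding sweep_spec_def
 proof (intro allI impI)
  fix r assume r: "r < L"
  have s: "no r --> nf r <= r & ok (nf r) & (nf r = r \<or> a (nf r) \<noteq> 0 & a (nf r) dvd r - nf r) & nv r = col_val V a Qf (nf r) r"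
   "ok r --> no r & V r <= nv r"
   "\<forall>z<r. ok z & a z \<noteq> 0 & a z dvd r - z --> no r & col_val V a Qf z r <= nv r \<or> beaten V a Qf no nf nv z r"
   using assms(1) r unfolding sweep_spec_def by blast+
  have 1: "no r --> nf r <= r & ok (nf r) & (nf r = r \<or> a (nf r) \<noteq> 0 & a (nf r) dvd r - nf r) & nv r = col_val V' a Qf (nf r) r"
  proof
   assume n: "no r"
   then have "ok (nf r)" "nf r < L" using s(1) r by (auto dest: le_less_trans)
   then show "nf r <= r & ok (nf r) & (nf r = r \<or> a (nf r) \<noteq> 0 & a (nf r) dvd r - nf r) & nv r = col_val V' a Qf (nf r) r"
    using s(1) n c by metis
  qed
  have 2: "ok r --> no r & V' r <= nv r" using s(2) assms(2)[OF r] by auto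
  have 3: "\<forall>z<r. ok z & a z \<noteq> 0 & a z dvd r - z --> no r & col_val V' a Qf z r <= nv r \<or> beaten V' a Qf no nf nv z r"
  proof (intro allI impI)
   fix z assume z: "z < r" "ok z & a z \<noteq> 0 & a z dvd r - z"
   have "z < L" using z r by simp
   then show "no r & col_val V' a Qf z r <= nv r \<or> beaten V' a Qf no nf nv z r"
    using s(3) z c[of z r] b[of z r] by auto
  qed
  show "(no r --> nf r <= r & ok (nf r) & (nf r = r \<or> a (nf r) \<noteq> 0 & a (nf r) dvd r - nf r) & nv r = col_val V' a Qf (nf r) r) &
   (ok r --> no r & V' r <= nv r) &
   (\<forall>z<r. ok z & a z \<noteq> 0 & a z dvd r - z --> no r & col_val V' a Qf z r <= nv r \<or> beaten V' a Qf no nf nv z r)"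
   by (intro conjI 1 2 3)
 qed
qed

context kv
begin

definition Uc :: "(nat => nat) => nat => nat set" where "Uc clr c = {w \<in> items I. clr w = c}"
definition Pc :: "(nat => nat) => nat => nat set" where "Pc clr c = {w \<in> items I. clr w < c}"

lemma wl_Uc: "z < L ==> set (wl clr L z c) = {w \<in> allowed I z. w \<in> Uc clr c & w < len I}"
 unfolding wl_set Uc_def using allowed_items[of z] item_pos by auto

lemma iso_wl: "z < L ==> inj_on (\<lambda>w. w mod d) (set (wl clr L z c)) \<longleftrightarrow> iso d (Uc clr c) z"
 by (simp add: wl_Uc iso_def)

lemma start_run:
 assumes st: "static K lg clr s" and v: "vars s ''c'' = int c" "vars s ''d'' = int d" "c < K" "1 <= d"
  and z: "\<And>i. i < L ==> ar s ''bz'' i = int (z i) & z i < L"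
 shows "run start_com s t (\<lambda>t' s'. t' <= t + 3 + L * (lg * (4 * lg + 5) + 12) & (\<forall>i<L. ar s' ''ok'' i = (if iso d (Uc clr c) (z i) then 1 else 0) &
   ar s' ''cv'' i = ar s ''bv'' i & ar s' ''cz'' i = ar s ''bz'' i & ar s' ''cl'' i = ar s ''bl'' i))"
  (is "run _ _ _ ?post")
proof -
 let ?c2 = "(Write ''ok'' ($''i'') ($''b'');; Write ''cv'' ($''i'') (Read ''bv'' ($''i''));; Write ''cz'' ($''i'') (Read ''bz'' ($''i''));; Write ''cl'' ($''i'') (Read ''bl'' ($''i''));; ''i'' ::= $''i'' +. #1)"
 let ?c1 = "(iso_com;; ?c2)"
 define fr :: "state => bool" where "fr = (\<lambda>s'. (\<forall>v. v \<notin> {''i'', ''p'', ''u'', ''b''} --> vars s' v = vars s v) & (\<forall>a. a \<notin> {''ok'', ''cv'', ''cz'', ''cl''} --> arrs s' a = arrs s a))"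
 define G :: "state => nat => bool" where "G = (\<lambda>s' i. ar s' ''ok'' i = (if iso d (Uc clr c) (z i) then 1 else 0) &
   ar s' ''cv'' i = ar s ''bv'' i & ar s' ''cz'' i = ar s ''bz'' i & ar s' ''cl'' i = ar s ''bl'' i)"
 define J :: "nat => nat => state => bool" where "J = (\<lambda>k t' s'. t' <= t + 1 + k * (lg * (4 * lg + 5) + 12) & fr s' & vars s' ''i'' = int k & (\<forall>i<k. G s' i))"
 have vL: "vars s ''L'' = int L" using st by (simp add: static_def inA_def)
 have pre: "run (''i'' ::= #0) s t (J 0)"
 proof -
  have P0: "J 0 t' s'" if "t' = t + 1" "arrs s' = arrs s" "vars s' = (vars s)(''i'' := 0)" for t' :: nat and s' :: state
   using that by (simp add: J_def fr_def)
  show ?thesis using M16 by (intro run_wp) (simp, rule P0, simp_all)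
 qed
 show ?thesis unfolding start_com_def
 proof (rule run_SeqI[OF pre], rule run_for[where Inv = J and n = L])
  fix i t2 :: nat and s2 :: state
  assume i: "i < L" and I: "J i t2 s2"
  have f2: "t2 <= t + 1 + i * (lg * (4 * lg + 5) + 12)" "fr s2" "vars s2 ''i'' = int i" "\<forall>j<i. G s2 j" using I unfolding J_def by blast+
  have st2: "static K lg clr s2" by (rule static_cong[OF st]) (use f2(2) in \<open>simp_all add: fr_def\<close>)
  have g2: "vars s2 ''c'' = int c" "vars s2 ''d'' = int d" "vars s2 ''L'' = int L" "arrs s2 ''bz'' = arrs s ''bz''" using f2(2) v vL by (simp_all add: fr_def)
  have zi: "ar s2 ''bz'' i = int (z i)" "z i < L" using z[OF i] g2(4) by simp_all
  have iso: "run iso_com s2 (t2 + 1) (\<lambda>t' s'. t' <= t2 + 1 + 4 + lg * (4 * lg + 5) & vars s' ''b'' = (if inj_on (\<lambda>w. w mod d) (set (wl clr L (z i) c)) then 1 else 0))"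
   by (rule iso_run[OF st2 f2(3) g2(1,2) v(3,4) zi])
  have blk: "run ?c2 s3 t3 (J (Suc i))"
   if a3: "t3 <= t2 + 1 + 4 + lg * (4 * lg + 5)" "vars s3 ''b'' = (if iso d (Uc clr c) (z i) then 1 else 0)"
    and v3: "vars s3 ''i'' = int i" "\<And>v. v \<notin> {''i'', ''p'', ''u'', ''b''} ==> vars s3 v = vars s v" and r3: "arrs s3 = arrs s2" for s3 :: state and t3 :: nat
  proof -
   have R: "J (Suc i) t4 s4" if "t4 = t3 + 5" "vars s4 = (vars s3)(''i'' := int i + 1)"
     "arrs s4 = (arrs s2)(''ok'' := (arrs s2 ''ok'')(int i := vars s3 ''b''), ''cv'' := (arrs s2 ''cv'')(int i := ar s ''bv'' i), ''cz'' := (arrs s2 ''cz'')(int i := ar s ''bz'' i), ''cl'' := (arrs s2 ''cl'')(int i := ar s ''bl'' i))" for t4 :: nat and s4 :: state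
   proof -
    have "fr s4" using f2(2) that v3(2) unfolding fr_def by simp
    moreover have "\<forall>j<Suc i. G s4 j"
    proof (intro allI impI)
     fix j assume "j < Suc i"
     then show "G s4 j" using f2(4) that(3) a3(2) by (cases "j = i") (simp_all add: G_def)
    qed
    moreover have "t4 <= t + 1 + Suc i * (lg * (4 * lg + 5) + 12)" using that(1) a3(1) f2(1) by simp
    ultimately show ?thesis unfolding J_def using that(2) by simp
   qed
   have ab: "arrs s2 ''bv'' = arrs s ''bv''" "arrs s2 ''bz'' = arrs s ''bz''" "arrs s2 ''bl'' = arrs s ''bl''" using f2(2) by (simp_all add: fr_def)
   show ?thesis
   proof (rule runI_Bd)
    assume B: "Bd M s3"
    have bds: "\<bar>vars s3 ''b''\<bar> <= M" "\<bar>ar s ''bv'' i\<bar> <= M" "\<bar>ar s ''bz'' i\<bar> <= M" "\<bar>ar s ''bl'' i\<bar> <= M" "int i + 1 <= M"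
     using BdD(1)[OF B, of "''b''"] BdD(2)[OF B, of "''bv''" "int i"] BdD(2)[OF B, of "''bz''" "int i"] BdD(2)[OF B, of "''bl''" "int i"] r3 ab i LM4 by simp_all
    show ?thesis using v3(1) r3 ab bds by (intro run_wp) (simp, rule R, simp_all)
   qed
  qed
  have "run ?c1 s2 (t2 + 1) (J (Suc i))"
  proof (rule run_SeqI[OF iso], rule blk)
   fix t3 :: nat and s3 :: state
   assume a3: "t3 <= t2 + 1 + 4 + lg * (4 * lg + 5) & vars s3 ''b'' = (if inj_on (\<lambda>w. w mod d) (set (wl clr L (z i) c)) then 1 else 0)"
    and v3: "\<And>v. v \<notin> asgd iso_com ==> vars s3 v = vars s2 v" and r3: "\<And>a. a \<notin> wrtn iso_com ==> arrs s3 a = arrs s2 a"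
   show "t3 <= t2 + 1 + 4 + lg * (4 * lg + 5)" using a3 by simp
   show "vars s3 ''b'' = (if iso d (Uc clr c) (z i) then 1 else 0)" using a3 iso_wl[OF zi(2)] by simp
   show "vars s3 ''i'' = int i" using v3[of "''i''"] f2(3) by (simp add: frames_main1)
   show "vars s3 v = vars s v" if "v \<notin> {''i'', ''p'', ''u'', ''b''}" for v using v3[of v] that f2(2) by (simp add: frames_main1 fr_def)
   show "arrs s3 = arrs s2" using r3 by (simp add: frames_main1 fun_eq_iff)
  qed
  then show "bval (evaluator_of I) s2 (Less ($''i'') ($''L'')) & run ?c1 s2 (t2 + 1) (J (Suc i))" using f2(3) g2(3) i by simp
 next
  fix t2 :: nat and s2 :: state assume I: "J L t2 s2"
  have "vars s2 ''L'' = int L" "vars s2 ''i'' = int L" "t2 <= t + 1 + L * (lg * (4 * lg + 5) + 12)" "\<forall>i<L. G s2 i" using I vL unfolding J_def fr_def by simp_all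
  then show "\<not> bval (evaluator_of I) s2 (Less ($''i'') ($''L'')) & ?post (t2 + 1) s2"
   unfolding G_def by simp
 qed auto
qed

lemma merge_run:
 assumes vL: "vars s ''L'' = int L"
 defines "cond \<equiv> \<lambda>i. ar s ''ok'' i = 1 & ar s ''av'' i < ar s ''cv'' i"
 shows "run merge_com s t (\<lambda>t' s'. t' <= t + 3 + 8 * L & (\<forall>i<L. ar s' ''av'' i = (if cond i then ar s ''cv'' i else ar s ''av'' i) &
   ar s' ''az'' i = (if cond i then ar s ''cz'' i else ar s ''az'' i) & ar s' ''al'' i = (if cond i then ar s ''cl'' i else ar s ''al'' i)))"
  (is "run _ _ _ ?post")
proof -
 let ?c1 = "(Cond (BAnd (Equal (Read ''ok'' ($''i'')) (#1)) (Less (Read ''av'' ($''i'')) (Read ''cv'' ($''i'')))) (Write ''av'' ($''i'') (Read ''cv'' ($''i''));; Write ''az'' ($''i'') (Read ''cz'' ($''i''));; Write ''al'' ($''i'') (Read ''cl'' ($''i''))) Skip;; ''i'' ::= $''i'' +. #1)"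
 define G :: "state => nat => nat => bool" where "G = (\<lambda>s' k i. ar s' ''av'' i = (if i < k & cond i then ar s ''cv'' i else ar s ''av'' i) &
   ar s' ''az'' i = (if i < k & cond i then ar s ''cz'' i else ar s ''az'' i) & ar s' ''al'' i = (if i < k & cond i then ar s ''cl'' i else ar s ''al'' i))"
 define J :: "nat => nat => state => bool" where "J = (\<lambda>k t' s'. t' <= t + 1 + 8 * k & vars s' = (vars s)(''i'' := int k) & (\<forall>a. a \<notin> {''av'', ''az'', ''al''} --> arrs s' a = arrs s a) & (\<forall>i<L. G s' k i))"
 have pre: "run (''i'' ::= #0) s t (J 0)"
 proof -
  have P0: "J 0 t' s'" if "t' = t + 1" "arrs s' = arrs s" "vars s' = (vars s)(''i'' := 0)" for t' :: nat and s' :: state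
   using that by (simp add: J_def G_def)
  show ?thesis using M16 by (intro run_wp) (simp, rule P0, simp_all)
 qed
 show ?thesis unfolding merge_com_def
 proof (rule run_SeqI[OF pre], rule run_for[where Inv = J and n = L])
  fix i t2 :: nat and s2 :: state
  assume i: "i < L" and I: "J i t2 s2" and B: "Bd M s2"
  have f2: "t2 <= t + 1 + 8 * i" "vars s2 = (vars s)(''i'' := int i)" "\<forall>j<L. G s2 i j" using I unfolding J_def by blast+
  have fa: "\<forall>a. a \<notin> {''av'', ''az'', ''al''} --> arrs s2 a = arrs s a" using I unfolding J_def by blast
  then have a2: "arrs s2 ''ok'' = arrs s ''ok''" "arrs s2 ''cv'' = arrs s ''cv''" "arrs s2 ''cz'' = arrs s ''cz''" "arrs s2 ''cl'' = arrs s ''cl''" by simp_all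
  have av: "ar s2 ''av'' i = ar s ''av'' i" using f2(3) i by (simp add: G_def)
  have R: "J (Suc i) t3 s3" if h: "t3 <= t2 + 8" "vars s3 = (vars s)(''i'' := int i + 1)"
   "\<And>x. x \<notin> {''av'', ''az'', ''al''} ==> arrs s3 x = arrs s2 x" "\<And>j. j \<noteq> i ==> ar s3 ''av'' j = ar s2 ''av'' j & ar s3 ''az'' j = ar s2 ''az'' j & ar s3 ''al'' j = ar s2 ''al'' j"
   "G s3 (Suc i) i" for t3 :: nat and s3 :: state
  proof -
   have "t3 <= t + 1 + 8 * Suc i" using h(1) f2(1) by simp
   moreover have "vars s3 = (vars s)(''i'' := int (Suc i))" unfolding h(2) of_nat_Suc by (subst add.commute) (rule refl)
   moreover have "\<forall>a. a \<notin> {''av'', ''az'', ''al''} --> arrs s3 a = arrs s a" using h(3) fa by metis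
   moreover have "\<forall>j<L. G s3 (Suc i) j"
   proof (intro allI impI)
    fix j assume j: "j < L"
    have g: "G s2 i j" using f2(3) j by blast
    show "G s3 (Suc i) j"
    proof (cases "j = i")
     case True
     then show ?thesis using h(5) by simp
    next
     case False
     then have e: "j < Suc i \<longleftrightarrow> j < i" by auto
     show ?thesis using g h(4)[OF False] unfolding G_def e by simp
    qed
   qed
   ultimately show ?thesis unfolding J_def by blast
  qed
  have g_i: "G s2 i i" using f2(3) i by blast
  have bds: "\<bar>ar s ''cv'' i\<bar> <= M" "\<bar>ar s ''cz'' i\<bar> <= M" "\<bar>ar s ''cl'' i\<bar> <= M" "int i + 1 <= M"
   using BdD(2)[OF B, of "''cv''" "int i"] BdD(2)[OF B, of "''cz''" "int i"] BdD(2)[OF B, of "''cl''" "int i"] a2 i LM4 by simp_all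
  have "run ?c1 s2 (t2 + 1) (J (Suc i))"
  proof (cases "cond i")
   case True
   then have T: "ar s ''ok'' i = 1" "ar s ''av'' i < ar s ''cv'' i" by (simp_all add: cond_def)
   show ?thesis using T f2(2) a2 av bds by (intro run_wp) (simp, rule R, simp_all add: True G_def)
  next
   case False
   then have T: "\<not> (ar s ''ok'' i = 1 & ar s ''av'' i < ar s ''cv'' i)" by (simp add: cond_def)
   show ?thesis using f2(2) a2 av bds g_i by (intro run_wp) (simp add: T, rule R, simp_all add: False G_def)
  qed
  then show "bval (evaluator_of I) s2 (Less ($''i'') ($''L'')) & run ?c1 s2 (t2 + 1) (J (Suc i))" using f2(2) vL i by simp
 next
  fix t2 :: nat and s2 :: state assume I: "J L t2 s2"
  have "vars s2 ''L'' = int L" "vars s2 ''i'' = int L" "t2 <= t + 1 + 8 * L" "\<forall>i<L. G s2 L i" using I vL unfolding J_def by simp_all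
  then show "\<not> bval (evaluator_of I) s2 (Less ($''i'') ($''L'')) & ?post (t2 + 1) s2"
   unfolding G_def by simp
 qed auto
qed

lemma flush_run:
 assumes vL: "vars s ''L'' = int L"
 shows "run flush_com s t (\<lambda>t' s'. t' <= t + 3 + 8 * L & (\<forall>i<L. ar s' ''bv'' i = ar s ''av'' i & ar s' ''bz'' i = ar s ''az'' i & ar s' ''bl'' i = ar s ''al'' i))"
proof -
 let ?c1 = "(Write ''bv'' ($''i'') (Read ''av'' ($''i''));; Write ''bz'' ($''i'') (Read ''az'' ($''i''));; Write ''bl'' ($''i'') (Read ''al'' ($''i''));; ''i'' ::= $''i'' +. #1)"
 define G :: "state => nat => bool" where "G = (\<lambda>s' i. ar s' ''bv'' i = ar s ''av'' i & ar s' ''bz'' i = ar s ''az'' i & ar s' ''bl'' i = ar s ''al'' i)"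
 define J :: "nat => nat => state => bool" where "J = (\<lambda>k t' s'. t' <= t + 1 + 8 * k & vars s' = (vars s)(''i'' := int k) & (\<forall>a. a \<notin> {''bv'', ''bz'', ''bl''} --> arrs s' a = arrs s a) & (\<forall>i<k. G s' i))"
 have pre: "run (''i'' ::= #0) s t (J 0)"
 proof -
  have P0: "J 0 t' s'" if "t' = t + 1" "arrs s' = arrs s" "vars s' = (vars s)(''i'' := 0)" for t' :: nat and s' :: state
   using that by (simp add: J_def)
  show ?thesis using M16 by (intro run_wp) (simp, rule P0, simp_all)
 qed
 show ?thesis unfolding flush_com_def
 proof (rule run_SeqI[OF pre], rule run_for[where Inv = J and n = L])
  fix i t2 :: nat and s2 :: state
  assume i: "i < L" and I: "J i t2 s2" and B: "Bd M s2"
  have f2: "t2 <= t + 1 + 8 * i" "vars s2 = (vars s)(''i'' := int i)" "\<forall>j<i. G s2 j" using I unfolding J_def by blast+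
  have fa: "\<forall>a. a \<notin> {''bv'', ''bz'', ''bl''} --> arrs s2 a = arrs s a" using I unfolding J_def by blast
  then have a2: "arrs s2 ''av'' = arrs s ''av''" "arrs s2 ''az'' = arrs s ''az''" "arrs s2 ''al'' = arrs s ''al''" by simp_all
  have R: "J (Suc i) t3 s3" if h: "t3 <= t2 + 8" "vars s3 = (vars s)(''i'' := int i + 1)"
   "arrs s3 = (arrs s2)(''bv'' := (arrs s2 ''bv'')(int i := ar s ''av'' i), ''bz'' := (arrs s2 ''bz'')(int i := ar s ''az'' i), ''bl'' := (arrs s2 ''bl'')(int i := ar s ''al'' i))" for t3 :: nat and s3 :: state
  proof -
   have "t3 <= t + 1 + 8 * Suc i" using h(1) f2(1) by simp
   moreover have "vars s3 = (vars s)(''i'' := int (Suc i))" unfolding h(2) of_nat_Suc by (subst add.commute) (rule refl)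
   moreover have "\<forall>a. a \<notin> {''bv'', ''bz'', ''bl''} --> arrs s3 a = arrs s a" using fa by (simp add: h(3))
   moreover have "\<forall>j<Suc i. G s3 j"
   proof (intro allI impI)
    fix j assume "j < Suc i"
    then show "G s3 j" using f2(3) h(3) by (cases "j = i") (simp_all add: G_def)
   qed
   ultimately show ?thesis unfolding J_def by blast
  qed
  have bds: "\<bar>ar s ''av'' i\<bar> <= M" "\<bar>ar s ''az'' i\<bar> <= M" "\<bar>ar s ''al'' i\<bar> <= M" "int i + 1 <= M"
   using BdD(2)[OF B, of "''av''" "int i"] BdD(2)[OF B, of "''az''" "int i"] BdD(2)[OF B, of "''al''" "int i"] a2 i LM4 by simp_all
  have "run ?c1 s2 (t2 + 1) (J (Suc i))"
   using f2(2) a2 bds by (intro run_wp) (simp, rule R, simp_all)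
  then show "bval (evaluator_of I) s2 (Less ($''i'') ($''L'')) & run ?c1 s2 (t2 + 1) (J (Suc i))" using f2(2) vL i by simp
 next
  fix t2 :: nat and s2 :: state assume I: "J L t2 s2"
  have "vars s2 ''L'' = int L" "vars s2 ''i'' = int L" "t2 <= t + 1 + 8 * L" "\<forall>i<L. G s2 i" using I vL unfolding J_def by simp_all
  then show "\<not> bval (evaluator_of I) s2 (Less ($''i'') ($''L'')) & t2 + 1 <= t + 3 + 8 * L & (\<forall>i<L. ar s2 ''bv'' i = ar s ''av'' i & ar s2 ''bz'' i = ar s ''az'' i & ar s2 ''bl'' i = ar s ''al'' i)"
   unfolding G_def by simp
 qed auto
qed

end

context kv
begin

definition Rc :: "(nat => nat) => nat => nat => nat => nat set" where "Rc clr c d \<rho> = {w \<in> Uc clr c. w mod d < \<rho>}"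
definition Ac :: "(nat => nat) => nat => nat => (nat => nat => nat) => nat set" where "Ac clr c d X = {i. iso d (Uc clr c) (i - wt (X i))}"

text \<open>The invariant between residue classes: some partial table \<open>Y\<close> on
  \<open>A\<close> is stored, it matches the maximizers as far as the residues below
  \<open>\<rho>\<close> are concerned, and all its entries are still isolated by
  \<open>d\<close>.\<close>

definition GI :: "state => nat => (nat => nat) => nat => nat => nat => (nat => nat => nat) => bool" where
 "GI s cn clr c d \<rho> X \<longleftrightarrow> (\<exists>A Y. (\<forall>i<L. ar s ''ok'' i = (if i \<in> A then 1 else 0)) & rep s cn ''cv'' ''cz'' ''cl'' A Y &
   wff (Pc clr c \<union> Rc clr c d \<rho>) A Y & G1 X (Ac clr c d X) (Pc clr c) (Rc clr c d \<rho>) A Y & (\<forall>i\<in>A. i < L --> iso d (Uc clr c) (i - wt (Y i))))"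

lemma GI_cong:
 assumes "GI s cn clr c d \<rho> X" "nagree cn s s'" "arrs s' ''ok'' = arrs s ''ok''" "arrs s' ''cv'' = arrs s ''cv''" "arrs s' ''cz'' = arrs s ''cz''" "arrs s' ''cl'' = arrs s ''cl''"
 shows "GI s' cn clr c d \<rho> X"
proof -
 obtain A Y where h: "\<forall>i<L. ar s ''ok'' i = (if i \<in> A then 1 else 0)" "rep s cn ''cv'' ''cz'' ''cl'' A Y"
   "wff (Pc clr c \<union> Rc clr c d \<rho>) A Y" "G1 X (Ac clr c d X) (Pc clr c) (Rc clr c d \<rho>) A Y" "\<forall>i\<in>A. i < L --> iso d (Uc clr c) (i - wt (Y i))"
  using assms(1) unfolding GI_def by blast
 have "rep s' cn ''cv'' ''cz'' ''cl'' A Y" using rep_cong[OF h(2) assms(2) order.refl assms(4-6)] .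
 then show ?thesis unfolding GI_def using h assms(3) by metis
qed

text \<open>Discharges the side conditions of a sweep. The essential one is that all candidate
  values fit into words.\<close>

lemma sweep_locale:
 assumes w: "wff (Pc clr c \<union> Rc clr c d \<rho>) A Y"
  and V: "\<And>i. i < L ==> i \<in> A ==> V i = Vl i (Y i)"
  and a: "\<And>i. i < L ==> i \<in> A ==> a i \<noteq> 0 ==> a i \<in> allowed I (i - wt (Y i)) & a i \<in> Uc clr c & a i mod d = \<rho> & a i < L"
  and lg: "L < 2 ^ lg"
 shows "sweep (evaluator_of I) W M L (\<lambda>i. i \<in> A) V a (profit I) lg"
proof -
 have ai: "a z \<in> items I" if "z < L" "z \<in> A" "a z \<noteq> 0" for z using a[OF that] by (simp add: Uc_def)
 have BM': "B <= M"
 proof -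
  have "1 * B <= (int L + 2) * B" using B0 by (intro mult_right_mono) auto
  then show ?thesis using BM by simp
 qed
 have conc: "strictly_concave (profit I (a z)) & profit I (a z) 0 = 0" if "z < L" "z \<in> A" "a z \<noteq> 0" for z
  using profit_concave[OF ai[OF that]] profit_0[OF ai[OF that]] by simp
 have aL: "a z <= L" if "z < L" "z \<in> A" for z using a[OF that] by (cases "a z = 0") auto
 have QQ: "evaluator_of I (int (a z)) (int k) = profit I (a z) k & \<bar>profit I (a z) k\<bar> <= M" if "z < L" "z \<in> A" "a z \<noteq> 0" "k <= L" for z k
  using profB[OF ai[OF that(1-3)] that(4)] BM' by (simp add: evaluator_of_def)
 \<comment> \<open>A column value is the value of an honest feasible vector, an entry of
   \<open>Y\<close> plus copies of an item outside its support, and so obeys the general bound on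
   values.\<close>
 have valM: "\<bar>col_val V a (profit I) z r\<bar> <= M" if z: "z < L" "z \<in> A" "a z \<noteq> 0" "z <= r" "r < L" "a z dvd r - z" for z r
 proof (cases "r = z")
  case True
  then show ?thesis using V[OF z(1,2)] Vl_bound[OF wff_feas[OF w z(2,1)] z(1)] by (simp add: col_val_def)
 next
  case False
  define k where "k = (r - z) div a z"
  have wk: "a z * k = r - z" using z(6) by (simp add: k_def)
  have sY: "supp (Y z) \<subseteq> Pc clr c \<union> Rc clr c d \<rho>" using w z by (auto simp: wff_def)
  have "a z \<notin> Pc clr c \<union> Rc clr c d \<rho>" using a[OF z(1-3)] by (auto simp: Pc_def Rc_def Uc_def)
  then have dj: "supp (Y z) \<inter> supp (vsingle (a z) k) = {}" using sY by (auto simp: supp_vsingle)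
  note it = ai[OF z(1-3)]
  have f: "feas z (Y z)" by (rule wff_feas[OF w z(2,1)])
  have "feas r (Y z \<oplus> vsingle (a z) k)" using f it wk z(4) by (auto simp: feas_def supp_vadd supp_vsingle wt_vadd wt_vsingle[OF it])
  from Vl_bound[OF this z(5)] have "\<bar>Vl (r - wt (vsingle (a z) k)) (Y z) + gain (vsingle (a z) k)\<bar> <= M" unfolding Vl_vadd[OF dj] .
  moreover have "r - wt (vsingle (a z) k) = z" using wk z(4) by (simp add: wt_vsingle[OF it])
  ultimately show ?thesis using V[OF z(1,2)] False by (simp add: col_val_def gain_vsingle[OF it] k_def)
 qed
 show ?thesis
  by (intro sweep.intro sweep0.intro sweep_axioms.intro) (rule machine_axioms conc LM4 lg aL QQ valM; assumption)+
qed

lemma phase_run: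
 assumes st: "static K lg clr s" and v: "vars s ''c'' = int c" "vars s ''d'' = int d" "vars s ''rh'' = int \<rho>" "c < K" "1 <= d"
  and cn: "vars s ''cnt'' = int cn" "int (cn + L + 1) <= M" and rM: "int \<rho> + 1 <= M" and lg: "L < 2 ^ lg"
  and wX: "wff (Pc clr c) UNIV X" and gi: "GI s cn clr c d \<rho> X"
 shows "run phase_com s t (\<lambda>t' s'. t' <= t + 140 * (lg + 1) * (L + 1) & vars s' ''rh'' = int (Suc \<rho>) &
   (\<exists>cn'. cn <= cn' & cn' <= cn + L & vars s' ''cnt'' = int cn' & nagree cn s s' & GI s' cn' clr c d (Suc \<rho>) X))"
  (is "run _ _ _ ?post")
proof -
 obtain A Y where h: "\<forall>i<L. ar s ''ok'' i = (if i \<in> A then 1 else 0)" "rep s cn ''cv'' ''cz'' ''cl'' A Y"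
   "wff (Pc clr c \<union> Rc clr c d \<rho>) A Y" "G1 X (Ac clr c d X) (Pc clr c) (Rc clr c d \<rho>) A Y" "\<forall>i\<in>A. i < L --> iso d (Uc clr c) (i - wt (Y i))"
  using gi unfolding GI_def by blast
 define z where "z = (\<lambda>i. i - wt (Y i))"
 have vL: "vars s ''L'' = int L" using st by (simp add: static_def inA_def)
 have zL: "z i < L" if "i < L" for i using that by (simp add: z_def)
 have okA: "ar s ''ok'' i = 1 \<longleftrightarrow> i \<in> A" if "i < L" for i using h(1) that by simp
 have hz: "ar s ''cz'' i = int (z i) & z i < L" if "i < L" "ar s ''ok'' i = 1" for i
  using h(2) okA[OF that(1)] that zL unfolding rep_def z_def by simp
 show ?thesis unfolding phase_com_def
 proof (rule run_SeqI[OF pick_run[OF st v hz]])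
  fix t1 :: nat and s1 :: state
  assume p1: "t1 <= t + 3 + L * (4 * lg + 8) & (\<forall>i<L. 0 <= ar s1 ''aa'' i & (ar s ''ok'' i = 1 --> pickpost (z i) c d \<rho> (ar s1 ''aa'' i) clr))"
   and v1: "\<And>v. v \<notin> asgd pick_com ==> vars s1 v = vars s v" and r1: "\<And>a. a \<notin> wrtn pick_com ==> arrs s1 a = arrs s a"
  define a where "a = (\<lambda>i. nat (ar s1 ''aa'' i))"
  define V where "V = (\<lambda>i::nat. ar s1 ''cv'' i)"
  have R1: "arrs s1 x = arrs s x" if "x \<noteq> ''aa''" for x by (rule r1, rule frames_phase(4)[OF that])
  have V1: "vars s1 x = vars s x" if "x \<in> {''L'', ''K'', ''c'', ''d'', ''rh'', ''cnt'', ''D'', ''lg''}" for x by (rule v1, rule frames_phase(3)[OF that])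
  have aa1: "ar s1 ''aa'' i = int (a i)" if "i < L" for i using p1 that by (simp add: a_def)
  have Ve: "V i = Vl i (Y i)" if "i < L" "i \<in> A" for i using h(2) that R1[of "''cv''"] unfolding rep_def V_def by simp
  have pp: "(a i \<noteq> 0 --> a i \<in> set (wl clr L (z i) c) & a i mod d = \<rho>) & ((\<exists>w\<in>set (wl clr L (z i) c). w mod d = \<rho>) --> a i \<noteq> 0)" if "i < L" "i \<in> A" for i
  proof -
   have "pickpost (z i) c d \<rho> (int (a i)) clr" using conjunct2[OF p1] that okA[OF that(1)] aa1[OF that(1)] by metis
   then show ?thesis unfolding pickpost_def by auto
  qed
  have a1: "a i \<in> allowed I (i - wt (Y i)) & a i \<in> Uc clr c & a i mod d = \<rho> & a i < L" if "i < L" "i \<in> A" "a i \<noteq> 0" for i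
   using pp[OF that(1,2)] that(3) wl_Uc[OF zL[OF that(1)]] unfolding z_def by simp
  interpret sw: sweep "evaluator_of I" W M L "\<lambda>i. i \<in> A" V a "profit I" lg
   by (rule sweep_locale[OF h(3) Ve a1 lg])
  have inp: "sw.inp s1" unfolding sw.inp_def using V1[of "''L''"] vL h(1) R1[of "''ok''"] aa1 by (simp add: V_def)
  show "run (sweep_com;; step_com;; ''rh'' ::= $''rh'' +. #1) s1 t1 ?post"
  proof (rule run_SeqI[OF sw.sweep_run[OF inp]])
   fix t2 :: nat and s2 :: state
   assume p2: "t2 <= t1 + 100 * (lg + 1) * (L + 1) & sweep_spec L (\<lambda>i. i \<in> A) V a (profit I) (\<lambda>r. ar s2 ''no'' r = 1) (\<lambda>r. nat (ar s2 ''nf'' r)) (\<lambda>r. ar s2 ''nv'' r)"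
    and v2: "\<And>v. v \<notin> asgd sweep_com ==> vars s2 v = vars s1 v" and r2: "\<And>a. a \<notin> wrtn sweep_com ==> arrs s2 a = arrs s1 a"
   define A' where "A' = {i. ar s2 ''no'' i = 1}"
   define nf where "nf = (\<lambda>r::nat. nat (ar s2 ''nf'' r))"
   define nv where "nv = (\<lambda>r::nat. ar s2 ''nv'' r)"
   have V2: "vars s2 x = vars s x" if "x \<in> {''L'', ''K'', ''c'', ''d'', ''rh'', ''cnt'', ''D'', ''lg''}" for x using v2[OF frames_phase(5)[OF that]] V1[OF that] by simp
   have R2: "arrs s2 x = arrs s1 x" if "x \<in> {''off'', ''S'', ''nx2'', ''h2'', ''q'', ''bv'', ''bz'', ''bl'', ''av'', ''az'', ''al'', ''cv'', ''cz'', ''cl'', ''ok'', ''aa'', ''ni'', ''nm'', ''nn''}" for x by (rule r2, rule frames_phase(6)[OF that])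
   have sp: "sweep_spec (len I) (\<lambda>i. i \<in> A) (\<lambda>i. Vl i (Y i)) a (profit I) (\<lambda>i. i \<in> A') nf nv"
    using sweep_spec_cong[OF conjunct2[OF p2], of "\<lambda>i. Vl i (Y i)"] Ve by (simp add: A'_def nf_def nv_def)
   define N where "N = {w \<in> Uc clr c. w mod d = \<rho>}"
   have PU: "Pc clr c \<inter> Uc clr c = {}" "Uc clr c \<subseteq> items I" by (auto simp: Pc_def Uc_def)
   note psA = phase_step[OF h(4) wX h(3) PU Rc_def N_def _ _ _ sp]
   have ps1: "iso d (Uc clr c) (i - wt (Y i))" if "i \<in> A" "i < len I" for i using h(5) that by blast
   have ps2: "a i \<in> allowed I (i - wt (Y i)) & a i \<in> N & a i < len I" if "i \<in> A" "i < len I" "a i \<noteq> 0" for i using a1[OF that(2,1,3)] by (simp add: N_def)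
   have ps3: "a i \<noteq> 0" if "i \<in> A" "i < len I" "w \<in> allowed I (i - wt (Y i))" "w \<in> N" "w < len I" for i w
   proof -
    have "w \<in> set (wl clr L (z i) c)" using wl_Uc[OF zL[OF that(2)]] that unfolding z_def N_def by simp
    then show ?thesis using pp[OF that(2,1)] that(4) unfolding N_def by blast
   qed
   have RN: "Rc clr c d \<rho> \<union> N = Rc clr c d (Suc \<rho>)" by (auto simp: Rc_def N_def)
   have q1: "wff (Pc clr c \<union> Rc clr c d (Suc \<rho>)) A' (step_fam a nf Y)" using psA(1)[OF ps1 ps2 ps3] RN by simp
   have q2: "G1 X (Ac clr c d X) (Pc clr c) (Rc clr c d (Suc \<rho>)) A' (step_fam a nf Y)" using psA(2)[OF ps1 ps2 ps3] RN by simp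
   have q3: "i - wt (step_fam a nf Y i) = nf i - wt (Y (nf i))" if "i \<in> A'" "i < len I" for i by (rule psA(3)[OF ps1 ps2 ps3 that])
   have q4: "nv i = Vl i (step_fam a nf Y i)" if "i \<in> A'" "i < len I" for i by (rule psA(4)[OF ps1 ps2 ps3 that])
   have spn: "nf i <= i & nf i \<in> A & (nf i = i \<or> a (nf i) \<noteq> 0 & a (nf i) dvd i - nf i)" if "i \<in> A'" "i < len I" for i
    using sp that unfolding sweep_spec_def by blast
   have ph: "phase_ok A Y a A' nf nv" unfolding phase_ok_def
   proof (intro ballI impI)
    fix i assume i: "i \<in> A'" "i < L"
    note s = spn[OF i]
    have nl: "nf i < L" using s i by simp
    have x: "a (nf i) \<notin> supp (Y (nf i)) & 0 < (i - nf i) div a (nf i)" if ne: "nf i \<noteq> i"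
    proof
     have an: "a (nf i) \<noteq> 0" "a (nf i) dvd i - nf i" using s ne by auto
     have "a (nf i) \<notin> Pc clr c \<union> Rc clr c d \<rho>" using a1[OF nl _ an(1)] s by (auto simp: Pc_def Rc_def Uc_def)
     moreover have "supp (Y (nf i)) \<subseteq> Pc clr c \<union> Rc clr c d \<rho>" using h(3) s nl unfolding wff_def by blast
     ultimately show "a (nf i) \<notin> supp (Y (nf i))" by blast
     have "0 < i - nf i" using s ne by simp
     then have "a (nf i) <= i - nf i" using an(2) by (intro dvd_imp_le) auto
     then show "0 < (i - nf i) div a (nf i)" using an(1) by (simp add: div_greater_zero_iff)
    qed
    show "nf i <= i & nf i \<in> A & nv i = Vl i (step_fam a nf Y i) & i - wt (step_fam a nf Y i) = nf i - wt (Y (nf i)) &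
      (nf i \<noteq> i --> a (nf i) \<notin> supp (Y (nf i)) & 0 < (i - nf i) div a (nf i))" using s q3[OF i] q4[OF i] x by blast
   qed
   have n2: "nagree cn s s2" by (rule nagree_same) (use R2[of "''nn''"] R2[of "''ni''"] R2[of "''nm''"] R1 in simp_all)
   have rp2: "rep s2 cn ''cv'' ''cz'' ''cl'' A Y" by (rule rep_cong[OF h(2) n2 order.refl]) (use R2[of "''cv''"] R2[of "''cz''"] R2[of "''cl''"] R1 in simp_all)
   have no2: "ar s2 ''no'' i = 1 \<longleftrightarrow> i \<in> A'" for i by (simp add: A'_def)
   have nf2: "nat (ar s2 ''nf'' i) = nf i" for i by (simp add: nf_def)
   have nv2: "ar s2 ''nv'' i = nv i" for i by (simp add: nv_def)
   have aa2: "ar s2 ''aa'' i = int (a i)" if "i < L" for i using aa1[OF that] R2[of "''aa''"] by simp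
   have vL2: "vars s2 ''L'' = int L" "vars s2 ''cnt'' = int cn" using V2 vL cn by simp_all
   show "run (step_com;; ''rh'' ::= $''rh'' +. #1) s2 t2 ?post"
   proof (rule run_SeqI[OF step_run[OF vL2 cn(2) rp2 no2 nf2 nv2 aa2 ph]])
    fix t3 :: nat and s3 :: state
    assume p3: "t3 <= t2 + 3 + 16 * L & (\<exists>cn'\<ge>cn. cn' <= cn + L & vars s3 ''cnt'' = int cn' & nagree cn s2 s3 &
      (\<forall>i<L. ar s3 ''ok'' i = (if i \<in> A' then 1 else 0)) & rep s3 cn' ''cv'' ''cz'' ''cl'' A' (step_fam a nf Y))"
     and v3: "\<And>v. v \<notin> asgd step_com ==> vars s3 v = vars s2 v"
    obtain c3 where c3: "cn <= c3" "c3 <= cn + L" "vars s3 ''cnt'' = int c3" "nagree cn s2 s3"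
      "\<forall>i<L. ar s3 ''ok'' i = (if i \<in> A' then 1 else 0)" "rep s3 c3 ''cv'' ''cz'' ''cl'' A' (step_fam a nf Y)" using p3 by blast
    have rh3: "vars s3 ''rh'' = int \<rho>" using v3[OF frames_phase(7)[of "''rh''"]] V2[of "''rh''"] v(3) by simp
    have n3: "nagree cn s s3" using n2 c3(4) unfolding nagree_def by simp
    \<comment> \<open>New entries inherit the residual of their source. Isolation, tested once at
      the start of a modulus, therefore survives all its residue classes.\<close>
    have i3: "\<forall>i\<in>A'. i < L --> iso d (Uc clr c) (i - wt (step_fam a nf Y i))"
    proof (intro ballI impI)
     fix i assume i: "i \<in> A'" "i < L"
     have "nf i \<in> A" "nf i < L" using spn[OF i] i by auto
     then show "iso d (Uc clr c) (i - wt (step_fam a nf Y i))" using ps1 q3[OF i] by simp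
    qed
    have g3: "GI s3 c3 clr c d (Suc \<rho>) X" unfolding GI_def using c3(5,6) q1 q2 i3 by blast
    have tt: "t3 + 1 <= t + 140 * (lg + 1) * (L + 1)"
    proof -
     have "t3 + 1 <= t + (L * (4 * lg + 8) + 7 + 100 * ((lg + 1) * (L + 1)) + 16 * L)" using conjunct1[OF p1] conjunct1[OF p2] conjunct1[OF p3] unfolding mult.assoc by linarith
     moreover have "L * (4 * lg + 8) + 7 + 100 * ((lg + 1) * (L + 1)) + 16 * L <= 140 * ((lg + 1) * (L + 1))" by (simp add: algebra_simps)
     ultimately show ?thesis unfolding mult.assoc by linarith
    qed
    have F: "?post t4 s4" if s4: "t4 = t3 + 1" "arrs s4 = arrs s3" "vars s4 = (vars s3)(''rh'' := int \<rho> + 1)" for t4 :: nat and s4 :: state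
    proof (intro conjI exI[of _ c3])
     show "t4 <= t + 140 * (lg + 1) * (L + 1)" using tt s4 by simp
     show "GI s4 c3 clr c d (Suc \<rho>) X" by (rule GI_cong[OF g3]) (use s4 in \<open>simp_all add: nagree_def\<close>)
     show "nagree cn s s4" using n3 s4 by (simp add: nagree_def)
    qed (use c3 s4 in simp_all)
    show "run (''rh'' ::= $''rh'' +. #1) s3 t3 ?post"
     by (rule run_conseq[where P = "\<lambda>t' s'. t' = t3 + 1 & arrs s' = arrs s3 & vars s' = (vars s3)(''rh'' := int \<rho> + 1)"])
      (rule run_wp, use rh3 rM in simp, rule F, simp_all)
   qed
  qed
 qed
qed

end

section \<open>Moduli, colours and the main loop\<close>

definition group_com :: com where
 "group_com = (start_com;; ''rh'' ::= #0;; While (Less ($''rh'') ($''d'')) phase_com;; merge_com;; ''d'' ::= $''d'' +. #1)"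

definition class_com :: com where
 "class_com = (''d'' ::= #1;; While (Less ($''d'') ($''D'' +. #1)) group_com;; flush_com;; ''c'' ::= $''c'' +. #1)"

definition main_com :: com where
 "main_com = (''c'' ::= #0;; While (Less ($''c'') ($''K'')) class_com)"

lemma frames_group:
 "v \<in> {''L'', ''K'', ''c'', ''D'', ''lg''} ==> v \<notin> asgd group_com"
 "a \<in> {''off'', ''S'', ''nx2'', ''h2'', ''q'', ''bv'', ''bz'', ''bl''} ==> a \<notin> wrtn group_com"
proof -
 assume v: "v \<in> {''L'', ''K'', ''c'', ''D'', ''lg''}"
 have 1: "v \<notin> asgd phase_com" by (rule frames_phase(1)) (use v in auto)
 have 2: "v \<notin> {''i'', ''p'', ''u'', ''b'', ''rh'', ''d''}" using v by auto
 have 3: "v \<notin> asgd start_com" using frames_loops(1) 2 by blast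
 have 4: "v \<notin> asgd merge_com" using frames_loops(3) 2 by blast
 show "v \<notin> asgd group_com" using 1 2 3 4 by (simp add: group_com_def)
next
 assume a: "a \<in> {''off'', ''S'', ''nx2'', ''h2'', ''q'', ''bv'', ''bz'', ''bl''}"
 have 1: "a \<notin> wrtn phase_com" by (rule frames_phase(2)) (use a in auto)
 have 2: "a \<notin> {''ok'', ''cv'', ''cz'', ''cl'', ''av'', ''az'', ''al''}" using a by auto
 have 3: "a \<notin> wrtn start_com" using frames_loops(2) 2 by blast
 have 4: "a \<notin> wrtn merge_com" using frames_loops(4) 2 by blast
 show "a \<notin> wrtn group_com" using 1 3 4 by (simp add: group_com_def)
qed

lemma frames_class:
 "v \<in> {''L'', ''K'', ''D'', ''lg''} ==> v \<notin> asgd class_com"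
 "a \<in> {''off'', ''S'', ''nx2'', ''h2'', ''q''} ==> a \<notin> wrtn class_com"
proof -
 assume v: "v \<in> {''L'', ''K'', ''D'', ''lg''}"
 have 1: "v \<notin> asgd group_com" by (rule frames_group(1)) (use v in auto)
 have 2: "v \<notin> {''i'', ''c'', ''d''}" using v by auto
 have 3: "v \<notin> asgd flush_com" using frames_loops(5) 2 by blast
 show "v \<notin> asgd class_com" using 1 2 3 by (simp add: class_com_def)
next
 assume a: "a \<in> {''off'', ''S'', ''nx2'', ''h2'', ''q''}"
 have 1: "a \<notin> wrtn group_com" by (rule frames_group(2)) (use a in auto)
 have 2: "a \<notin> {''bv'', ''bz'', ''bl''}" using a by auto
 have 3: "a \<notin> wrtn flush_com" using frames_loops(6) 2 by blast
 show "a \<notin> wrtn class_com" using 1 3 by (simp add: class_com_def)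
qed

context kv
begin

text \<open>A sweep costs about \<open>(lg + 1) * (L + 1)\<close>; the second factor
  \<open>lg + 1\<close> is due to the pairwise isolation tests.\<close>

definition EE :: "nat => nat" where "EE lg = (lg + 1) * (lg + 1) * (L + 1)"

lemma group_time: "1 <= d ==> L * (lg * (4 * lg + 5) + 12) + d * (140 * (lg + 1) * (L + 1) + 1) + 8 * L + 10 <= 170 * (d * EE lg)"
proof -
 assume d: "1 <= d"
 have E0: "1 <= EE lg" "L + 1 <= EE lg" "(lg + 1) * (L + 1) <= EE lg"
  using mult_le_mono1[of "lg + 1" "(lg + 1) * (lg + 1)" "L + 1"] by (simp_all only: EE_def) simp_all
 have "L * (lg * (4 * lg + 5) + 12) <= 12 * EE lg" by (simp add: EE_def algebra_simps)
 moreover have "140 * (lg + 1) * (L + 1) + 1 <= 141 * EE lg" using E0 unfolding mult.assoc by linarith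
 then have "d * (140 * (lg + 1) * (L + 1) + 1) <= d * (141 * EE lg)" by (rule mult_le_mono2)
 moreover have "EE lg <= d * EE lg" using d by simp
 moreover have "d * (141 * EE lg) = 141 * (d * EE lg)" by simp
 ultimately show ?thesis using E0 by linarith
qed

lemma class_time: "1 <= d ==> d * (170 * (d * EE lg) + 1) + 8 * L + 10 <= 190 * (d * (d * EE lg))"
proof -
 assume d: "1 <= d"
 have e1: "1 <= EE lg" "L + 1 <= EE lg" by (simp_all add: EE_def)
 moreover have e2: "EE lg <= d * EE lg" using d by simp
 moreover have "d <= d * (d * EE lg)" "d * EE lg <= d * (d * EE lg)" using mult_le_mono2[of 1 "d * EE lg" d] mult_le_mono2[OF e2, of d] e1 e2 by simp_all
 moreover have "d * (170 * (d * EE lg) + 1) = 170 * (d * (d * EE lg)) + d" by (simp add: algebra_simps)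
 ultimately show ?thesis by linarith
qed

lemma wff_mono: "wff P A X ==> P \<subseteq> P' ==> wff P' A X" by (fastforce simp: wff_def)

lemma Pc_Uc: "Pc clr c \<union> Uc clr c = Pc clr (Suc c)" by (auto simp: Pc_def Uc_def)

lemma nagree_trans: "nagree cn s s' ==> nagree cn' s' s'' ==> cn <= cn' ==> nagree cn s s''" by (simp add: nagree_def)

text \<open>Three tables are kept apart: \<open>X\<close> in the \<open>b\<close> arrays is the
  state before the colour and the starting point for every modulus, the \<open>c\<close> arrays are
  the working table of the current modulus, and \<open>X'\<close> in the \<open>a\<close> arrays is
  the best result of the moduli so far.\<close>

lemma group_run:
 assumes st: "static K lg clr s" and v: "vars s ''c'' = int c" "vars s ''d'' = int d" "c < K" "1 <= d"
  and cn: "vars s ''cnt'' = int cn" "int (cn + L * d + 1) <= M" and dM: "int d + 1 <= M" and lg: "L < 2 ^ lg"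
  and wX: "wff (Pc clr c) UNIV X" and rX: "rep s cn ''bv'' ''bz'' ''bl'' UNIV X"
  and rX': "rep s cn ''av'' ''az'' ''al'' UNIV X'" and wX': "wff (Pc clr (Suc c)) UNIV X'"
 shows "run group_com s t (\<lambda>t' s'. t' <= t + 170 * (d * EE lg) & vars s' ''d'' = int (Suc d) &
   (\<exists>cn' X''. cn <= cn' & cn' <= cn + L * d & vars s' ''cnt'' = int cn' & nagree cn s s' & rep s' cn' ''av'' ''az'' ''al'' UNIV X'' & wff (Pc clr (Suc c)) UNIV X'' &
    (\<forall>i<L. Vl i (X' i) <= Vl i (X'' i)) & (\<exists>A Y. G1 X (Ac clr c d X) (Pc clr c) (Uc clr c) A Y & (\<forall>i\<in>A. i < L --> Vl i (Y i) <= Vl i (X'' i)))))"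
  (is "run _ _ _ ?P")
proof -
 have vL: "vars s ''L'' = int L" using st by (simp add: static_def inA_def)
 have bz: "ar s ''bz'' i = int (i - wt (X i)) & i - wt (X i) < L" if "i < L" for i using rX that unfolding rep_def by auto
 define T where "T = 140 * (lg + 1) * (L + 1) + 1"
 define t0 where "t0 = t + 3 + L * (lg * (4 * lg + 5) + 12) + 1"
 define fr :: "state => bool" where "fr = (\<lambda>s'. (\<forall>v\<in>{''L'', ''K'', ''c'', ''d'', ''D'', ''lg''}. vars s' v = vars s v) &
   (\<forall>a\<in>{''off'', ''S'', ''nx2'', ''h2'', ''q'', ''bv'', ''bz'', ''bl'', ''av'', ''az'', ''al''}. arrs s' a = arrs s a))"
 define J :: "nat => nat => state => bool" where "J = (\<lambda>\<rho> t' s'. t' <= t0 + \<rho> * T & vars s' ''rh'' = int \<rho> & fr s' &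
   (\<exists>cn'. cn <= cn' & cn' <= cn + L * \<rho> & vars s' ''cnt'' = int cn' & nagree cn s s' & GI s' cn' clr c d \<rho> X))"
 have W: "run (While (Less ($''rh'') ($''d'')) phase_com) s1 t1 (\<lambda>t' s'. J d (t' - 1) s' & 1 <= t')" if J0: "J 0 t1 s1" for s1 :: state and t1 :: nat
 proof (rule run_for[where Inv = J and n = d, OF _ _ J0])
  fix \<rho> t2 :: nat and s2 :: state
  assume \<rho>: "\<rho> < d" and I: "J \<rho> t2 s2"
  obtain c2 where c2: "cn <= c2" "c2 <= cn + L * \<rho>" "vars s2 ''cnt'' = int c2" "nagree cn s s2" "GI s2 c2 clr c d \<rho> X" using I unfolding J_def by blast
  have f2: "t2 <= t0 + \<rho> * T" "vars s2 ''rh'' = int \<rho>" "fr s2" using I unfolding J_def by blast+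
  have st2: "static K lg clr s2" by (rule static_cong[OF st]) (use f2(3) in \<open>simp_all add: fr_def\<close>)
  have g2: "vars s2 ''c'' = int c" "vars s2 ''d'' = int d" using f2(3) v by (simp_all add: fr_def)
  have "L * \<rho> + L <= L * d" using \<rho> mult_le_mono2[of "Suc \<rho>" d L] by simp
  then have "c2 + L + 1 <= cn + L * d + 1" using c2(2) by linarith
  then have cM: "int (c2 + L + 1) <= M" using cn(2) by linarith
  have rM: "int \<rho> + 1 <= M" using \<rho> dM by linarith
  have "run phase_com s2 (t2 + 1) (J (Suc \<rho>))"
  proof (rule run_conseq[OF phase_run[OF st2 g2 f2(2) v(3,4) c2(3) cM rM lg wX c2(5)]])
   fix t3 :: nat and s3 :: state
   assume p3: "t3 <= t2 + 1 + 140 * (lg + 1) * (L + 1) & vars s3 ''rh'' = int (Suc \<rho>) &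
     (\<exists>cn'\<ge>c2. cn' <= c2 + L & vars s3 ''cnt'' = int cn' & nagree c2 s2 s3 & GI s3 cn' clr c d (Suc \<rho>) X)"
    and v3: "\<And>v. v \<notin> asgd phase_com ==> vars s3 v = vars s2 v" and r3: "\<And>a. a \<notin> wrtn phase_com ==> arrs s3 a = arrs s2 a"
   obtain c3 where c3: "c2 <= c3" "c3 <= c2 + L" "vars s3 ''cnt'' = int c3" "nagree c2 s2 s3" "GI s3 c3 clr c d (Suc \<rho>) X" using p3 by blast
   have "fr s3" unfolding fr_def
   proof (intro conjI ballI)
    fix x assume x: "x \<in> {''L'', ''K'', ''c'', ''d'', ''D'', ''lg''}"
    then show "vars s3 x = vars s x" using v3[OF frames_phase(1)[OF x]] f2(3) unfolding fr_def by simp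
   next
    fix x assume x: "x \<in> {''off'', ''S'', ''nx2'', ''h2'', ''q'', ''bv'', ''bz'', ''bl'', ''av'', ''az'', ''al''}"
    then show "arrs s3 x = arrs s x" using r3[OF frames_phase(2)[OF x]] f2(3) unfolding fr_def by simp
   qed
   moreover have "t3 <= t0 + Suc \<rho> * T" using conjunct1[OF p3] f2(1) unfolding T_def by simp
   moreover have "cn <= c3" "c3 <= cn + L * Suc \<rho>" using c2(1,2) c3(1,2) by simp_all
   moreover have "nagree cn s s3" by (rule nagree_trans[OF c2(4) c3(4) c2(1)])
   ultimately show "J (Suc \<rho>) t3 s3" unfolding J_def using p3 c3(3,5) by blast
  qed
  then show "bval (evaluator_of I) s2 (Less ($''rh'') ($''d'')) & run phase_com s2 (t2 + 1) (J (Suc \<rho>))" using f2(2) g2(2) \<rho> by simp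
 next
  fix t2 :: nat and s2 :: state assume I: "J d t2 s2"
  have "fr s2" "vars s2 ''rh'' = int d" using I unfolding J_def by blast+
  then show "\<not> bval (evaluator_of I) s2 (Less ($''rh'') ($''d'')) & J d (t2 + 1 - 1) s2 & 1 <= t2 + 1" using I v(2) by (simp add: fr_def)
 qed auto
 show ?thesis unfolding group_com_def
 proof (rule run_SeqI[OF start_run[OF st v bz]])
  fix t1 :: nat and s1 :: state
  assume p1: "t1 <= t + 3 + L * (lg * (4 * lg + 5) + 12) & (\<forall>i<L. ar s1 ''ok'' i = (if iso d (Uc clr c) (i - wt (X i)) then 1 else 0) &
    ar s1 ''cv'' i = ar s ''bv'' i & ar s1 ''cz'' i = ar s ''bz'' i & ar s1 ''cl'' i = ar s ''bl'' i)"
   and v1: "\<And>v. v \<notin> asgd start_com ==> vars s1 v = vars s v" and r1: "\<And>a. a \<notin> wrtn start_com ==> arrs s1 a = arrs s a"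
  have V1: "vars s1 x = vars s x" if "x \<notin> {''i'', ''p'', ''u'', ''b''}" for x by (rule v1) (use frames_loops(1) that in blast)
  have R1: "arrs s1 x = arrs s x" if "x \<notin> {''ok'', ''cv'', ''cz'', ''cl''}" for x by (rule r1) (use frames_loops(2) that in blast)
  have n1: "nagree cn s s1" by (rule nagree_same) (simp_all add: R1)
  have gi1: "GI s1 cn clr c d 0 X" unfolding GI_def
  proof (intro exI[of _ "Ac clr c d X"] exI[of _ X] conjI)
   show "\<forall>i<L. ar s1 ''ok'' i = (if i \<in> Ac clr c d X then 1 else 0)" using p1 by (simp add: Ac_def)
   have "rep s1 cn ''cv'' ''cz'' ''cl'' UNIV X" unfolding rep_def
   proof (intro ballI impI)
    fix i assume i: "i < L"
    have "ar s ''bv'' i = Vl i (X i) & ar s ''bz'' i = int (i - wt (X i)) & vrep s cn (ar s ''bl'' i) (X i)" using rX i unfolding rep_def by simp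
    then show "ar s1 ''cv'' i = Vl i (X i) & ar s1 ''cz'' i = int (i - wt (X i)) & vrep s1 cn (ar s1 ''cl'' i) (X i)"
     using conjunct2[OF p1] i vrep_cong[OF _ n1 order.refl] by simp
   qed
   then show "rep s1 cn ''cv'' ''cz'' ''cl'' (Ac clr c d X) X" by (simp add: rep_def)
   have "Rc clr c d 0 = {}" by (simp add: Rc_def)
   then show "wff (Pc clr c \<union> Rc clr c d 0) (Ac clr c d X) X" "G1 X (Ac clr c d X) (Pc clr c) (Rc clr c d 0) (Ac clr c d X) X" using wX G1_init by (simp_all add: wff_def)
   show "\<forall>i\<in>Ac clr c d X. i < L --> iso d (Uc clr c) (i - wt (X i))" by (simp add: Ac_def)
  qed
  have A: "run (''rh'' ::= #0) s1 t1 (J 0)"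
  proof -
   have P0: "J 0 t' s'" if s': "t' = t1 + 1" "arrs s' = arrs s1" "vars s' = (vars s1)(''rh'' := 0)" for t' :: nat and s' :: state
   proof -
    have "fr s'" using s' V1 R1 unfolding fr_def by simp
    moreover have "t' <= t0 + 0 * T" using s'(1) conjunct1[OF p1] unfolding t0_def by linarith
    moreover have "vars s' ''rh'' = int 0" "vars s' ''cnt'' = int cn" using s'(3) cn(1) V1 by simp_all
    moreover have "nagree cn s s'" using n1 s'(2) by (simp add: nagree_def)
    moreover have "GI s' cn clr c d 0 X" by (rule GI_cong[OF gi1]) (use s' in \<open>simp_all add: nagree_def\<close>)
    moreover have "cn <= cn + L * 0" by simp
    ultimately show ?thesis unfolding J_def by blast
   qed
   show ?thesis using M16 by (intro run_wp) (simp, rule P0, simp_all)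
  qed
  show "run (''rh'' ::= #0;; While (Less ($''rh'') ($''d'')) phase_com;; merge_com;; ''d'' ::= $''d'' +. #1) s1 t1 ?P"
  proof (rule run_SeqI[OF A], rule run_SeqI[OF W], assumption)
   fix t2 :: nat and s2 :: state
   assume j2: "J d (t2 - 1) s2 & 1 <= t2"
   have tt2: "t2 <= t0 + d * T + 1" using j2 unfolding J_def by linarith
   obtain c2 where c2: "cn <= c2" "c2 <= cn + L * d" "vars s2 ''cnt'' = int c2" "nagree cn s s2" "GI s2 c2 clr c d d X" using j2 unfolding J_def by blast
   have fr2: "fr s2" using j2 unfolding J_def by blast
   then have g2: "vars s2 ''L'' = int L" "vars s2 ''d'' = int d" using v vL by (simp_all add: fr_def)
   obtain A Y where h: "\<forall>i<L. ar s2 ''ok'' i = (if i \<in> A then 1 else 0)" "rep s2 c2 ''cv'' ''cz'' ''cl'' A Y"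
     "wff (Pc clr c \<union> Rc clr c d d) A Y" "G1 X (Ac clr c d X) (Pc clr c) (Rc clr c d d) A Y" using c2(5) unfolding GI_def by blast
   have Rd: "Rc clr c d d = Uc clr c" using v(4) by (auto simp: Rc_def)
   have rA: "rep s2 c2 ''av'' ''az'' ''al'' UNIV X'" by (rule rep_cong[OF rX' c2(4,1)]) (use fr2 in \<open>simp_all add: fr_def\<close>)
   \<comment> \<open>A modulus yields entries only at some indices, so its table is merged pointwise
     into the accumulated one, which is defined everywhere.\<close>
   define X'' where "X'' = (\<lambda>i. if i \<in> A & Vl i (X' i) < Vl i (Y i) then Y i else X' i)"
   have wX'': "wff (Pc clr (Suc c)) UNIV X''" using h(3) wX' unfolding wff_def X''_def Rd Pc_Uc by simp
   have ge1: "\<forall>i<L. Vl i (X' i) <= Vl i (X'' i)" and ge2: "\<forall>i\<in>A. i < L --> Vl i (Y i) <= Vl i (X'' i)" by (simp_all add: X''_def)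
   show "run (merge_com;; ''d'' ::= $''d'' +. #1) s2 t2 ?P"
   proof (rule run_SeqI[OF merge_run[OF g2(1)]])
    fix t3 :: nat and s3 :: state
    let ?cond = "\<lambda>i. ar s2 ''ok'' i = 1 & ar s2 ''av'' i < ar s2 ''cv'' i"
    assume p3: "t3 <= t2 + 3 + 8 * L & (\<forall>i<L. ar s3 ''av'' i = (if ?cond i then ar s2 ''cv'' i else ar s2 ''av'' i) &
      ar s3 ''az'' i = (if ?cond i then ar s2 ''cz'' i else ar s2 ''az'' i) & ar s3 ''al'' i = (if ?cond i then ar s2 ''cl'' i else ar s2 ''al'' i))"
     and v3: "\<And>v. v \<notin> asgd merge_com ==> vars s3 v = vars s2 v" and r3: "\<And>a. a \<notin> wrtn merge_com ==> arrs s3 a = arrs s2 a"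
    have V3: "vars s3 x = vars s2 x" if "x \<noteq> ''i''" for x by (rule v3) (use frames_loops(3) that in blast)
    have R3: "arrs s3 x = arrs s2 x" if "x \<notin> {''av'', ''az'', ''al''}" for x by (rule r3) (use frames_loops(4) that in blast)
    have n3: "nagree c2 s2 s3" by (rule nagree_same) (simp_all add: R3)
    have r3'': "rep s3 c2 ''av'' ''az'' ''al'' UNIV X''" unfolding rep_def
    proof (intro ballI impI)
     fix i assume i: "i < L"
     have q: "ar s2 ''av'' i = Vl i (X' i)" "ar s2 ''az'' i = int (i - wt (X' i))" "vrep s2 c2 (ar s2 ''al'' i) (X' i)" using rA i unfolding rep_def by simp_all
     have p3i: "ar s3 ''av'' i = (if ?cond i then ar s2 ''cv'' i else ar s2 ''av'' i)"
       "ar s3 ''az'' i = (if ?cond i then ar s2 ''cz'' i else ar s2 ''az'' i)" "ar s3 ''al'' i = (if ?cond i then ar s2 ''cl'' i else ar s2 ''al'' i)"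
      using conjunct2[OF p3] i by blast+
     show "ar s3 ''av'' i = Vl i (X'' i) & ar s3 ''az'' i = int (i - wt (X'' i)) & vrep s3 c2 (ar s3 ''al'' i) (X'' i)"
     proof (cases "i \<in> A")
      case True
      have qc: "ar s2 ''cv'' i = Vl i (Y i)" "ar s2 ''cz'' i = int (i - wt (Y i))" "vrep s2 c2 (ar s2 ''cl'' i) (Y i)" using h(2) True i unfolding rep_def by simp_all
      have ci: "?cond i \<longleftrightarrow> Vl i (X' i) < Vl i (Y i)" using h(1) i True q(1) qc(1) by simp
      show ?thesis using True q qc vrep_cong[OF q(3) n3 order.refl] vrep_cong[OF qc(3) n3 order.refl] unfolding p3i ci X''_def by simp
     next
      case False
      then have ci: "ar s2 ''ok'' i \<noteq> 1" using h(1) i by simp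
      show ?thesis using False q vrep_cong[OF q(3) n3 order.refl] ci unfolding p3i X''_def by simp
     qed
    qed
    have tt: "t3 + 1 <= t + 170 * (d * EE lg)" using conjunct1[OF p3] tt2 group_time[OF v(4), of lg] unfolding t0_def T_def by linarith
    have F: "?P t4 s4" if s4: "t4 = t3 + 1" "arrs s4 = arrs s3" "vars s4 = (vars s3)(''d'' := int d + 1)" for t4 :: nat and s4 :: state
    proof (intro conjI exI[of _ c2] exI[of _ X''])
     show "t4 <= t + 170 * (d * EE lg)" using tt s4 by simp
     show "rep s4 c2 ''av'' ''az'' ''al'' UNIV X''" by (rule rep_cong[OF r3'']) (use s4 in \<open>simp_all add: nagree_def\<close>)
     show "nagree cn s s4" using nagree_trans[OF c2(4) n3 c2(1)] s4 by (simp add: nagree_def)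
     show "vars s4 ''cnt'' = int c2" using s4(3) V3 c2(3) by simp
     show "vars s4 ''d'' = int (Suc d)" using s4(3) by simp
     show "cn <= c2" by (fact c2(1))
     show "c2 <= cn + L * d" by (fact c2(2))
     show "wff (Pc clr (Suc c)) UNIV X''" by (fact wX'')
     show "\<forall>i<L. Vl i (X' i) <= Vl i (X'' i)" by (fact ge1)
     show "\<exists>A Y. G1 X (Ac clr c d X) (Pc clr c) (Uc clr c) A Y & (\<forall>i\<in>A. i < L --> Vl i (Y i) <= Vl i (X'' i))" using h(4) ge2 unfolding Rd by blast
    qed
    have d3: "vars s3 ''d'' = int d" using V3 g2(2) by simp
    show "run (''d'' ::= $''d'' +. #1) s3 t3 ?P"
     by (rule run_conseq[where P = "\<lambda>t' s'. t' = t3 + 1 & arrs s' = arrs s3 & vars s' = (vars s3)(''d'' := int d + 1)"])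
      (rule run_wp, use d3 dM in simp, rule F, simp_all)
   qed
  qed
 qed
qed

text \<open>Between colours the base table and the accumulated table coincide.\<close>

definition CI :: "state => (nat => nat) => nat => nat => bool" where
 "CI s clr c cn \<longleftrightarrow> vars s ''cnt'' = int cn & (\<exists>X. rep s cn ''bv'' ''bz'' ''bl'' UNIV X & rep s cn ''av'' ''az'' ''al'' UNIV X & wff (Pc clr c) UNIV X & G0 (Pc clr c) X)"

lemma CI_cong:
 assumes "CI s clr c cn" "vars s' ''cnt'' = vars s ''cnt''" "\<And>a. a \<in> {''bv'', ''bz'', ''bl'', ''av'', ''az'', ''al'', ''nn'', ''ni'', ''nm''} ==> arrs s' a = arrs s a"
 shows "CI s' clr c cn"
proof -
 obtain X where X: "rep s cn ''bv'' ''bz'' ''bl'' UNIV X" "rep s cn ''av'' ''az'' ''al'' UNIV X" "wff (Pc clr c) UNIV X" "G0 (Pc clr c) X" using assms(1) unfolding CI_def by blast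
 have n: "nagree cn s s'" by (rule nagree_same) (simp_all add: assms(3))
 have "rep s' cn ''bv'' ''bz'' ''bl'' UNIV X" by (rule rep_cong[OF X(1) n order.refl]) (simp_all add: assms(3))
 moreover have "rep s' cn ''av'' ''az'' ''al'' UNIV X" by (rule rep_cong[OF X(2) n order.refl]) (simp_all add: assms(3))
 ultimately show ?thesis unfolding CI_def using X(3,4) assms(1,2) unfolding CI_def by auto
qed

text \<open>At every index some modulus up to \<open>DD\<close> isolates the entry, so the
  accumulated table satisfies \<open>G0\<close> for one more colour. There are at most
  \<open>DD * DD\<close> sweeps, and each allocates at most \<open>L\<close> list nodes.\<close>

lemma class_run:
 assumes st: "static K lg clr s" and v: "vars s ''c'' = int c" "vars s ''D'' = int DD" "c < K" and DD: "DD = 2 * (lg * lg * lg) + 1"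
  and cn: "int (cn + L * (DD * DD) + 1) <= M" and dM: "int DD + 2 <= M" and cM: "int c + 1 <= M" and lg: "L < 2 ^ lg"
  and ci: "CI s clr c cn"
 shows "run class_com s t (\<lambda>t' s'. t' <= t + 190 * (DD * (DD * EE lg)) & vars s' ''c'' = int (Suc c) & (\<exists>cn'\<le>cn + L * (DD * DD). CI s' clr (Suc c) cn'))"
  (is "run _ _ _ ?P")
proof -
 obtain X where X: "rep s cn ''bv'' ''bz'' ''bl'' UNIV X" "rep s cn ''av'' ''az'' ''al'' UNIV X" "wff (Pc clr c) UNIV X" "G0 (Pc clr c) X" and vcn: "vars s ''cnt'' = int cn"
  using ci unfolding CI_def by blast
 have vL: "vars s ''L'' = int L" using st by (simp add: static_def inA_def)
 define T where "T = 170 * (DD * EE lg) + 1"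
 define fr :: "state => bool" where "fr = (\<lambda>s'. (\<forall>v\<in>{''L'', ''K'', ''c'', ''D'', ''lg''}. vars s' v = vars s v) &
   (\<forall>a\<in>{''off'', ''S'', ''nx2'', ''h2'', ''q'', ''bv'', ''bz'', ''bl''}. arrs s' a = arrs s a))"
 define H where "H = (\<lambda>X' d. \<exists>A Y. G1 X (Ac clr c d X) (Pc clr c) (Uc clr c) A Y & (\<forall>i\<in>A. i < L --> Vl i (Y i) <= Vl i (X' i)))"
 define J :: "nat => nat => state => bool" where "J = (\<lambda>k t' s'. t' <= t + 1 + k * T & vars s' ''d'' = int (Suc k) & fr s' &
   (\<exists>cn' X'. cn <= cn' & cn' <= cn + L * (DD * k) & vars s' ''cnt'' = int cn' & nagree cn s s' & rep s' cn' ''av'' ''az'' ''al'' UNIV X' & wff (Pc clr (Suc c)) UNIV X' & (\<forall>d\<in>{1..k}. H X' d)))"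
 have A: "run (''d'' ::= #1) s t (J 0)"
 proof -
  have P0: "J 0 t' s'" if s': "t' = t + 1" "arrs s' = arrs s" "vars s' = (vars s)(''d'' := 1)" for t' :: nat and s' :: state
  proof -
   have "fr s'" using s' unfolding fr_def by simp
   moreover have "t' <= t + 1 + 0 * T" using s'(1) by simp
   moreover have "vars s' ''d'' = int (Suc 0)" "vars s' ''cnt'' = int cn" using s'(3) vcn by simp_all
   moreover have na: "nagree cn s s'" using s'(2) by (simp add: nagree_def)
   moreover have "rep s' cn ''av'' ''az'' ''al'' UNIV X" by (rule rep_cong[OF X(2) na]) (use s' in simp_all)
   moreover have "wff (Pc clr (Suc c)) UNIV X" by (rule wff_mono[OF X(3)]) (auto simp: Pc_def)
   moreover have "cn <= cn + L * (DD * 0)" "\<forall>d\<in>{1..0}. H X d" by simp_all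
   ultimately show ?thesis unfolding J_def by blast
  qed
  show ?thesis using M16 by (intro run_wp) (simp, rule P0, simp_all)
 qed
 have W: "run (While (Less ($''d'') ($''D'' +. #1)) group_com) s1 t1 (\<lambda>t' s'. J DD (t' - 1) s' & 1 <= t')" if J0: "J 0 t1 s1" for s1 :: state and t1 :: nat
 proof (rule run_for[where Inv = J and n = DD, OF _ _ J0])
  fix k t2 :: nat and s2 :: state
  assume k: "k < DD" and I: "J k t2 s2"
  obtain c2 X' where c2: "cn <= c2" "c2 <= cn + L * (DD * k)" "vars s2 ''cnt'' = int c2" "nagree cn s s2" "rep s2 c2 ''av'' ''az'' ''al'' UNIV X'" "wff (Pc clr (Suc c)) UNIV X'" "\<forall>d\<in>{1..k}. H X' d"
   using I unfolding J_def by blast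
  have f2: "t2 <= t + 1 + k * T" "vars s2 ''d'' = int (Suc k)" "fr s2" using I unfolding J_def by blast+
  have st2: "static K lg clr s2" by (rule static_cong[OF st]) (use f2(3) in \<open>simp_all add: fr_def\<close>)
  have g2: "vars s2 ''c'' = int c" "vars s2 ''D'' = int DD" using f2(3) v by (simp_all add: fr_def)
  have k1: "1 <= Suc k" by simp
  \<comment> \<open>Modulus \<open>Suc k\<close> allocates up to \<open>L * Suc k\<close> nodes and
    is charged \<open>L * DD\<close>, which keeps the count of nodes linear in the number of
    moduli.\<close>
  have st0: "DD * k + Suc k <= DD * Suc k" using k by simp
  have step: "L * (DD * k) + L * Suc k <= L * (DD * Suc k)" using mult_le_mono2[OF st0, of L] by (simp only: add_mult_distrib2)
  have "L * (DD * Suc k) <= L * (DD * DD)" using k by (intro mult_le_mono2) simp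
  then have "c2 + L * Suc k + 1 <= cn + L * (DD * DD) + 1" using c2(2) step by linarith
  then have cM2: "int (c2 + L * Suc k + 1) <= M" using cn by linarith
  have dM2: "int (Suc k) + 1 <= M" using k dM by linarith
  have rb: "rep s2 c2 ''bv'' ''bz'' ''bl'' UNIV X" by (rule rep_cong[OF X(1) c2(4,1)]) (use f2(3) in \<open>simp_all add: fr_def\<close>)
  have "run group_com s2 (t2 + 1) (J (Suc k))"
  proof (rule run_conseq[OF group_run[OF st2 g2(1) f2(2) v(3) k1 c2(3) cM2 dM2 lg X(3) rb c2(5,6)]])
   fix t3 :: nat and s3 :: state
   assume p3: "t3 <= t2 + 1 + 170 * (Suc k * EE lg) & vars s3 ''d'' = int (Suc (Suc k)) &
     (\<exists>cn' X''. c2 <= cn' & cn' <= c2 + L * Suc k & vars s3 ''cnt'' = int cn' & nagree c2 s2 s3 & rep s3 cn' ''av'' ''az'' ''al'' UNIV X'' & wff (Pc clr (Suc c)) UNIV X'' &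
     (\<forall>i<L. Vl i (X' i) <= Vl i (X'' i)) & (\<exists>A Y. G1 X (Ac clr c (Suc k) X) (Pc clr c) (Uc clr c) A Y & (\<forall>i\<in>A. i < L --> Vl i (Y i) <= Vl i (X'' i))))"
    and v3: "\<And>v. v \<notin> asgd group_com ==> vars s3 v = vars s2 v" and r3: "\<And>a. a \<notin> wrtn group_com ==> arrs s3 a = arrs s2 a"
   obtain c3 X'' where c3: "c2 <= c3" "c3 <= c2 + L * Suc k" "vars s3 ''cnt'' = int c3" "nagree c2 s2 s3" "rep s3 c3 ''av'' ''az'' ''al'' UNIV X''" "wff (Pc clr (Suc c)) UNIV X''"
     "\<forall>i<L. Vl i (X' i) <= Vl i (X'' i)" "H X'' (Suc k)" using p3 unfolding H_def by blast
   have "fr s3" unfolding fr_def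
   proof (intro conjI ballI)
    fix x assume x: "x \<in> {''L'', ''K'', ''c'', ''D'', ''lg''}"
    then show "vars s3 x = vars s x" using v3[OF frames_group(1)[OF x]] f2(3) unfolding fr_def by simp
   next
    fix x assume x: "x \<in> {''off'', ''S'', ''nx2'', ''h2'', ''q'', ''bv'', ''bz'', ''bl''}"
    then show "arrs s3 x = arrs s x" using r3[OF frames_group(2)[OF x]] f2(3) unfolding fr_def by simp
   qed
   moreover have "t3 <= t + 1 + Suc k * T"
   proof -
    have "Suc k * EE lg <= DD * EE lg" using k by (intro mult_le_mono1) simp
    then have "t3 <= t2 + T" using conjunct1[OF p3] unfolding T_def by linarith
    then show ?thesis using f2(1) by simp
   qed
   moreover have "cn <= c3" "c3 <= cn + L * (DD * Suc k)" using c2(1,2) c3(1,2) step by linarith+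
   moreover have "nagree cn s s3" by (rule nagree_trans[OF c2(4) c3(4) c2(1)])
   moreover have "\<forall>d\<in>{1..Suc k}. H X'' d"
   proof
    fix d assume d: "d \<in> {1..Suc k}"
    show "H X'' d"
    proof (cases "d = Suc k")
     case True
     then show ?thesis using c3(8) by simp
    next
     case False
     then have "H X' d" using c2(7) d by simp
     then obtain A Y where AY: "G1 X (Ac clr c d X) (Pc clr c) (Uc clr c) A Y" "\<forall>i\<in>A. i < L --> Vl i (Y i) <= Vl i (X' i)" unfolding H_def by blast
     have "\<forall>i\<in>A. i < L --> Vl i (Y i) <= Vl i (X'' i)" using AY(2) c3(7) by (meson order_trans)
     then show ?thesis unfolding H_def using AY(1) by blast
    qed
   qed
   ultimately show "J (Suc k) t3 s3" unfolding J_def using p3 c3(3,5,6) by blast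
  qed
  then show "bval (evaluator_of I) s2 (Less ($''d'') ($''D'' +. #1)) & run group_com s2 (t2 + 1) (J (Suc k))" using f2(2) g2(2) k by simp
 next
  fix t2 :: nat and s2 :: state assume I: "J DD t2 s2"
  have "fr s2" "vars s2 ''d'' = int (Suc DD)" using I unfolding J_def by blast+
  then show "\<not> bval (evaluator_of I) s2 (Less ($''d'') ($''D'' +. #1)) & J DD (t2 + 1 - 1) s2 & 1 <= t2 + 1" using I v(2) by (simp add: fr_def)
 qed auto
 show ?thesis unfolding class_com_def
 proof (rule run_SeqI[OF A], rule run_SeqI[OF W], assumption)
  fix t2 :: nat and s2 :: state
  assume j2: "J DD (t2 - 1) s2 & 1 <= t2"
  have tt2: "t2 <= t + 1 + DD * T + 1" using j2 unfolding J_def by linarith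
  obtain c2 X' where c2: "cn <= c2" "c2 <= cn + L * (DD * DD)" "vars s2 ''cnt'' = int c2" "nagree cn s s2" "rep s2 c2 ''av'' ''az'' ''al'' UNIV X'" "wff (Pc clr (Suc c)) UNIV X'" "\<forall>d\<in>{1..DD}. H X' d"
   using j2 unfolding J_def by blast
  have fr2: "fr s2" using j2 unfolding J_def by blast
  then have g2: "vars s2 ''L'' = int L" "vars s2 ''c'' = int c" using v vL by (simp_all add: fr_def)
  have g0: "G0 (Pc clr (Suc c)) X'"
  proof -
   obtain Af Yf where AY: "\<And>d. d \<in> {1..DD} ==> G1 X (Ac clr c d X) (Pc clr c) (Uc clr c) (Af d) (Yf d) & (\<forall>i\<in>Af d. i < L --> Vl i (Yf d i) <= Vl i (X' i))"
    using c2(7) unfolding H_def by metis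
   have "G0 (Pc clr c \<union> Uc clr c) X'"
   proof (rule G0_combine[where D = "{1..DD}" and A = Af and Y = Yf and ?A0.0 = "\<lambda>d. Ac clr c d X", OF X(4,3)])
    show "wff (Pc clr c \<union> Uc clr c) UNIV X'" using c2(6) by (simp add: Pc_Uc)
    show "Pc clr c \<inter> Uc clr c = {}" by (auto simp: Pc_def Uc_def)
    \<comment> \<open>The bucket has fewer than \<open>lg\<close> items, all below
      \<open>L < 2 ^ lg\<close>; the isolation lemma with both parameters equal to \<open>lg\<close>
      produces precisely the range up to \<open>DD\<close>.\<close>
    show "\<exists>d\<in>{1..DD}. i \<in> Ac clr c d X" if i: "i < len I" for i
    proof -
     define z where "z = i - wt (X i)"
     have z: "z < L" using i by (simp add: z_def)
     have len: "length (wl clr L z c) < lg" using st z v(3) unfolding static_def by blast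
     have "\<exists>d\<in>{1..2 * (lg * lg * lg) + 1}. inj_on (\<lambda>w. w mod d) (set (wl clr L z c))"
     proof (rule exists_isolating_modulus[of _ _ L])
      show "card (set (wl clr L z c)) <= lg" using card_length[of "wl clr L z c"] len by linarith
      show "\<forall>w\<in>set (wl clr L z c). w < L" by (simp add: wl_set)
     qed (use lg in simp_all)
     then show ?thesis using iso_wl[OF z] unfolding DD Ac_def z_def by auto
    qed
   qed (use AY in blast)+
   then show ?thesis by (simp add: Pc_Uc)
  qed
  show "run (flush_com;; ''c'' ::= $''c'' +. #1) s2 t2 ?P"
  proof (rule run_SeqI[OF flush_run[OF g2(1)]])
   fix t3 :: nat and s3 :: state
   assume p3: "t3 <= t2 + 3 + 8 * L & (\<forall>i<L. ar s3 ''bv'' i = ar s2 ''av'' i & ar s3 ''bz'' i = ar s2 ''az'' i & ar s3 ''bl'' i = ar s2 ''al'' i)"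
    and v3: "\<And>v. v \<notin> asgd flush_com ==> vars s3 v = vars s2 v" and r3: "\<And>a. a \<notin> wrtn flush_com ==> arrs s3 a = arrs s2 a"
   have V3: "vars s3 x = vars s2 x" if "x \<noteq> ''i''" for x by (rule v3) (use frames_loops(5) that in blast)
   have R3: "arrs s3 x = arrs s2 x" if "x \<notin> {''bv'', ''bz'', ''bl''}" for x by (rule r3) (use frames_loops(6) that in blast)
   have n3: "nagree c2 s2 s3" by (rule nagree_same) (simp_all add: R3)
   have ra: "rep s3 c2 ''av'' ''az'' ''al'' UNIV X'" by (rule rep_cong[OF c2(5) n3 order.refl]) (simp_all add: R3)
   have rb: "rep s3 c2 ''bv'' ''bz'' ''bl'' UNIV X'" using ra conjunct2[OF p3] R3[of "''av''"] R3[of "''az''"] R3[of "''al''"] unfolding rep_def by simp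
   have ci3: "CI s3 clr (Suc c) c2" unfolding CI_def using ra rb c2(3,6) g0 V3[of "''cnt''"] by auto
   have tt: "t3 + 1 <= t + 190 * (DD * (DD * EE lg))" using conjunct1[OF p3] tt2 class_time[of DD lg] DD unfolding T_def by linarith
   have F: "?P t4 s4" if s4: "t4 = t3 + 1" "arrs s4 = arrs s3" "vars s4 = (vars s3)(''c'' := int c + 1)" for t4 :: nat and s4 :: state
   proof (intro conjI exI[of _ c2])
    show "t4 <= t + 190 * (DD * (DD * EE lg))" using tt s4 by simp
    show "CI s4 clr (Suc c) c2" by (rule CI_cong[OF ci3]) (use s4 in simp_all)
    show "vars s4 ''c'' = int (Suc c)" using s4(3) by simp
   qed (fact c2(2))
   have d3: "vars s3 ''c'' = int c" using V3 g2(2) by simp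
   show "run (''c'' ::= $''c'' +. #1) s3 t3 ?P"
    by (rule run_conseq[where P = "\<lambda>t' s'. t' = t3 + 1 & arrs s' = arrs s3 & vars s' = (vars s3)(''c'' := int c + 1)"])
     (rule run_wp, use d3 cM in simp, rule F, simp_all)
  qed
 qed
qed

lemma main_run:
 assumes st: "static K lg clr s" and vD: "vars s ''D'' = int DD" and DD: "DD = 2 * (lg * lg * lg) + 1"
  and KM: "int ((L * (DD * DD)) * Suc K + 1) <= M" and dM: "int DD + 2 <= M" "int K <= M" and lg: "L < 2 ^ lg"
  and ci: "CI s clr 0 0"
 shows "run main_com s t (\<lambda>t' s'. t' <= t + 2 + K * (190 * (DD * (DD * EE lg)) + 1) &
   (\<exists>cn X. rep s' cn ''bv'' ''bz'' ''bl'' UNIV X & wff (items I) UNIV X & G0 (items I) X))"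
  (is "run _ _ _ ?P")
proof -
 define T where "T = 190 * (DD * (DD * EE lg)) + 1"
 define fr :: "state => bool" where "fr = (\<lambda>s'. (\<forall>v\<in>{''L'', ''K'', ''D'', ''lg''}. vars s' v = vars s v) & (\<forall>a\<in>{''off'', ''S'', ''nx2'', ''h2'', ''q''}. arrs s' a = arrs s a))"
 define J :: "nat => nat => state => bool" where "J = (\<lambda>c t' s'. t' <= t + 1 + c * T & vars s' ''c'' = int c & fr s' & (\<exists>cn'\<le>L * (DD * DD) * c. CI s' clr c cn'))"
 have vK: "vars s ''K'' = int K" using st by (simp add: static_def)
 have A: "run (''c'' ::= #0) s t (J 0)"
 proof -
  have P0: "J 0 t' s'" if s': "t' = t + 1" "arrs s' = arrs s" "vars s' = (vars s)(''c'' := 0)" for t' :: nat and s' :: state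
  proof -
   have "CI s' clr 0 0" by (rule CI_cong[OF ci]) (use s' in simp_all)
   moreover have "fr s'" using s' unfolding fr_def by simp
   ultimately show ?thesis unfolding J_def using s' by simp
  qed
  show ?thesis using M16 by (intro run_wp) (simp, rule P0, simp_all)
 qed
 show ?thesis unfolding main_com_def
 proof (rule run_SeqI[OF A], rule run_for[where Inv = J and n = K])
  fix c t2 :: nat and s2 :: state
  assume c: "c < K" and I: "J c t2 s2"
  obtain c2 where c2: "c2 <= L * (DD * DD) * c" "CI s2 clr c c2" using I unfolding J_def by blast
  have f2: "t2 <= t + 1 + c * T" "vars s2 ''c'' = int c" "fr s2" using I unfolding J_def by blast+
  have st2: "static K lg clr s2" by (rule static_cong[OF st]) (use f2(3) in \<open>simp_all add: fr_def\<close>)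
  have g2: "vars s2 ''D'' = int DD" "vars s2 ''K'' = int K" using f2(3) vD vK by (simp_all add: fr_def)
  have "L * (DD * DD) * Suc c <= L * (DD * DD) * Suc K" using c by (intro mult_le_mono2) simp
  then have "c2 + L * (DD * DD) + 1 <= L * (DD * DD) * Suc K + 1" using c2(1) unfolding mult_Suc_right by linarith
  then have cM: "int (c2 + L * (DD * DD) + 1) <= M" using KM by linarith
  have cM2: "int c + 1 <= M" using c dM by linarith
  have "run class_com s2 (t2 + 1) (J (Suc c))"
  proof (rule run_conseq[OF class_run[OF st2 f2(2) g2(1) c DD cM dM(1) cM2 lg c2(2)]])
   fix t3 :: nat and s3 :: state
   assume p3: "t3 <= t2 + 1 + 190 * (DD * (DD * EE lg)) & vars s3 ''c'' = int (Suc c) & (\<exists>cn'\<le>c2 + L * (DD * DD). CI s3 clr (Suc c) cn')"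
    and v3: "\<And>v. v \<notin> asgd class_com ==> vars s3 v = vars s2 v" and r3: "\<And>a. a \<notin> wrtn class_com ==> arrs s3 a = arrs s2 a"
   obtain c3 where c3: "c3 <= c2 + L * (DD * DD)" "CI s3 clr (Suc c) c3" using p3 by blast
   have "fr s3" unfolding fr_def
   proof (intro conjI ballI)
    fix x assume x: "x \<in> {''L'', ''K'', ''D'', ''lg''}"
    then show "vars s3 x = vars s x" using v3[OF frames_class(1)[OF x]] f2(3) unfolding fr_def by simp
   next
    fix x assume x: "x \<in> {''off'', ''S'', ''nx2'', ''h2'', ''q''}"
    then show "arrs s3 x = arrs s x" using r3[OF frames_class(2)[OF x]] f2(3) unfolding fr_def by simp
   qed
   moreover have "t3 <= t + 1 + Suc c * T" using conjunct1[OF p3] f2(1) unfolding T_def by simp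
   moreover have "c3 <= L * (DD * DD) * Suc c" using c3(1) c2(1) by simp
   ultimately show "J (Suc c) t3 s3" unfolding J_def using p3 c3(2) by blast
  qed
  then show "bval (evaluator_of I) s2 (Less ($''c'') ($''K'')) & run class_com s2 (t2 + 1) (J (Suc c))" using f2(2) g2(2) c by simp
 next
  fix t2 :: nat and s2 :: state assume I: "J K t2 s2"
  obtain c2 where c2: "CI s2 clr K c2" using I unfolding J_def by blast
  have f2: "t2 <= t + 1 + K * T" "vars s2 ''c'' = int K" "fr s2" using I unfolding J_def by blast+
  have "Pc clr K = items I" using st by (auto simp: Pc_def static_def)
  then have "\<exists>cn X. rep s2 cn ''bv'' ''bz'' ''bl'' UNIV X & wff (items I) UNIV X & G0 (items I) X" using c2 unfolding CI_def by auto
  moreover have "vars s2 ''K'' = int K" using f2(3) vK by (simp add: fr_def)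
  ultimately show "\<not> bval (evaluator_of I) s2 (Less ($''c'') ($''K'')) & t2 + 1 <= t + 2 + K * (190 * (DD * (DD * EE lg)) + 1) &
   (\<exists>cn X. rep s2 cn ''bv'' ''bz'' ''bl'' UNIV X & wff (items I) UNIV X & G0 (items I) X)" using f2(1,2) unfolding T_def by simp
 qed auto
qed

end

section \<open>Initial tables and output\<close>

definition init_com :: com where
 "init_com =
  ((''cnt'' ::= #0;; ''i'' ::= #0);;
  While (Less ($''i'') ($''L''))
   (Write ''bv'' ($''i'') (Read ''q'' ($''i''));; Write ''bz'' ($''i'') ($''i'');; Write ''bl'' ($''i'') (#0);;
    Write ''av'' ($''i'') (Read ''q'' ($''i''));; Write ''az'' ($''i'') ($''i'');; Write ''al'' ($''i'') (#0);;
    ''i'' ::= $''i'' +. #1))"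

text \<open>Each table entry is feasible, so its objective is finite and \<open>fin\<close> is
  always 1. The final write supplies the end of the last block.\<close>

definition out_com :: com where
 "out_com =
  ((''i'' ::= #0;; ''o'' ::= #0);;
  While (Less ($''i'') ($''L''))
   ((Write ''xoff'' ($''i'') ($''o'');; Write ''z'' ($''i'') (Read ''bz'' ($''i''));; Write ''r'' ($''i'') (Read ''bv'' ($''i''));;
    Write ''fin'' ($''i'') (#1);; ''p'' ::= Read ''bl'' ($''i''));;
    While (BNot (Equal ($''p'') (#0)))
     (Write ''supp'' ($''o'') (Read ''ni'' ($''p''));; Write ''mult'' ($''o'') (Read ''nm'' ($''p''));;
     ''o'' ::= $''o'' +. #1;; ''p'' ::= Read ''nn'' ($''p''));;
    ''i'' ::= $''i'' +. #1);;
  Write ''xoff'' ($''i'') ($''o''))"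

definition total_com :: com where
 "total_com = (setup_com;; idx_com;; color_com;; init_com;; main_com;; out_com)"

lemma length_concat_upt: "length (concat (map f [0..<n])) = (\<Sum>j<n. length (f j))"
 by (induction n) simp_all

lemma nth_concat_upt: "i < n ==> k < length (f i) ==> concat (map f [0..<n]) ! ((\<Sum>j<i. length (f j)) + k) = f i ! k"
proof (induction n)
 case (Suc n)
 show ?case
 proof (cases "i = n")
  case True
  then show ?thesis by (simp add: nth_append length_concat_upt)
 next
  case False
  then have i: "i < n" using Suc by simp
  have "(\<Sum>j<i. length (f j)) + k < (\<Sum>j<Suc i. length (f j))" using Suc by simp
  also have "\<dots> <= (\<Sum>j<n. length (f j))" using i by (intro sum_mono2) auto
  finally show ?thesis using Suc.IH[OF i Suc.prems(2)] by (simp add: nth_append length_concat_upt)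
 qed
qed simp

lemma output_block_eq:
 assumes "ar s ''xoff'' i = int p" "arrs s ''xoff'' (int i + 1) = int (p + length ys)"
  "\<And>k. k < length ys ==> ar s a (p + k) = int (ys ! k)"
 shows "output_block s a i = map int ys"
proof (rule nth_equalityI)
 show l: "length (output_block s a i) = length (map int ys)" using assms(1,2) by (simp add: output_block_def)
 fix k assume "k < length (output_block s a i)"
 then have k: "k < length ys" using l by simp
 have "[int p .. int (p + length ys) - 1] ! k = int p + int k" by (rule nth_upto) (use k in simp)
 moreover have "k < length [int p .. int (p + length ys) - 1]" using k by simp
 ultimately show "output_block s a i ! k = map int ys ! k" using assms(3)[OF k] k unfolding output_block_def assms(1,2) by (simp del: length_upto)
qed

context kv
begin

lemma init_run:
 assumes vL: "vars s ''L'' = int L" and q: "\<And>i. i < L ==> ar s ''q'' i = init I i"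
 shows "run init_com s t (\<lambda>t' s'. t' <= t + 4 + 8 * L & CI s' clr 0 0)"
proof -
 let ?c1 = "(Write ''bv'' ($''i'') (Read ''q'' ($''i''));; Write ''bz'' ($''i'') ($''i'');; Write ''bl'' ($''i'') (#0);; Write ''av'' ($''i'') (Read ''q'' ($''i''));; Write ''az'' ($''i'') ($''i'');; Write ''al'' ($''i'') (#0);; ''i'' ::= $''i'' +. #1)"
 define G :: "state => nat => bool" where "G = (\<lambda>s' i. ar s' ''bv'' i = init I i & ar s' ''bz'' i = int i & ar s' ''bl'' i = 0 &
   ar s' ''av'' i = init I i & ar s' ''az'' i = int i & ar s' ''al'' i = 0)"
 define J :: "nat => nat => state => bool" where "J = (\<lambda>k t' s'. t' <= t + 2 + 8 * k & vars s' ''i'' = int k & vars s' ''L'' = int L & vars s' ''cnt'' = 0 & arrs s' ''q'' = arrs s ''q'' & (\<forall>i<k. G s' i))"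
 have pre: "run (''cnt'' ::= #0;; ''i'' ::= #0) s t (J 0)"
 proof -
  have P0: "J 0 t' s'" if "t' = t + 2" "arrs s' = arrs s" "vars s' = (vars s)(''cnt'' := 0, ''i'' := 0)" for t' :: nat and s' :: state
   using that vL by (simp add: J_def)
  show ?thesis using M16 by (intro run_wp) (simp, rule P0, simp_all)
 qed
 show ?thesis unfolding init_com_def
 proof (rule run_SeqI[OF pre], rule run_for[where Inv = J and n = L])
  fix i t2 :: nat and s2 :: state
  assume i: "i < L" and I: "J i t2 s2" and B: "Bd M s2"
  have f2: "t2 <= t + 2 + 8 * i" "vars s2 ''i'' = int i" "vars s2 ''L'' = int L" "vars s2 ''cnt'' = 0" "arrs s2 ''q'' = arrs s ''q''" "\<forall>j<i. G s2 j" using I unfolding J_def by blast+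
  have qi: "ar s2 ''q'' i = init I i" using q[OF i] f2(5) by simp
  have R: "J (Suc i) t3 s3" if h: "t3 <= t2 + 8" "vars s3 = (vars s2)(''i'' := int i + 1)"
   "arrs s3 = (arrs s2)(''bv'' := (arrs s2 ''bv'')(int i := init I i), ''bz'' := (arrs s2 ''bz'')(int i := int i), ''bl'' := (arrs s2 ''bl'')(int i := 0),
     ''av'' := (arrs s2 ''av'')(int i := init I i), ''az'' := (arrs s2 ''az'')(int i := int i), ''al'' := (arrs s2 ''al'')(int i := 0))" for t3 :: nat and s3 :: state
  proof -
   have "t3 <= t + 2 + 8 * Suc i" using h(1) f2(1) by simp
   moreover have "vars s3 ''i'' = int (Suc i)" "vars s3 ''L'' = int L" "vars s3 ''cnt'' = 0" using h(2) f2 by simp_all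
   moreover have "arrs s3 ''q'' = arrs s ''q''" using f2(5) by (simp add: h(3))
   moreover have "\<forall>j<Suc i. G s3 j"
   proof (intro allI impI)
    fix j assume "j < Suc i"
    then show "G s3 j" using f2(6) by (cases "j = i") (simp_all add: G_def h(3))
   qed
   ultimately show ?thesis unfolding J_def by blast
  qed
  have bds: "\<bar>init I i\<bar> <= M" "int i + 1 <= M"
   using BdD(2)[OF B, of "''q''" "int i"] qi i LM4 by simp_all
  have "run ?c1 s2 (t2 + 1) (J (Suc i))"
   using f2(2) qi bds M16 by (intro run_wp) (simp, rule R, simp_all)
  then show "bval (evaluator_of I) s2 (Less ($''i'') ($''L'')) & run ?c1 s2 (t2 + 1) (J (Suc i))" using f2(2,3) i by simp
 next
  fix t2 :: nat and s2 :: state assume I: "J L t2 s2"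
  have f2: "t2 <= t + 2 + 8 * L" "vars s2 ''i'' = int L" "vars s2 ''L'' = int L" "vars s2 ''cnt'' = 0" "\<forall>j<L. G s2 j" using I unfolding J_def by blast+
  have V0: "Vl i (\<lambda>_. 0) = init I i" for i by (simp add: Vl_def wt_0 gain_0)
  have "rep s2 0 ''bv'' ''bz'' ''bl'' UNIV (\<lambda>_ _. 0)" "rep s2 0 ''av'' ''az'' ''al'' UNIV (\<lambda>_ _. 0)"
   using f2(5) vrep_nil by (simp_all add: rep_def G_def V0 wt_0)
  moreover have "Pc clr 0 = {}" by (simp add: Pc_def)
  ultimately have "CI s2 clr 0 0" unfolding CI_def using f2(4) wff_init G0_init by auto
  then show "\<not> bval (evaluator_of I) s2 (Less ($''i'') ($''L'')) & t2 + 1 <= t + 4 + 8 * L & CI s2 clr 0 0" using f2(1-3) by simp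
 qed auto
qed

lemma out_run:
 assumes vL: "vars s ''L'' = int L" and rp: "rep s cn ''bv'' ''bz'' ''bl'' UNIV X" and wX: "wff (items I) UNIV X"
 shows "run out_com s t (\<lambda>t' s'. t' <= t + 4 + L * (5 * bb + 9) & encodes_output I s' X (\<lambda>i. residual I i (X i)) (\<lambda>i. objective I i (X i)))"
  (is "run _ _ _ ?post")
proof -
 let ?c3 = "(Write ''supp'' ($''o'') (Read ''ni'' ($''p''));; Write ''mult'' ($''o'') (Read ''nm'' ($''p''));; ''o'' ::= $''o'' +. #1;; ''p'' ::= Read ''nn'' ($''p''))"
 let ?c2 = "(Write ''xoff'' ($''i'') ($''o'');; Write ''z'' ($''i'') (Read ''bz'' ($''i''));; Write ''r'' ($''i'') (Read ''bv'' ($''i''));; Write ''fin'' ($''i'') (#1);; ''p'' ::= Read ''bl'' ($''i''))"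
 let ?c1 = "(?c2;; While (BNot (Equal ($''p'') (#0))) ?c3;; ''i'' ::= $''i'' +. #1)"
 have "\<exists>p w. chn (arrs s ''nn'') (ar s ''bl'' i) p & length w = length p & distinct w & set w = supp (X i) &
   (\<forall>k<length p. ar s ''ni'' (p ! k) = int (w ! k) & ar s ''nm'' (p ! k) = int (X i (w ! k)))" if "i < L" for i
  using rp that unfolding rep_def vrep_def by blast
 then obtain ps ws where pw: "\<And>i. i < L ==> chn (arrs s ''nn'') (ar s ''bl'' i) (ps i) & length (ws i) = length (ps i) & distinct (ws i) & set (ws i) = supp (X i) &
   (\<forall>k<length (ps i). ar s ''ni'' (ps i ! k) = int (ws i ! k) & ar s ''nm'' (ps i ! k) = int (X i (ws i ! k)))" by metis
 \<comment> \<open>The support of an entry lies in the set \<open>S[z]\<close> of its residual. This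
   bounds the length of the list by \<open>bb\<close> and the output by
   \<open>L * bb\<close>.\<close>
 have lb: "length (ws i) <= bb" "length (ws i) = length (ps i)" if i: "i < L" for i
 proof -
  have z: "i - wt (X i) < L" using i by simp
  have "length (ws i) = card (supp (X i))" using pw[OF i] distinct_card by metis
  also have "\<dots> <= card (allowed I (i - wt (X i)))"
   using wX i allowed_items[OF z] fin_items by (intro card_mono) (auto simp: wff_def intro: finite_subset)
  also have "\<dots> <= bb" by (rule bbc[OF z])
  finally show "length (ws i) <= bb" .
  show "length (ws i) = length (ps i)" using pw[OF i] by blast
 qed
 define off where "off = (\<lambda>k. \<Sum>j<k. length (ws j))"
 have OS: "off (Suc k) = off k + length (ws k)" for k by (simp add: off_def)
 have Ob: "k <= L ==> off k <= k * bb" for k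
 proof (induction k)
  case (Suc k)
  then show ?case using lb(1)[of k] OS[of k] by simp
 qed (simp add: off_def)
 have LbM: "int (L * bb + 1) <= M" by (rule ZM[of _ 1]) (use Z_basic(3) in simp_all)
 have ObM: "int (off k) + 1 <= M" if "k <= L" for k
 proof -
  have "off k <= L * bb" using Ob[OF that] mult_le_mono1[OF that, of bb] by linarith
  then show ?thesis using LbM by linarith
 qed
 define Sf where "Sf = (\<lambda>q. concat (map ws [0..<L]) ! q)"
 define Mf where "Mf = (\<lambda>q. concat (map (\<lambda>i. map (X i) (ws i)) [0..<L]) ! q)"
 have Sfe: "Sf (off i + k) = ws i ! k" "Mf (off i + k) = X i (ws i ! k)" if "i < L" "k < length (ws i)" for i k
  using nth_concat_upt[of i L k ws] nth_concat_upt[of i L k "\<lambda>i. map (X i) (ws i)"] that by (simp_all add: Sf_def Mf_def off_def)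
 define fr :: "state => bool" where "fr = (\<lambda>s'. vars s' ''L'' = int L & (\<forall>a\<in>{''bv'', ''bz'', ''bl'', ''nn'', ''ni'', ''nm''}. arrs s' a = arrs s a))"
 define Es :: "state => nat => bool" where "Es = (\<lambda>s' n. \<forall>q<n. ar s' ''supp'' q = int (Sf q) & ar s' ''mult'' q = int (Mf q))"
 define Dn :: "state => nat => bool" where "Dn = (\<lambda>s' j. ar s' ''xoff'' j = int (off j) & ar s' ''z'' j = int (j - wt (X j)) & ar s' ''r'' j = Vl j (X j) & ar s' ''fin'' j = 1)"
 define J :: "nat => nat => state => bool" where "J = (\<lambda>i t' s'. t' <= t + 2 + i * (5 * bb + 9) & vars s' ''i'' = int i & vars s' ''o'' = int (off i) & fr s' & Es s' (off i) & (\<forall>j<i. Dn s' j))"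
 have pre: "run (''i'' ::= #0;; ''o'' ::= #0) s t (J 0)"
 proof -
  have P0: "J 0 t' s'" if "t' = t + 2" "arrs s' = arrs s" "vars s' = (vars s)(''i'' := 0, ''o'' := 0)" for t' :: nat and s' :: state
   using that vL by (simp add: J_def fr_def Es_def off_def)
  show ?thesis using M16 by (intro run_wp) (simp, rule P0, simp_all)
 qed
 have W: "run (While (Less ($''i'') ($''L''))
   ?c1) s1 t1 (\<lambda>t' s'. J L (t' - 1) s' & 1 <= t')" if J0: "J 0 t1 s1" for s1 :: state and t1 :: nat
 proof (rule run_for[where Inv = J and n = L, OF _ _ J0])
  fix i t2 :: nat and s2 :: state
  assume i: "i < L" and I: "J i t2 s2" and B: "Bd M s2"
  have f2: "t2 <= t + 2 + i * (5 * bb + 9)" "vars s2 ''i'' = int i" "vars s2 ''o'' = int (off i)" "fr s2" "Es s2 (off i)" "\<forall>j<i. Dn s2 j" using I unfolding J_def by blast+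
  have a2: "arrs s2 ''bv'' = arrs s ''bv''" "arrs s2 ''bz'' = arrs s ''bz''" "arrs s2 ''bl'' = arrs s ''bl''" "vars s2 ''L'' = int L" using f2(4) unfolding fr_def by simp_all
  have ri: "ar s ''bv'' i = Vl i (X i)" "ar s ''bz'' i = int (i - wt (X i))" using rp i unfolding rep_def by simp_all
  have pwi: "chn (arrs s ''nn'') (ar s ''bl'' i) (ps i)" "\<And>k. k < length (ps i) ==> ar s ''ni'' (ps i ! k) = int (ws i ! k) & ar s ''nm'' (ps i ! k) = int (X i (ws i ! k))" using pw[OF i] by blast+
  define JJ :: "nat => nat => state => bool" where "JJ = (\<lambda>k t' s'. t' <= t2 + 6 + 5 * k & vars s' ''i'' = int i & vars s' ''o'' = int (off i + k) & fr s' & Es s' (off i + k) & (\<forall>j<Suc i. Dn s' j) &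
    chn (arrs s ''nn'') (vars s' ''p'') (drop k (ps i)))"
  have p1: "run ?c2 s2 (t2 + 1) (JJ 0)"
  proof -
   have R: "JJ 0 t3 s3" if h: "t3 = t2 + 6" "vars s3 = (vars s2)(''p'' := ar s ''bl'' i)"
    "arrs s3 = (arrs s2)(''xoff'' := (arrs s2 ''xoff'')(int i := int (off i)), ''z'' := (arrs s2 ''z'')(int i := int (i - wt (X i))), ''r'' := (arrs s2 ''r'')(int i := Vl i (X i)), ''fin'' := (arrs s2 ''fin'')(int i := 1))" for t3 :: nat and s3 :: state
   proof -
    have "fr s3" using f2(4) unfolding fr_def by (simp add: h(2,3))
    moreover have "Es s3 (off i + 0)" using f2(5) unfolding Es_def by (simp add: h(3))
    moreover have "\<forall>j<Suc i. Dn s3 j"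
    proof (intro allI impI)
     fix j assume "j < Suc i"
     then show "Dn s3 j" using f2(6) by (cases "j = i") (simp_all add: Dn_def h(3))
    qed
    moreover have "t3 <= t2 + 6 + 5 * 0" "vars s3 ''i'' = int i" "vars s3 ''o'' = int (off i + 0)" "chn (arrs s ''nn'') (vars s3 ''p'') (drop 0 (ps i))" using pwi(1) f2(2,3) by (simp_all add: h(1,2))
    ultimately show ?thesis unfolding JJ_def by blast
   qed
   have bds: "\<bar>Vl i (X i)\<bar> <= M" "\<bar>int (i - wt (X i))\<bar> <= M" "\<bar>ar s ''bl'' i\<bar> <= M" "int (off i) <= M"
    using BdD(2)[OF B, of "''bv''" "int i"] BdD(2)[OF B, of "''bz''" "int i"] BdD(2)[OF B, of "''bl''" "int i"] a2 ri ObM[of i] i by simp_all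
   show ?thesis using f2(2,3) a2 ri bds M16 by (intro run_wp) (simp, rule R, simp_all)
  qed
  have W2: "run (While (BNot (Equal ($''p'') (#0)))
     ?c3) s3 t3 (\<lambda>t' s'. JJ (length (ps i)) (t' - 1) s' & 1 <= t')" if "JJ 0 t3 s3" for s3 :: state and t3 :: nat
  proof (rule run_for[where Inv = JJ and n = "length (ps i)", OF _ _ that])
   fix k t4 :: nat and s4 :: state
   assume k: "k < length (ps i)" and I4: "JJ k t4 s4" and B4: "Bd M s4"
   have f4: "t4 <= t2 + 6 + 5 * k" "vars s4 ''i'' = int i" "vars s4 ''o'' = int (off i + k)" "fr s4" "Es s4 (off i + k)" "\<forall>j<Suc i. Dn s4 j" "chn (arrs s ''nn'') (vars s4 ''p'') (drop k (ps i))" using I4 unfolding JJ_def by blast+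
   define q where "q = ps i ! k"
   have ch: "vars s4 ''p'' = int q" "q \<noteq> 0" "chn (arrs s ''nn'') (ar s ''nn'' q) (drop (Suc k) (ps i))"
    using chn_drop[of "arrs s ''nn''" "vars s4 ''p''" k "ps i"] f4(7) k unfolding q_def by auto
   have a4: "arrs s4 ''nn'' = arrs s ''nn''" "arrs s4 ''ni'' = arrs s ''ni''" "arrs s4 ''nm'' = arrs s ''nm''" using f4(4) unfolding fr_def by simp_all
   have kw: "k < length (ws i)" using k lb(2)[OF i] by simp
   have val: "ar s ''ni'' q = int (Sf (off i + k))" "ar s ''nm'' q = int (Mf (off i + k))" using pwi(2)[OF k] Sfe[OF i kw] unfolding q_def by simp_all
   have R: "JJ (Suc k) t5 s5" if h: "t5 = t4 + 5" "vars s5 = (vars s4)(''o'' := int (off i + k) + 1, ''p'' := ar s ''nn'' q)"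
    "arrs s5 = (arrs s4)(''supp'' := (arrs s4 ''supp'')(int (off i + k) := int (Sf (off i + k))), ''mult'' := (arrs s4 ''mult'')(int (off i + k) := int (Mf (off i + k))))" for t5 :: nat and s5 :: state
   proof -
    have "fr s5" using f4(4) unfolding fr_def by (simp add: h(2,3))
    moreover have "Es s5 (off i + Suc k)" unfolding Es_def
    proof (intro allI impI)
     fix m assume m: "m < off i + Suc k"
     show "ar s5 ''supp'' m = int (Sf m) & ar s5 ''mult'' m = int (Mf m)"
     proof (cases "m = off i + k")
      case True
      then show ?thesis unfolding True h(3) by simp
     next
      case False
      then have "m < off i + k" "int m \<noteq> int (off i + k)" using m by linarith+
      then show ?thesis using f4(5) unfolding Es_def h(3) by simp
     qed
    qed
    moreover have "\<forall>j<Suc i. Dn s5 j" using f4(6) unfolding Dn_def by (simp add: h(3))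
    moreover have "t5 <= t2 + 6 + 5 * Suc k" "vars s5 ''i'' = int i" "vars s5 ''o'' = int (off i + Suc k)" "chn (arrs s ''nn'') (vars s5 ''p'') (drop (Suc k) (ps i))" using ch(3) f4(1,2) by (simp_all add: h(1,2))
    ultimately show ?thesis unfolding JJ_def by blast
   qed
   have "off i + k + 1 <= off (Suc i)" using OS[of i] kw by simp
   then have oM: "int (off i + k) + 1 <= M" using ObM[of "Suc i"] i by linarith
   have bds: "\<bar>int (Sf (off i + k))\<bar> <= M" "\<bar>int (Mf (off i + k))\<bar> <= M" "\<bar>ar s ''nn'' q\<bar> <= M"
    using BdD(2)[OF B4, of "''ni''" "int q"] BdD(2)[OF B4, of "''nm''" "int q"] BdD(2)[OF B4, of "''nn''" "int q"] a4 val by simp_all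
   have "run ?c3 s4 (t4 + 1) (JJ (Suc k))"
    using f4(3) ch(1) a4 val bds oM by (intro run_wp) (simp, rule R, simp_all)
   then show "bval (evaluator_of I) s4 (BNot (Equal ($''p'') (#0))) & run ?c3 s4 (t4 + 1) (JJ (Suc k))" using ch(1,2) by simp
  next
   fix t4 :: nat and s4 :: state assume I4: "JJ (length (ps i)) t4 s4"
   then have "vars s4 ''p'' = 0" unfolding JJ_def by simp
   then show "\<not> bval (evaluator_of I) s4 (BNot (Equal ($''p'') (#0))) & JJ (length (ps i)) (t4 + 1 - 1) s4 & 1 <= t4 + 1" using I4 by simp
  qed auto
  have p3: "run (''i'' ::= $''i'' +. #1) s3 t3 (J (Suc i))" if j: "JJ (length (ps i)) (t3 - 1) s3 & 1 <= t3" for s3 :: state and t3 :: nat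
  proof -
   have f3: "t3 - 1 <= t2 + 6 + 5 * length (ps i)" "vars s3 ''i'' = int i" "vars s3 ''o'' = int (off i + length (ps i))" "fr s3" "Es s3 (off i + length (ps i))" "\<forall>j<Suc i. Dn s3 j" using j unfolding JJ_def by blast+
   have Oe: "off i + length (ps i) = off (Suc i)" using OS[of i] lb(2)[OF i] by simp
   have "length (ps i) <= bb" using lb[OF i] by simp
   then have tt: "t3 + 1 <= t + 2 + Suc i * (5 * bb + 9)" using f3(1) f2(1) j by simp
   have R: "J (Suc i) t4 s4" if h: "t4 = t3 + 1" "arrs s4 = arrs s3" "vars s4 = (vars s3)(''i'' := int i + 1)" for t4 :: nat and s4 :: state
   proof -
    have "fr s4" using f3(4) unfolding fr_def by (simp add: h(2,3))
    moreover have "Es s4 (off (Suc i))" "\<forall>j<Suc i. Dn s4 j" using f3(5,6) Oe unfolding Es_def Dn_def by (simp_all add: h(2))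
    moreover have "vars s4 ''i'' = int (Suc i)" "vars s4 ''o'' = int (off (Suc i))" using f3(3) Oe by (simp_all add: h(3))
    moreover have "t4 <= t + 2 + Suc i * (5 * bb + 9)" using tt h(1) by simp
    ultimately show ?thesis unfolding J_def by blast
   qed
   have iM: "int i + 1 <= M" using i LM4 by linarith
   show ?thesis using f3(2) iM by (intro run_wp) (simp, rule R, simp_all)
  qed
  have "run ?c1 s2 (t2 + 1) (J (Suc i))"
   by (rule run_SeqI[OF p1], rule run_SeqI[OF W2], assumption, rule p3, assumption)
  then show "bval (evaluator_of I) s2 (Less ($''i'') ($''L'')) & run ?c1 s2 (t2 + 1) (J (Suc i))" using f2(2) a2(4) i by simp
 next
  fix t2 :: nat and s2 :: state assume I: "J L t2 s2"
  have "vars s2 ''i'' = int L" "fr s2" using I unfolding J_def by blast+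
  then show "\<not> bval (evaluator_of I) s2 (Less ($''i'') ($''L'')) & J L (t2 + 1 - 1) s2 & 1 <= t2 + 1" using I by (simp add: fr_def)
 qed auto
 show ?thesis unfolding out_com_def
 proof (rule run_SeqI[OF pre], rule run_SeqI[OF W], assumption)
  fix t2 :: nat and s2 :: state
  assume j: "J L (t2 - 1) s2 & 1 <= t2"
  have f2: "t2 - 1 <= t + 2 + L * (5 * bb + 9)" "vars s2 ''i'' = int L" "vars s2 ''o'' = int (off L)" "Es s2 (off L)" "\<forall>j<L. Dn s2 j" using j unfolding J_def by blast+
  have F: "?post t3 s3"
   if h: "t3 = t2 + 1" "arrs s3 = (arrs s2)(''xoff'' := (arrs s2 ''xoff'')(int L := int (off L)))" for t3 :: nat and s3 :: state
  proof
   show "t3 <= t + 4 + L * (5 * bb + 9)" using f2(1) h(1) j by linarith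
   have xo: "ar s3 ''xoff'' i = int (off i)" if "i <= L" for i
    using f2(5) that by (cases "i = L") (simp_all add: h(2) Dn_def)
   show "encodes_output I s3 X (\<lambda>i. residual I i (X i)) (\<lambda>i. objective I i (X i))" unfolding encodes_output_def
   proof (intro allI impI)
    fix i assume i: "i < len I"
    have wi: "wt (X i) <= i" using wX i by (auto simp: wff_def)
    have x0: "ar s3 ''xoff'' i = int (off i)" using xo[of i] i by simp
    have x1: "arrs s3 ''xoff'' (int i + 1) = int (off i + length (ws i))" using xo[of "Suc i"] i OS[of i] by (simp add: add.commute)
    have e: "ar s3 ''supp'' (off i + k) = int (ws i ! k) & ar s3 ''mult'' (off i + k) = int (X i (ws i ! k))" if k: "k < length (ws i)" for k
    proof -
     have "off (Suc i) <= off L" unfolding off_def using i by (intro sum_mono2) auto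
     then have "off i + k < off L" using OS[of i] k by linarith
     then have "ar s2 ''supp'' (off i + k) = int (Sf (off i + k)) & ar s2 ''mult'' (off i + k) = int (Mf (off i + k))" using f2(4) unfolding Es_def by blast
     then show ?thesis using Sfe[OF i k] by (simp add: h(2))
    qed
    have ob1: "output_block s3 ''supp'' i = map int (ws i)" by (rule output_block_eq[OF x0 x1]) (use e in blast)
    have ob2: "output_block s3 ''mult'' i = map int (map (X i) (ws i))" by (rule output_block_eq[OF x0]) (use x1 e in simp_all)
    have D: "ar s3 ''z'' i = int (i - wt (X i))" "ar s3 ''r'' i = Vl i (X i)" "ar s3 ''fin'' i = 1" using f2(5) i by (simp_all add: Dn_def h(2))
    have dw: "distinct (ws i)" "set (ws i) = supp (X i)" using pw[OF i] by blast+
    have "distinct (output_block s3 ''supp'' i)" using dw(1) by (simp add: ob1 distinct_map)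
    moreover have "set (output_block s3 ''supp'' i) = int ` supp (X i)" using dw(2) by (simp add: ob1)
    moreover have "output_block s3 ''mult'' i = map (\<lambda>w. int (X i (nat w))) (output_block s3 ''supp'' i)" by (simp add: ob1 ob2)
    moreover have "ar s3 ''z'' i = residual I i (X i)" using wi by (simp add: D residual_eq of_nat_diff)
    moreover have "objective I i (X i) = (if ar s3 ''fin'' i = 0 then - \<infinity> else ereal (of_int (ar s3 ''r'' i)))" using objective_feas[OF i wi] by (simp add: D)
    ultimately show "distinct (output_block s3 ''supp'' i) & set (output_block s3 ''supp'' i) = int ` supp (X i) & output_block s3 ''mult'' i = map (\<lambda>w. int (X i (nat w))) (output_block s3 ''supp'' i) &
     ar s3 ''z'' i = residual I i (X i) & objective I i (X i) = (if ar s3 ''fin'' i = 0 then - \<infinity> else ereal (of_int (ar s3 ''r'' i)))" by blast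
   qed
  qed
  have oM: "int (off L) <= M" using ObM[of L] by simp
  show "run (Write ''xoff'' ($''i'') ($''o'')) s2 t2 ?post"
   by (rule run_conseq[where P = "\<lambda>t' s'. t' = t2 + 1 & arrs s' = (arrs s2)(''xoff'' := (arrs s2 ''xoff'')(int L := int (off L)))"])
    (rule run_wp, use f2(2,3) oM in simp, rule F, simp_all)
 qed
qed

end

lemma frames_prep:
 "''L'' \<notin> asgd setup_com" "wrtn setup_com = {}"
 "''L'' \<notin> asgd idx_com" "''K'' \<notin> asgd idx_com" "''D'' \<notin> asgd idx_com"
 "''off'' \<notin> wrtn idx_com" "''S'' \<notin> wrtn idx_com" "''E'' \<notin> wrtn idx_com" "''h2'' \<notin> wrtn idx_com" "''q'' \<notin> wrtn idx_com"
 "''L'' \<notin> asgd color_com" "''K'' \<notin> asgd color_com" "''D'' \<notin> asgd color_com"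
 "''off'' \<notin> wrtn color_com" "''S'' \<notin> wrtn color_com" "''q'' \<notin> wrtn color_com"
 "''L'' \<notin> asgd init_com" "''K'' \<notin> asgd init_com" "''D'' \<notin> asgd init_com"
 "''off'' \<notin> wrtn init_com" "''S'' \<notin> wrtn init_com" "''nx2'' \<notin> wrtn init_com" "''h2'' \<notin> wrtn init_com"
 by (simp_all add: setup_com_def idx_com_def color_com_def init_com_def frames_color2)

lemma L_main: "''L'' \<notin> asgd main_com"
 using frames_class(1)[of "''L''"] by (simp add: main_com_def)

section \<open>Total running time and word size\<close>

context kv
begin

text \<open>The main loop dominates: \<open>K <= 4 * bb\<close> colours, \<open>DD ^ 2\<close> of
  order \<open>(lg + 1) ^ 6\<close>, and \<open>EE lg\<close> of order
  \<open>(lg + 1) ^ 2 * L\<close>.\<close>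

lemma total_time:
 assumes p: "params b H K lg"
 shows "20 * (L + lg + 1) + (9 * NN + 5 * L + 5) + 20 * (H + 2) * (NN + L + 1) + (4 + 8 * L) +
   (2 + K * (190 * ((2 * (lg * lg * lg) + 1) * ((2 * (lg * lg * lg) + 1) * EE lg)) + 1)) + (4 + L * (5 * bb + 9)) <= 7000 * ((lg + 1) ^ 8 * (bb * L))"
proof -
 define n where "n = lg + 1"
 define P where "P = bb * L"
 have P: "L <= P" "bb <= P" "NN <= P" "1 <= P" using L_bb NN_le len1 by (simp_all add: P_def mult.commute)
 have n1: "1 <= n ^ 8" "n <= n ^ 8" by (simp_all add: n_def self_le_power)
 have nP: "P <= n ^ 8 * P" "n * P <= n ^ 8 * P" using mult_le_mono1[OF n1(1), of P] mult_le_mono1[OF n1(2), of P] by simp_all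
 have nle: "n <= n * P" "P <= n * P" using mult_le_mono2[OF P(4), of n] by (simp_all add: n_def)
 have H: "H <= lg" "K <= 4 * bb" using p by (simp_all add: params_def)
 have 1: "20 * (L + lg + 1) <= 40 * (n * P)" using P(1) nle by (simp add: n_def)
 have "20 * (H + 2) <= 40 * n" "NN + L + 1 <= 3 * P" using H(1) P by (simp_all add: n_def)
 then have "20 * (H + 2) * (NN + L + 1) <= (40 * n) * (3 * P)" by (rule mult_le_mono)
 then have 2: "20 * (H + 2) * (NN + L + 1) <= 120 * (n * P)" by simp
 have 3: "L * (5 * bb + 9) <= 14 * P" using P(1) by (simp add: P_def distrib_left mult.commute mult.left_commute)
 have D: "2 * (lg * lg * lg) + 1 <= 2 * (n * n * n)" by (simp add: n_def algebra_simps)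
 have "EE lg = n * n * L + n * n" by (simp add: EE_def n_def algebra_simps)
 moreover have "n * n * 1 <= n * n * L" using len1 by (rule mult_le_mono2)
 ultimately have E: "EE lg <= 2 * (n * n * L)" by linarith
 define DD where "DD = 2 * (lg * lg * lg) + 1"
 have "DD * (DD * EE lg) <= (2 * (n * n * n)) * ((2 * (n * n * n)) * (2 * (n * n * L)))" using D E unfolding DD_def by (intro mult_le_mono)
 also have "\<dots> = 8 * (n ^ 8 * L)" by algebra
 finally have DE: "DD * (DD * EE lg) <= 8 * (n ^ 8 * L)" .
 have "1 * 1 <= n ^ 8 * L" using n1(1) len1 by (intro mult_le_mono)
 then have "190 * (DD * (DD * EE lg)) + 1 <= 1521 * (n ^ 8 * L)" using DE by linarith
 then have "K * (190 * (DD * (DD * EE lg)) + 1) <= (4 * bb) * (1521 * (n ^ 8 * L))" using H(2) by (intro mult_le_mono)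
 also have "\<dots> = 6084 * (n ^ 8 * P)" by (simp add: P_def mult.assoc mult.left_commute mult.commute)
 finally have 4: "K * (190 * (DD * (DD * EE lg)) + 1) <= 6084 * (n ^ 8 * P)" .
 show ?thesis using 1 2 3 4 P nP unfolding DD_def[symmetric] n_def[symmetric] P_def[symmetric] by linarith
qed

text \<open>The largest counter is the number of list nodes, which stays below
  \<open>ZZ ^ 11\<close>.\<close>

lemma word_bounds:
 assumes p: "params b H K lg" and DD: "DD = 2 * (lg * lg * lg) + 1"
 shows "int ((L * (DD * DD)) * Suc K + 1) <= M" "int DD + 2 <= M" "int K <= M" "int L + 1 <= M" "int NN + 1 <= M" "L < 2 ^ lg"
proof -
 have Z32: "32 <= ZZ" by (rule Z_basic(4))
 have lz: "lg <= ZZ ^ 1" using params_lg[OF p] by simp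
 have Z1: "1 <= ZZ ^ 3" using Z32 by simp
 have "lg * lg * lg <= ZZ ^ 3" using Z_mult[OF Z_mult[OF lz lz] lz] by (simp add: numeral_eq_Suc)
 then have "DD + 2 <= 5 * ZZ ^ 3" using Z1 unfolding DD by linarith
 also have "\<dots> <= ZZ ^ 1 * ZZ ^ 3" using Z32 by (intro mult_le_mono1) simp
 finally have D2: "DD + 2 <= ZZ ^ 4" by (simp add: eval_nat_numeral)
 then have D1: "DD <= ZZ ^ 4" by simp
 have K4: "K <= 4 * bb" using p by (simp add: params_def)
 then have KZ: "Suc K <= ZZ ^ 1" using Z_basic(2) by simp
 have LZ: "L <= ZZ ^ 1" using Z_basic(1) by simp
 have "L * (DD * DD) * Suc K <= ZZ ^ (1 + (4 + 4) + 1)" by (rule Z_mult[OF Z_mult[OF LZ Z_mult[OF D1 D1]] KZ])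
 then have "L * (DD * DD) * Suc K <= ZZ ^ 10" by simp
 moreover have "1 <= ZZ ^ 10" using Z32 by simp
 ultimately have "L * (DD * DD) * Suc K + 1 <= 2 * ZZ ^ 10" by linarith
 also have "\<dots> <= ZZ ^ 1 * ZZ ^ 10" using Z32 by (intro mult_le_mono1) simp
 also have "\<dots> = ZZ ^ 11" by (simp flip: power_Suc)
 finally have "L * (DD * DD) * Suc K + 1 <= ZZ ^ 11" .
 then show "int ((L * (DD * DD)) * Suc K + 1) <= M" by (rule ZM) simp
 show "int DD + 2 <= M" using ZM[OF D2] by simp
 show "int K <= M" using ZM[OF KZ] by simp
 have "L + 1 <= ZZ ^ 1" using Z_basic(1) by simp
 from ZM[OF this] show "int L + 1 <= M" by simp
 have "NN + 1 <= ZZ ^ 1" using NN_le Z_basic(3) by simp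
 from ZM[OF this] show "int NN + 1 <= M" by simp
 have q: "2 * L * K < 2 ^ lg" "K = 2 ^ H" using p unfolding params_def by blast+
 have "L <= 2 * L * K" using q(2) mult_le_mono2[of 1 "2 * 2 ^ H" L] by (simp add: mult.left_commute mult.commute)
 then show "L < 2 ^ lg" using q(1) by linarith
qed

lemma solution:
 assumes g: "G0 (items I) X" and w: "wff (items I) UNIV X"
 shows "kew_solution I X (\<lambda>i. residual I i (X i)) (\<lambda>i. objective I i (X i))"
 unfolding kew_solution_def
proof (intro allI impI conjI)
 fix i assume i: "i < len I"
 show "X i \<in> vectors I" using wff_feas[OF w UNIV_I i] by (simp add: feas_def vectors_def)
 assume h: "\<forall>y. maximizer I i y --> supp y \<subseteq> allowed I (nat (residual I i y))"
 obtain y where "maximizer I i y" using maximizer_exists[OF i] by blast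
 then have "Mx i y" using h i unfolding Mx_def by blast
 then show "maximizer I i (X i)" by (rule G0_final[OF g w])
qed (rule refl)+

lemma total_run:
 assumes inA: "inA s" and z0: "\<And>k. arrs s ''hd'' k = 0" "\<And>k. arrs s ''E'' k = 0" "\<And>k. arrs s ''h2'' k = 0" and q: "\<And>i. i < L ==> ar s ''q'' i = init I i"
 shows "run total_com s 0 (\<lambda>t' s'. \<exists>lg X. 2 ^ lg <= 16 * (bb * L) & t' <= 7000 * ((lg + 1) ^ 8 * (bb * L)) &
   encodes_output I s' X (\<lambda>i. residual I i (X i)) (\<lambda>i. objective I i (X i)) & kew_solution I X (\<lambda>i. residual I i (X i)) (\<lambda>i. objective I i (X i)))"
  (is "run _ _ _ ?P")
 unfolding total_com_def
proof (rule run_SeqI[OF setup_run[OF inA]])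
 fix t1 :: nat and s1 :: state
 assume p1: "\<exists>b H K lg. params b H K lg & t1 <= 0 + 20 * (L + lg + 1) & vars s1 ''K'' = int K & vars s1 ''lg'' = int lg & vars s1 ''D'' = int (2 * (lg * lg * lg) + 1)"
  and v1: "\<And>v. v \<notin> asgd setup_com ==> vars s1 v = vars s v" and r1: "\<And>a. a \<notin> wrtn setup_com ==> arrs s1 a = arrs s a"
 obtain b H K lg where p: "params b H K lg" and t1: "t1 <= 20 * (L + lg + 1)" and K1: "vars s1 ''K'' = int K" "vars s1 ''D'' = int (2 * (lg * lg * lg) + 1)" using p1 by auto
 define DD where "DD = 2 * (lg * lg * lg) + 1"
 note wb = word_bounds[OF p DD_def]
 have A1: "arrs s1 = arrs s" by (rule ext, rule r1) (simp add: frames_prep)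
 have L1: "vars s1 ''L'' = vars s ''L''" by (rule v1) (rule frames_prep)
 have in1: "inA s1" using inA A1 L1 unfolding inA_def by simp
 have hd1: "arrs s1 ''hd'' k = 0" for k using z0(1) A1 by simp
 have pp: "K = 2 ^ H" "2 * b <= K" "K <= 4 * bb" "2 * L * K < 2 ^ lg" "2 ^ lg <= 4 * L * K" using p unfolding params_def by blast+
 have pb: "card (allowed I z) <= b" if "z < L" for z using p that unfolding params_def by blast
 have lgb: "2 ^ lg <= 16 * (bb * L)"
 proof -
  have "4 * L * K <= 4 * L * (4 * bb)" using pp(3) by (intro mult_le_mono2)
  also have "\<dots> = 16 * (bb * L)" by simp
  finally show ?thesis using pp(5) by linarith
 qed
 show "run (idx_com;; color_com;; init_com;; main_com;; out_com) s1 t1 ?P"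
 proof (rule run_SeqI[OF idx_run[OF in1 hd1 wb(4,5)]])
  fix t2 :: nat and s2 :: state
  assume p2: "t2 <= t1 + 9 * NN + 5 * L + 5 & ixd NN s2"
   and v2: "\<And>v. v \<notin> asgd idx_com ==> vars s2 v = vars s1 v" and r2: "\<And>a. a \<notin> wrtn idx_com ==> arrs s2 a = arrs s1 a"
  have V2: "vars s2 ''L'' = vars s ''L''" "vars s2 ''K'' = int K" "vars s2 ''D'' = int DD" using v2[OF frames_prep(3)] v2[OF frames_prep(4)] v2[OF frames_prep(5)] L1 K1 DD_def by simp_all
  have R2: "arrs s2 ''off'' = arrs s ''off''" "arrs s2 ''S'' = arrs s ''S''" "arrs s2 ''E'' = arrs s ''E''" "arrs s2 ''h2'' = arrs s ''h2''" "arrs s2 ''q'' = arrs s ''q''"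
   using r2[OF frames_prep(6)] r2[OF frames_prep(7)] r2[OF frames_prep(8)] r2[OF frames_prep(9)] r2[OF frames_prep(10)] A1 by simp_all
  have in2: "inA s2" using inA V2(1) R2(1,2) unfolding inA_def by simp
  have E2: "arrs s2 ''E'' k = 0" "arrs s2 ''h2'' k = 0" for k using z0 R2 by simp_all
  show "run (color_com;; init_com;; main_com;; out_com) s2 t2 ?P"
  proof (rule run_SeqI[OF color_run[OF conjunct2[OF p2] in2 V2(2) capK_ok[OF pp(3)] pp(1,2) pb E2]])
   fix t3 :: nat and s3 :: state
   assume p3: "t3 <= t2 + 20 * (H + 2) * (NN + L + 1) & (\<exists>cl E. colst K b E cl L & (\<forall>u. cl u < K) & (\<forall>z<L. \<forall>c<K. bkt s3 K z c (wl cl L z c)))"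
    and v3: "\<And>v. v \<notin> asgd color_com ==> vars s3 v = vars s2 v" and r3: "\<And>a. a \<notin> wrtn color_com ==> arrs s3 a = arrs s2 a"
   obtain clr E where cl: "colst K b E clr L" "\<forall>u. clr u < K" "\<forall>z<L. \<forall>c<K. bkt s3 K z c (wl clr L z c)" using p3 by blast
   have V3: "vars s3 ''L'' = vars s ''L''" "vars s3 ''K'' = int K" "vars s3 ''D'' = int DD" using v3[OF frames_prep(11)] v3[OF frames_prep(12)] v3[OF frames_prep(13)] V2 by simp_all
   have R3: "arrs s3 ''off'' = arrs s ''off''" "arrs s3 ''S'' = arrs s ''S''" "arrs s3 ''q'' = arrs s ''q''"
    using r3[OF frames_prep(14)] r3[OF frames_prep(15)] r3[OF frames_prep(16)] R2 by simp_all
   have in3: "inA s3" using inA V3(1) R3(1,2) unfolding inA_def by simp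
   have K1': "1 <= K" using pp(1) by simp
   have "\<forall>z<L. \<forall>c<K. length (wl clr L z c) < lg" using colst_load[OF cl(1) K1' _ _ pb pp(4)] by blast
   then have st3: "static K lg clr s3" unfolding static_def using in3 V3(2) cl(2,3) by blast
   have vL3: "vars s3 ''L'' = int L" using in3 unfolding inA_def by blast
   have q3: "ar s3 ''q'' i = init I i" if "i < L" for i using q[OF that] R3(3) by simp
   show "run (init_com;; main_com;; out_com) s3 t3 ?P"
   proof (rule run_SeqI[OF init_run[OF vL3 q3, of _ clr]])
    fix t4 :: nat and s4 :: state
    assume p4: "t4 <= t3 + 4 + 8 * L & CI s4 clr 0 0"
     and v4: "\<And>v. v \<notin> asgd init_com ==> vars s4 v = vars s3 v" and r4: "\<And>a. a \<notin> wrtn init_com ==> arrs s4 a = arrs s3 a"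
    have st4: "static K lg clr s4" by (rule static_cong[OF st3]) (simp_all add: v4 r4 frames_prep)
    have D4: "vars s4 ''D'' = int DD" using v4[OF frames_prep(19)] V3(3) by simp
    have vL4: "vars s4 ''L'' = int L" using v4[OF frames_prep(17)] vL3 by simp
    show "run (main_com;; out_com) s4 t4 ?P"
    proof (rule run_SeqI[OF main_run[OF st4 D4 DD_def wb(1-3,6) conjunct2[OF p4]]])
     fix t5 :: nat and s5 :: state
     assume p5: "t5 <= t4 + 2 + K * (190 * (DD * (DD * EE lg)) + 1) & (\<exists>cn X. rep s5 cn ''bv'' ''bz'' ''bl'' UNIV X & wff (items I) UNIV X & G0 (items I) X)"
      and v5: "\<And>v. v \<notin> asgd main_com ==> vars s5 v = vars s4 v"
     obtain cn X where X: "rep s5 cn ''bv'' ''bz'' ''bl'' UNIV X" "wff (items I) UNIV X" "G0 (items I) X" using p5 by blast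
     have vL5: "vars s5 ''L'' = int L" using v5[OF L_main] vL4 by simp
     have T: "t5 + (4 + L * (5 * bb + 9)) <= 7000 * ((lg + 1) ^ 8 * (bb * L))"
      using t1 conjunct1[OF p2] conjunct1[OF p3] conjunct1[OF p4] conjunct1[OF p5] total_time[OF p] unfolding DD_def by linarith
     show "run out_com s5 t5 ?P"
     proof (rule run_conseq[OF out_run[OF vL5 X(1,2)]])
      fix t6 :: nat and s6 :: state
      assume p6: "t6 <= t5 + 4 + L * (5 * bb + 9) & encodes_output I s6 X (\<lambda>i. residual I i (X i)) (\<lambda>i. objective I i (X i))"
      have "t6 <= 7000 * ((lg + 1) ^ 8 * (bb * L))" using conjunct1[OF p6] T by linarith
      then show "?P t6 s6" using lgb conjunct2[OF p6] solution[OF X(3,2)] by blast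
     qed
    qed
   qed
  qed
 qed
qed

end

lemma array_of_bound: "(\<And>x. x \<in> set xs ==> \<bar>x\<bar> <= c) ==> 0 <= c ==> \<bar>array_of xs k\<bar> <= c"
 by (auto simp: array_of_def nat_less_iff)

text \<open>The factor 16 in the bound for \<open>2 ^ lg\<close> costs 4 bits. With
  \<open>r = log 2 (f + 1) \<ge> 1\<close> this gives \<open>lg + 1 \<le> 5 + r \<le> 6 * r\<close>,
  whence the factor \<open>6 ^ 8\<close>; the rest of the constant is
  \<open>400 * 7000\<close>.\<close>

lemma polylog_time:
 fixes t lg n f :: nat
 assumes t: "t <= 400 * (7000 * ((lg + 1) ^ 8 * n))" and lg: "2 ^ lg <= 16 * n" and nf: "n <= f" and f1: "1 <= f"
 shows "real t <= polylog_bound (2800000 * 6 ^ 8) 8 f"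
proof -
 define r where "r = log 2 (real f + 1)"
 have "(2::real) ^ 1 <= real f + 1" using f1 by simp
 then have r1: "1 <= r" using le_log_of_power[of 2 1 "real f + 1"] by (simp add: r_def)
 have lgr: "real lg <= 4 + r"
 proof (cases "lg < 4")
  case True
  then show ?thesis using r1 by linarith
 next
  case False
  define m where "m = lg - 4"
  have "lg = m + 4" using False by (simp add: m_def)
  then have "2 ^ m * 16 <= 16 * f" using lg nf by (simp add: power_add)
  then have "2 ^ m <= f" by simp
  then have "real (2 ^ m) <= real f" by (simp only: of_nat_le_iff)
  then have "(2::real) ^ m <= real f" by (simp only: of_nat_power of_nat_numeral)
  then have "(2::real) ^ m <= real f + 1" by linarith
  then have "real m <= r" unfolding r_def by (rule le_log_of_power) simp
  then show ?thesis using \<open>lg = m + 4\<close> by simp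
 qed
 have "(real lg + 1) ^ 8 <= (6 * r) ^ 8" using lgr r1 by (intro power_mono) auto
 then have p: "(real lg + 1) ^ 8 * real n <= (6 * r) ^ 8 * real f" using nf r1 by (intro mult_mono) auto
 have "real t <= real (400 * (7000 * ((lg + 1) ^ 8 * n)))" using t by (simp only: of_nat_le_iff)
 also have "\<dots> = 2800000 * ((real lg + 1) ^ 8 * real n)" by (simp add: add.commute)
 also have "\<dots> <= 2800000 * ((6 * r) ^ 8 * real f)" using p by linarith
 also have "\<dots> = polylog_bound (2800000 * 6 ^ 8) 8 f" unfolding polylog_bound_def r_def[symmetric] by (simp add: power_mult_distrib)
 finally show ?thesis .
qed

text \<open>All bounds are converted to powers of \<open>T = 2 ^ l\<close>. The chain is
  \<open>ZZ \<le> T ^ 8\<close>, \<open>M = T ^ 160\<close> because \<open>ZZ ^ 20\<close> has to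
  fit, and \<open>(M + 1) ^ 20 \<le> (T ^ 161) ^ 20 = T ^ 3220\<close> for intermediate
  results.\<close>

lemma solves_total:
 assumes inst: "kew_instance I" and len: "len I \<ge> 1" and b: "b \<ge> 1" "\<forall>i<len I. card (allowed I i) <= b" and f: "b * len I <= f"
 shows "solves_within total_com 3220 I (polylog_bound (2800000 * 6 ^ 8) 8 f)"
 unfolding solves_within_def
proof (intro allI impI)
 fix l :: nat and s :: state
 assume fit: "fits l I" and enc: "encodes_input I s"
 obtain us ss where us: "distinct us" "set us = items I" and lss: "length ss = len I" and ssd: "\<forall>i<len I. distinct (ss ! i) & set (ss ! i) = allowed I i" and s: "s = input_state I us ss"
  using enc unfolding encodes_input_def by blast
 define T :: int where "T = 2 ^ l"
 \<comment> \<open>A positive length fits into \<open>l\<close> bits only if \<open>l\<close> is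
   positive.\<close>
 have T2: "2 <= T"
 proof (cases l)
  case 0
  then show ?thesis using fit len by (simp add: fits_def)
 next
  case (Suc k)
  then show ?thesis by (simp add: T_def)
 qed
 have lT: "int (len I) <= T" "int (wmax I) <= T"
 proof -
  have "len I < 2 ^ l" "wmax I < 2 ^ l" using fit by (simp_all add: fits_def)
  then have "int (len I) < int (2 ^ l)" "int (wmax I) < int (2 ^ l)" by (simp_all only: of_nat_less_iff)
  then show "int (len I) <= T" "int (wmax I) <= T" by (simp_all add: T_def)
 qed
 have it: "items I \<subseteq> {1..wmax I}" using inst by (simp add: kew_instance_def)
 have fini: "finite (items I)" using it finite_subset by blast
 have cardi: "card (items I) <= wmax I" using card_mono[OF _ it] by simp
 have itT: "int w <= T" if "w \<in> items I" for w using it that lT(2) by auto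
 have al: "allowed I i \<subseteq> items I" if "i < len I" for i using inst that by (simp add: kew_instance_def)
 \<comment> \<open>The given \<open>b\<close> may be far too large for a word. The largest set size,
   raised to at least 1, is at most \<open>T\<close> and can replace it.\<close>
 define Cs where "Cs = insert 1 ((\<lambda>i. card (allowed I i)) ` {..<len I})"
 define bb where "bb = Max Cs"
 have Cs: "finite Cs" "Cs \<noteq> {}" by (simp_all add: Cs_def)
 have bb1: "1 <= bb" unfolding bb_def by (rule Max_ge[OF Cs(1)]) (simp add: Cs_def)
 have bbc: "card (allowed I z) <= bb" if "z < len I" for z unfolding bb_def by (rule Max_ge[OF Cs(1)]) (use that in \<open>simp add: Cs_def\<close>)
 have bbb: "bb <= b" unfolding bb_def by (rule Max.boundedI[OF Cs]) (use b in \<open>auto simp: Cs_def\<close>)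
 have bbT: "int bb <= T"
 proof -
  have "bb \<in> Cs" unfolding bb_def by (rule Max_in[OF Cs])
  then consider "bb = 1" | i where "i < len I" "bb = card (allowed I i)" by (auto simp: Cs_def)
  then show ?thesis
  proof cases
   case 1
   then show ?thesis using T2 by simp
  next
   case 2
   then have "bb <= card (items I)" using card_mono[OF fini al[OF 2(1)]] by simp
   then show ?thesis using cardi lT(2) by linarith
  qed
 qed
 define M where "M = T ^ 160"
 define W where "W = T ^ 3220"
 have TM: "T ^ k <= M" if "k <= 160" for k unfolding M_def using T2 that by (intro power_increasing) auto
 have M16: "16 <= M"
 proof -
  have "(2::int) ^ 4 <= T ^ 4" using T2 by (intro power_mono) auto
  then show ?thesis using TM[of 4] by simp
 qed
 have MW: "(M + 1) ^ 20 <= W"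
 proof -
  have "2 * M <= T * M" using T2 M16 by (intro mult_right_mono) auto
  then have "M + 1 <= T ^ 161" using M16 by (simp add: M_def flip: power_Suc)
  then have "(M + 1) ^ 20 <= (T ^ 161) ^ 20" using M16 by (intro power_mono) auto
  then show ?thesis by (simp add: W_def flip: power_mult)
 qed
 have MZ: "int ((32 * len I * bb + 32) ^ 20) <= M"
 proof -
  have "int (len I) * int bb <= T * T" using lT(1) bbT T2 by (intro mult_mono) auto
  moreover have "1 * 1 <= T * T" using T2 by (intro mult_mono) auto
  ultimately have "32 * (int (len I) * int bb) + 32 <= 64 * (T * T)" by linarith
  also have "\<dots> <= T ^ 6 * (T * T)" using T2 power_mono[of 2 T 6] by (intro mult_right_mono) auto
  also have "\<dots> = T ^ 8" by (simp add: eval_nat_numeral)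
  finally have "(32 * (int (len I) * int bb) + 32) ^ 20 <= (T ^ 8) ^ 20" by (intro power_mono) auto
  then show ?thesis by (simp add: M_def mult.assoc flip: power_mult)
 qed
 have T0: "0 <= T" using T2 by simp
 have initB: "\<bar>init I i\<bar> <= T" if "i < len I" for i using fit that by (auto simp: fits_def T_def intro: less_imp_le)
 have profB: "\<bar>profit I w k\<bar> <= T" if "w \<in> items I" "k <= len I" for w k using fit that by (auto simp: fits_def T_def intro: less_imp_le)
 have BM: "(int (len I) + 2) * T <= M"
 proof -
  have "(int (len I) + 2) * T <= (T + T) * T" using lT(1) T2 by (intro mult_right_mono) auto
  also have "\<dots> <= (T * T) * T" using T2 mult_right_mono[of 2 T T] by (intro mult_right_mono) auto
  also have "\<dots> = T ^ 3" by (simp add: eval_nat_numeral)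
  also have "\<dots> <= M" by (rule TM) simp
  finally show ?thesis .
 qed
 have ssd': "distinct (ss ! i) & set (ss ! i) = allowed I i" if "i < len I" for i using ssd that by blast
 interpret kv I W M ss bb T
  by (intro kv.intro kb.intro kp.intro knap.intro machine.intro kp_axioms.intro kb_axioms.intro kv_axioms.intro)
   (rule inst len M16 MW lss ssd' bb1 bbc MZ T0 initB profB BM; assumption)+
 have M0: "0 <= M" "T <= M" using M16 TM[of 1] by simp_all
 have bd: "Bd M s"
 proof -
  have "length us = card (items I)" using us distinct_card by metis
  then have v: "int (length us) <= M" "int (len I) <= M" "int (wmax I) <= M" using cardi lT M0(2) by linarith+
  have cs: "x \<in> items I" if xs: "x \<in> set (concat ss)" for x
  proof -
   obtain ys where "ys \<in> set ss" "x \<in> set ys" using xs by auto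
   then obtain i where "i < length ss" "x \<in> set (ss ! i)" by (metis in_set_conv_nth)
   then show ?thesis using ssd' al lss by auto
  qed
  have a1: "\<bar>array_of (map int us) k\<bar> <= M" for k by (rule array_of_bound[OF _ M0(1)]) (use us itT M0(2) in fastforce)
  have a2: "\<bar>array_of (map (init I) [0..<len I]) k\<bar> <= M" for k by (rule array_of_bound[OF _ M0(1)]) (use initB M0(2) in fastforce)
  have a3: "\<bar>array_of (map int (concat ss)) k\<bar> <= M" for k by (rule array_of_bound[OF _ M0(1)]) (use cs itT M0(2) in fastforce)
  \<comment> \<open>The offsets are the only numbers in the input that may exceed \<open>T\<close>;
    they are at most \<open>T * T\<close>.\<close>
  have o: "int (oz i) <= M" if "i <= len I" for i
  proof -
   have "oz i <= bb * len I" using oz_le[OF that] mult_le_mono2[OF that, of bb] by linarith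
   then have "int (oz i) <= int bb * int (len I)" by (metis of_nat_le_iff of_nat_mult)
   also have "\<dots> <= T * T" using lT(1) bbT T2 by (intro mult_mono) auto
   also have "\<dots> <= M" using TM[of 2] by (simp add: power2_eq_square)
   finally show ?thesis .
  qed
  have a4: "\<bar>array_of (map (\<lambda>i. int (length (concat (take i ss)))) [0..<len I + 1]) k\<bar> <= M" for k
  proof (rule array_of_bound[OF _ M0(1)])
   fix x assume "x \<in> set (map (\<lambda>i. int (length (concat (take i ss)))) [0..<len I + 1])"
   then obtain i where "i \<in> set [0..<len I + 1]" "x = int (length (concat (take i ss)))" by (metis (no_types, lifting) imageE set_map)
   then have "i <= len I" "x = int (oz i)" by (auto simp: oz_def)
   then show "\<bar>x\<bar> <= M" using o by simp
  qed
  show ?thesis unfolding Bd_def s input_state_def using v a1 a2 a3 a4 M0(1) by simp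
 qed
 have inA: "inA s" unfolding inA_def s input_state_def
  by (simp add: array_of_def oz_def NN_def pS_def del: upt_Suc)
 have z0: "arrs s ''hd'' k = 0" "arrs s ''E'' k = 0" "arrs s ''h2'' k = 0" for k by (simp_all add: s input_state_def)
 have q: "ar s ''q'' i = init I i" if "i < len I" for i using that by (simp add: s input_state_def array_of_def)
 obtain t n s' lg X where e: "exec (evaluator_of I) W total_com s t s'" "t <= 400 * n" and
  x: "2 ^ lg <= 16 * (bb * len I)" "0 + n <= 7000 * ((lg + 1) ^ 8 * (bb * len I))" "encodes_output I s' X (\<lambda>i. residual I i (X i)) (\<lambda>i. objective I i (X i))"
   "kew_solution I X (\<lambda>i. residual I i (X i)) (\<lambda>i. objective I i (X i))"
  using total_run[OF inA z0 q] bd unfolding run_def by blast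
 have "bb * len I <= b * len I" using bbb by (rule mult_le_mono1)
 then have nf: "bb * len I <= f" using f by linarith
 have "1 * 1 <= bb * len I" using bb1 len by (rule mult_le_mono)
 then have f1: "1 <= f" using nf by linarith
 have "t <= 400 * (7000 * ((lg + 1) ^ 8 * (bb * len I)))" using e(2) x(2) by linarith
 then have "real t <= polylog_bound (2800000 * 6 ^ 8) 8 f" by (rule polylog_time[OF _ x(1) nf f1])
 moreover have "W = 2 ^ (3220 * l)" by (simp add: W_def T_def mult.commute flip: power_mult)
 ultimately show "\<exists>t s' x z r. exec (evaluator_of I) (2 ^ (3220 * l)) total_com s t s' & real t <= polylog_bound (2800000 * 6 ^ 8) 8 f &
   encodes_output I s' x z r & kew_solution I x z r" using e(1) x(3,4) by blast
qed

theorem theorem5p8: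
  shows "\<exists>(P :: com) (\<kappa> :: nat) (C :: real) (k :: nat).
    \<forall>(I :: kew) (m :: nat) (b :: nat).
      kew_instance I \<longrightarrow> len I \<ge> 1 \<longrightarrow> b \<ge> 1 \<longrightarrow>
      m = card (allowed I ` {..<len I}) \<longrightarrow>
      (\<forall>i<len I. card (allowed I i) \<le> b) \<longrightarrow>
      solves_within P \<kappa> I (polylog_bound C k (card (items I) * m + b * len I))"
proof (intro exI allI impI)
  fix I :: kew and m b :: nat
  assume "kew_instance I" "len I \<ge> 1" "b \<ge> 1" "\<forall>i<len I. card (allowed I i) <= b"
  then show "solves_within total_com 3220 I (polylog_bound (2800000 * 6 ^ 8) 8 (card (items I) * m + b * len I))"
    by (rule solves_total) simp
qed

end
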